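(* There exists a Salem number $\alpha$ such that for every $n\ge 2$ and every compact hyperbolic Coxeter polyhedron $P\subset\mathbb H^n$, the growth rate $\tau_P$ of $P$ is different from $\alpha$. In other words, not every Salem number is the growth rate of a compact hyperbolic Coxeter polyhedron.
   Context: A Salem number is a real algebraic integer $\alpha>1$ such that all its other Galois conjugates have absolute value at most $1$ and at least one of them has absolute value equal to $1$. A compact hyperbolic Coxeter polyhedron of dimension $n\ge2$ is a compact convex polyhedron $P\subset\mathbb H^n$ (with non-empty interior) bounded by finitely many hyperbolic hyperplanes $H_1,\dots,H_N$, $N\ge n+1$, any two of which either intersect under a dihedral angle of the form $\pi/k$ with an integer $k\ge 2$, or admit a common perpendicular in $\mathbb H^n$. Let $r_i$ be the reflection of $\mathbb H^n$ in $H_i$, let $S=\{r_1,\dots,r_N\}$, and let $G\subset\mathrm{Isom}(\mathbb H^n)$ be the discrete group generated by $S$; $(G,S)$ is a Coxeter system. For a Coxeter system $(W,S)$ with $S$ finite, let $a_k$ be the number of elements $w\in W$ of $S$-length $k$ (word length with respect to $S$). The growth series is $f_S(t)=1+\sum_{k\ge1}a_kt^k$, and the growth rate is $\tau_{(W,S)}=\limsup_{k\to\infty}\sqrt[k]{a_k}$, i.e. the inverse of the radius of convergence of $f_S$. The growth rate $\tau_P$ of $P$ is the growth rate of $(G,S)$. *)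

theory Defs
  imports
    "HOL-Analysis.Analysis"
    "HOL-Computational_Algebra.Computational_Algebra"
    "HOL-Algebra.Bij"
    "HOL-Algebra.Generated_Groups"
begin

section \<open>Salem numbers\<close>

definition galois_conjugate :: "complex \<Rightarrow> complex \<Rightarrow> bool" where
  "galois_conjugate x y \<longleftrightarrow>
     (\<exists>p :: rat poly. irreducible p \<and>
        poly (map_poly of_rat p) x = 0 \<and> poly (map_poly of_rat p) y = 0)"

definition salem_number :: "real \<Rightarrow> bool" where
  "salem_number \<alpha> \<longleftrightarrow> algebraic_int \<alpha> \<and> \<alpha> > 1 \<and>
     (\<forall>z. galois_conjugate (of_real \<alpha>) z \<and> z \<noteq> of_real \<alpha> \<longrightarrow> norm z \<le> 1) \<and>
     (\<exists>z. galois_conjugate (of_real \<alpha>) z \<and> z \<noteq> of_real \<alpha> \<and> norm z = 1)"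


section \<open>Growth rates\<close>

text \<open>
  Words are products of elements of \<^term>\<open>S\<close> only, without inverses. Below, \<^term>\<open>S\<close> consists of
  involutions, so every element of the generated subgroup is such a product.
\<close>

definition word_length :: "('g, 'm) monoid_scheme \<Rightarrow> 'g set \<Rightarrow> 'g \<Rightarrow> nat" where
  "word_length G S w =
     (LEAST k. \<exists>ss. length ss = k \<and> set ss \<subseteq> S \<and> foldr (mult G) ss (one G) = w)"

definition growth_coeff :: "('g, 'm) monoid_scheme \<Rightarrow> 'g set \<Rightarrow> nat \<Rightarrow> nat" where
  "growth_coeff G S k = card {w \<in> generate G S. word_length G S w = k}"

definition growth_rate :: "('g, 'm) monoid_scheme \<Rightarrow> 'g set \<Rightarrow> ereal" where
  "growth_rate G S = limsup (\<lambda>k. ereal (root k (real (growth_coeff G S k))))"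


section \<open>Hyperbolic space\<close>

text \<open>
  The dimension is a natural number over which statements quantify, so the hyperboloid model lives
  in the sequences supported on \<open>{0..n}\<close>, with time coordinate \<open>0\<close>. On these sequences the product
  topology of \<^typ>\<open>nat \<Rightarrow> real\<close> is the Euclidean one, and on the hyperboloid it is the topology of
  the hyperbolic metric.
\<close>

definition minkowski_space :: "nat \<Rightarrow> (nat \<Rightarrow> real) set" where
  "minkowski_space n = {x. \<forall>i>n. x i = 0}"

definition minkowski_form :: "nat \<Rightarrow> (nat \<Rightarrow> real) \<Rightarrow> (nat \<Rightarrow> real) \<Rightarrow> real" where
  "minkowski_form n x y = (\<Sum>i=1..n. x i * y i) - x 0 * y 0"

definition hyp_space :: "nat \<Rightarrow> (nat \<Rightarrow> real) set" where
  "hyp_space n = {x \<in> minkowski_space n. minkowski_form n x x = -1 \<and> x 0 > 0}"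

definition hyp_dist :: "nat \<Rightarrow> (nat \<Rightarrow> real) \<Rightarrow> (nat \<Rightarrow> real) \<Rightarrow> real" where
  "hyp_dist n x y = arcosh (- minkowski_form n x y)"

definition hyp_isom :: "nat \<Rightarrow> ((nat \<Rightarrow> real) \<Rightarrow> (nat \<Rightarrow> real)) monoid" where
  "hyp_isom n = (BijGroup (hyp_space n))
     \<lparr>carrier := {f \<in> Bij (hyp_space n).
        \<forall>x\<in>hyp_space n. \<forall>y\<in>hyp_space n. hyp_dist n (f x) (f y) = hyp_dist n x y}\<rparr>"

text \<open>
  A hyperplane is represented by a unit spacelike normal \<open>e\<close>, which also fixes the closed half-space
  whose outer normal is \<open>e\<close>.
\<close>

definition unit_spacelike :: "nat \<Rightarrow> (nat \<Rightarrow> real) set" where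
  "unit_spacelike n = {e \<in> minkowski_space n. minkowski_form n e e = 1}"

definition hyperplane :: "nat \<Rightarrow> (nat \<Rightarrow> real) \<Rightarrow> (nat \<Rightarrow> real) set" where
  "hyperplane n e = {x \<in> hyp_space n. minkowski_form n x e = 0}"

definition half_space :: "nat \<Rightarrow> (nat \<Rightarrow> real) \<Rightarrow> (nat \<Rightarrow> real) set" where
  "half_space n e = {x \<in> hyp_space n. minkowski_form n x e \<le> 0}"

definition hyp_reflection :: "nat \<Rightarrow> (nat \<Rightarrow> real) \<Rightarrow> (nat \<Rightarrow> real) \<Rightarrow> (nat \<Rightarrow> real)" where
  "hyp_reflection n e = (\<lambda>x\<in>hyp_space n. \<lambda>i. x i - 2 * minkowski_form n x e * e i)"

text \<open>
  At a common point of the two hyperplanes \<open>e\<close> and \<open>f\<close> are tangent vectors, namely the outer normals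
  of the two half-spaces; the interior angle of the wedge is \<open>\<pi>\<close> minus the angle between them.
\<close>

definition dihedral_angle :: "nat \<Rightarrow> (nat \<Rightarrow> real) \<Rightarrow> (nat \<Rightarrow> real) \<Rightarrow> real" where
  "dihedral_angle n e f = pi - arccos (minkowski_form n e f)"

text \<open>The unit speed geodesic line through the point \<open>p\<close> in the unit tangent direction \<open>v\<close>.\<close>

definition unit_tangent :: "nat \<Rightarrow> (nat \<Rightarrow> real) \<Rightarrow> (nat \<Rightarrow> real) set" where
  "unit_tangent n p = {v \<in> unit_spacelike n. minkowski_form n p v = 0}"

definition geodesic :: "(nat \<Rightarrow> real) \<Rightarrow> (nat \<Rightarrow> real) \<Rightarrow> real \<Rightarrow> (nat \<Rightarrow> real)" where
  "geodesic p v s = (\<lambda>i. cosh s * p i + sinh s * v i)"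

definition geodesic_velocity :: "(nat \<Rightarrow> real) \<Rightarrow> (nat \<Rightarrow> real) \<Rightarrow> real \<Rightarrow> (nat \<Rightarrow> real)" where
  "geodesic_velocity p v s = (\<lambda>i. sinh s * p i + cosh s * v i)"

text \<open>The tangent space of a hyperplane at one of its points \<open>x\<close>, inside Minkowski space.\<close>

definition hyperplane_tangent :: "nat \<Rightarrow> (nat \<Rightarrow> real) \<Rightarrow> (nat \<Rightarrow> real) \<Rightarrow> (nat \<Rightarrow> real) set" where
  "hyperplane_tangent n e x =
     {w \<in> minkowski_space n. minkowski_form n w x = 0 \<and> minkowski_form n w e = 0}"

definition meets_perpendicularly ::
  "nat \<Rightarrow> (nat \<Rightarrow> real) \<Rightarrow> (nat \<Rightarrow> real) \<Rightarrow> (nat \<Rightarrow> real) \<Rightarrow> bool" where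
  "meets_perpendicularly n p v e \<longleftrightarrow>
     (\<exists>s. geodesic p v s \<in> hyperplane n e \<and>
        (\<forall>w\<in>hyperplane_tangent n e (geodesic p v s).
           minkowski_form n w (geodesic_velocity p v s) = 0))"

definition admit_common_perpendicular :: "nat \<Rightarrow> (nat \<Rightarrow> real) \<Rightarrow> (nat \<Rightarrow> real) \<Rightarrow> bool" where
  "admit_common_perpendicular n e f \<longleftrightarrow>
     (\<exists>p\<in>hyp_space n. \<exists>v\<in>unit_tangent n p.
        meets_perpendicularly n p v e \<and> meets_perpendicularly n p v f)"


section \<open>Compact Coxeter polyhedra\<close>

text \<open>
  \<open>e 0, \<dots>, e (N - 1)\<close> are the outer unit normals of the bounding hyperplanes of \<open>P\<close>. That all of
  these hyperplanes actually bound \<open>P\<close> is expressed by the irredundancy of the half-spaces; it also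
  makes the hyperplanes pairwise distinct when \<open>P\<close> has interior points.
\<close>

definition compact_coxeter_polyhedron ::
  "nat \<Rightarrow> nat \<Rightarrow> (nat \<Rightarrow> nat \<Rightarrow> real) \<Rightarrow> (nat \<Rightarrow> real) set \<Rightarrow> bool" where
  "compact_coxeter_polyhedron n N e P \<longleftrightarrow>
     n \<ge> 2 \<and> N \<ge> n + 1 \<and>
     (\<forall>i<N. e i \<in> unit_spacelike n) \<and>
     P = (\<Inter>i<N. half_space n (e i)) \<and>
     (\<forall>j<N. P \<noteq> (\<Inter>i\<in>{..<N} - {j}. half_space n (e i))) \<and>
     compact P \<and>
     (top_of_set (hyp_space n)) interior_of P \<noteq> {} \<and>
     (\<forall>i<N. \<forall>j<N. i \<noteq> j \<longrightarrow>
        (hyperplane n (e i) \<inter> hyperplane n (e j) \<noteq> {} \<and>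
          (\<exists>k::nat. k \<ge> 2 \<and> dihedral_angle n (e i) (e j) = pi / real k)) \<or>
        admit_common_perpendicular n (e i) (e j))"

definition wall_reflections ::
  "nat \<Rightarrow> nat \<Rightarrow> (nat \<Rightarrow> nat \<Rightarrow> real) \<Rightarrow> ((nat \<Rightarrow> real) \<Rightarrow> (nat \<Rightarrow> real)) set" where
  "wall_reflections n N e = (\<lambda>i. hyp_reflection n (e i)) ` {..<N}"

definition polyhedron_growth_rate :: "nat \<Rightarrow> nat \<Rightarrow> (nat \<Rightarrow> nat \<Rightarrow> real) \<Rightarrow> ereal" where
  "polyhedron_growth_rate n N e = growth_rate (hyp_isom n) (wall_reflections n N e)"

end

theory Submission
  imports Defs "HOL-Complex_Analysis.Complex_Analysis"
begin

text \<open>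
  For a Coxeter group the reciprocals of the growth series \<open>G V\<close> of its parabolic subgroups satisfy
  \<open>(\<Sum>V \<subseteq> U. (-1)^|V| / G V) = E U / G U\<close>, where \<open>E U = t^L\<close> if \<open>W U\<close> is finite with longest element
  of length \<open>L\<close>, and \<open>E U = 0\<close> otherwise. Take a Salem number \<open>\<alpha>\<close> of degree 18 between 1.188 and 1.19. If
  it were the growth rate of a compact polyhedron, all these series would converge, to values at
  least 1, at \<open>t = 21/25 < 1/\<alpha>\<close>. The identity then rules out numerically a short list of Coxeter
  diagrams of rank 3, 4 and 5; apart from the triangle (2,3,7), this list is such that every diagram
  avoiding it is either positive definite or contains an affine diagram. Since \<open>N \<ge> n + 1\<close>, the Gram
  matrix is not positive definite, and compactness forbids affine subdiagrams. The triangle group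
  (2,3,7) itself is excluded because its growth series is rational with denominator Lehmer's
  polynomial, which has no zeros of modulus below 0.846, whereas \<open>1/\<alpha> < 0.842\<close>.
\<close>

section \<open>Reflection systems\<close>

text \<open>The obstacle is that dimension and number of walls are unbounded, while a numerical test
  sees only finitely many diagrams. Lengths in a parabolic subgroup agree with those in the whole
  group, so convergence at one point t passes to every subset U of the walls. For nonempty U one has
  \<open>0 <= E U < 1\<close> and \<open>G U >= 1\<close>; moving the term of U itself to the other
  side, the alternating sum over the proper subsets becomes \<open>(E U - (-1)^|U|) / G U\<close>,
  positive for odd and negative for even |U|. A diagram whose group grows too fast violates this
  sign. The diagrams tested in ranks 4 and 5 are the compact hyperbolic simplices and the quadruples
  that extend (2,3,7). The step to arbitrary rank is a descent: a minimal diagram that is not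
  positive definite has only labels 2, 3 and 4, its form becomes integral and even, and a smallest
  nonnegative integer vector with nonpositive value turns out to be an affine null vector.\<close>

declare in_listsD [rule del] in_listsI [rule del]

lemma rev_in_lists [simp]: "rev ss \<in> lists U \<longleftrightarrow> ss \<in> lists U"
  by (simp add: in_lists_conv_set)

fun act :: "(nat \<Rightarrow> 'x \<Rightarrow> 'x) \<Rightarrow> nat list \<Rightarrow> 'x \<Rightarrow> 'x" where
  "act s [] x = x"
| "act s (i # ss) x = s i (act s ss x)"

lemma act_append: "act s (ss @ tt) x = act s ss (act s tt x)"
  by (induction ss) auto

fun alt :: "nat \<Rightarrow> nat \<Rightarrow> nat \<Rightarrow> nat list" where
  "alt 0 i j = []"
| "alt (Suc k) i j = i # alt k j i"

lemma length_alt [simp]: "length (alt k i j) = k"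
  by (induction k i j rule: alt.induct) auto

lemma alt_in_lists: "i \<in> U \<Longrightarrow> j \<in> U \<Longrightarrow> alt k i j \<in> lists U"
  by (induction k i j rule: alt.induct) auto

lemma alt_add: "alt (a + b) i j = alt a i j @ (if even a then alt b i j else alt b j i)"
  by (induction a i j rule: alt.induct) auto

section \<open>Chebyshev polynomials and dihedral orbits\<close>

fun cheb :: "real \<Rightarrow> nat \<Rightarrow> real" where
  "cheb k 0 = 0"
| "cheb k (Suc 0) = 1"
| "cheb k (Suc (Suc n)) = k * cheb k (Suc n) - cheb k n"

text \<open>\<open>cheb (2 * cos x) n\<close> is the Chebyshev polynomial of the second kind sin (n
  x) / sin x; multiplying by sin x avoids the division.\<close>

lemma cheb_cos: "cheb (2 * cos \<theta>) n * sin \<theta> = sin (real n * \<theta>)"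
proof (induction "2 * cos \<theta>" n rule: cheb.induct)
  case (3 n)
  have "sin (real (Suc (Suc n)) * \<theta>) = sin (real (Suc n) * \<theta> + \<theta>)"
    and "sin (real n * \<theta>) = sin (real (Suc n) * \<theta> - \<theta>)"
    by (simp_all add: algebra_simps)
  then have "sin (real (Suc (Suc n)) * \<theta>) = 2 * cos \<theta> * sin (real (Suc n) * \<theta>) - sin (real n * \<theta>)"
    by (simp only: sin_add sin_diff) (simp add: algebra_simps)
  moreover have "cheb (2 * cos \<theta>) (Suc (Suc n)) * sin \<theta>
    = 2 * cos \<theta> * (cheb (2 * cos \<theta>) (Suc n) * sin \<theta>) - cheb (2 * cos \<theta>) n * sin \<theta>"
    by (simp add: algebra_simps)
  ultimately show ?case
    using 3 by simp
qed auto

lemma cheb_pos_cos: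
  assumes "m \<ge> 2" "0 < n" "n < m"
  shows "cheb (2 * cos (pi / real m)) n > 0"
proof -
  have s: "sin (pi / real m) > 0"
    using assms by (intro sin_gt_zero) (auto simp: field_simps)
  have "sin (real n * (pi / real m)) > 0"
    using assms by (intro sin_gt_zero) (auto simp: field_simps)
  then show ?thesis
    using cheb_cos[of "pi / real m" n] s by (metis zero_less_mult_pos2)
qed

text \<open>These are sin pi = 0 and sin (pi + pi/m) = - sin (pi/m): the coefficients along an
  alternating word first stop being positive at index m.\<close>

lemma cheb_end_cos:
  assumes "m \<ge> 2"
  shows "cheb (2 * cos (pi / real m)) m = 0" "cheb (2 * cos (pi / real m)) (Suc m) = -1"
proof -
  have s: "sin (pi / real m) > 0"
    using assms by (intro sin_gt_zero) (auto simp: field_simps)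
  show "cheb (2 * cos (pi / real m)) m = 0"
    using cheb_cos[of "pi / real m" m] s assms by simp
  have "real (Suc m) * (pi / real m) = pi + pi / real m"
    using assms by (simp add: field_simps)
  then show "cheb (2 * cos (pi / real m)) (Suc m) = -1"
    using cheb_cos[of "pi / real m" "Suc m"] s
    by (metis minus_equation_iff mult_cancel_right mult_minus1 order_less_irrefl sin_periodic_pi2)
qed

text \<open>The case of an infinite label. Monotonicity is carried along because the recursion
  subtracts the previous term.\<close>

lemma cheb_pos_ge2:
  assumes "k \<ge> 2"
  shows "cheb k (Suc n) \<ge> 1" "cheb k (Suc n) \<ge> cheb k n"
proof -
  have "cheb k (Suc n) \<ge> 1 \<and> cheb k (Suc n) \<ge> cheb k n"
  proof (induction n)
    case (Suc n)
    have "k * cheb k (Suc n) \<ge> 2 * cheb k (Suc n)"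
      using Suc assms by (intro mult_right_mono) auto
    then show ?case
      using Suc unfolding cheb.simps by linarith
  qed simp
  then show "cheb k (Suc n) \<ge> 1" "cheb k (Suc n) \<ge> cheb k n" by auto
qed

text \<open>Kept apart from \<open>reflection_system\<close> because the braid relation required
  there is deduced, for hyperbolic reflections, from \<open>lam_braid\<close> of this
  locale.\<close>

locale reflections =
  fixes I :: "nat set" and X :: "'x set" and s :: "nat \<Rightarrow> 'x \<Rightarrow> 'x"
    and lam :: "nat \<Rightarrow> 'x \<Rightarrow> real" and c :: "nat \<Rightarrow> nat \<Rightarrow> real"
  assumes s_in: "i \<in> I \<Longrightarrow> x \<in> X \<Longrightarrow> s i x \<in> X"
    and lam_s: "i \<in> I \<Longrightarrow> j \<in> I \<Longrightarrow> x \<in> X \<Longrightarrow> lam j (s i x) = lam j x - c i j * lam i x"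
    and c_refl: "i \<in> I \<Longrightarrow> c i i = 2"
    and c_sym: "i \<in> I \<Longrightarrow> j \<in> I \<Longrightarrow> c i j = c j i"
begin

lemma act_in: "ss \<in> lists I \<Longrightarrow> x \<in> X \<Longrightarrow> act s ss x \<in> X"
  by (induction ss) (auto intro: s_in)

lemma lam_alt:
  assumes "i \<in> I" "j \<in> I" "x \<in> X"
  shows "lam i (act s (alt k j i) x) =
    (if even k then cheb (- c i j) (Suc k) * lam i x + cheb (- c i j) k * lam j x
     else cheb (- c i j) (Suc k) * lam j x + cheb (- c i j) k * lam i x)"
  using assms
proof (induction k arbitrary: i j rule: less_induct)
  case (less k)
  show ?case
  proof (cases k)
    case (Suc l)
    have y: "act s (alt l i j) x \<in> X"
      using less.prems by (intro act_in alt_in_lists)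
    have "lam i (act s (alt k j i) x) = lam i (act s (alt l i j) x) - c i j * lam j (act s (alt l i j) x)"
      using Suc less.prems y by (simp add: lam_s c_sym)
    moreover have "lam j (act s (alt l i j) x) =
      (if even l then cheb (- c i j) (Suc l) * lam j x + cheb (- c i j) l * lam i x
       else cheb (- c i j) (Suc l) * lam i x + cheb (- c i j) l * lam j x)"
      using less.IH[of l j i] Suc less.prems by (simp add: c_sym)
    \<comment> \<open>Removing the leading \<open>i\<close> of the word only negates
      \<open>lam i\<close>, so the induction hypothesis two letters back applies; the empty word
      stands apart.\<close>
    moreover have "lam i (act s (alt l i j) x) =
      (if l = 0 then lam i x else - (if odd l then cheb (- c i j) l * lam i x + cheb (- c i j) (l - 1) * lam j x
       else cheb (- c i j) l * lam j x + cheb (- c i j) (l - 1) * lam i x))"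
    proof (cases l)
      case l: (Suc l')
      have "act s (alt l' j i) x \<in> X"
        using less.prems by (intro act_in alt_in_lists)
      then have "lam i (act s (alt l i j) x) = - lam i (act s (alt l' j i) x)"
        using less.prems l by (simp add: lam_s c_refl)
      then show ?thesis
        using less.IH[of l' i j] Suc l less.prems by simp
    qed simp
    ultimately show ?thesis
      using Suc by (cases l) (auto simp: algebra_simps)
  qed simp
qed

text \<open>At length m both words turn \<open>lam i\<close> into the same one of
  \<open>- lam i\<close> and \<open>- lam j\<close>, depending on the parity of m. This is the braid
  relation as far as the walls can see it.\<close>

lemma lam_braid:
  assumes ij: "i \<in> I" "j \<in> I" and x: "x \<in> X" and m: "m \<ge> 2" and c: "c i j = - 2 * cos (pi / real m)"
  shows "lam i (act s (alt m i j) x) = lam i (act s (alt m j i) x)"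
proof -
  have k: "- c i j = 2 * cos (pi / real m)" using c by simp
  obtain l where l: "m = Suc l" using m by (cases m) auto
  have y: "act s (alt l j i) x \<in> X"
    using ij x by (intro act_in alt_in_lists)
  have "lam i (act s (alt m i j) x) = - lam i (act s (alt l j i) x)"
    using y ij l by (simp add: lam_s c_refl)
  moreover have "cheb (- c i j) m = 0" "cheb (- c i j) (Suc m) = -1"
    using cheb_end_cos[OF m] by (simp_all add: k)
  moreover from this have "cheb (- c i j) l = 1" by (simp add: l)
  ultimately show ?thesis
    using lam_alt[OF ij x, of m] lam_alt[OF ij x, of l] by (simp add: l)
qed

end

text \<open>
  \<open>lam i\<close> are the values on the walls, negative on the chamber of \<open>p\<close>, and \<open>c\<close> is twice the Gram matrix.
  The label \<open>m i j = 0\<close> stands for an infinite one.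
\<close>

locale reflection_system = reflections I X s lam c
  for I :: "nat set" and X :: "'x set" and s :: "nat \<Rightarrow> 'x \<Rightarrow> 'x"
    and lam :: "nat \<Rightarrow> 'x \<Rightarrow> real" and c :: "nat \<Rightarrow> nat \<Rightarrow> real" +
  fixes m :: "nat \<Rightarrow> nat \<Rightarrow> nat" and p :: 'x
  assumes fin: "finite I"
    and s_s: "i \<in> I \<Longrightarrow> x \<in> X \<Longrightarrow> s i (s i x) = x"
    and m_sym: "i \<in> I \<Longrightarrow> j \<in> I \<Longrightarrow> m i j = m j i"
    and p_in: "p \<in> X"
    and lam_p: "i \<in> I \<Longrightarrow> lam i p < 0"
    and c_inf: "i \<in> I \<Longrightarrow> j \<in> I \<Longrightarrow> i \<noteq> j \<Longrightarrow> m i j = 0 \<Longrightarrow> c i j \<le> -2"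
    and m_ge2: "i \<in> I \<Longrightarrow> j \<in> I \<Longrightarrow> i \<noteq> j \<Longrightarrow> m i j \<noteq> 0 \<Longrightarrow> m i j \<ge> 2"
    and c_cos: "i \<in> I \<Longrightarrow> j \<in> I \<Longrightarrow> i \<noteq> j \<Longrightarrow> m i j \<noteq> 0 \<Longrightarrow> c i j = - 2 * cos (pi / real (m i j))"
    and braid: "i \<in> I \<Longrightarrow> j \<in> I \<Longrightarrow> i \<noteq> j \<Longrightarrow> m i j \<noteq> 0 \<Longrightarrow> x \<in> X \<Longrightarrow>
      act s (alt (m i j) i j) x = act s (alt (m i j) j i) x"
begin

text \<open>Restricted to \<open>X\<close>, so that equality of elements is equality of functions
  and agrees with the extensional functions of \<open>BijGroup\<close>.\<close>

definition elt :: "nat list \<Rightarrow> 'x \<Rightarrow> 'x" where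
  "elt ss = restrict (act s ss) X"

definition W :: "nat set \<Rightarrow> ('x \<Rightarrow> 'x) set" where
  "W U = elt ` lists U"

definition len :: "nat set \<Rightarrow> ('x \<Rightarrow> 'x) \<Rightarrow> nat" where
  "len U w = (LEAST k. \<exists>ss\<in>lists U. length ss = k \<and> elt ss = w)"

abbreviation mul (infixl "\<odot>" 70) where
  "u \<odot> v \<equiv> compose X u v"

definition red :: "nat set \<Rightarrow> nat list \<Rightarrow> bool" where
  "red U ss \<longleftrightarrow> ss \<in> lists U \<and> len U (elt ss) = length ss"

text \<open>The analogue of a positive root: the wall functional \<open>lam i\<close>, pulled back
  along w, is a nonnegative combination of the walls of U.\<close>

definition Pos :: "nat set \<Rightarrow> nat \<Rightarrow> ('x \<Rightarrow> 'x) \<Rightarrow> bool" where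
  "Pos U i w \<longleftrightarrow> (\<exists>b. (\<forall>j\<in>U. b j \<ge> 0) \<and> (\<forall>x\<in>X. lam i (w x) = (\<Sum>j\<in>U. b j * lam j x)))"

lemma lists_I: "U \<subseteq> I \<Longrightarrow> ss \<in> lists U \<Longrightarrow> ss \<in> lists I"
  by (meson lists_mono subsetD)

lemma elt_append: "ss \<in> lists I \<Longrightarrow> tt \<in> lists I \<Longrightarrow> elt (ss @ tt) = elt ss \<odot> elt tt"
  by (rule ext) (auto simp: elt_def compose_def act_append act_in)

lemma elt_Cons: "i \<in> I \<Longrightarrow> tt \<in> lists I \<Longrightarrow> elt (i # tt) = elt [i] \<odot> elt tt"
  using elt_append[of "[i]" tt] by simp

lemma elt_ConsU: "U \<subseteq> I \<Longrightarrow> i \<in> U \<Longrightarrow> tt \<in> lists U \<Longrightarrow> elt (i # tt) = elt [i] \<odot> elt tt"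
  using elt_Cons lists_I by blast

lemma elt_apply: "x \<in> X \<Longrightarrow> elt ss x = act s ss x"
  by (simp add: elt_def)

lemma act_rev: "ss \<in> lists I \<Longrightarrow> x \<in> X \<Longrightarrow> act s (rev ss) (act s ss x) = x"
  by (induction ss) (auto simp: act_append act_in s_s)

lemma elt_rev: "ss \<in> lists I \<Longrightarrow> elt (rev ss) \<odot> elt ss = elt []"
  by (rule ext) (auto simp: elt_def compose_def act_rev act_in)

lemma W_elt [intro]: "ss \<in> lists U \<Longrightarrow> elt ss \<in> W U"
  by (auto simp: W_def)

lemma W_mono: "V \<subseteq> U \<Longrightarrow> W V \<subseteq> W U"
  using lists_mono by (fastforce simp: W_def)

lemma W_in: "U \<subseteq> I \<Longrightarrow> w \<in> W U \<Longrightarrow> x \<in> X \<Longrightarrow> w x \<in> X"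
  using act_in lists_I by (fastforce simp: W_def elt_apply)

lemma W_mul: "U \<subseteq> I \<Longrightarrow> u \<in> W U \<Longrightarrow> v \<in> W U \<Longrightarrow> u \<odot> v \<in> W U"
proof -
  assume U: "U \<subseteq> I" and "u \<in> W U" "v \<in> W U"
  then obtain ss tt where "ss \<in> lists U" "tt \<in> lists U" "u = elt ss" "v = elt tt"
    by (auto simp: W_def)
  then show "u \<odot> v \<in> W U"
    using elt_append[of ss tt] lists_I[OF U] by (metis W_elt append_in_lists_conv)
qed

lemma mul_assoc: "U \<subseteq> I \<Longrightarrow> w \<in> W U \<Longrightarrow> (u \<odot> v) \<odot> w = u \<odot> (v \<odot> w)"
  by (auto simp: compose_def W_in)

lemma one_mul: "U \<subseteq> I \<Longrightarrow> w \<in> W U \<Longrightarrow> elt [] \<odot> w = w"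
  using W_in by (auto simp: compose_def elt_def W_def fun_eq_iff)

lemma mul_one: "U \<subseteq> I \<Longrightarrow> w \<in> W U \<Longrightarrow> w \<odot> elt [] = w"
  by (rule ext) (auto simp: compose_def elt_def W_def)

lemma W_inv:
  assumes "U \<subseteq> I" "w \<in> W U"
  obtains w' where "w' \<in> W U" "w' \<odot> w = elt []" "w \<odot> w' = elt []"
proof -
  obtain ss where "ss \<in> lists U" "w = elt ss"
    using assms by (auto simp: W_def)
  then have "elt (rev ss) \<in> W U" "elt (rev ss) \<odot> w = elt []" "w \<odot> elt (rev ss) = elt []"
    using elt_rev[of ss] elt_rev[of "rev ss"] lists_I[OF assms(1), of ss] by auto
  then show ?thesis using that by blast
qed

lemma gen_gen: "U \<subseteq> I \<Longrightarrow> w \<in> W U \<Longrightarrow> i \<in> U \<Longrightarrow> elt [i] \<odot> (elt [i] \<odot> w) = w"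
proof -
  assume a: "U \<subseteq> I" "w \<in> W U" "i \<in> U"
  have "elt [i] \<odot> elt [i] = elt []"
    using elt_rev[of "[i]"] a by auto
  then show ?thesis
    using mul_assoc[OF a(1,2), of "elt [i]" "elt [i]"] one_mul[OF a(1,2)] by simp
qed

lemma lam_gen: "i \<in> I \<Longrightarrow> x \<in> X \<Longrightarrow> U \<subseteq> I \<Longrightarrow> w \<in> W U \<Longrightarrow> lam i ((elt [i] \<odot> w) x) = - lam i (w x)"
  by (simp add: compose_def elt_apply W_in lam_s c_refl)

lemma len_le: "ss \<in> lists U \<Longrightarrow> len U (elt ss) \<le> length ss"
  unfolding len_def by (rule Least_le) auto

lemma red_ex:
  assumes "w \<in> W U"
  obtains ss where "red U ss" "elt ss = w" "length ss = len U w"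
proof -
  have "\<exists>k. \<exists>ss\<in>lists U. length ss = k \<and> elt ss = w"
    using assms by (auto simp: W_def)
  from LeastI_ex[OF this] obtain ss where "ss \<in> lists U" "length ss = len U w" "elt ss = w"
    by (auto simp: len_def)
  then show ?thesis using that by (auto simp: red_def)
qed

lemma len_mono: "V \<subseteq> U \<Longrightarrow> w \<in> W V \<Longrightarrow> len U w \<le> len V w"
  by (metis lists_mono red_ex len_le red_def subsetD)

lemma len_mul: "U \<subseteq> I \<Longrightarrow> u \<in> W U \<Longrightarrow> v \<in> W U \<Longrightarrow> len U (u \<odot> v) \<le> len U u + len U v"
proof -
  assume U: "U \<subseteq> I" and u: "u \<in> W U" and v: "v \<in> W U"
  obtain ss tt where "red U ss" "elt ss = u" "length ss = len U u" "red U tt" "elt tt = v" "length tt = len U v"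
    using red_ex[OF u] red_ex[OF v] by metis
  moreover from this have "ss @ tt \<in> lists U" "elt (ss @ tt) = u \<odot> v"
    using elt_append lists_I[OF U] by (auto simp: red_def)
  ultimately show ?thesis
    using len_le[of "ss @ tt" U] by simp
qed

lemma len_one [simp]: "len U (elt []) = 0"
  using len_le[of "[]" U] by simp

lemma len_0: "w \<in> W U \<Longrightarrow> len U w = 0 \<Longrightarrow> w = elt []"
  using red_ex by (metis length_0_conv)

lemma len_gen: "i \<in> U \<Longrightarrow> len U (elt [i]) \<le> 1"
  using len_le[of "[i]" U] by simp

lemma W_gen: "i \<in> U \<Longrightarrow> elt [i] \<in> W U"
  by auto

lemma len_gen_mul:
  assumes "U \<subseteq> I" "w \<in> W U" "i \<in> U"
  shows "len U (elt [i] \<odot> w) \<le> Suc (len U w)" "len U w \<le> Suc (len U (elt [i] \<odot> w))"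
proof -
  show "len U (elt [i] \<odot> w) \<le> Suc (len U w)"
    using len_mul[OF assms(1) W_gen[OF assms(3)] assms(2)] len_gen[OF assms(3)] by simp
  have "elt [i] \<odot> w \<in> W U"
    using assms by (intro W_mul) auto
  then show "len U w \<le> Suc (len U (elt [i] \<odot> w))"
    using len_mul[OF assms(1) W_gen[OF assms(3)], of "elt [i] \<odot> w"] len_gen[OF assms(3)]
      gen_gen[OF assms] by simp
qed

lemma red_tl: "U \<subseteq> I \<Longrightarrow> red U (i # ss) \<Longrightarrow> red U ss"
proof -
  assume U: "U \<subseteq> I" and r: "red U (i # ss)"
  then have "ss \<in> lists U" "i \<in> U" by (auto simp: red_def)
  moreover from this have "Suc (length ss) \<le> Suc (len U (elt ss))"
    using len_gen_mul(1)[OF U, of "elt ss" i] r elt_ConsU[OF U, of i ss] by (auto simp: red_def)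
  ultimately show "red U ss"
    using len_le[of ss U] by (auto simp: red_def)
qed

lemma red_not_desc:
  assumes "U \<subseteq> I" "red U (i # ss)"
  shows "len U (elt [i] \<odot> elt (i # ss)) < len U (elt (i # ss))"
proof -
  have i: "i \<in> U" "ss \<in> lists U" using assms by (auto simp: red_def)
  then have "elt [i] \<odot> elt (i # ss) = elt ss"
    using gen_gen[OF assms(1), of "elt ss" i] elt_ConsU[OF assms(1), of i ss] by auto
  then show ?thesis
    using len_le[OF i(2)] assms by (auto simp: red_def)
qed

text \<open>Two equal neighbouring letters would cancel and shorten the word, so the letters
  alternate.\<close>

lemma red_alt:
  assumes "i \<in> I" "j \<in> I" "red {i, j} ss"
  shows "ss = alt (length ss) i j \<or> ss = alt (length ss) j i"
  using assms(3)
proof (induction ss)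
  case (Cons k ss)
  have U: "{i, j} \<subseteq> I" using assms by auto
  have k: "k = i \<or> k = j" using Cons by (auto simp: red_def)
  have ss: "ss = alt (length ss) i j \<or> ss = alt (length ss) j i"
    using Cons red_tl[OF U] by blast
  show ?case
  proof (cases ss)
    case (Cons k' tt)
    have "k' \<noteq> k"
    proof
      assume "k' = k"
      have "red {i, j} (k # k # tt)" using Cons.prems \<open>ss = k' # tt\<close> \<open>k' = k\<close> by simp
      moreover from red_not_desc[OF U red_tl[OF U this]]
      have "len {i, j} (elt (k # k # tt)) < Suc (length tt)"
        using elt_Cons[of k "k # tt"] lists_I[OF U, of "k # tt"] Cons.prems U \<open>ss = k' # tt\<close> \<open>k' = k\<close> k
          red_tl[OF U calculation]
        by (auto simp: red_def)
      ultimately show False by (simp add: red_def)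
    qed
    then show ?thesis
      using k ss Cons by auto
  qed (use k in auto)
qed simp

text \<open>Treats finite and infinite labels together. At k = m - 1 the coefficient with index
  \<open>Suc k\<close> is already 0, hence the separate condition for strictness.\<close>

lemma cheb_c_nonneg:
  assumes "i \<in> I" "j \<in> I" "i \<noteq> j" "m i j = 0 \<or> k < m i j"
  shows "cheb (- c i j) k \<ge> 0" "m i j = 0 \<or> Suc k < m i j \<Longrightarrow> cheb (- c i j) (Suc k) > 0"
    "cheb (- c i j) (Suc k) \<ge> 0"
proof -
  consider "m i j = 0" | "m i j \<noteq> 0" "k < m i j" using assms by auto
  then have "cheb (- c i j) k \<ge> 0 \<and> (m i j = 0 \<or> Suc k < m i j \<longrightarrow> cheb (- c i j) (Suc k) > 0)
    \<and> cheb (- c i j) (Suc k) \<ge> 0"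
  proof cases
    case 1
    then have "- c i j \<ge> 2" using c_inf assms by fastforce
    from cheb_pos_ge2[OF this, of k] cheb_pos_ge2[OF this, of "k - 1"] show ?thesis
      by (cases k) auto
  next
    case 2
    then have c: "- c i j = 2 * cos (pi / real (m i j))" and m: "m i j \<ge> 2"
      using c_cos m_ge2 assms by auto
    have "cheb (- c i j) n \<ge> 0" if "n \<le> m i j" for n
      using cheb_pos_cos[OF m, of n] cheb_end_cos[OF m] that unfolding c
      by (cases "n = 0"; cases "n = m i j") auto
    then show ?thesis
      using cheb_pos_cos[OF m, of "Suc k"] 2 unfolding c by auto
  qed
  then show "cheb (- c i j) k \<ge> 0" "m i j = 0 \<or> Suc k < m i j \<Longrightarrow> cheb (- c i j) (Suc k) > 0"
    "cheb (- c i j) (Suc k) \<ge> 0" by auto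
qed

text \<open>A reduced word of u cannot begin with i, so it alternates and begins with j. If it had
  at least m letters, the braid relation would turn it into an equally long word beginning with
  i.\<close>

lemma dihedral_word:
  assumes ij: "i \<in> I" "j \<in> I" "i \<noteq> j" and u: "u \<in> W {i, j}"
    and l: "len {i, j} u \<le> len {i, j} (elt [i] \<odot> u)"
  obtains k where "u = elt (alt k j i)" "m i j = 0 \<or> k < m i j" "len {i, j} u = k"
proof -
  have U: "{i, j} \<subseteq> I" using ij by auto
  obtain ss where ss: "red {i, j} ss" "elt ss = u" "length ss = len {i, j} u"
    using red_ex[OF u] by blast
  define k where "k = length ss"
  have no: False if r: "red {i, j} (i # tt)" "elt (i # tt) = u" for tt
    using red_not_desc[OF U r(1)] l r by simp
  have ssk: "ss = alt k j i"
    using red_alt[OF ij(1,2) ss(1)] no ss by (cases k) (auto simp: k_def)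
  moreover have "m i j = 0 \<or> k < m i j"
  proof (rule ccontr)
    assume n: "\<not> (m i j = 0 \<or> k < m i j)"
    then obtain d where d: "k = m i j + d" using le_Suc_ex by (metis not_less)
    have m2: "m i j \<ge> 2" using n m_ge2 ij by auto
    obtain rest where rest: "alt k j i = alt (m i j) j i @ rest" "rest \<in> lists {i, j}"
      using alt_add[of "m i j" d j i] d by (metis alt_in_lists insertI1 insertI2)
    define tt where "tt = alt (m i j) i j @ rest"
    have tl: "tt \<in> lists {i, j}" using rest by (simp add: tt_def alt_in_lists)
    have "elt tt = elt ss"
      using braid[OF ij] n rest ssk act_in[of rest] lists_I[OF U rest(2)]
      by (auto simp: elt_def tt_def act_append restrict_def)
    moreover have "length tt = length ss"
      using rest ssk by (simp add: tt_def)
    ultimately have "red {i, j} tt" using tl ss by (simp add: red_def)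
    moreover obtain tt' where "tt = i # tt'"
      using m2 by (cases "m i j") (auto simp: tt_def)
    ultimately show False using no \<open>elt tt = elt ss\<close> ss by blast
  qed
  ultimately have "u = elt (alt k j i)" "m i j = 0 \<or> k < m i j" "len {i, j} u = k"
    using ss by (simp_all add: k_def)
  then show ?thesis by (rule that)
qed

section \<open>Lengths and the signs of pulled-back walls\<close>

lemma dihedral_Pos:
  assumes ij: "i \<in> I" "j \<in> I" "i \<noteq> j" and u: "u \<in> W {i, j}"
    and l: "len {i, j} u \<le> len {i, j} (elt [i] \<odot> u)"
  shows "Pos {i, j} i u"
proof -
  obtain k where k: "u = elt (alt k j i)" "m i j = 0 \<or> k < m i j"
    using dihedral_word[OF assms] by metis
  note nn = cheb_c_nonneg[OF ij k(2)]
  define b where "b = (\<lambda>n. if (n = i) = even k then cheb (- c i j) (Suc k) else cheb (- c i j) k)"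
  have "\<forall>n\<in>{i, j}. b n \<ge> 0"
    using nn by (auto simp: b_def)
  moreover have "lam i (u x) = (\<Sum>n\<in>{i, j}. b n * lam n x)" if "x \<in> X" for x
    using lam_alt[OF ij(1,2) that, of k] that ij(3) k(1) by (auto simp: elt_apply b_def)
  ultimately show ?thesis unfolding Pos_def by blast
qed

lemma Pos_compose:
  assumes "U \<subseteq> I" "V \<subseteq> I" "Pos V i u" "\<And>k. k \<in> V \<Longrightarrow> Pos U k v" "v \<in> W U"
  shows "Pos U i (u \<odot> v)"
proof -
  obtain b where b: "\<forall>j\<in>V. b j \<ge> 0" "\<forall>x\<in>X. lam i (u x) = (\<Sum>j\<in>V. b j * lam j x)"
    using assms by (auto simp: Pos_def)
  have "\<forall>k\<in>V. \<exists>d. (\<forall>j\<in>U. d j \<ge> 0) \<and> (\<forall>x\<in>X. lam k (v x) = (\<Sum>j\<in>U. d j * lam j x))"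
    using assms by (auto simp: Pos_def)
  then obtain d where d: "\<And>k j. k \<in> V \<Longrightarrow> j \<in> U \<Longrightarrow> d k j \<ge> 0"
    "\<And>k x. k \<in> V \<Longrightarrow> x \<in> X \<Longrightarrow> lam k (v x) = (\<Sum>j\<in>U. d k j * lam j x)"
    by metis
  define a where "a = (\<lambda>j. \<Sum>k\<in>V. b k * d k j)"
  have "\<forall>j\<in>U. a j \<ge> 0"
    using b d by (auto simp: a_def intro!: sum_nonneg)
  moreover have "lam i ((u \<odot> v) x) = (\<Sum>j\<in>U. a j * lam j x)" if "x \<in> X" for x
  proof -
    have "lam i ((u \<odot> v) x) = (\<Sum>k\<in>V. b k * (\<Sum>j\<in>U. d k j * lam j x))"
      using that b d W_in[OF assms(1,5)] by (simp add: compose_def)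
    also have "\<dots> = (\<Sum>k\<in>V. \<Sum>j\<in>U. b k * d k j * lam j x)"
      by (simp add: sum_distrib_left mult.assoc)
    also have "\<dots> = (\<Sum>j\<in>U. \<Sum>k\<in>V. b k * d k j * lam j x)"
      by (rule sum.swap)
    finally show ?thesis
      by (simp add: a_def sum_distrib_right)
  qed
  ultimately show ?thesis unfolding Pos_def by blast
qed

text \<open>Tits' reduction to rank two. With j the first letter of a reduced word of w, write w = u
  v with u in the dihedral group of i and j, lengths adding up, and v as short as possible. Then v
  has no descent at i or j and is shorter than w, so the induction hypothesis applies to v and the
  dihedral case to u.\<close>

lemma tits:
  assumes U: "U \<subseteq> I" and "w \<in> W U" "i \<in> U" "len U w \<le> len U (elt [i] \<odot> w)"
  shows "Pos U i w"
  using assms(2-)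
proof (induction "len U w" arbitrary: w i rule: less_induct)
  case (less w i)
  obtain ss where ss: "red U ss" "elt ss = w" "length ss = len U w"
    using red_ex less.prems by blast
  have finU: "finite U" using U fin finite_subset by blast
  show ?case
  proof (cases ss)
    case Nil
    then have w: "w = elt []" using ss by simp
    have "lam i (w x) = (\<Sum>j\<in>U. (if j = i then 1 else 0) * lam j x)" if "x \<in> X" for x
      using that less.prems finU by (simp add: w elt_apply if_distrib[of "\<lambda>z. z * _"] cong: if_cong)
    then show ?thesis unfolding Pos_def
      by (intro exI[of _ "\<lambda>j. if j = i then 1 else 0"]) auto
  next
    case (Cons j tt)
    have j: "j \<in> U" and tt: "tt \<in> lists U" "red U tt" and wj: "w = elt [j] \<odot> elt tt"
      using ss(1,2) Cons elt_Cons[of j tt] U lists_I[OF U, of tt] red_tl[OF U, of j tt]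
      by (auto simp: red_def)
    have "j \<noteq> i"
      using red_not_desc[OF U] ss Cons less.prems by fastforce
    define V where "V = {i, j}"
    have V: "V \<subseteq> U" "V \<subseteq> I" using j less.prems U by (auto simp: V_def)
    \<comment> \<open>The possible right factors v. One of them is \<open>elt tt\<close>, with the
      single letter j as left factor, so a shortest v is strictly shorter than w.\<close>
    define A where "A = {v. v \<in> W U \<and> (\<exists>u\<in>W V. u \<odot> v = w \<and> len V u + len U v = len U w)}"
    have "len V (elt [j]) \<noteq> 0"
    proof
      assume "len V (elt [j]) = 0"
      then have "elt [j] = elt []" using len_0[of "elt [j]" V] W_gen by (auto simp: V_def)
      then have "w = elt tt" using wj one_mul[OF U] tt by auto
      then show False using len_le[OF tt(1)] ss Cons by simp
    qed
    then have "len V (elt [j]) = 1" using len_gen[of j V] by (simp add: V_def)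
    then have "elt tt \<in> A"
      using wj tt ss Cons by (auto simp: A_def red_def V_def)
    then obtain v where v: "v \<in> A" "\<And>v'. v' \<in> A \<Longrightarrow> len U v \<le> len U v'"
      using ex_has_least_nat[of "\<lambda>v. v \<in> A" "elt tt" "len U"] by blast
    then obtain u where u: "u \<in> W V" "u \<odot> v = w" "len V u + len U v = len U w" and vW: "v \<in> W U"
      by (auto simp: A_def)
    have "len U v \<le> len U (elt tt)" using v \<open>elt tt \<in> A\<close> by blast
    then have lv: "len U v < len U w" using tt ss Cons by (auto simp: red_def)
    \<comment> \<open>A descent at k could be moved from v into u, contradicting the choice of
      v.\<close>
    have asc: "len U v \<le> len U (elt [k] \<odot> v)" if k: "k \<in> V" for k
    proof (rule ccontr)
      assume n: "\<not> len U v \<le> len U (elt [k] \<odot> v)"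
      define u' where "u' = u \<odot> elt [k]"
      define v' where "v' = elt [k] \<odot> v"
      have u': "u' \<in> W V" "len V u' \<le> Suc (len V u)"
        using W_mul[OF V(2) u(1) W_gen[OF k]] len_mul[OF V(2) u(1) W_gen[OF k]] len_gen[of k V] k
        by (auto simp: u'_def)
      have v': "v' \<in> W U" using W_mul[OF U _ vW] k V by (auto simp: v'_def)
      have "u' \<odot> v' = w"
        using mul_assoc[OF U v', of u "elt [k]"] gen_gen[OF U vW] k V u by (auto simp: u'_def v'_def)
      moreover have "len U w \<le> len V u' + len U v'"
        using len_mul[OF U, of u' v'] calculation u' v' W_mono[OF V(1)] len_mono[OF V(1) u'(1)] by force
      ultimately have "v' \<in> A"
        using u' v' n u by (auto simp: A_def v'_def intro!: bexI[of _ u'])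
      then show False using v n by (auto simp: v'_def)
    qed
    have PU: "Pos U k v" if "k \<in> V" for k
      using less.hyps[OF lv vW _ asc[OF that]] that V by blast
    have "len V u \<le> len V (elt [i] \<odot> u)"
    proof (rule ccontr)
      assume n: "\<not> ?thesis"
      have iu: "elt [i] \<odot> u \<in> W V" using W_mul[OF V(2) _ u(1)] by (auto simp: V_def)
      have "len U (elt [i] \<odot> w) = len U ((elt [i] \<odot> u) \<odot> v)"
        using mul_assoc[OF U vW, of "elt [i]" u] u by simp
      also have "\<dots> \<le> len V (elt [i] \<odot> u) + len U v"
        using len_mul[OF U, of "elt [i] \<odot> u" v] iu W_mono[OF V(1)] vW len_mono[OF V(1) iu] by force
      finally show False using n u less.prems by simp
    qed
    then have "Pos V i u"
      using dihedral_Pos[of i j u] u less.prems j U \<open>j \<noteq> i\<close> by (auto simp: V_def)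
    from Pos_compose[OF U V(2) this PU vW] show ?thesis using u by simp
  qed
qed

lemma Pos_strict:
  assumes "U \<subseteq> I" "w \<in> W U" "i \<in> U" "Pos U i w" "x \<in> X"
  shows "(\<forall>j\<in>U. lam j x < 0) \<Longrightarrow> lam i (w x) < 0" "(\<forall>j\<in>U. lam j x > 0) \<Longrightarrow> lam i (w x) > 0"
proof -
  obtain b where b: "\<forall>j\<in>U. b j \<ge> 0" "\<forall>x\<in>X. lam i (w x) = (\<Sum>j\<in>U. b j * lam j x)"
    using assms by (auto simp: Pos_def)
  have finU: "finite U" using assms(1) fin finite_subset by blast
  \<comment> \<open>The coefficients cannot all vanish: at the point that w sends to p the
    combination equals \<open>lam i p\<close>, which is negative.\<close>
  obtain w' where "w' \<in> W U" "w \<odot> w' = elt []"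
    using W_inv[OF assms(1,2)] by metis
  then have "w (w' p) = p" "w' p \<in> X"
    using p_in W_in[OF assms(1)] by (auto simp: compose_def elt_def fun_eq_iff split: if_splits)
  then have "(\<Sum>j\<in>U. b j * lam j (w' p)) < 0"
    using b lam_p[of i] assms by (metis subsetD)
  then obtain k where k: "k \<in> U" "b k \<noteq> 0"
    by (metis (mono_tags, lifting) less_irrefl mult_zero_left sum.neutral)
  have w: "lam i (w x) = (\<Sum>j\<in>U. b j * lam j x)" using b assms by blast
  show "lam i (w x) < 0" if "\<forall>j\<in>U. lam j x < 0"
  proof -
    have "(\<Sum>j\<in>U. b j * lam j x) < (\<Sum>j\<in>U. 0)"
      using b k that finU
      by (intro sum_strict_mono_ex1) (auto simp: mult_nonneg_nonpos less_imp_le intro!: bexI[of _ k] mult_pos_neg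
          order.not_eq_order_implies_strict)
    then show ?thesis using w by simp
  qed
  show "lam i (w x) > 0" if "\<forall>j\<in>U. lam j x > 0"
  proof -
    have "(\<Sum>j\<in>U. 0) < (\<Sum>j\<in>U. b j * lam j x)"
      using b k that finU
      by (intro sum_strict_mono_ex1) (auto simp: less_imp_le intro!: bexI[of _ k] mult_pos_pos
          order.not_eq_order_implies_strict)
    then show ?thesis using w by simp
  qed
qed

text \<open>By \<open>tits\<close> the pullback of wall i is positive along w or along
  \<open>elt [i]\<close> times w, and the sign of \<open>lam i (w p)\<close> tells which. In
  particular this value is never 0.\<close>

lemma len_ascent:
  assumes "U \<subseteq> I" "w \<in> W U" "i \<in> U"
  shows "lam i (w p) < 0 \<Longrightarrow> len U (elt [i] \<odot> w) = Suc (len U w) \<and> Pos U i w"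
    and "\<not> lam i (w p) < 0 \<Longrightarrow> Suc (len U (elt [i] \<odot> w)) = len U w \<and> lam i (w p) > 0 \<and> Pos U i (elt [i] \<odot> w)"
proof -
  define w' where "w' = elt [i] \<odot> w"
  have w': "w' \<in> W U"
    unfolding w'_def by (rule W_mul[OF assms(1) W_gen[OF assms(3)] assms(2)])
  have ww: "elt [i] \<odot> w' = w" using gen_gen assms by (simp add: w'_def)
  have lw: "lam i (w' p) = - lam i (w p)"
    using lam_gen[OF _ p_in assms(1,2), of i] assms by (auto simp: w'_def)
  have lp: "\<forall>j\<in>U. lam j p < 0" using lam_p assms by blast
  have a: "len U w \<le> len U w' \<Longrightarrow> Pos U i w \<and> lam i (w p) < 0"
    using tits[OF assms] Pos_strict(1)[OF assms _ p_in lp] by (auto simp: w'_def)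
  have b: "len U w' \<le> len U w \<Longrightarrow> Pos U i w' \<and> lam i (w' p) < 0"
    using tits[OF assms(1) w' assms(3)] Pos_strict(1)[OF assms(1) w' assms(3) _ p_in lp] ww by auto
  have ineq: "len U w' \<le> Suc (len U w)" "len U w \<le> Suc (len U w')"
    using len_gen_mul[OF assms] by (auto simp: w'_def)
  show "lam i (w p) < 0 \<Longrightarrow> len U (elt [i] \<odot> w) = Suc (len U w) \<and> Pos U i w"
    using a b ineq lw unfolding w'_def[symmetric] by linarith
  show "\<not> lam i (w p) < 0 \<Longrightarrow> Suc (len U (elt [i] \<odot> w)) = len U w \<and> lam i (w p) > 0 \<and> Pos U i (elt [i] \<odot> w)"
    using a b ineq lw unfolding w'_def[symmetric] by linarith
qed

section \<open>Minimal coset representatives of parabolic subgroups\<close>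

definition minrep :: "nat set \<Rightarrow> nat set \<Rightarrow> ('x \<Rightarrow> 'x) set" where
  "minrep V U = {v \<in> W U. \<forall>i\<in>V. lam i (v p) < 0}"

text \<open>\<open>minrep V U\<close> consists of the shortest elements of the cosets of
  \<open>W V\<close>, which acts from the left. When a reduced word of u is prepended letter by
  letter, each letter is an ascent: the pullback of its wall along the part of u already present is
  a nonnegative combination of walls of V, all of which are negative at \<open>v p\<close>.\<close>

lemma len_minrep:
  assumes "V \<subseteq> U" "U \<subseteq> I" "v \<in> minrep V U" "u \<in> W V"
  shows "len U (u \<odot> v) = len V u + len U v"
proof -
  have V: "V \<subseteq> I" and v: "v \<in> W U" "\<forall>i\<in>V. lam i (v p) < 0"
    using assms by (auto simp: minrep_def)
  have "len U (elt ss \<odot> v) = length ss + len U v" if "red V ss" for ss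
    using that
  proof (induction ss)
    case Nil
    then show ?case using one_mul[OF assms(2) v(1)] by simp
  next
    case (Cons i ss)
    have r: "red V ss" and i: "i \<in> V" and ss: "ss \<in> lists V" "elt ss \<in> W V"
      using Cons red_tl[OF V] by (auto simp: red_def)
    have "lam i (elt ss p) < 0"
    proof (rule ccontr)
      assume "\<not> ?thesis"
      from len_ascent(2)[OF V ss(2) i this] have "len V (elt [i] \<odot> elt ss) < len V (elt ss)" by simp
      moreover have "elt [i] \<odot> elt ss = elt (i # ss)"
        by (rule elt_Cons[symmetric]) (use i V lists_I[OF V ss(1)] in auto)
      ultimately show False
        using Cons.prems r by (simp add: red_def)
    qed
    from len_ascent(1)[OF V ss(2) i this] have P: "Pos V i (elt ss)" by blast
    have m: "elt ss \<odot> v \<in> W U" using W_mul[OF assms(2) _ v(1)] ss W_mono[OF assms(1)] by blast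
    have "lam i (elt ss (v p)) < 0"
      using Pos_strict(1)[OF V ss(2) i P] v W_in[OF assms(2) v(1) p_in] by blast
    then have "lam i ((elt ss \<odot> v) p) < 0"
      using p_in by (simp add: compose_def)
    from len_ascent(1)[OF assms(2) m _ this] i assms(1)
    have "len U (elt [i] \<odot> (elt ss \<odot> v)) = Suc (len U (elt ss \<odot> v))" by blast
    moreover have "elt [i] \<odot> (elt ss \<odot> v) = elt (i # ss) \<odot> v"
      using elt_ConsU[OF V i ss(1)] mul_assoc[OF assms(2) v(1), of "elt [i]" "elt ss"] by simp
    ultimately show ?case
      using Cons.IH[OF r] by simp
  qed
  then show ?thesis
    using red_ex[OF assms(4)] by metis
qed

lemma one_minrep: "V \<subseteq> U \<Longrightarrow> U \<subseteq> I \<Longrightarrow> elt [] \<in> minrep V U"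
  using lam_p p_in by (auto simp: minrep_def elt_apply)

text \<open>The case v = 1 of \<open>len_minrep\<close>. It carries summability from the whole group
  to its parabolic subgroups.\<close>

lemma len_parabolic:
  assumes "V \<subseteq> U" "U \<subseteq> I" "u \<in> W V"
  shows "len U u = len V u"
  using len_minrep[OF assms(1,2) one_minrep[OF assms(1,2)] assms(3)] mul_one[of V u] assms by simp

lemma minrep_ex:
  assumes "V \<subseteq> U" "U \<subseteq> I" "w \<in> W U"
  obtains u v where "u \<in> W V" "v \<in> minrep V U" "u \<odot> v = w"
proof -
  have V: "V \<subseteq> I" using assms by auto
  define A where "A = {v \<in> W U. \<exists>u\<in>W V. u \<odot> v = w}"
  have "w \<in> A" using one_mul[OF assms(2,3)] assms(3) by (auto simp: A_def intro!: bexI[of _ "elt []"])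
  then obtain v where v: "v \<in> A" "\<And>v'. v' \<in> A \<Longrightarrow> len U v \<le> len U v'"
    using ex_has_least_nat[of "\<lambda>v. v \<in> A" w "len U"] by blast
  then obtain u where u: "u \<in> W V" "u \<odot> v = w" and vW: "v \<in> W U" by (auto simp: A_def)
  have "lam i (v p) < 0" if i: "i \<in> V" for i
  proof (rule ccontr)
    assume "\<not> ?thesis"
    from len_ascent(2)[OF assms(2) vW _ this] i assms have l: "Suc (len U (elt [i] \<odot> v)) = len U v" by blast
    have v': "elt [i] \<odot> v \<in> W U"
      by (rule W_mul[OF assms(2) _ vW], rule W_gen) (use i assms in auto)
    have "(u \<odot> elt [i]) \<odot> (elt [i] \<odot> v) = w"
      using mul_assoc[OF assms(2) v', of u "elt [i]"] gen_gen[OF assms(2) vW, of i] i assms(1) u by auto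
    moreover have "u \<odot> elt [i] \<in> W V" by (rule W_mul[OF V u(1) W_gen[OF i]])
    ultimately have "elt [i] \<odot> v \<in> A" using v' by (auto simp: A_def)
    then show False using v l by fastforce
  qed
  then have "v \<in> minrep V U" using vW by (simp add: minrep_def)
  then show ?thesis using that[OF u(1) _ u(2)] by blast
qed

text \<open>Each representative is an element of \<open>W V\<close> times the other one; adding the
  two length equations shows that both factors have length 0.\<close>

lemma minrep_unique:
  assumes "V \<subseteq> U" "U \<subseteq> I" "u \<in> W V" "u' \<in> W V" "v \<in> minrep V U" "v' \<in> minrep V U" "u \<odot> v = u' \<odot> v'"
  shows "u = u' \<and> v = v'"
proof -
  have V: "V \<subseteq> I" using assms by auto
  have vW: "v \<in> W U" "v' \<in> W U" using assms by (auto simp: minrep_def)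
  obtain a where a: "a \<in> W V" "a \<odot> u = elt []" "u \<odot> a = elt []" using W_inv[OF V assms(3)] by metis
  obtain a' where a': "a' \<in> W V" "a' \<odot> u' = elt []" "u' \<odot> a' = elt []" using W_inv[OF V assms(4)] by metis
  have "v = a \<odot> (u \<odot> v)"
    using mul_assoc[OF assms(2) vW(1), of a u] a one_mul[OF assms(2) vW(1)] by simp
  also have "\<dots> = (a \<odot> u') \<odot> v'"
    using mul_assoc[OF assms(2) vW(2), of a u'] assms(7) by simp
  finally have 1: "v = (a \<odot> u') \<odot> v'" .
  have "v' = a' \<odot> (u' \<odot> v')"
    using mul_assoc[OF assms(2) vW(2), of a' u'] a' one_mul[OF assms(2) vW(2)] by simp
  also have "\<dots> = (a' \<odot> u) \<odot> v"
    using mul_assoc[OF assms(2) vW(1), of a' u] assms(7) by simp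
  finally have 2: "v' = (a' \<odot> u) \<odot> v" .
  have au: "a \<odot> u' \<in> W V" "a' \<odot> u \<in> W V" using W_mul[OF V] a a' assms by auto
  have "len U v = len V (a \<odot> u') + len U v'"
    using len_minrep[OF assms(1,2,6) au(1)] 1 by simp
  moreover have "len U v' = len V (a' \<odot> u) + len U v"
    using len_minrep[OF assms(1,2,5) au(2)] 2 by simp
  ultimately have "len V (a \<odot> u') = 0" by simp
  then have e: "a \<odot> u' = elt []" using len_0[OF au(1)] by simp
  then have "v = v'" using 1 one_mul[OF assms(2) vW(2)] by simp
  moreover have "u = u \<odot> (a \<odot> u')" using e mul_one[OF V assms(3)] by simp
  then have "u = u'"
    using mul_assoc[OF V assms(4), of u a] a one_mul[OF V assms(4)] by simp
  ultimately show ?thesis by simp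
qed

lemma minrep_bij:
  assumes "V \<subseteq> U" "U \<subseteq> I"
  shows "bij_betw (\<lambda>(u, v). u \<odot> v) (W V \<times> minrep V U) (W U)"
  unfolding bij_betw_def
proof
  show "inj_on (\<lambda>(u, v). u \<odot> v) (W V \<times> minrep V U)"
    using minrep_unique[OF assms] by (auto simp: inj_on_def)
  show "(\<lambda>(u, v). u \<odot> v) ` (W V \<times> minrep V U) = W U"
  proof
    show "(\<lambda>(u, v). u \<odot> v) ` (W V \<times> minrep V U) \<subseteq> W U"
    proof clarify
      fix u v assume "u \<in> W V" "v \<in> minrep V U"
      then show "u \<odot> v \<in> W U"
        using W_mul[OF assms(2), of u v] W_mono[OF assms(1)] unfolding minrep_def by blast
    qed
    show "W U \<subseteq> (\<lambda>(u, v). u \<odot> v) ` (W V \<times> minrep V U)"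
    proof
      fix w assume "w \<in> W U"
      then obtain u v where "u \<in> W V" "v \<in> minrep V U" "u \<odot> v = w"
        using minrep_ex[OF assms] by blast
      then show "w \<in> (\<lambda>(u, v). u \<odot> v) ` (W V \<times> minrep V U)"
        by (intro image_eqI[of _ _ "(u, v)"]) auto
    qed
  qed
qed

text \<open>
  This set has at most one element, the longest one, and it is empty when \<open>W U\<close> is infinite.
\<close>

definition fulldesc :: "nat set \<Rightarrow> ('x \<Rightarrow> 'x) set" where
  "fulldesc U = {w \<in> W U. \<forall>i\<in>U. lam i (w p) > 0}"

text \<open>Every reduced word is a beginning of w. All walls are positive at \<open>w p\<close>,
  and along the inverse of the letters already removed the pullback of the next wall is a
  nonnegative combination of walls, so each further letter is a descent.\<close>

lemma fulldesc_len:
  assumes U: "U \<subseteq> I" and w: "w \<in> fulldesc U" and r: "red U ss"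
  shows "len U (elt (rev ss) \<odot> w) + length ss = len U w"
  using r
proof (induction ss rule: rev_induct)
  case Nil
  then show ?case using one_mul[OF U] w by (simp add: fulldesc_def)
next
  case (snoc i ss)
  have wW: "w \<in> W U" "\<forall>i\<in>U. lam i (w p) > 0" using w by (auto simp: fulldesc_def)
  have l: "ss \<in> lists U" "i \<in> U" "rev ss \<in> lists U" and r: "len U (elt (ss @ [i])) = Suc (length ss)"
    using snoc.prems by (auto simp: red_def)
  \<comment> \<open>Inversion does not lengthen an element; the letters of ss are stripped from the
    left of w, which multiplies by the reversed word.\<close>
  have rr: "len U (elt (rev tt)) \<le> len U (elt tt)" if tt: "tt \<in> lists U" for tt
  proof -
    obtain vv where vv: "red U vv" "elt vv = elt tt" "length vv = len U (elt tt)"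
      using red_ex[OF W_elt[OF tt]] by blast
    have lv: "vv \<in> lists U" using vv by (simp add: red_def)
    have "elt (rev vv) = elt (rev vv) \<odot> (elt tt \<odot> elt (rev tt))"
      using elt_rev[of "rev tt"] mul_one[OF U W_elt[of "rev vv" U]] tt lv lists_I[OF U tt] by auto
    also have "\<dots> = elt (rev tt)"
    proof -
      have t: "elt (rev tt) \<in> W U" using tt by auto
      show ?thesis
        using mul_assoc[OF U t, of "elt (rev vv)" "elt vv"] elt_rev[OF lists_I[OF U lv]] vv(2)
          one_mul[OF U t] by simp
    qed
    finally show ?thesis using len_le[of "rev vv" U] lv vv by auto
  qed
  have "red U ss"
  proof -
    have "Suc (length ss) \<le> len U (elt ss) + 1"
      using r len_mul[OF U, of "elt ss" "elt [i]"] elt_append[of ss "[i]"] l lists_I[OF U] len_gen[OF l(2)] U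
      by force
    then show ?thesis using len_le[OF l(1)] l by (simp add: red_def)
  qed
  note IH = snoc.IH[OF this]
  have rW: "elt (rev ss) \<in> W U" using l by auto
  have "lam i (elt (rev ss) p) < 0"
  proof (rule ccontr)
    assume "\<not> ?thesis"
    from len_ascent(2)[OF U rW l(2) this] have "Suc (len U (elt [i] \<odot> elt (rev ss))) = len U (elt (rev ss))" by blast
    moreover have "elt [i] \<odot> elt (rev ss) = elt (rev (ss @ [i]))"
      using elt_ConsU[OF U l(2,3)] by simp
    moreover have "len U (elt (ss @ [i])) \<le> len U (elt (rev (ss @ [i])))"
      using rr[of "rev (ss @ [i])"] l by simp
    moreover have "len U (elt (rev ss)) \<le> length ss" using len_le[OF l(3)] by simp
    ultimately show False using r by simp
  qed
  from len_ascent(1)[OF U rW l(2) this] have "Pos U i (elt (rev ss))" by blast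
  then have "lam i (elt (rev ss) (w p)) > 0"
    using Pos_strict(2)[OF U rW l(2)] W_in[OF U wW(1) p_in] wW by blast
  then have pos: "\<not> lam i ((elt (rev ss) \<odot> w) p) < 0"
    using p_in by (simp add: compose_def)
  have mW: "elt (rev ss) \<odot> w \<in> W U" using W_mul[OF U rW wW(1)] .
  from len_ascent(2)[OF U mW l(2) pos]
  have "Suc (len U (elt [i] \<odot> (elt (rev ss) \<odot> w))) = len U (elt (rev ss) \<odot> w)" by blast
  moreover have "elt [i] \<odot> (elt (rev ss) \<odot> w) = elt (rev (ss @ [i])) \<odot> w"
    using elt_ConsU[OF U l(2,3)] mul_assoc[OF U wW(1), of "elt [i]" "elt (rev ss)"] by simp
  ultimately show ?case using IH by simp
qed

lemma fulldesc_le: "U \<subseteq> I \<Longrightarrow> w \<in> fulldesc U \<Longrightarrow> red U ss \<Longrightarrow> length ss \<le> len U w"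
  using fulldesc_len by (metis le_add2)

lemma fulldesc_unique:
  assumes U: "U \<subseteq> I" and w: "w \<in> fulldesc U" "w' \<in> fulldesc U"
  shows "w = w'"
proof -
  have wW: "w \<in> W U" "w' \<in> W U" using w by (auto simp: fulldesc_def)
  obtain ss where ss: "red U ss" "elt ss = w'" "length ss = len U w'" using red_ex wW by metis
  obtain tt where tt: "red U tt" "elt tt = w" "length tt = len U w" using red_ex wW by metis
  have "len U w = len U w'" using fulldesc_le[OF U] w ss tt by (metis antisym)
  then have "len U (elt (rev ss) \<odot> w) = 0"
    using fulldesc_len[OF U w(1) ss(1)] ss by simp
  moreover have rW: "elt (rev ss) \<in> W U" and "ss \<in> lists I"
    using ss lists_I[OF U, of ss] by (auto simp: red_def)
  ultimately have "elt (rev ss) \<odot> w = elt []"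
    by (intro len_0[OF W_mul[OF U rW wW(1)]])
  then have "w' \<odot> (elt (rev ss) \<odot> w) = w'" using mul_one[OF U wW(2)] by simp
  then show ?thesis
    using mul_assoc[OF U wW(1), of w' "elt (rev ss)"] elt_rev[of "rev ss"] ss \<open>ss \<in> lists I\<close>
      one_mul[OF U wW(1)] by auto
qed

end

section \<open>Growth functions\<close>

lemma sum_Pow_insert:
  fixes f :: "'a set \<Rightarrow> 'b::comm_monoid_add"
  assumes "finite A" "a \<notin> A"
  shows "sum f (Pow (insert a A)) = sum f (Pow A) + (\<Sum>V\<in>Pow A. f (insert a V))"
proof -
  have "sum f (Pow (insert a A)) = sum f (Pow A) + sum f (insert a ` Pow A)"
    using assms by (subst Pow_insert, subst sum.union_disjoint) auto
  also have "sum f (insert a ` Pow A) = (\<Sum>V\<in>Pow A. f (insert a V))"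
  proof (subst sum.reindex)
    show "inj_on (insert a) (Pow A)"
      using assms(2) by (intro inj_onI) (metis Pow_iff insert_ident subsetD)
  qed simp
  finally show ?thesis .
qed

lemma sum_Pow_alternating:
  assumes "finite A" "A \<noteq> {}"
  shows "(\<Sum>V\<in>Pow A. (-1) ^ card V) = (0::real)"
proof -
  obtain a B where A: "A = insert a B" "a \<notin> B" using assms by (metis all_not_in_conv mk_disjoint_insert)
  have fB: "finite B" using A assms by auto
  have "(\<Sum>V\<in>Pow B. (-1) ^ card (insert a V)) = (\<Sum>V\<in>Pow B. - ((-1) ^ card V) :: real)"
    using A fB by (intro sum.cong) (auto simp: finite_subset card_insert_if)
  then show ?thesis
    using A fB by (simp add: sum_Pow_insert sum_negf)
qed

lemma has_sum_linear_combination: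
  fixes h :: "'k \<Rightarrow> 'a \<Rightarrow> real"
  assumes "finite F" "\<And>V. V \<in> F \<Longrightarrow> (h V has_sum H V) A"
  shows "((\<lambda>w. \<Sum>V\<in>F. k V * h V w) has_sum (\<Sum>V\<in>F. k V * H V)) A"
  using assms by (induction F rule: finite_induct) (auto intro!: has_sum_add has_sum_cmult_right)

text \<open>All growth series are evaluated at one fixed real t, and their convergence there is the
  sole analytic input.\<close>

locale growth_system = reflection_system +
  fixes t :: real
  assumes t: "0 < t" "t < 1"
    and summ: "(\<lambda>w. t ^ len I w) summable_on W I"
begin

definition G :: "nat set \<Rightarrow> real" where
  "G U = infsum (\<lambda>w. t ^ len U w) (W U)"

definition g :: "nat set \<Rightarrow> real" where
  "g U = 1 / G U"

text \<open>A sum over at most one element: it gives \<open>t ^ L\<close> for the longest element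
  and 0 in an infinite group without a case distinction.\<close>

definition E :: "nat set \<Rightarrow> real" where
  "E U = infsum (\<lambda>w. t ^ len U w) (fulldesc U)"

lemma summ_sub:
  assumes "U \<subseteq> I" "B \<subseteq> W U"
  shows "(\<lambda>w. t ^ len U w) summable_on B"
proof -
  have "(\<lambda>w. t ^ len I w) summable_on B"
    using summable_on_subset_banach[OF summ] W_mono[OF assms(1)] assms(2) by blast
  then show ?thesis
    using assms len_parabolic[OF assms(1) order_refl] by (subst summable_on_cong[of _ _ "\<lambda>w. t ^ len I w"]) auto
qed

lemma G_ge_1: "U \<subseteq> I \<Longrightarrow> G U \<ge> 1"
proof -
  assume U: "U \<subseteq> I"
  have "sum (\<lambda>w. t ^ len U w) {elt []} \<le> G U"
    unfolding G_def using U t by (intro finite_sum_le_infsum summ_sub) auto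
  then show ?thesis by simp
qed

lemma g_pos: "U \<subseteq> I \<Longrightarrow> 0 < g U"
  using G_ge_1[of U] by (simp add: g_def)

lemma E_nonneg: "E U \<ge> 0"
  unfolding E_def using t by (intro infsum_nonneg) auto

lemma fulldesc_sub: "fulldesc U \<subseteq> W U"
  by (auto simp: fulldesc_def)

lemma E_eq: "U \<subseteq> I \<Longrightarrow> w \<in> fulldesc U \<Longrightarrow> E U = t ^ len U w"
proof -
  assume "U \<subseteq> I" "w \<in> fulldesc U"
  then have "fulldesc U = {w}" using fulldesc_unique by blast
  then show ?thesis by (simp add: E_def)
qed

lemma E_empty: "fulldesc U = {} \<Longrightarrow> E U = 0"
  by (simp add: E_def)

text \<open>A reduced word bounds \<open>E\<close> from above whether or not a longest element
  exists, because the value 0 of the infinite case lies below every power of t.\<close>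

lemma E_le:
  assumes "U \<subseteq> I" "red U ss"
  shows "E U \<le> t ^ length ss"
proof (cases "fulldesc U = {}")
  case True
  then show ?thesis using t by (simp add: E_empty)
next
  case False
  then obtain w where w: "w \<in> fulldesc U" by blast
  have "t ^ len U w \<le> t ^ length ss"
    using fulldesc_le[OF assms(1) w assms(2)] t by (intro power_decreasing) auto
  then show ?thesis using E_eq[OF assms(1) w] by simp
qed

lemma E_ge:
  assumes "U \<subseteq> I" "ss \<in> lists U" "\<And>i. i \<in> U \<Longrightarrow> lam i (act s ss p) > 0"
  shows "E U \<ge> t ^ length ss"
proof -
  have "elt ss \<in> fulldesc U" using assms p_in by (auto simp: fulldesc_def elt_apply)
  from E_eq[OF assms(1) this] show ?thesis
    using len_le[OF assms(2)] t by (auto intro: power_decreasing)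
qed

text \<open>\<open>W U\<close> is the product of \<open>W V\<close> with the minimal representatives
  and lengths add up, so the series of U factors and the sum over the representatives is G U / G
  V.\<close>

lemma G_minrep:
  assumes "V \<subseteq> U" "U \<subseteq> I"
  shows "((\<lambda>w. t ^ len U w) has_sum (G U * g V)) (minrep V U)"
proof -
  have V: "V \<subseteq> I" using assms by auto
  have sm: "(\<lambda>w. t ^ len U w) summable_on minrep V U"
    using assms by (intro summ_sub) (auto simp: minrep_def)
  define H where "H = infsum (\<lambda>w. t ^ len U w) (minrep V U)"
  note b = minrep_bij[OF assms]
  have "G U = infsum (\<lambda>x. t ^ len U ((\<lambda>(u, v). u \<odot> v) x)) (W V \<times> minrep V U)"
    unfolding G_def using infsum_reindex_bij_betw[OF b, of "\<lambda>w. t ^ len U w"] by simp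
  also have "\<dots> = infsum (\<lambda>(u, v). t ^ len V u * t ^ len U v) (W V \<times> minrep V U)"
    by (intro infsum_cong) (auto simp: len_minrep[OF assms] power_add)
  also have "\<dots> = infsum (\<lambda>u. infsum (\<lambda>v. t ^ len V u * t ^ len U v) (minrep V U)) (W V)"
  proof (subst infsum_Sigma_banach[symmetric])
    have "(\<lambda>x. t ^ len U ((\<lambda>(u, v). u \<odot> v) x)) summable_on (W V \<times> minrep V U)"
      using summable_on_reindex_bij_betw[OF b, of "\<lambda>w. t ^ len U w"] summ_sub[OF assms(2) order_refl] by simp
    then show "(\<lambda>(u, v). t ^ len V u * t ^ len U v) summable_on (W V \<times> minrep V U)"
      by (subst summable_on_cong[of _ _ "\<lambda>x. t ^ len U ((\<lambda>(u, v). u \<odot> v) x)"])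
        (auto simp: len_minrep[OF assms] power_add)
  qed simp
  also have "\<dots> = G V * H"
    by (simp add: infsum_cmult_right' infsum_cmult_left' G_def H_def)
  finally have "G U * g V = H"
    using G_ge_1[OF V] by (simp add: g_def)
  then show ?thesis
    using sm by (simp add: H_def)
qed

text \<open>Inclusion-exclusion over ascents. In the sum of (-1)^|V| G U / G V an element w is
  counted once for every set V of its ascents, so its total weight is 0 unless w has no ascent at
  all, that is, unless w is the longest element.\<close>

lemma identity:
  assumes U: "U \<subseteq> I"
  shows "(\<Sum>V\<in>Pow U. (-1) ^ card V * g V) = E U * g U"
proof -
  have fU: "finite U" using U fin finite_subset by blast
  define A where "A = (\<lambda>w. {i\<in>U. lam i (w p) < 0})"
  have h: "((\<lambda>w. if V \<subseteq> A w then t ^ len U w else 0) has_sum (G U * g V)) (W U)" if "V \<in> Pow U" for V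
  proof -
    have "((\<lambda>w. t ^ len U w) has_sum (G U * g V)) (minrep V U)" using G_minrep that U by blast
    then show ?thesis
      by (subst has_sum_cong_neutral[of _ _ "\<lambda>w. t ^ len U w"])
        (use that in \<open>auto simp: minrep_def A_def\<close>)
  qed
  have "((\<lambda>w. \<Sum>V\<in>Pow U. (-1) ^ card V * (if V \<subseteq> A w then t ^ len U w else 0)) has_sum
    (\<Sum>V\<in>Pow U. (-1) ^ card V * (G U * g V))) (W U)"
    using fU h by (intro has_sum_linear_combination) auto
  then have "((\<lambda>w. if A w = {} then t ^ len U w else 0) has_sum
    (\<Sum>V\<in>Pow U. (-1) ^ card V * (G U * g V))) (W U)"
  proof (rule has_sum_cong[THEN iffD1, rotated])
    fix w assume "w \<in> W U"
    have "(\<Sum>V\<in>Pow U. (-1) ^ card V * (if V \<subseteq> A w then t ^ len U w else 0)) =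
      (\<Sum>V\<in>Pow (A w). (-1) ^ card V * t ^ len U w)"
      using fU by (intro sum.mono_neutral_cong_right) (auto simp: A_def)
    also have "\<dots> = (\<Sum>V\<in>Pow (A w). (-1) ^ card V) * t ^ len U w"
      by (simp add: sum_distrib_right)
    also have "\<dots> = (if A w = {} then t ^ len U w else 0)"
    proof (cases "A w = {}")
      case False
      moreover have "finite (A w)" using fU by (simp add: A_def)
      ultimately show ?thesis using sum_Pow_alternating[of "A w"] by simp
    qed simp
    finally show "(\<Sum>V\<in>Pow U. (-1) ^ card V * (if V \<subseteq> A w then t ^ len U w else 0)) =
      (if A w = {} then t ^ len U w else 0)" .
  qed
  then have "infsum (\<lambda>w. if A w = {} then t ^ len U w else 0) (W U) = (\<Sum>V\<in>Pow U. (-1) ^ card V * (G U * g V))"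
    by (rule infsumI)
  moreover have "infsum (\<lambda>w. if A w = {} then t ^ len U w else 0) (W U) = E U"
    unfolding E_def
  proof (rule infsum_cong_neutral)
    fix w assume "w \<in> W U - fulldesc U"
    then obtain i where i: "w \<in> W U" "i \<in> U" "\<not> lam i (w p) > 0" by (auto simp: fulldesc_def)
    then have "lam i (w p) < 0" using len_ascent(2)[OF U i(1,2)] by blast
    then show "(if A w = {} then t ^ len U w else 0) = 0" using i by (auto simp: A_def)
  next
    fix w assume "w \<in> W U \<inter> fulldesc U"
    then have "\<forall>i\<in>U. \<not> lam i (w p) < 0" by (simp add: fulldesc_def not_less less_imp_le)
    then have "A w = {}" by (simp add: A_def)
    then show "(if A w = {} then t ^ len U w else 0) = t ^ len U w" by simp
  next
    fix w assume "w \<in> fulldesc U - W U"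
    then show "t ^ len U w = 0" using fulldesc_sub[of U] by blast
  qed
  moreover have "(\<Sum>V\<in>Pow U. (-1) ^ card V * (G U * g V)) = G U * (\<Sum>V\<in>Pow U. (-1) ^ card V * g V)"
    by (simp add: sum_distrib_left mult_ac)
  ultimately show ?thesis
    using G_ge_1[OF U] by (simp add: g_def field_simps)
qed

lemma g_empty: "g {} = 1"
proof -
  have "W {} = {elt []}" by (auto simp: W_def)
  then show ?thesis by (simp add: g_def G_def)
qed

lemma red_Cons:
  assumes "U \<subseteq> I" "red U ss" "i \<in> U" "lam i (act s ss p) < 0"
  shows "red U (i # ss)"
proof -
  have ss: "ss \<in> lists U" using assms by (simp add: red_def)
  then have w: "elt ss \<in> W U" by auto
  have "lam i (elt ss p) < 0" using assms p_in by (simp add: elt_apply)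
  from len_ascent(1)[OF assms(1) w assms(3) this] show ?thesis
    using assms elt_ConsU[OF assms(1,3) ss] ss by (auto simp: red_def)
qed

lemma red_Nil: "red U []"
  by (simp add: red_def)

lemma g_single: "i \<in> I \<Longrightarrow> g {i} = 1 / (1 + t)"
proof -
  assume i: "i \<in> I"
  have U: "{i} \<subseteq> I" using i by simp
  have "red {i} [i]" using red_Cons[OF U red_Nil, of i] lam_p[OF i] by simp
  then have "E {i} \<le> t" using E_le[OF U] by fastforce
  moreover have "E {i} \<ge> t"
    using E_ge[OF U, of "[i]"] lam_p[OF i] i p_in by (simp add: lam_s c_refl)
  ultimately have "1 - g {i} = t * g {i}"
    using identity[OF U] by (simp add: sum_Pow_insert g_empty)
  then show ?thesis using t by (simp add: field_simps)
qed

lemma red_alt_word: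
  assumes "i \<in> I" "j \<in> I" "i \<noteq> j" "k \<le> m i j"
  shows "red {i, j} (alt k i j)"
  using assms
proof (induction k i j rule: alt.induct)
  case (2 k i j)
  note ij = 2(2-4)
  have k: "k < m i j" using 2 by simp
  have "lam i (act s (alt k j i) p) < 0"
  proof -
    note nn = cheb_c_nonneg[OF ij, of k]
    have "cheb (- c i j) (Suc k) > 0 \<or> cheb (- c i j) k > 0"
    proof (cases "Suc k < m i j")
      case False
      then have "Suc (k - 1) = k" "m i j \<ge> 2" using k m_ge2[OF ij] by auto
      then show ?thesis using cheb_c_nonneg(2)[OF ij, of "k - 1"] k by auto
    qed (use nn k in auto)
    moreover have "cheb (- c i j) (Suc k) \<ge> 0" "cheb (- c i j) k \<ge> 0" using nn k by auto
    ultimately have "cheb (- c i j) (Suc k) * x + cheb (- c i j) k * y < 0" if "x < 0" "y < 0" for x y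
      using that by (metis add_neg_nonpos add_nonpos_neg less_imp_le mult_nonneg_nonpos mult_pos_neg)
    then show ?thesis
      using lam_alt[OF ij(1,2) p_in, of k] lam_p ij by simp
  qed
  moreover have "red {i, j} (alt k j i)"
    using 2 m_sym[of i j] by (simp add: insert_commute)
  ultimately show ?case
    using red_Cons[of "{i, j}" "alt k j i" i] ij by simp
qed (simp add: red_Nil)

lemma g_pair_aux:
  assumes "i \<in> I" "j \<in> I" "i \<noteq> j"
  shows "1 - 2 / (1 + t) + g {i, j} = E {i, j} * g {i, j}"
  using identity[of "{i, j}"] assms by (simp add: sum_Pow_insert g_empty g_single)

lemma g_pair:
  assumes "i \<in> I" "j \<in> I" "i \<noteq> j" "m i j \<noteq> 0"
  shows "g {i, j} = (1 - t) / ((1 + t) * (1 - t ^ m i j))"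
proof -
  have U: "{i, j} \<subseteq> I" using assms by simp
  have m2: "m i j \<ge> 2" using m_ge2 assms by blast
  have "E {i, j} \<le> t ^ m i j"
    using E_le[OF U red_alt_word[OF assms(1-3) order_refl]] by simp
  moreover have "E {i, j} \<ge> t ^ m i j"
  proof -
    have c: "- c i j = 2 * cos (pi / real (m i j))" using c_cos assms by auto
    have pos: "lam i (act s (alt (m i j) j i) p) > 0" "lam j (act s (alt (m i j) i j) p) > 0"
      using lam_alt[OF assms(1,2) p_in, of "m i j"] lam_alt[OF assms(2,1) p_in, of "m i j"]
        cheb_end_cos[OF m2] lam_p assms c c_sym[OF assms(1,2)] by auto
    have "lam k (act s (alt (m i j) i j) p) > 0" if "k \<in> {i, j}" for k
      using that pos braid[OF assms(1-4) p_in] by auto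
    from E_ge[OF U _ this] show ?thesis by (simp add: alt_in_lists)
  qed
  ultimately have "1 - 2 / (1 + t) + g {i, j} = t ^ m i j * g {i, j}"
    using g_pair_aux[OF assms(1-3)] by simp
  moreover have "t ^ m i j < 1" using t m2 by (simp add: power_less_one_iff)
  moreover from calculation have "g {i, j} * ((1 + t) * (1 - t ^ m i j)) = 1 - t"
    using t by (simp add: field_simps)
  ultimately show ?thesis using t by (simp add: eq_divide_eq)
qed

text \<open>No alternating word, however long, makes both walls positive, so there is no longest
  element.\<close>

lemma g_pair_inf:
  assumes "i \<in> I" "j \<in> I" "i \<noteq> j" "m i j = 0"
  shows "g {i, j} = (1 - t) / (1 + t)"
proof -
  have neg: "lam i (act s (alt k j i) p) < 0" if "i \<in> I" "j \<in> I" "i \<noteq> j" "m i j = 0" for i j k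
  proof -
    have "cheb (- c i j) (Suc k) * x + cheb (- c i j) k * y < 0" if "x < 0" "y < 0" for x y
      using cheb_c_nonneg[of i j k] \<open>i \<in> I\<close> \<open>j \<in> I\<close> \<open>i \<noteq> j\<close> \<open>m i j = 0\<close> that
      by (metis add_neg_nonpos mult_nonneg_nonpos mult_pos_neg less_imp_le)
    then show ?thesis using lam_alt[OF that(1,2) p_in, of k] lam_p that by simp
  qed
  have "fulldesc {i, j} = {}"
  proof (rule ccontr)
    assume "fulldesc {i, j} \<noteq> {}"
    then obtain w where w: "w \<in> W {i, j}" "lam i (w p) > 0" "lam j (w p) > 0" by (auto simp: fulldesc_def)
    obtain ss where ss: "red {i, j} ss" "elt ss = w" using red_ex[OF w(1)] by blast
    have "w p = act s ss p" using ss p_in by (auto simp: elt_apply)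
    then show False
      using red_alt[OF assms(1,2) ss(1)] neg[of i j "length ss"] neg[of j i "length ss"] assms w m_sym[of i j]
      by auto
  qed
  then have "1 - 2 / (1 + t) + g {i, j} = 0"
    using g_pair_aux[OF assms(1-3)] by (simp add: E_empty)
  then show ?thesis using t by (simp add: field_simps)
qed

text \<open>The minimal representatives of \<open>W A\<close> in the group of the union are exactly
  the elements of \<open>W B\<close>: letters of B leave the walls of A unchanged and can be moved
  past the letters of A.\<close>

lemma g_product:
  assumes "A \<subseteq> I" "B \<subseteq> I" "A \<inter> B = {}" "\<And>i j. i \<in> A \<Longrightarrow> j \<in> B \<Longrightarrow> m i j = 2"
  shows "g (A \<union> B) = g A * g B"
proof -
  define U where "U = A \<union> B"
  have U: "U \<subseteq> I" "A \<subseteq> U" "B \<subseteq> U" using assms by (auto simp: U_def)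
  have c0: "c i j = 0" "c j i = 0" if "i \<in> A" "j \<in> B" for i j
  proof -
    have "i \<in> I" "j \<in> I" "i \<noteq> j" "m i j = 2" using assms that by auto
    then show "c i j = 0" "c j i = 0" using c_cos[of i j] c_sym[of i j] by auto
  qed
  have com: "s i (s j x) = s j (s i x)" if "i \<in> A" "j \<in> B" "x \<in> X" for i j x
  proof -
    have "i \<in> I" "j \<in> I" "i \<noteq> j" "m i j = 2" using assms that by auto
    then show ?thesis using braid[of i j x] that by (simp add: numeral_2_eq_2)
  qed
  have comw: "s j (act s ss x) = act s ss (s j x)" if "ss \<in> lists A" "j \<in> B" "x \<in> X" for ss j x
    using that
  proof (induction ss)
    case (Cons i ss)
    have "act s ss x \<in> X" using Cons lists_I[OF assms(1)] act_in by simp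
    then show ?case using Cons com[of i j "act s ss x"] by simp
  qed simp
  have B_min: "W B \<subseteq> minrep A U"
  proof
    fix u assume u: "u \<in> W B"
    then obtain ss where ss: "ss \<in> lists B" "u = elt ss" by (auto simp: W_def)
    have "lam i (act s ss p) = lam i p" if i: "i \<in> A" for i
      using ss(1)
    proof (induction ss)
      case (Cons j ss)
      have "act s ss p \<in> X" using Cons lists_I[OF assms(2)] act_in p_in by simp
      moreover have "i \<in> I" "j \<in> I" using Cons i assms by auto
      ultimately show ?case using Cons i c0[of i j] by (simp add: lam_s)
    qed simp
    then show "u \<in> minrep A U"
      using u ss W_mono[OF U(3)] lam_p assms(1) p_in by (auto simp: minrep_def elt_apply subset_iff)
  qed
  have dec: "\<exists>u\<in>W A. \<exists>v\<in>W B. elt ss = u \<odot> v" if "ss \<in> lists U" for ss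
    using that
  proof (induction ss)
    case Nil
    show ?case
      using one_mul[OF assms(2) W_elt[of "[]"]] by (intro bexI[of _ "elt []"]) auto
  next
    case (Cons i ss)
    then have iU: "i \<in> U" "ss \<in> lists U" by auto
    from Cons obtain aa bb where ab: "aa \<in> lists A" "bb \<in> lists B" "elt ss = elt aa \<odot> elt bb"
      by (auto simp: W_def)
    have abI: "aa \<in> lists I" "bb \<in> lists I" using ab lists_I assms by auto
    have bX: "elt bb \<in> W B" using ab by auto
    have iss: "elt (i # ss) = elt [i] \<odot> (elt aa \<odot> elt bb)"
      using elt_ConsU[OF U(1) iU] ab by simp
    show ?case
    proof (cases "i \<in> A")
      case True
      have "elt (i # ss) = elt (i # aa) \<odot> elt bb"
        using iss mul_assoc[OF assms(2) bX, of "elt [i]" "elt aa"] elt_ConsU[OF assms(1) True ab(1)] by simp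
      then show ?thesis using True ab by (intro bexI[of _ "elt (i # aa)"] bexI[of _ "elt bb"]) auto
    next
      case False
      then have iB: "i \<in> B" using iU by (auto simp: U_def)
      have "elt [i] \<odot> elt aa = elt aa \<odot> elt [i]"
        using comw[OF ab(1) iB] act_in[OF abI(1)] s_in[of i] iB assms(2)
        by (auto simp: compose_def elt_apply subset_iff intro!: restrict_ext)
      then have "elt (i # ss) = elt aa \<odot> (elt [i] \<odot> elt bb)"
        using iss mul_assoc[OF assms(2) bX, of "elt [i]" "elt aa"] mul_assoc[OF assms(2) bX, of "elt aa" "elt [i]"]
        by simp
      moreover have "elt aa \<in> W A" "elt [i] \<odot> elt bb \<in> W B"
        using iB ab elt_ConsU[OF assms(2) iB ab(2)] W_elt[of "i # bb" B] by auto
      ultimately show ?thesis by blast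
    qed
  qed
  have "minrep A U = W B"
  proof
    show "minrep A U \<subseteq> W B"
    proof
      fix v assume v: "v \<in> minrep A U"
      then obtain ss where ss: "ss \<in> lists U" "v = elt ss" by (auto simp: minrep_def W_def)
      then obtain a b where ab: "a \<in> W A" "b \<in> W B" "v = a \<odot> b" using dec by blast
      have "v \<in> W U" using v by (simp add: minrep_def)
      then have e: "elt [] \<odot> v = a \<odot> b" using ab(3) one_mul[OF U(1)] by simp
      have 1: "elt [] \<in> W A" by auto
      have "b \<in> minrep A U" using B_min ab(2) by (rule subsetD)
      from minrep_unique[OF U(2,1) 1 ab(1) v this e] ab(2) show "v \<in> W B" by simp
    qed
  qed (rule B_min)
  then have "((\<lambda>w. t ^ len U w) has_sum (G U * g A)) (W B)"
    using G_minrep[OF U(2,1)] by simp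
  then have "((\<lambda>w. t ^ len B w) has_sum (G U * g A)) (W B)"
    using len_parabolic[OF U(3,1)] by (subst has_sum_cong[of _ _ "\<lambda>w. t ^ len U w"]) auto
  then have "G B = G U * g A" unfolding G_def by (rule infsumI)
  then have "g U = g A * g B"
    using G_ge_1[OF U(1)] G_ge_1[OF assms(1)] G_ge_1[OF assms(2)] by (simp add: g_def field_simps)
  then show ?thesis by (simp add: U_def)
qed

end

section \<open>Reduced words\<close>

text \<open>
  Reducedness of explicit words is checked by computation. The pair \<open>(a, b)\<close> stands for \<open>a + b \<theta>\<close>, where
  \<open>\<theta>\<^sup>2 = A \<theta> + B\<close>. Row \<open>k\<close> of the tableau for \<open>w\<close> expresses \<open>lam k (w p)\<close> through the \<open>lam l p\<close>; a
  letter is accepted only if the coefficients in its row are nonnegative, that is, if it is an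
  ascent, and the element is the longest one as soon as all coefficients are nonpositive.
\<close>

type_synonym quad = "int \<times> int"

definition qval :: "real \<Rightarrow> quad \<Rightarrow> real" where
  "qval \<theta> x = of_int (fst x) + of_int (snd x) * \<theta>"

fun qmul :: "int \<Rightarrow> int \<Rightarrow> quad \<Rightarrow> quad \<Rightarrow> quad" where
  "qmul A B (a, b) (c, d) = (a * c + B * (b * d), a * d + b * c + A * (b * d))"

fun qadd :: "quad \<Rightarrow> quad \<Rightarrow> quad" where
  "qadd (a, b) (c, d) = (a + c, b + d)"

definition rstep :: "int \<Rightarrow> int \<Rightarrow> quad list list \<Rightarrow> nat \<Rightarrow> quad list list \<Rightarrow> quad list list" where
  "rstep A B K i S = map (\<lambda>(x, r). map2 (\<lambda>y z. qadd y (qmul A B x z)) r (S ! i)) (zip (K ! i) S)"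

fun run_word :: "int \<Rightarrow> int \<Rightarrow> quad list list \<Rightarrow> nat list \<Rightarrow> quad list list \<Rightarrow> quad list list option" where
  "run_word A B K [] S = Some S"
| "run_word A B K (i # w) S = (case run_word A B K w S of None \<Rightarrow> None | Some T \<Rightarrow>
     if list_all (\<lambda>(a, b). a \<ge> 0 \<and> b \<ge> 0) (T ! i) then Some (rstep A B K i T) else None)"

definition unit_rows :: "nat \<Rightarrow> quad list list" where
  "unit_rows n = map (\<lambda>k. map (\<lambda>l. if l = k then (1, 0) else (0, 0)) [0..<n]) [0..<n]"

definition all_neg :: "quad list list \<Rightarrow> bool" where
  "all_neg S \<longleftrightarrow> list_all (list_all (\<lambda>(a, b). a \<le> 0 \<and> b \<le> 0)) S"

abbreviation "run_ok A B K w \<equiv> run_word A B K w (unit_rows (length K)) \<noteq> None"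

abbreviation "run_full A B K w \<equiv>
  (case run_word A B K w (unit_rows (length K)) of None \<Rightarrow> False | Some S \<Rightarrow> all_neg S)"

lemma qval_mul: "\<theta> * \<theta> = of_int A * \<theta> + of_int B \<Longrightarrow> qval \<theta> (qmul A B x y) = qval \<theta> x * qval \<theta> y"
proof (cases x; cases y)
  fix a b c d assume h: "\<theta> * \<theta> = of_int A * \<theta> + of_int B" "x = (a, b)" "y = (c, d)"
  have "of_int b * of_int d * (\<theta> * \<theta>) = of_int b * of_int d * (of_int A * \<theta> + of_int B)"
    by (simp only: h(1))
  then show "qval \<theta> (qmul A B x y) = qval \<theta> x * qval \<theta> y"
    unfolding h(2,3) qval_def by (simp add: algebra_simps)
qed

lemma qval_add: "qval \<theta> (qadd x y) = qval \<theta> x + qval \<theta> y"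
  by (cases x; cases y) (simp add: qval_def algebra_simps)

context growth_system
begin

text \<open>The rows of \<open>K\<close> hold the Gram entries with opposite sign, so that the
  letter i adds \<open>K ! i ! k\<close> times row i to row k of the tableau.\<close>

definition cox_rows :: "real \<Rightarrow> quad list list \<Rightarrow> nat list \<Rightarrow> bool" where
  "cox_rows \<theta> K ns \<longleftrightarrow> distinct ns \<and> set ns \<subseteq> I \<and> length K = length ns \<and>
     (\<forall>i<length ns. length (K ! i) = length ns \<and>
       (\<forall>k<length ns. qval \<theta> (K ! i ! k) = - c (ns ! i) (ns ! k)))"

lemma run_word_sound:
  assumes \<theta>: "\<theta> \<ge> 0" "\<theta> * \<theta> = of_int A * \<theta> + of_int B" and K: "cox_rows \<theta> K ns"
    and w: "set w \<subseteq> {..<length ns}"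
    and "run_word A B K w (unit_rows (length K)) = Some S"
  shows "red (set ns) (map ((!) ns) w) \<and> length S = length ns \<and> (\<forall>k<length ns. length (S ! k) = length ns) \<and>
    (\<forall>k<length ns. - lam (ns ! k) (act s (map ((!) ns) w) p) = (\<Sum>l<length ns. qval \<theta> (S ! k ! l) * - lam (ns ! l) p))"
  using w assms(5)
proof (induction w arbitrary: S)
  case Nil
  define n where "n = length ns"
  have S: "S = unit_rows n" using Nil K by (simp add: n_def cox_rows_def)
  have "(\<Sum>l<n. qval \<theta> (S ! k ! l) * - lam (ns ! l) p) = - lam (ns ! k) p" if "k < n" for k
  proof -
    have "(\<Sum>l<n. qval \<theta> (S ! k ! l) * - lam (ns ! l) p) = (\<Sum>l<n. if l = k then - lam (ns ! l) p else 0)"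
      using that by (intro sum.cong) (auto simp: S unit_rows_def qval_def)
    then show ?thesis using that by simp
  qed
  then show ?case
    by (simp add: S unit_rows_def red_Nil flip: n_def)
next
  case (Cons i w)
  define n where "n = length ns"
  define q where "q = act s (map ((!) ns) w) p"
  have nsI: "set ns \<subseteq> I" and Kl: "length K = n" "\<And>i. i < n \<Longrightarrow> length (K ! i) = n"
    and Kc: "\<And>i k. i < n \<Longrightarrow> k < n \<Longrightarrow> qval \<theta> (K ! i ! k) = - c (ns ! i) (ns ! k)"
    using K by (auto simp: cox_rows_def n_def)
  obtain T where T: "run_word A B K w (unit_rows (length K)) = Some T"
    "list_all (\<lambda>(a, b). a \<ge> 0 \<and> b \<ge> 0) (T ! i)" "S = rstep A B K i T"
    using Cons.prems by (auto split: option.splits if_splits)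
  have i: "i < n" "set w \<subseteq> {..<n}" using Cons.prems by (auto simp: n_def)
  have IH: "red (set ns) (map ((!) ns) w)" "length T = n" "\<And>k. k < n \<Longrightarrow> length (T ! k) = n"
    "\<And>k. k < n \<Longrightarrow> - lam (ns ! k) q = (\<Sum>l<n. qval \<theta> (T ! k ! l) * - lam (ns ! l) p)"
    using Cons.IH[OF _ T(1)] i by (auto simp: n_def q_def)
  have ns: "ns ! k \<in> set ns" "ns ! k \<in> I" if "k < n" for k
    using that nsI by (auto simp: n_def)
  have wl: "map ((!) ns) w \<in> lists (set ns)" using IH by (simp add: red_def)
  have qX: "q \<in> X" using act_in[OF lists_I[OF nsI wl] p_in] by (simp add: q_def)
  have "- lam (ns ! i) q \<ge> 0"
  proof -
    have "qval \<theta> (T ! i ! l) * - lam (ns ! l) p \<ge> 0" if "l < n" for l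
    proof -
      have "T ! i ! l \<in> set (T ! i)" using IH(3)[OF i(1)] that by simp
      then have "qval \<theta> (T ! i ! l) \<ge> 0" using T(2) \<theta>(1) by (auto simp: list_all_iff qval_def)
      moreover have "- lam (ns ! l) p \<ge> 0" using lam_p[OF ns(2)[OF that]] by simp
      ultimately show ?thesis by (rule mult_nonneg_nonneg)
    qed
    then show ?thesis using IH(4)[OF i(1)] by (auto intro: sum_nonneg)
  qed
  moreover have qe: "elt (map ((!) ns) w) p = q" using p_in by (simp add: elt_apply q_def)
  \<comment> \<open>Nonnegative coefficients only yield a value at most 0. By
    \<open>len_ascent\<close> a value that is not negative would be positive, so it is
    negative.\<close>
  ultimately have neg: "lam (ns ! i) q < 0"
    using len_ascent(2)[OF nsI W_elt[OF wl] ns(1)[OF i(1)]] unfolding qe by argo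
  have r: "red (set ns) (map ((!) ns) (i # w))"
    using red_Cons[OF nsI IH(1) ns(1)[OF i(1)]] neg by (simp add: q_def)
  have Sl: "length S = n" using T Kl IH i by (simp add: rstep_def)
  have Sk: "S ! k = map2 (\<lambda>y z. qadd y (qmul A B (K ! i ! k) z)) (T ! k) (T ! i)" if "k < n" for k
    using T Kl IH i that by (simp add: rstep_def)
  have Skl: "qval \<theta> (S ! k ! l) = qval \<theta> (T ! k ! l) - c (ns ! i) (ns ! k) * qval \<theta> (T ! i ! l)"
    if "k < n" "l < n" for k l
    using that Sk[OF that(1)] IH(3) i Kc[OF i(1) that(1)] by (simp add: qval_add qval_mul[OF \<theta>(2)])
  have "- lam (ns ! k) (s (ns ! i) q) = (\<Sum>l<n. qval \<theta> (S ! k ! l) * - lam (ns ! l) p)" if k: "k < n" for k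
  proof -
    have "- lam (ns ! k) (s (ns ! i) q) = - lam (ns ! k) q - c (ns ! i) (ns ! k) * (- lam (ns ! i) q)"
      using lam_s[OF ns(2)[OF i(1)] ns(2)[OF k] qX] by simp
    also have "\<dots> = (\<Sum>l<n. (qval \<theta> (T ! k ! l) - c (ns ! i) (ns ! k) * qval \<theta> (T ! i ! l)) * - lam (ns ! l) p)"
      unfolding IH(4)[OF k] IH(4)[OF i(1)]
      by (simp only: sum_distrib_left left_diff_distrib sum_subtractf mult.assoc)
    also have "\<dots> = (\<Sum>l<n. qval \<theta> (S ! k ! l) * - lam (ns ! l) p)"
      using Skl[OF k] by (intro sum.cong) auto
    finally show ?thesis .
  qed
  moreover have "\<forall>k<n. length (S ! k) = n" using Sk IH(3) i by simp
  moreover have "act s (map ((!) ns) (i # w)) p = s (ns ! i) q" by (simp add: q_def)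
  ultimately show ?case
    using r Sl unfolding n_def by simp
qed

lemma word_le:
  assumes "\<theta> \<ge> 0" "\<theta> * \<theta> = of_int A * \<theta> + of_int B" "cox_rows \<theta> K ns" "set w \<subseteq> {..<length ns}" "run_ok A B K w"
    and "length w = n"
  shows "E (set ns) \<le> t ^ n"
proof -
  from assms obtain S where "run_word A B K w (unit_rows (length K)) = Some S" by auto
  from run_word_sound[OF assms(1-4) this] have "red (set ns) (map ((!) ns) w)" by blast
  moreover have "set ns \<subseteq> I" using assms by (simp add: cox_rows_def)
  ultimately show ?thesis using E_le[of "set ns" "map ((!) ns) w"] assms(6) by simp
qed

lemma word_ge:
  assumes "\<theta> \<ge> 0" "\<theta> * \<theta> = of_int A * \<theta> + of_int B" "cox_rows \<theta> K ns" "set w \<subseteq> {..<length ns}" "run_full A B K w"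
    and "length w = n"
  shows "E (set ns) \<ge> t ^ n"
proof -
  from assms obtain S where S: "run_word A B K w (unit_rows (length K)) = Some S" "all_neg S"
    by (auto split: option.splits)
  note snd = run_word_sound[OF assms(1-4) S(1)]
  have nsI: "set ns \<subseteq> I" using assms by (simp add: cox_rows_def)
  have wl: "map ((!) ns) w \<in> lists (set ns)" using snd by (simp add: red_def)
  have "lam j (act s (map ((!) ns) w) p) > 0" if j: "j \<in> set ns" for j
  proof -
    obtain k where k: "k < length ns" "j = ns ! k" using j unfolding in_set_conv_nth by auto
    have "qval \<theta> (S ! k ! l) * - lam (ns ! l) p \<le> 0" if "l < length ns" for l
    proof -
      have "S ! k \<in> set S" "S ! k ! l \<in> set (S ! k)" using snd k that by auto
      then have "qval \<theta> (S ! k ! l) \<le> 0"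
        using S(2) assms(1) by (auto simp: all_neg_def list_all_iff qval_def add_nonpos_nonpos mult_nonpos_nonneg
            dest!: bspec)
      moreover have "- lam (ns ! l) p \<ge> 0" using lam_p[of "ns ! l"] nsI that by (simp add: less_imp_le subset_iff)
      ultimately show ?thesis by (rule mult_nonpos_nonneg)
    qed
    then have "- lam j (act s (map ((!) ns) w) p) \<le> 0"
      using snd k by (auto intro: sum_nonpos)
    then show ?thesis
      using len_ascent(2)[OF nsI W_elt[OF wl] j] p_in by (simp add: elt_apply)
  qed
  from E_ge[OF nsI wl this] show ?thesis using assms(6) by simp
qed

end

text \<open>The path with labels 3 and k, where x encodes 2 cos (pi / k): types A3, B3 and
  H3.\<close>

definition path3_rows :: "quad \<Rightarrow> quad list list" where
  "path3_rows x = [[(-2,0),(1,0),(0,0)],[(1,0),(-2,0),x],[(0,0),x,(-2,0)]]"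

definition path4_rows :: "quad \<Rightarrow> quad \<Rightarrow> quad list list" where
  "path4_rows x y = [[(-2,0),(1,0),(0,0),(0,0)],[(1,0),(-2,0),x,(0,0)],[(0,0),x,(-2,0),y],[(0,0),(0,0),y,(-2,0)]]"

definition star4_rows :: "quad list list" where
  "star4_rows = [[(-2,0),(1,0),(1,0),(1,0)],[(1,0),(-2,0),(0,0),(0,0)],[(1,0),(0,0),(-2,0),(0,0)],[(1,0),(0,0),(0,0),(-2,0)]]"

lemma run_A3: "run_full 0 1 (path3_rows (1,0)) [0,1,2,0,1,0]"
  by code_simp

lemma run_B3: "run_full 0 2 (path3_rows (0,1)) [2,1,2,0,1,2,0,1,0]"
  by code_simp

lemma run_H3: "run_full 1 1 (path3_rows (0,1)) [2,1,2,0,1,2,0,1,2,0,1,2,0,1,0]"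
  by code_simp

text \<open>In rank 4 only upper bounds for \<open>E\<close> enter the estimates, so reducedness
  suffices; rank 3 needs exact values and therefore \<open>run_full\<close>.\<close>

lemma run_A4: "run_ok 0 1 (path4_rows (1,0) (1,0)) [0,1,2,3,0,1,2,0,1,0]"
  by code_simp

lemma run_B4: "run_ok 0 2 (path4_rows (1,0) (0,1)) [3,2,3,1,2,3,0,1,2,3,0,1,2,0,1,0]"
  by code_simp

lemma run_F4: "run_ok 0 2 (path4_rows (0,1) (1,0)) [3,2,1,2,0,1,2,3,2,1,2,0,1,2,3,2,1,2,0,1,2,0,1,0]"
  by code_simp

lemma run_D4: "run_ok 0 1 star4_rows [3,0,2,1,0,3,1,0,2,1,0,1]"
  by code_simp

text \<open>The longest element of type H4 has length 60; a reduced word of 40 letters already gives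
  a sufficient bound.\<close>

lemma run_H4: "run_ok 1 1 (path4_rows (1,0) (0,1))
  [2,3,0,1,2,3,0,1,2,3,0,1,2,3,0,1,2,3,0,1,2,3,0,1,2,3,0,1,2,3,0,1,2,3,0,1,2,0,1,0]"
  by code_simp

section \<open>Numerical bounds\<close>

definition gold :: real where
  "gold = 2 * cos (pi / 5)"

text \<open>\<open>cheb x 5\<close> factors as (x^2 - x - 1)(x^2 + x - 1), and the second factor is
  positive for x > 1. So this is the golden ratio.\<close>

lemma gold: "gold > 1" "gold * gold = gold + 1"
proof -
  have "cos (pi / 3) < cos (pi / 5)"
    by (rule cos_monotone_0_pi) auto
  then show 1: "gold > 1" by (simp add: gold_def cos_60)
  have "cheb (2 * cos (pi / real 5)) 5 = 0"
    by (rule cheb_end_cos) simp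
  then have "cheb gold 5 = 0" by (simp add: gold_def)
  then have "(gold * gold - gold - 1) * (gold * gold + gold - 1) = 0"
    by (simp add: numeral_eq_Suc algebra_simps)
  moreover have "gold * gold + gold - 1 > 0" using 1 by (smt (verit) mult_less_cancel_left1)
  ultimately show "gold * gold = gold + 1" by simp
qed

context reflection_system
begin

lemma c_label:
  assumes "i \<in> I" "j \<in> I" "i \<noteq> j"
  shows "m i j = 2 \<Longrightarrow> c i j = 0" "m i j = 3 \<Longrightarrow> c i j = -1" "m i j = 4 \<Longrightarrow> c i j = - sqrt 2"
    "m i j = 5 \<Longrightarrow> c i j = - gold"
  using c_cos[OF assms] by (simp_all add: cos_60 cos_45 gold_def)

end

text \<open>
  At \<open>t = 21/25\<close> the value \<open>gp k\<close> is the reciprocal of the growth series of the dihedral group with label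
  \<open>k\<close>, and \<open>td p q r\<close> is the alternating sum of the identity over the proper subsets of a triple. In
  \<open>tb\<close> the exponents 6, 9 and 15 are the lengths of the longest elements of types A3, B3 and H3.
\<close>

definition gp :: "nat \<Rightarrow> real" where
  "gp k = (if k = 0 then 2 / 23 else 2 / 23 / (1 - (21 / 25) ^ k))"

definition td :: "nat \<Rightarrow> nat \<Rightarrow> nat \<Rightarrow> real" where
  "td p q r = gp p + gp q + gp r - 29 / 46"

definition perm3 :: "nat \<Rightarrow> nat \<Rightarrow> nat \<Rightarrow> nat \<Rightarrow> bool" where
  "perm3 k p q r \<longleftrightarrow> (p, q, r) \<in> {(3, k, 2), (k, 3, 2), (2, 3, k), (2, k, 3), (3, 2, k), (k, 2, 3)}"

text \<open>The triples for which \<open>tb\<close> is the exact value: one wall orthogonal to the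
  two others, whose label is arbitrary, or type A3, B3 or H3.\<close>

definition spherical3 :: "nat \<Rightarrow> nat \<Rightarrow> nat \<Rightarrow> bool" where
  "spherical3 p q r \<longleftrightarrow> p = 2 \<and> q = 2 \<or> q = 2 \<and> r = 2 \<or> p = 2 \<and> r = 2
     \<or> perm3 3 p q r \<or> perm3 4 p q r \<or> perm3 5 p q r"

definition tb :: "nat \<Rightarrow> nat \<Rightarrow> nat \<Rightarrow> real" where
  "tb p q r = (if p = 2 \<and> q = 2 then 25 / 46 * gp r else if q = 2 \<and> r = 2 then 25 / 46 * gp p
     else if p = 2 \<and> r = 2 then 25 / 46 * gp q
     else if perm3 3 p q r then td p q r / (1 + (21 / 25) ^ 6)
     else if perm3 4 p q r then td p q r / (1 + (21 / 25) ^ 9)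
     else if perm3 5 p q r then td p q r / (1 + (21 / 25) ^ 15)
     else td p q r)"

section \<open>The identity at t = 21/25 in ranks up to five\<close>

locale growth_system_21_25 = growth_system +
  assumes t0: "t = 21 / 25"
begin

lemma g1: "i \<in> I \<Longrightarrow> g {i} = 25 / 46"
proof -
  assume "i \<in> I"
  moreover have "1 / (1 + t) = 25 / 46" by (simp add: t0)
  ultimately show ?thesis using g_single by simp
qed

lemma g2: "i \<in> I \<Longrightarrow> j \<in> I \<Longrightarrow> i \<noteq> j \<Longrightarrow> g {i, j} = gp (m i j)"
proof (cases "m i j = 0")
  case True
  assume "i \<in> I" "j \<in> I" "i \<noteq> j"
  moreover have "(1 - t) / (1 + t) = gp (m i j)" using True by (simp add: gp_def t0)
  ultimately show ?thesis using g_pair_inf True by simp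
next
  case False
  assume a: "i \<in> I" "j \<in> I" "i \<noteq> j"
  have "(21 / 25 :: real) ^ m i j < 1" using False by (simp add: power_less_one_iff)
  then have "(1 - t) / ((1 + t) * (1 - t ^ m i j)) = gp (m i j)"
    using False by (simp add: gp_def t0 divide_simps)
  then show ?thesis
    using g_pair[OF a False] by simp
qed

text \<open>The constants 29/46 (inside \<open>td\<close>), 27/23 and 79/46 of this and the next two
  lemmas come from the empty set and the k singletons: they are k * 25/46 - 1 for k = 3, 4,
  5.\<close>

lemma tri_id:
  assumes "distinct [a, b, c']" "{a, b, c'} \<subseteq> I"
  shows "td (m a b) (m b c') (m a c') - g {a, b, c'} = E {a, b, c'} * g {a, b, c'}"
  using identity[OF assms(2)] assms
  by (simp add: sum_Pow_insert g_empty g1 g2 td_def insert_commute m_sym)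

lemma quad_id:
  assumes "distinct [a, b, c', d]" "{a, b, c', d} \<subseteq> I"
  shows "gp (m a b) + gp (m a c') + gp (m a d) + gp (m b c') + gp (m b d) + gp (m c' d) - 27 / 23
    - g {a, b, c'} - g {a, b, d} - g {a, c', d} - g {b, c', d} + g {a, b, c', d} = E {a, b, c', d} * g {a, b, c', d}"
  using identity[OF assms(2)] assms
  by (simp add: sum_Pow_insert g_empty g1 g2 insert_commute m_sym)

lemma quint_id:
  assumes "distinct [a, b, c', d, e]" "{a, b, c', d, e} \<subseteq> I"
  shows "gp (m a b) + gp (m a c') + gp (m a d) + gp (m a e) + gp (m b c') + gp (m b d) + gp (m b e)
    + gp (m c' d) + gp (m c' e) + gp (m d e) - 79 / 46
    - g {a, b, c'} - g {a, b, d} - g {a, b, e} - g {a, c', d} - g {a, c', e} - g {a, d, e}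
    - g {b, c', d} - g {b, c', e} - g {b, d, e} - g {c', d, e}
    + g {a, b, c', d} + g {a, b, c', e} + g {a, b, d, e} + g {a, c', d, e} + g {b, c', d, e}
    - g {a, b, c', d, e} = E {a, b, c', d, e} * g {a, b, c', d, e}"
  using identity[OF assms(2)] assms
  by (simp add: sum_Pow_insert g_empty g1 g2 insert_commute m_sym)

text \<open>The sum over the proper subsets of a triple is \<open>(1 + E) * g\<close>.\<close>

lemma tri_pos:
  assumes "distinct [a, b, c']" "{a, b, c'} \<subseteq> I"
  shows "td (m a b) (m b c') (m a c') > 0"
proof -
  have "E {a, b, c'} * g {a, b, c'} \<ge> 0"
    using E_nonneg g_pos[OF assms(2)] by (simp add: less_imp_le)
  then show ?thesis using tri_id[OF assms] g_pos[OF assms(2)] by linarith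
qed

lemma run_full_ok: "run_full A B K w \<Longrightarrow> run_ok A B K w"
  by (auto split: option.splits)

lemma cox_path3:
  assumes "distinct [a, b, c']" "{a, b, c'} \<subseteq> I" "m a b = 3" "m a c' = 2" "c b c' = - qval \<theta> x"
  shows "cox_rows \<theta> (path3_rows x) [a, b, c']"
  using assms c_label[of a b] c_label[of a c'] c_sym[of a b] c_sym[of a c'] c_sym[of b c'] c_refl
  by (simp add: cox_rows_def path3_rows_def All_less_Suc2 qval_def)

lemma E_A3:
  assumes "distinct [a, b, c']" "{a, b, c'} \<subseteq> I" "m a b = 3" "m a c' = 2" "m b c' = 3"
  shows "E {a, b, c'} = (21 / 25) ^ 6"
proof -
  have "cox_rows 1 (path3_rows (1, 0)) [a, b, c']"
    using assms c_label[of b c'] by (intro cox_path3) (auto simp: qval_def)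
  from word_ge[OF _ _ this _ run_A3, of 6] word_le[OF _ _ this _ run_full_ok[OF run_A3], of 6]
  have "E {a, b, c'} = t ^ 6" by simp
  then show ?thesis by (simp only: t0)
qed

lemma E_B3:
  assumes "distinct [a, b, c']" "{a, b, c'} \<subseteq> I" "m a b = 3" "m a c' = 2" "m b c' = 4"
  shows "E {a, b, c'} = (21 / 25) ^ 9"
proof -
  have "cox_rows (sqrt 2) (path3_rows (0, 1)) [a, b, c']"
    using assms c_label[of b c'] by (intro cox_path3) (auto simp: qval_def)
  from word_ge[OF _ _ this _ run_B3, of 9] word_le[OF _ _ this _ run_full_ok[OF run_B3], of 9]
  have "E {a, b, c'} = t ^ 9" by simp
  then show ?thesis by (simp only: t0)
qed

lemma E_H3:
  assumes "distinct [a, b, c']" "{a, b, c'} \<subseteq> I" "m a b = 3" "m a c' = 2" "m b c' = 5"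
  shows "E {a, b, c'} = (21 / 25) ^ 15"
proof -
  have "cox_rows gold (path3_rows (0, 1)) [a, b, c']"
    using assms c_label[of b c'] by (intro cox_path3) (auto simp: qval_def)
  from word_ge[OF _ _ this _ run_H3, of 15] word_le[OF _ _ this _ run_full_ok[OF run_H3], of 15] gold
  have "E {a, b, c'} = t ^ 15" by simp
  then show ?thesis by (simp only: t0)
qed

lemma tri_path:
  assumes "distinct [a, b, c']" "{a, b, c'} \<subseteq> I" "m a b = 3" "m a c' = 2" "E {a, b, c'} = x" "x > 0"
  shows "g {a, b, c'} = td 3 (m b c') 2 / (1 + x)"
  using tri_id[OF assms(1,2)] assms by (simp add: field_simps)

text \<open>For a product the factorisation, and for a spherical path the value of \<open>E\<close>,
  is known and makes \<open>tb\<close> exact; in all other cases \<open>E >= 0\<close> leaves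
  \<open>td\<close> as an upper bound.\<close>

lemma
  assumes d: "distinct [a, b, c']" and I: "{a, b, c'} \<subseteq> I"
  shows tri_le: "g {a, b, c'} \<le> tb (m a b) (m b c') (m a c')"
    and tri_eq: "spherical3 (m a b) (m b c') (m a c') \<Longrightarrow> g {a, b, c'} = tb (m a b) (m b c') (m a c')"
proof -
  have pr: "g {x, y, z} = 25 / 46 * gp (m y z)"
    if "{x, y, z} \<subseteq> I" "m x y = 2" "m x z = 2" "distinct [x, y, z]" for x y z
  proof -
    have "g ({x} \<union> {y, z}) = g {x} * g {y, z}"
      using that by (intro g_product) auto
    then show ?thesis using g1[of x] g2[of y z] that by (simp add: insert_commute)
  qed
  have td_le: "g {a, b, c'} \<le> td (m a b) (m b c') (m a c')"
  proof -
    have "E {a, b, c'} * g {a, b, c'} \<ge> 0"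
      using E_nonneg g_pos[OF I] by (simp add: less_imp_le)
    then show ?thesis using tri_id[OF d I] by linarith
  qed
  have td_sym: "td x y z = td y x z" "td x y z = td x z y" for x y z
    by (simp_all add: td_def)
  have core: "g {a, b, c'} = td 3 k 2 / (1 + x) \<and> td (m a b) (m b c') (m a c') = td 3 k 2"
    if p: "perm3 k (m a b) (m b c') (m a c')" and E: "x > 0"
      "\<And>a b c'. distinct [a, b, c'] \<Longrightarrow> {a, b, c'} \<subseteq> I \<Longrightarrow> m a b = 3 \<Longrightarrow> m a c' = 2 \<Longrightarrow> m b c' = k \<Longrightarrow>
        E {a, b, c'} = x" for k x
  proof -
    have T: "g {u, v, w} = td 3 k 2 / (1 + x)"
      if "distinct [u, v, w]" "{u, v, w} \<subseteq> I" "m u v = 3" "m u w = 2" "m v w = k" for u v w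
      using tri_path[OF that(1-4) E(2)[OF that] E(1)] that by simp
    have S: "m b a = m a b" "m c' b = m b c'" "m c' a = m a c'" using I m_sym by auto
    have P: "{a, b, c'} = {b, a, c'}" "{a, b, c'} = {c', b, a}" "{a, b, c'} = {a, c', b}"
      "{a, b, c'} = {b, c', a}" "{a, b, c'} = {c', a, b}" by auto
    have "g {a, b, c'} = td 3 k 2 / (1 + x)"
      using p T[of a b c'] T[of b a c'] T[of c' b a] T[of a c' b] T[of b c' a] T[of c' a b] d I S
      by (auto simp: perm3_def insert_commute)
    then show ?thesis using p td_sym by (auto simp: perm3_def)
  qed
  note facts = pr[of a b c'] pr[of b a c'] pr[of c' a b] td_le core[OF _ _ E_A3] core[OF _ _ E_B3]
    core[OF _ _ E_H3] d I m_sym[of a b] m_sym[of b c'] m_sym[of a c']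
  show "g {a, b, c'} \<le> tb (m a b) (m b c') (m a c')"
    using facts by (auto simp: tb_def insert_commute)
  show "g {a, b, c'} = tb (m a b) (m b c') (m a c')" if "spherical3 (m a b) (m b c') (m a c')"
    using facts that by (auto simp: tb_def spherical3_def insert_commute)
qed

text \<open>
  The analogue of \<open>td\<close> for quadruples, with the triples bounded by \<open>tb\<close>; negative for every
  admissible diagram.
\<close>

definition qd :: "nat \<Rightarrow> nat \<Rightarrow> nat \<Rightarrow> nat \<Rightarrow> nat \<Rightarrow> nat \<Rightarrow> real" where
  "qd ab ac ad bc bd cd = gp ab + gp ac + gp ad + gp bc + gp bd + gp cd - 27 / 23
    - tb ab bc ac - tb ab bd ad - tb ac cd ad - tb bc cd bd"

text \<open>A single letter is a reduced word, so \<open>E <= t < 1\<close> and the sum over the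
  proper subsets, \<open>(E - 1) * g\<close>, is negative. The triples enter it with a minus sign,
  so their upper bounds may replace them.\<close>

lemma quad_neg:
  assumes "distinct [a, b, c', d]" "{a, b, c', d} \<subseteq> I"
  shows "qd (m a b) (m a c') (m a d) (m b c') (m b d) (m c' d) < 0"
proof -
  have "red {a, b, c', d} [a]" using red_Cons[OF assms(2) red_Nil] lam_p[of a] assms(2) by simp
  then have "E {a, b, c', d} \<le> t" using E_le[OF assms(2)] by fastforce
  then have "E {a, b, c', d} * g {a, b, c', d} < g {a, b, c', d}"
    using t g_pos[OF assms(2)] by simp
  moreover have "g {a, b, c'} \<le> tb (m a b) (m b c') (m a c')" "g {a, b, d} \<le> tb (m a b) (m b d) (m a d)"
    "g {a, c', d} \<le> tb (m a c') (m c' d) (m a d)" "g {b, c', d} \<le> tb (m b c') (m c' d) (m b d)"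
    using assms by (intro tri_le; auto)+
  ultimately show ?thesis using quad_id[OF assms] unfolding qd_def by linarith
qed

text \<open>Quadruples enter the sum of rank five with a plus sign and have to be bounded from above
  there; x is any bound for \<open>E\<close>.\<close>

lemma quad_le:
  assumes "distinct [a, b, c', d]" "{a, b, c', d} \<subseteq> I" "E {a, b, c', d} \<le> x"
  shows "g {a, b, c', d} * (1 - x) \<le>
    g {a, b, c'} + g {a, b, d} + g {a, c', d} + g {b, c', d} + 27 / 23
    - (gp (m a b) + gp (m a c') + gp (m a d) + gp (m b c') + gp (m b d) + gp (m c' d))"
proof -
  have "E {a, b, c', d} * g {a, b, c', d} \<le> x * g {a, b, c', d}"
    using assms g_pos[OF assms(2)] by (intro mult_right_mono) auto
  then show ?thesis using quad_id[OF assms(1,2)] by (simp add: algebra_simps)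
qed

lemma g_prod1:
  assumes "distinct [a, b, c', d]" "{a, b, c', d} \<subseteq> I" "m a b = 2" "m a c' = 2" "m a d = 2"
  shows "g {a, b, c', d} = 25 / 46 * g {b, c', d}"
proof -
  have "g ({a} \<union> {b, c', d}) = g {a} * g {b, c', d}"
    using assms by (intro g_product) auto
  then show ?thesis using g1[of a] assms by (simp add: insert_commute)
qed

lemma g_prod2:
  assumes "distinct [a, b, c', d]" "{a, b, c', d} \<subseteq> I" "m a c' = 2" "m a d = 2" "m b c' = 2" "m b d = 2"
  shows "g {a, b, c', d} = gp (m a b) * gp (m c' d)"
proof -
  have "g ({a, b} \<union> {c', d}) = g {a, b} * g {c', d}"
    using assms by (intro g_product) auto
  then show ?thesis using g2[of a b] g2[of c' d] assms by (simp add: insert_commute)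
qed

lemma cox_path4:
  assumes "distinct [a, b, c', d]" "{a, b, c', d} \<subseteq> I" "m a b = 3" "m a c' = 2" "m a d = 2" "m b d = 2"
    "c b c' = - qval \<theta> x" "c c' d = - qval \<theta> y"
  shows "cox_rows \<theta> (path4_rows x y) [a, b, c', d]"
proof -
  have "c a b = -1" "c a c' = 0" "c a d = 0" "c b d = 0"
    using assms c_label(2)[of a b] c_label(1)[of a c'] c_label(1)[of a d] c_label(1)[of b d] by simp_all
  moreover from this have "c b a = -1" "c c' a = 0" "c d a = 0" "c d b = 0" "c c' b = c b c'" "c d c' = c c' d"
    using assms(2) c_sym[of a b] c_sym[of a c'] c_sym[of a d] c_sym[of b d] c_sym[of b c'] c_sym[of c' d]
    by simp_all
  moreover have "c a a = 2" "c b b = 2" "c c' c' = 2" "c d d = 2" using assms(2) c_refl by simp_all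
  ultimately show ?thesis
    using assms(1,2,7,8) by (simp add: cox_rows_def path4_rows_def All_less_Suc2 qval_def)
qed

lemma E_A4:
  assumes "distinct [a, b, c', d]" "{a, b, c', d} \<subseteq> I" "m a b = 3" "m a c' = 2" "m a d = 2" "m b d = 2"
    "m b c' = 3" "m c' d = 3"
  shows "E {a, b, c', d} \<le> 174901229 / 1000000000"
proof -
  have "c b c' = -1" "c c' d = -1"
    using assms c_label(2)[of b c'] c_label(2)[of c' d] by simp_all
  then have "cox_rows 1 (path4_rows (1, 0) (1, 0)) [a, b, c', d]"
    using assms by (intro cox_path4) (simp_all add: qval_def)
  from word_le[OF _ _ this _ run_A4, of 10] have "E {a, b, c', d} \<le> t ^ 10" by simp
  also have "\<dots> = (21 / 25) ^ 10" by (simp only: t0)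
  also have "\<dots> \<le> 174901229 / 1000000000" by (simp add: power_divide)
  finally show ?thesis .
qed

lemma E_B4:
  assumes "distinct [a, b, c', d]" "{a, b, c', d} \<subseteq> I" "m a b = 3" "m a c' = 2" "m a d = 2" "m b d = 2"
    "m b c' = 3" "m c' d = 4"
  shows "E {a, b, c', d} \<le> 61442458 / 1000000000"
proof -
  have "c b c' = -1" "c c' d = - sqrt 2"
    using assms c_label(2)[of b c'] c_label(3)[of c' d] by simp_all
  then have "cox_rows (sqrt 2) (path4_rows (1, 0) (0, 1)) [a, b, c', d]"
    using assms by (intro cox_path4) (simp_all add: qval_def)
  from word_le[OF _ _ this _ run_B4, of 16] have "E {a, b, c', d} \<le> t ^ 16" by simp
  also have "\<dots> = (21 / 25) ^ 16" by (simp only: t0)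
  also have "\<dots> \<le> 61442458 / 1000000000" by (simp add: power_divide)
  finally show ?thesis .
qed

lemma E_F4:
  assumes "distinct [a, b, c', d]" "{a, b, c', d} \<subseteq> I" "m a b = 3" "m a c' = 2" "m a d = 2" "m b d = 2"
    "m b c' = 4" "m c' d = 3"
  shows "E {a, b, c', d} \<le> 15230104 / 1000000000"
proof -
  have "c b c' = - sqrt 2" "c c' d = -1"
    using assms c_label(3)[of b c'] c_label(2)[of c' d] by simp_all
  then have "cox_rows (sqrt 2) (path4_rows (0, 1) (1, 0)) [a, b, c', d]"
    using assms by (intro cox_path4) (simp_all add: qval_def)
  from word_le[OF _ _ this _ run_F4, of 24] have "E {a, b, c', d} \<le> t ^ 24" by simp
  also have "\<dots> = (21 / 25) ^ 24" by (simp only: t0)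
  also have "\<dots> \<le> 15230104 / 1000000000" by (simp add: power_divide)
  finally show ?thesis .
qed

lemma E_H4:
  assumes "distinct [a, b, c', d]" "{a, b, c', d} \<subseteq> I" "m a b = 3" "m a c' = 2" "m a d = 2" "m b d = 2"
    "m b c' = 3" "m c' d = 5"
  shows "E {a, b, c', d} \<le> 935776 / 1000000000"
proof -
  have "c b c' = -1" "c c' d = - gold"
    using assms c_label(2)[of b c'] c_label(4)[of c' d] by simp_all
  then have "cox_rows gold (path4_rows (1, 0) (0, 1)) [a, b, c', d]"
    using assms by (intro cox_path4) (simp_all add: qval_def)
  from word_le[OF _ _ this _ run_H4, of 40] gold have "E {a, b, c', d} \<le> t ^ 40" by simp
  also have "\<dots> = (21 / 25) ^ 40" by (simp only: t0)
  also have "\<dots> \<le> 935776 / 1000000000" by (simp add: power_divide)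
  finally show ?thesis .
qed

lemma E_D4:
  assumes "distinct [a, b, c', d]" "{a, b, c', d} \<subseteq> I" "m a b = 3" "m a c' = 3" "m a d = 3" "m b d = 2"
    "m b c' = 2" "m c' d = 2"
  shows "E {a, b, c', d} \<le> 123410308 / 1000000000"
proof -
  have "c a b = -1" "c a c' = -1" "c a d = -1" "c b d = 0" "c b c' = 0" "c c' d = 0"
    using assms c_label(2)[of a b] c_label(2)[of a c'] c_label(2)[of a d] c_label(1)[of b d] c_label(1)[of b c']
      c_label(1)[of c' d] by simp_all
  moreover from this have "c b a = -1" "c c' a = -1" "c d a = -1" "c d b = 0" "c c' b = 0" "c d c' = 0"
    using assms(2) c_sym[of a b] c_sym[of a c'] c_sym[of a d] c_sym[of b d] c_sym[of b c'] c_sym[of c' d] by simp_all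
  moreover have "c a a = 2" "c b b = 2" "c c' c' = 2" "c d d = 2" using assms(2) c_refl by simp_all
  ultimately have "cox_rows 1 star4_rows [a, b, c', d]"
    using assms(1,2) by (simp add: cox_rows_def star4_rows_def All_less_Suc2 qval_def)
  from word_le[OF _ _ this _ run_D4, of 12] have "E {a, b, c', d} \<le> t ^ 12" by simp
  also have "\<dots> = (21 / 25) ^ 12" by (simp only: t0)
  also have "\<dots> \<le> 123410308 / 1000000000" by (simp add: power_divide)
  finally show ?thesis .
qed

lemma gp_values:
  shows "gp 2 = 625 / 2116"
    and "gp 3 = 15625 / 73186"
    and "gp 4 = 390625 / 2255656"
    and "gp 5 = 9765625 / 65337526"
    and "gp 7 = 6103515625 / 49477911466"
  by (simp_all add: gp_def power_divide)

text \<open>Rounded to nine decimals in both directions, which leaves the later estimates to linear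
  arithmetic with one common denominator.\<close>

lemma gp_bounds:
  shows "295368620 / 1000000000 \<le> gp 2" "gp 2 \<le> 295368621 / 1000000000"
    and "213497116 / 1000000000 \<le> gp 3" "gp 3 \<le> 213497117 / 1000000000"
    and "173175785 / 1000000000 \<le> gp 4" "gp 4 \<le> 173175786 / 1000000000"
    and "149464260 / 1000000000 \<le> gp 5" "gp 5 \<le> 149464261 / 1000000000"
    and "123358392 / 1000000000 \<le> gp 7" "gp 7 \<le> 123358393 / 1000000000"
  by (simp_all add: gp_values)

lemma tb_bounds:
  shows "tb 2 2 2 \<le> 160526424 / 1000000000"
    and "tb 2 2 3 \<le> 116031042 / 1000000000"
    and "tb 2 3 2 \<le> 116031042 / 1000000000"
    and "tb 2 3 3 \<le> 68029457 / 1000000000"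
    and "tb 2 3 4 \<le> 42713183 / 1000000000"
    and "tb 2 3 5 \<le> 25993873 / 1000000000"
    and "tb 2 3 7 \<le> 1789347 / 1000000000"
    and "tb 2 4 2 \<le> 94117275 / 1000000000"
    and "tb 2 4 3 \<le> 42713183 / 1000000000"
    and "tb 2 5 2 \<le> 81230577 / 1000000000"
    and "tb 2 5 3 \<le> 25993873 / 1000000000"
    and "tb 2 7 2 \<le> 67042605 / 1000000000"
    and "tb 3 2 2 \<le> 116031042 / 1000000000"
    and "tb 3 2 3 \<le> 68029457 / 1000000000"
    and "tb 3 2 4 \<le> 42713183 / 1000000000"
    and "tb 3 2 5 \<le> 25993873 / 1000000000"
    and "tb 3 2 7 \<le> 1789347 / 1000000000"
    and "tb 3 3 2 \<le> 68029457 / 1000000000"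
    and "tb 3 4 2 \<le> 42713183 / 1000000000"
    and "tb 3 5 2 \<le> 25993873 / 1000000000"
    and "tb 3 7 2 \<le> 1789347 / 1000000000"
    and "tb 4 2 2 \<le> 94117275 / 1000000000"
    and "tb 4 2 3 \<le> 42713183 / 1000000000"
    and "tb 4 3 2 \<le> 42713183 / 1000000000"
    and "tb 5 2 2 \<le> 81230577 / 1000000000"
    and "tb 5 2 3 \<le> 25993873 / 1000000000"
    and "tb 5 3 2 \<le> 25993873 / 1000000000"
    and "tb 7 2 2 \<le> 67042605 / 1000000000"
    and "tb 7 2 3 \<le> 1789347 / 1000000000"
    and "tb 7 3 2 \<le> 1789347 / 1000000000"
  by (simp_all add: tb_def td_def perm3_def gp_values power_divide)

text \<open>In rank five the triples occur with both signs, directly and through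
  \<open>quad_le\<close>, so lower bounds are required too; all triples listed are of exact
  type.\<close>

lemma tb_bounds5:
  shows "spherical3 2 2 2" "160526423 / 1000000000 \<le> tb 2 2 2"
    and "spherical3 2 2 3" "116031041 / 1000000000 \<le> tb 2 2 3"
    and "spherical3 2 3 2" "116031041 / 1000000000 \<le> tb 2 3 2"
    and "spherical3 2 3 3" "68029456 / 1000000000 \<le> tb 2 3 3"
    and "spherical3 2 4 2" "94117274 / 1000000000 \<le> tb 2 4 2"
    and "spherical3 2 5 2" "81230576 / 1000000000 \<le> tb 2 5 2"
    and "spherical3 3 2 2" "116031041 / 1000000000 \<le> tb 3 2 2"
    and "spherical3 3 2 3" "68029456 / 1000000000 \<le> tb 3 2 3"
    and "spherical3 3 3 2" "68029456 / 1000000000 \<le> tb 3 3 2"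
    and "spherical3 3 4 2" "42713182 / 1000000000 \<le> tb 3 4 2"
    and "spherical3 3 5 2" "25993872 / 1000000000 \<le> tb 3 5 2"
    and "spherical3 4 2 2" "94117274 / 1000000000 \<le> tb 4 2 2"
    and "spherical3 4 2 3" "42713182 / 1000000000 \<le> tb 4 2 3"
    and "spherical3 4 3 2" "42713182 / 1000000000 \<le> tb 4 3 2"
    and "spherical3 5 2 2" "81230576 / 1000000000 \<le> tb 5 2 2"
    and "spherical3 5 3 2" "25993872 / 1000000000 \<le> tb 5 3 2"
  by (simp_all add: tb_def td_def perm3_def gp_values spherical3_def power_divide)

text \<open>Each of these contradicts \<open>quad_neg\<close>. The arguments are in the order ab,
  ac, ad, bc, bd, cd. The first nine are the compact hyperbolic tetrahedra: the paths 3-5-3, 5-3-4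
  and 5-3-5, the star 5,3,3 and five cycles. The other ten contain the triangle (2,3,7).\<close>

lemma qd_values:
  shows "qd 3 2 2 5 2 3 \<ge> 0"
    and "qd 5 2 2 3 2 4 \<ge> 0"
    and "qd 5 2 2 3 2 5 \<ge> 0"
    and "qd 5 3 3 2 2 2 \<ge> 0"
    and "qd 4 2 3 3 2 3 \<ge> 0"
    and "qd 5 2 3 3 2 3 \<ge> 0"
    and "qd 4 2 3 3 2 4 \<ge> 0"
    and "qd 4 2 3 3 2 5 \<ge> 0"
    and "qd 5 2 3 3 2 5 \<ge> 0"
    and "qd 7 3 3 2 2 2 \<ge> 0"
    and "qd 3 2 2 7 2 3 \<ge> 0"
    and "qd 3 2 3 7 2 3 \<ge> 0"
    and "qd 3 2 2 3 2 7 \<ge> 0"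
    and "qd 3 2 4 7 2 3 \<ge> 0"
    and "qd 4 2 2 3 2 7 \<ge> 0"
    and "qd 3 2 5 7 2 3 \<ge> 0"
    and "qd 5 2 2 3 2 7 \<ge> 0"
    and "qd 3 2 7 7 2 3 \<ge> 0"
    and "qd 7 2 2 3 2 7 \<ge> 0"
  unfolding qd_def using gp_bounds tb_bounds by linarith+

text \<open>This and the next four lemmas treat the five compact hyperbolic simplices of dimension
  four: the paths 5-3-3-3, 5-3-3-4 and 5-3-3-5, a branched diagram, and the cycle 4,3,3,3,3. The sum
  over the proper subsets, \<open>(1 + E) * g\<close>, has to be positive. Bounding the quadruples
  through their triples, and the triples numerically from both sides, refutes this.\<close>

lemma no_diagram_5333:
  assumes "distinct [a, b, c', d, e]" "{a, b, c', d, e} \<subseteq> I"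
    "m a b = 5" "m a c' = 2" "m a d = 2" "m a e = 2" "m b c' = 3" "m b d = 2" "m b e = 2" "m c' d = 3" "m c' e = 2" "m d e = 3"
  shows False
proof -
  have ne: "a \<noteq> b" "a \<noteq> c'" "a \<noteq> d" "a \<noteq> e" "b \<noteq> c'" "b \<noteq> d" "b \<noteq> e" "c' \<noteq> d" "c' \<noteq> e" "d \<noteq> e"
    and inI: "a \<in> I" "b \<in> I" "c' \<in> I" "d \<in> I" "e \<in> I"
    using assms(1,2) by auto
  have sy: "m b a = 5" "m c' a = 2" "m d a = 2" "m e a = 2" "m c' b = 3" "m d b = 2" "m e b = 2" "m d c' = 3" "m e c' = 2" "m e d = 3"
    using assms inI by (auto simp: m_sym)
  note mm = assms(3-) sy
  have T0: "g {a, b, c'} \<le> 25993873 / 1000000000"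
    by (rule order_trans[OF tri_le[of a b c', unfolded mm] tb_bounds(27)]) (use ne inI in auto)
  have L0: "25993872 / 1000000000 \<le> g {a, b, c'}"
    by (rule order_trans[OF tb_bounds5(32) eq_refl[OF tri_eq[of a b c', unfolded mm, OF _ _ tb_bounds5(31), symmetric]]]) (use ne inI in auto)
  have T1: "g {a, b, d} \<le> 81230577 / 1000000000"
    by (rule order_trans[OF tri_le[of a b d, unfolded mm] tb_bounds(25)]) (use ne inI in auto)
  have L1: "81230576 / 1000000000 \<le> g {a, b, d}"
    by (rule order_trans[OF tb_bounds5(30) eq_refl[OF tri_eq[of a b d, unfolded mm, OF _ _ tb_bounds5(29), symmetric]]]) (use ne inI in auto)
  have T2: "g {a, b, e} \<le> 81230577 / 1000000000"
    by (rule order_trans[OF tri_le[of a b e, unfolded mm] tb_bounds(25)]) (use ne inI in auto)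
  have L2: "81230576 / 1000000000 \<le> g {a, b, e}"
    by (rule order_trans[OF tb_bounds5(30) eq_refl[OF tri_eq[of a b e, unfolded mm, OF _ _ tb_bounds5(29), symmetric]]]) (use ne inI in auto)
  have T3: "g {a, c', d} \<le> 116031042 / 1000000000"
    by (rule order_trans[OF tri_le[of a c' d, unfolded mm] tb_bounds(3)]) (use ne inI in auto)
  have L3: "116031041 / 1000000000 \<le> g {a, c', d}"
    by (rule order_trans[OF tb_bounds5(6) eq_refl[OF tri_eq[of a c' d, unfolded mm, OF _ _ tb_bounds5(5), symmetric]]]) (use ne inI in auto)
  have T4: "g {a, c', e} \<le> 160526424 / 1000000000"
    by (rule order_trans[OF tri_le[of a c' e, unfolded mm] tb_bounds(1)]) (use ne inI in auto)
  have L4: "160526423 / 1000000000 \<le> g {a, c', e}"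
    by (rule order_trans[OF tb_bounds5(2) eq_refl[OF tri_eq[of a c' e, unfolded mm, OF _ _ tb_bounds5(1), symmetric]]]) (use ne inI in auto)
  have T5: "g {a, d, e} \<le> 116031042 / 1000000000"
    by (rule order_trans[OF tri_le[of a d e, unfolded mm] tb_bounds(3)]) (use ne inI in auto)
  have L5: "116031041 / 1000000000 \<le> g {a, d, e}"
    by (rule order_trans[OF tb_bounds5(6) eq_refl[OF tri_eq[of a d e, unfolded mm, OF _ _ tb_bounds5(5), symmetric]]]) (use ne inI in auto)
  have T6: "g {b, c', d} \<le> 68029457 / 1000000000"
    by (rule order_trans[OF tri_le[of b c' d, unfolded mm] tb_bounds(18)]) (use ne inI in auto)
  have L6: "68029456 / 1000000000 \<le> g {b, c', d}"
    by (rule order_trans[OF tb_bounds5(18) eq_refl[OF tri_eq[of b c' d, unfolded mm, OF _ _ tb_bounds5(17), symmetric]]]) (use ne inI in auto)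
  have T7: "g {b, c', e} \<le> 116031042 / 1000000000"
    by (rule order_trans[OF tri_le[of b c' e, unfolded mm] tb_bounds(13)]) (use ne inI in auto)
  have L7: "116031041 / 1000000000 \<le> g {b, c', e}"
    by (rule order_trans[OF tb_bounds5(14) eq_refl[OF tri_eq[of b c' e, unfolded mm, OF _ _ tb_bounds5(13), symmetric]]]) (use ne inI in auto)
  have T8: "g {b, d, e} \<le> 116031042 / 1000000000"
    by (rule order_trans[OF tri_le[of b d e, unfolded mm] tb_bounds(3)]) (use ne inI in auto)
  have L8: "116031041 / 1000000000 \<le> g {b, d, e}"
    by (rule order_trans[OF tb_bounds5(6) eq_refl[OF tri_eq[of b d e, unfolded mm, OF _ _ tb_bounds5(5), symmetric]]]) (use ne inI in auto)
  have T9: "g {c', d, e} \<le> 68029457 / 1000000000"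
    by (rule order_trans[OF tri_le[of c' d e, unfolded mm] tb_bounds(18)]) (use ne inI in auto)
  have L9: "68029456 / 1000000000 \<le> g {c', d, e}"
    by (rule order_trans[OF tb_bounds5(18) eq_refl[OF tri_eq[of c' d e, unfolded mm, OF _ _ tb_bounds5(17), symmetric]]]) (use ne inI in auto)
  have E0: "E {a, b, c', d} \<le> 935776 / 1000000000"
    using E_H4[of d c' b a] ne inI mm by (simp add: insert_commute)
  have "distinct [a, b, c', d]" "{a, b, c', d} \<subseteq> I" using ne inI by auto
  \<comment> \<open>999064224 is 10^9 - 935776, from the bound on \<open>E\<close>; 288651304 / 10^9
    is a lower bound for the six pair values minus 27/23.\<close>
  from quad_le[OF this E0, unfolded mm] have Q0: "g {a, b, c', d} * (999064224 / 1000000000) \<le> g {a, b, c'} + g {a, b, d} + g {a, c', d} + g {b, c', d} + -288651304 / 1000000000"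
    using gp_bounds by simp
  have Q1: "g {a, b, c', e} = 25 / 46 * g {a, b, c'}"
    using g_prod1[of e a b c'] ne inI mm by (simp add: insert_commute)
  have Q2: "g {a, b, d, e} = gp 5 * gp 3"
    using g_prod2[of a b d e] ne inI mm by (simp add: insert_commute)
  have P2: "g {a, b, d, e} \<le> 31910192 / 1000000000"
    unfolding Q2 using mult_mono[of "gp 5" "149464261 / 1000000000" "gp 3" "213497117 / 1000000000"] gp_bounds by simp
  have Q3: "g {a, c', d, e} = 25 / 46 * g {c', d, e}"
    using g_prod1[of a c' d e] ne inI mm by (simp add: insert_commute)
  have E4: "E {b, c', d, e} \<le> 174901229 / 1000000000"
    using E_A4[of b c' d e] ne inI mm by (simp add: insert_commute)
  have "distinct [b, c', d, e]" "{b, c', d, e} \<subseteq> I" using ne inI by auto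
  from quad_le[OF this E4, unfolded mm] have Q4: "g {b, c', d, e} * (825098771 / 1000000000) \<le> g {b, c', d} + g {b, c', e} + g {b, d, e} + g {c', d, e} + -352684161 / 1000000000"
    using gp_bounds by simp
  have "E {a, b, c', d, e} * g {a, b, c', d, e} \<ge> 0" "g {a, b, c', d, e} > 0"
    using E_nonneg g_pos[OF assms(2)] by (simp_all add: less_imp_le)
  \<comment> \<open>The constant is an upper bound for the ten pair values minus 79/46.\<close>
  then have "0 < 844776038 / 1000000000 - g {a, b, c'} - g {a, b, d} - g {a, b, e} - g {a, c', d} - g {a, c', e} - g {a, d, e} - g {b, c', d} - g {b, c', e} - g {b, d, e} - g {c', d, e} + g {a, b, c', d} + g {a, b, c', e} + g {a, b, d, e} + g {a, c', d, e} + g {b, c', d, e}"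
    using quint_id[OF assms(1,2), unfolded mm] gp_bounds by linarith
  then show False
    using Q0 Q1 P2 Q3 Q4 T0 T1 T2 T3 T4 T5 T6 T7 T8 T9 L0 L1 L2 L3 L4 L5 L6 L7 L8 L9
    by linarith
qed

lemma no_diagram_5334:
  assumes "distinct [a, b, c', d, e]" "{a, b, c', d, e} \<subseteq> I"
    "m a b = 5" "m a c' = 2" "m a d = 2" "m a e = 2" "m b c' = 3" "m b d = 2" "m b e = 2" "m c' d = 3" "m c' e = 2" "m d e = 4"
  shows False
proof -
  have ne: "a \<noteq> b" "a \<noteq> c'" "a \<noteq> d" "a \<noteq> e" "b \<noteq> c'" "b \<noteq> d" "b \<noteq> e" "c' \<noteq> d" "c' \<noteq> e" "d \<noteq> e"
    and inI: "a \<in> I" "b \<in> I" "c' \<in> I" "d \<in> I" "e \<in> I"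
    using assms(1,2) by auto
  have sy: "m b a = 5" "m c' a = 2" "m d a = 2" "m e a = 2" "m c' b = 3" "m d b = 2" "m e b = 2" "m d c' = 3" "m e c' = 2" "m e d = 4"
    using assms inI by (auto simp: m_sym)
  note mm = assms(3-) sy
  have T0: "g {a, b, c'} \<le> 25993873 / 1000000000"
    by (rule order_trans[OF tri_le[of a b c', unfolded mm] tb_bounds(27)]) (use ne inI in auto)
  have L0: "25993872 / 1000000000 \<le> g {a, b, c'}"
    by (rule order_trans[OF tb_bounds5(32) eq_refl[OF tri_eq[of a b c', unfolded mm, OF _ _ tb_bounds5(31), symmetric]]]) (use ne inI in auto)
  have T1: "g {a, b, d} \<le> 81230577 / 1000000000"
    by (rule order_trans[OF tri_le[of a b d, unfolded mm] tb_bounds(25)]) (use ne inI in auto)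
  have L1: "81230576 / 1000000000 \<le> g {a, b, d}"
    by (rule order_trans[OF tb_bounds5(30) eq_refl[OF tri_eq[of a b d, unfolded mm, OF _ _ tb_bounds5(29), symmetric]]]) (use ne inI in auto)
  have T2: "g {a, b, e} \<le> 81230577 / 1000000000"
    by (rule order_trans[OF tri_le[of a b e, unfolded mm] tb_bounds(25)]) (use ne inI in auto)
  have L2: "81230576 / 1000000000 \<le> g {a, b, e}"
    by (rule order_trans[OF tb_bounds5(30) eq_refl[OF tri_eq[of a b e, unfolded mm, OF _ _ tb_bounds5(29), symmetric]]]) (use ne inI in auto)
  have T3: "g {a, c', d} \<le> 116031042 / 1000000000"
    by (rule order_trans[OF tri_le[of a c' d, unfolded mm] tb_bounds(3)]) (use ne inI in auto)
  have L3: "116031041 / 1000000000 \<le> g {a, c', d}"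
    by (rule order_trans[OF tb_bounds5(6) eq_refl[OF tri_eq[of a c' d, unfolded mm, OF _ _ tb_bounds5(5), symmetric]]]) (use ne inI in auto)
  have T4: "g {a, c', e} \<le> 160526424 / 1000000000"
    by (rule order_trans[OF tri_le[of a c' e, unfolded mm] tb_bounds(1)]) (use ne inI in auto)
  have L4: "160526423 / 1000000000 \<le> g {a, c', e}"
    by (rule order_trans[OF tb_bounds5(2) eq_refl[OF tri_eq[of a c' e, unfolded mm, OF _ _ tb_bounds5(1), symmetric]]]) (use ne inI in auto)
  have T5: "g {a, d, e} \<le> 94117275 / 1000000000"
    by (rule order_trans[OF tri_le[of a d e, unfolded mm] tb_bounds(8)]) (use ne inI in auto)
  have L5: "94117274 / 1000000000 \<le> g {a, d, e}"
    by (rule order_trans[OF tb_bounds5(10) eq_refl[OF tri_eq[of a d e, unfolded mm, OF _ _ tb_bounds5(9), symmetric]]]) (use ne inI in auto)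
  have T6: "g {b, c', d} \<le> 68029457 / 1000000000"
    by (rule order_trans[OF tri_le[of b c' d, unfolded mm] tb_bounds(18)]) (use ne inI in auto)
  have L6: "68029456 / 1000000000 \<le> g {b, c', d}"
    by (rule order_trans[OF tb_bounds5(18) eq_refl[OF tri_eq[of b c' d, unfolded mm, OF _ _ tb_bounds5(17), symmetric]]]) (use ne inI in auto)
  have T7: "g {b, c', e} \<le> 116031042 / 1000000000"
    by (rule order_trans[OF tri_le[of b c' e, unfolded mm] tb_bounds(13)]) (use ne inI in auto)
  have L7: "116031041 / 1000000000 \<le> g {b, c', e}"
    by (rule order_trans[OF tb_bounds5(14) eq_refl[OF tri_eq[of b c' e, unfolded mm, OF _ _ tb_bounds5(13), symmetric]]]) (use ne inI in auto)
  have T8: "g {b, d, e} \<le> 94117275 / 1000000000"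
    by (rule order_trans[OF tri_le[of b d e, unfolded mm] tb_bounds(8)]) (use ne inI in auto)
  have L8: "94117274 / 1000000000 \<le> g {b, d, e}"
    by (rule order_trans[OF tb_bounds5(10) eq_refl[OF tri_eq[of b d e, unfolded mm, OF _ _ tb_bounds5(9), symmetric]]]) (use ne inI in auto)
  have T9: "g {c', d, e} \<le> 42713183 / 1000000000"
    by (rule order_trans[OF tri_le[of c' d e, unfolded mm] tb_bounds(19)]) (use ne inI in auto)
  have L9: "42713182 / 1000000000 \<le> g {c', d, e}"
    by (rule order_trans[OF tb_bounds5(20) eq_refl[OF tri_eq[of c' d e, unfolded mm, OF _ _ tb_bounds5(19), symmetric]]]) (use ne inI in auto)
  have E0: "E {a, b, c', d} \<le> 935776 / 1000000000"
    using E_H4[of d c' b a] ne inI mm by (simp add: insert_commute)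
  have "distinct [a, b, c', d]" "{a, b, c', d} \<subseteq> I" using ne inI by auto
  from quad_le[OF this E0, unfolded mm] have Q0: "g {a, b, c', d} * (999064224 / 1000000000) \<le> g {a, b, c'} + g {a, b, d} + g {a, c', d} + g {b, c', d} + -288651304 / 1000000000"
    using gp_bounds by simp
  have Q1: "g {a, b, c', e} = 25 / 46 * g {a, b, c'}"
    using g_prod1[of e a b c'] ne inI mm by (simp add: insert_commute)
  have Q2: "g {a, b, d, e} = gp 5 * gp 4"
    using g_prod2[of a b d e] ne inI mm by (simp add: insert_commute)
  have P2: "g {a, b, d, e} \<le> 25883594 / 1000000000"
    unfolding Q2 using mult_mono[of "gp 5" "149464261 / 1000000000" "gp 4" "173175786 / 1000000000"] gp_bounds by simp
  have Q3: "g {a, c', d, e} = 25 / 46 * g {c', d, e}"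
    using g_prod1[of a c' d e] ne inI mm by (simp add: insert_commute)
  have E4: "E {b, c', d, e} \<le> 61442458 / 1000000000"
    using E_B4[of b c' d e] ne inI mm by (simp add: insert_commute)
  have "distinct [b, c', d, e]" "{b, c', d, e} \<subseteq> I" using ne inI by auto
  from quad_le[OF this E4, unfolded mm] have Q4: "g {b, c', d, e} * (938557542 / 1000000000) \<le> g {b, c', d} + g {b, c', e} + g {b, d, e} + g {c', d, e} + -312362830 / 1000000000"
    using gp_bounds by simp
  have "E {a, b, c', d, e} * g {a, b, c', d, e} \<ge> 0" "g {a, b, c', d, e} > 0"
    using E_nonneg g_pos[OF assms(2)] by (simp_all add: less_imp_le)
  then have "0 < 804454706 / 1000000000 - g {a, b, c'} - g {a, b, d} - g {a, b, e} - g {a, c', d} - g {a, c', e} - g {a, d, e} - g {b, c', d} - g {b, c', e} - g {b, d, e} - g {c', d, e} + g {a, b, c', d} + g {a, b, c', e} + g {a, b, d, e} + g {a, c', d, e} + g {b, c', d, e}"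
    using quint_id[OF assms(1,2), unfolded mm] gp_bounds by linarith
  then show False
    using Q0 Q1 P2 Q3 Q4 T0 T1 T2 T3 T4 T5 T6 T7 T8 T9 L0 L1 L2 L3 L4 L5 L6 L7 L8 L9
    by linarith
qed

lemma no_diagram_5335:
  assumes "distinct [a, b, c', d, e]" "{a, b, c', d, e} \<subseteq> I"
    "m a b = 5" "m a c' = 2" "m a d = 2" "m a e = 2" "m b c' = 3" "m b d = 2" "m b e = 2" "m c' d = 3" "m c' e = 2" "m d e = 5"
  shows False
proof -
  have ne: "a \<noteq> b" "a \<noteq> c'" "a \<noteq> d" "a \<noteq> e" "b \<noteq> c'" "b \<noteq> d" "b \<noteq> e" "c' \<noteq> d" "c' \<noteq> e" "d \<noteq> e"
    and inI: "a \<in> I" "b \<in> I" "c' \<in> I" "d \<in> I" "e \<in> I"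
    using assms(1,2) by auto
  have sy: "m b a = 5" "m c' a = 2" "m d a = 2" "m e a = 2" "m c' b = 3" "m d b = 2" "m e b = 2" "m d c' = 3" "m e c' = 2" "m e d = 5"
    using assms inI by (auto simp: m_sym)
  note mm = assms(3-) sy
  have T0: "g {a, b, c'} \<le> 25993873 / 1000000000"
    by (rule order_trans[OF tri_le[of a b c', unfolded mm] tb_bounds(27)]) (use ne inI in auto)
  have L0: "25993872 / 1000000000 \<le> g {a, b, c'}"
    by (rule order_trans[OF tb_bounds5(32) eq_refl[OF tri_eq[of a b c', unfolded mm, OF _ _ tb_bounds5(31), symmetric]]]) (use ne inI in auto)
  have T1: "g {a, b, d} \<le> 81230577 / 1000000000"
    by (rule order_trans[OF tri_le[of a b d, unfolded mm] tb_bounds(25)]) (use ne inI in auto)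
  have L1: "81230576 / 1000000000 \<le> g {a, b, d}"
    by (rule order_trans[OF tb_bounds5(30) eq_refl[OF tri_eq[of a b d, unfolded mm, OF _ _ tb_bounds5(29), symmetric]]]) (use ne inI in auto)
  have T2: "g {a, b, e} \<le> 81230577 / 1000000000"
    by (rule order_trans[OF tri_le[of a b e, unfolded mm] tb_bounds(25)]) (use ne inI in auto)
  have L2: "81230576 / 1000000000 \<le> g {a, b, e}"
    by (rule order_trans[OF tb_bounds5(30) eq_refl[OF tri_eq[of a b e, unfolded mm, OF _ _ tb_bounds5(29), symmetric]]]) (use ne inI in auto)
  have T3: "g {a, c', d} \<le> 116031042 / 1000000000"
    by (rule order_trans[OF tri_le[of a c' d, unfolded mm] tb_bounds(3)]) (use ne inI in auto)
  have L3: "116031041 / 1000000000 \<le> g {a, c', d}"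
    by (rule order_trans[OF tb_bounds5(6) eq_refl[OF tri_eq[of a c' d, unfolded mm, OF _ _ tb_bounds5(5), symmetric]]]) (use ne inI in auto)
  have T4: "g {a, c', e} \<le> 160526424 / 1000000000"
    by (rule order_trans[OF tri_le[of a c' e, unfolded mm] tb_bounds(1)]) (use ne inI in auto)
  have L4: "160526423 / 1000000000 \<le> g {a, c', e}"
    by (rule order_trans[OF tb_bounds5(2) eq_refl[OF tri_eq[of a c' e, unfolded mm, OF _ _ tb_bounds5(1), symmetric]]]) (use ne inI in auto)
  have T5: "g {a, d, e} \<le> 81230577 / 1000000000"
    by (rule order_trans[OF tri_le[of a d e, unfolded mm] tb_bounds(10)]) (use ne inI in auto)
  have L5: "81230576 / 1000000000 \<le> g {a, d, e}"
    by (rule order_trans[OF tb_bounds5(12) eq_refl[OF tri_eq[of a d e, unfolded mm, OF _ _ tb_bounds5(11), symmetric]]]) (use ne inI in auto)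
  have T6: "g {b, c', d} \<le> 68029457 / 1000000000"
    by (rule order_trans[OF tri_le[of b c' d, unfolded mm] tb_bounds(18)]) (use ne inI in auto)
  have L6: "68029456 / 1000000000 \<le> g {b, c', d}"
    by (rule order_trans[OF tb_bounds5(18) eq_refl[OF tri_eq[of b c' d, unfolded mm, OF _ _ tb_bounds5(17), symmetric]]]) (use ne inI in auto)
  have T7: "g {b, c', e} \<le> 116031042 / 1000000000"
    by (rule order_trans[OF tri_le[of b c' e, unfolded mm] tb_bounds(13)]) (use ne inI in auto)
  have L7: "116031041 / 1000000000 \<le> g {b, c', e}"
    by (rule order_trans[OF tb_bounds5(14) eq_refl[OF tri_eq[of b c' e, unfolded mm, OF _ _ tb_bounds5(13), symmetric]]]) (use ne inI in auto)
  have T8: "g {b, d, e} \<le> 81230577 / 1000000000"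
    by (rule order_trans[OF tri_le[of b d e, unfolded mm] tb_bounds(10)]) (use ne inI in auto)
  have L8: "81230576 / 1000000000 \<le> g {b, d, e}"
    by (rule order_trans[OF tb_bounds5(12) eq_refl[OF tri_eq[of b d e, unfolded mm, OF _ _ tb_bounds5(11), symmetric]]]) (use ne inI in auto)
  have T9: "g {c', d, e} \<le> 25993873 / 1000000000"
    by (rule order_trans[OF tri_le[of c' d e, unfolded mm] tb_bounds(20)]) (use ne inI in auto)
  have L9: "25993872 / 1000000000 \<le> g {c', d, e}"
    by (rule order_trans[OF tb_bounds5(22) eq_refl[OF tri_eq[of c' d e, unfolded mm, OF _ _ tb_bounds5(21), symmetric]]]) (use ne inI in auto)
  have E0: "E {a, b, c', d} \<le> 935776 / 1000000000"
    using E_H4[of d c' b a] ne inI mm by (simp add: insert_commute)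
  have "distinct [a, b, c', d]" "{a, b, c', d} \<subseteq> I" using ne inI by auto
  from quad_le[OF this E0, unfolded mm] have Q0: "g {a, b, c', d} * (999064224 / 1000000000) \<le> g {a, b, c'} + g {a, b, d} + g {a, c', d} + g {b, c', d} + -288651304 / 1000000000"
    using gp_bounds by simp
  have Q1: "g {a, b, c', e} = 25 / 46 * g {a, b, c'}"
    using g_prod1[of e a b c'] ne inI mm by (simp add: insert_commute)
  have Q2: "g {a, b, d, e} = gp 5 * gp 5"
    using g_prod2[of a b d e] ne inI mm by (simp add: insert_commute)
  have P2: "g {a, b, d, e} \<le> 22339569 / 1000000000"
    unfolding Q2 using mult_mono[of "gp 5" "149464261 / 1000000000" "gp 5" "149464261 / 1000000000"] gp_bounds by simp
  have Q3: "g {a, c', d, e} = 25 / 46 * g {c', d, e}"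
    using g_prod1[of a c' d e] ne inI mm by (simp add: insert_commute)
  have E4: "E {b, c', d, e} \<le> 935776 / 1000000000"
    using E_H4[of b c' d e] ne inI mm by (simp add: insert_commute)
  have "distinct [b, c', d, e]" "{b, c', d, e} \<subseteq> I" using ne inI by auto
  from quad_le[OF this E4, unfolded mm] have Q4: "g {b, c', d, e} * (999064224 / 1000000000) \<le> g {b, c', d} + g {b, c', e} + g {b, d, e} + g {c', d, e} + -288651304 / 1000000000"
    using gp_bounds by simp
  have "E {a, b, c', d, e} * g {a, b, c', d, e} \<ge> 0" "g {a, b, c', d, e} > 0"
    using E_nonneg g_pos[OF assms(2)] by (simp_all add: less_imp_le)
  then have "0 < 780743181 / 1000000000 - g {a, b, c'} - g {a, b, d} - g {a, b, e} - g {a, c', d} - g {a, c', e} - g {a, d, e} - g {b, c', d} - g {b, c', e} - g {b, d, e} - g {c', d, e} + g {a, b, c', d} + g {a, b, c', e} + g {a, b, d, e} + g {a, c', d, e} + g {b, c', d, e}"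
    using quint_id[OF assms(1,2), unfolded mm] gp_bounds by linarith
  then show False
    using Q0 Q1 P2 Q3 Q4 T0 T1 T2 T3 T4 T5 T6 T7 T8 T9 L0 L1 L2 L3 L4 L5 L6 L7 L8 L9
    by linarith
qed

text \<open>Deleting a vertex of the branched diagram leaves type H4 twice, type D4 once, and a
  product with a single wall twice.\<close>

lemma no_diagram_53311:
  assumes "distinct [a, b, c', d, e]" "{a, b, c', d, e} \<subseteq> I"
    "m a b = 5" "m a c' = 2" "m a d = 2" "m a e = 2" "m b c' = 3" "m b d = 2" "m b e = 2" "m c' d = 3" "m c' e = 3" "m d e = 2"
  shows False
proof -
  have ne: "a \<noteq> b" "a \<noteq> c'" "a \<noteq> d" "a \<noteq> e" "b \<noteq> c'" "b \<noteq> d" "b \<noteq> e" "c' \<noteq> d" "c' \<noteq> e" "d \<noteq> e"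
    and inI: "a \<in> I" "b \<in> I" "c' \<in> I" "d \<in> I" "e \<in> I"
    using assms(1,2) by auto
  have sy: "m b a = 5" "m c' a = 2" "m d a = 2" "m e a = 2" "m c' b = 3" "m d b = 2" "m e b = 2" "m d c' = 3" "m e c' = 3" "m e d = 2"
    using assms inI by (auto simp: m_sym)
  note mm = assms(3-) sy
  have T0: "g {a, b, c'} \<le> 25993873 / 1000000000"
    by (rule order_trans[OF tri_le[of a b c', unfolded mm] tb_bounds(27)]) (use ne inI in auto)
  have L0: "25993872 / 1000000000 \<le> g {a, b, c'}"
    by (rule order_trans[OF tb_bounds5(32) eq_refl[OF tri_eq[of a b c', unfolded mm, OF _ _ tb_bounds5(31), symmetric]]]) (use ne inI in auto)
  have T1: "g {a, b, d} \<le> 81230577 / 1000000000"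
    by (rule order_trans[OF tri_le[of a b d, unfolded mm] tb_bounds(25)]) (use ne inI in auto)
  have L1: "81230576 / 1000000000 \<le> g {a, b, d}"
    by (rule order_trans[OF tb_bounds5(30) eq_refl[OF tri_eq[of a b d, unfolded mm, OF _ _ tb_bounds5(29), symmetric]]]) (use ne inI in auto)
  have T2: "g {a, b, e} \<le> 81230577 / 1000000000"
    by (rule order_trans[OF tri_le[of a b e, unfolded mm] tb_bounds(25)]) (use ne inI in auto)
  have L2: "81230576 / 1000000000 \<le> g {a, b, e}"
    by (rule order_trans[OF tb_bounds5(30) eq_refl[OF tri_eq[of a b e, unfolded mm, OF _ _ tb_bounds5(29), symmetric]]]) (use ne inI in auto)
  have T3: "g {a, c', d} \<le> 116031042 / 1000000000"
    by (rule order_trans[OF tri_le[of a c' d, unfolded mm] tb_bounds(3)]) (use ne inI in auto)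
  have L3: "116031041 / 1000000000 \<le> g {a, c', d}"
    by (rule order_trans[OF tb_bounds5(6) eq_refl[OF tri_eq[of a c' d, unfolded mm, OF _ _ tb_bounds5(5), symmetric]]]) (use ne inI in auto)
  have T4: "g {a, c', e} \<le> 116031042 / 1000000000"
    by (rule order_trans[OF tri_le[of a c' e, unfolded mm] tb_bounds(3)]) (use ne inI in auto)
  have L4: "116031041 / 1000000000 \<le> g {a, c', e}"
    by (rule order_trans[OF tb_bounds5(6) eq_refl[OF tri_eq[of a c' e, unfolded mm, OF _ _ tb_bounds5(5), symmetric]]]) (use ne inI in auto)
  have T5: "g {a, d, e} \<le> 160526424 / 1000000000"
    by (rule order_trans[OF tri_le[of a d e, unfolded mm] tb_bounds(1)]) (use ne inI in auto)
  have L5: "160526423 / 1000000000 \<le> g {a, d, e}"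
    by (rule order_trans[OF tb_bounds5(2) eq_refl[OF tri_eq[of a d e, unfolded mm, OF _ _ tb_bounds5(1), symmetric]]]) (use ne inI in auto)
  have T6: "g {b, c', d} \<le> 68029457 / 1000000000"
    by (rule order_trans[OF tri_le[of b c' d, unfolded mm] tb_bounds(18)]) (use ne inI in auto)
  have L6: "68029456 / 1000000000 \<le> g {b, c', d}"
    by (rule order_trans[OF tb_bounds5(18) eq_refl[OF tri_eq[of b c' d, unfolded mm, OF _ _ tb_bounds5(17), symmetric]]]) (use ne inI in auto)
  have T7: "g {b, c', e} \<le> 68029457 / 1000000000"
    by (rule order_trans[OF tri_le[of b c' e, unfolded mm] tb_bounds(18)]) (use ne inI in auto)
  have L7: "68029456 / 1000000000 \<le> g {b, c', e}"
    by (rule order_trans[OF tb_bounds5(18) eq_refl[OF tri_eq[of b c' e, unfolded mm, OF _ _ tb_bounds5(17), symmetric]]]) (use ne inI in auto)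
  have T8: "g {b, d, e} \<le> 160526424 / 1000000000"
    by (rule order_trans[OF tri_le[of b d e, unfolded mm] tb_bounds(1)]) (use ne inI in auto)
  have L8: "160526423 / 1000000000 \<le> g {b, d, e}"
    by (rule order_trans[OF tb_bounds5(2) eq_refl[OF tri_eq[of b d e, unfolded mm, OF _ _ tb_bounds5(1), symmetric]]]) (use ne inI in auto)
  have T9: "g {c', d, e} \<le> 68029457 / 1000000000"
    by (rule order_trans[OF tri_le[of c' d e, unfolded mm] tb_bounds(14)]) (use ne inI in auto)
  have L9: "68029456 / 1000000000 \<le> g {c', d, e}"
    by (rule order_trans[OF tb_bounds5(16) eq_refl[OF tri_eq[of c' d e, unfolded mm, OF _ _ tb_bounds5(15), symmetric]]]) (use ne inI in auto)
  have E0: "E {a, b, c', d} \<le> 935776 / 1000000000"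
    using E_H4[of d c' b a] ne inI mm by (simp add: insert_commute)
  have "distinct [a, b, c', d]" "{a, b, c', d} \<subseteq> I" using ne inI by auto
  from quad_le[OF this E0, unfolded mm] have Q0: "g {a, b, c', d} * (999064224 / 1000000000) \<le> g {a, b, c'} + g {a, b, d} + g {a, c', d} + g {b, c', d} + -288651304 / 1000000000"
    using gp_bounds by simp
  have E1: "E {a, b, c', e} \<le> 935776 / 1000000000"
    using E_H4[of e c' b a] ne inI mm by (simp add: insert_commute)
  have "distinct [a, b, c', e]" "{a, b, c', e} \<subseteq> I" using ne inI by auto
  from quad_le[OF this E1, unfolded mm] have Q1: "g {a, b, c', e} * (999064224 / 1000000000) \<le> g {a, b, c'} + g {a, b, e} + g {a, c', e} + g {b, c', e} + -288651304 / 1000000000"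
    using gp_bounds by simp
  have Q2: "g {a, b, d, e} = 25 / 46 * g {a, b, e}"
    using g_prod1[of d a b e] ne inI mm by (simp add: insert_commute)
  have Q3: "g {a, c', d, e} = 25 / 46 * g {c', d, e}"
    using g_prod1[of a c' d e] ne inI mm by (simp add: insert_commute)
  have E4: "E {b, c', d, e} \<le> 123410308 / 1000000000"
    using E_D4[of c' b d e] ne inI mm by (simp add: insert_commute)
  have "distinct [b, c', d, e]" "{b, c', d, e} \<subseteq> I" using ne inI by auto
  from quad_le[OF this E4, unfolded mm] have Q4: "g {b, c', d, e} * (876589692 / 1000000000) \<le> g {b, c', d} + g {b, c', e} + g {b, d, e} + g {c', d, e} + -352684161 / 1000000000"
    using gp_bounds by simp
  have "E {a, b, c', d, e} * g {a, b, c', d, e} \<ge> 0" "g {a, b, c', d, e} > 0"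
    using E_nonneg g_pos[OF assms(2)] by (simp_all add: less_imp_le)
  then have "0 < 844776038 / 1000000000 - g {a, b, c'} - g {a, b, d} - g {a, b, e} - g {a, c', d} - g {a, c', e} - g {a, d, e} - g {b, c', d} - g {b, c', e} - g {b, d, e} - g {c', d, e} + g {a, b, c', d} + g {a, b, c', e} + g {a, b, d, e} + g {a, c', d, e} + g {b, c', d, e}"
    using quint_id[OF assms(1,2), unfolded mm] gp_bounds by linarith
  then show False
    using Q0 Q1 Q2 Q3 Q4 T0 T1 T2 T3 T4 T5 T6 T7 T8 T9 L0 L1 L2 L3 L4 L5 L6 L7 L8 L9
    by linarith
qed

text \<open>Deleting a vertex of the cycle leaves a path: type F4 opposite the edge labelled 4,
  otherwise B4 or A4, each twice.\<close>

lemma no_diagram_c43333: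
  assumes "distinct [a, b, c', d, e]" "{a, b, c', d, e} \<subseteq> I"
    "m a b = 4" "m a c' = 2" "m a d = 2" "m a e = 3" "m b c' = 3" "m b d = 2" "m b e = 2" "m c' d = 3" "m c' e = 2" "m d e = 3"
  shows False
proof -
  have ne: "a \<noteq> b" "a \<noteq> c'" "a \<noteq> d" "a \<noteq> e" "b \<noteq> c'" "b \<noteq> d" "b \<noteq> e" "c' \<noteq> d" "c' \<noteq> e" "d \<noteq> e"
    and inI: "a \<in> I" "b \<in> I" "c' \<in> I" "d \<in> I" "e \<in> I"
    using assms(1,2) by auto
  have sy: "m b a = 4" "m c' a = 2" "m d a = 2" "m e a = 3" "m c' b = 3" "m d b = 2" "m e b = 2" "m d c' = 3" "m e c' = 2" "m e d = 3"
    using assms inI by (auto simp: m_sym)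
  note mm = assms(3-) sy
  have T0: "g {a, b, c'} \<le> 42713183 / 1000000000"
    by (rule order_trans[OF tri_le[of a b c', unfolded mm] tb_bounds(24)]) (use ne inI in auto)
  have L0: "42713182 / 1000000000 \<le> g {a, b, c'}"
    by (rule order_trans[OF tb_bounds5(28) eq_refl[OF tri_eq[of a b c', unfolded mm, OF _ _ tb_bounds5(27), symmetric]]]) (use ne inI in auto)
  have T1: "g {a, b, d} \<le> 94117275 / 1000000000"
    by (rule order_trans[OF tri_le[of a b d, unfolded mm] tb_bounds(22)]) (use ne inI in auto)
  have L1: "94117274 / 1000000000 \<le> g {a, b, d}"
    by (rule order_trans[OF tb_bounds5(24) eq_refl[OF tri_eq[of a b d, unfolded mm, OF _ _ tb_bounds5(23), symmetric]]]) (use ne inI in auto)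
  have T2: "g {a, b, e} \<le> 42713183 / 1000000000"
    by (rule order_trans[OF tri_le[of a b e, unfolded mm] tb_bounds(23)]) (use ne inI in auto)
  have L2: "42713182 / 1000000000 \<le> g {a, b, e}"
    by (rule order_trans[OF tb_bounds5(26) eq_refl[OF tri_eq[of a b e, unfolded mm, OF _ _ tb_bounds5(25), symmetric]]]) (use ne inI in auto)
  have T3: "g {a, c', d} \<le> 116031042 / 1000000000"
    by (rule order_trans[OF tri_le[of a c' d, unfolded mm] tb_bounds(3)]) (use ne inI in auto)
  have L3: "116031041 / 1000000000 \<le> g {a, c', d}"
    by (rule order_trans[OF tb_bounds5(6) eq_refl[OF tri_eq[of a c' d, unfolded mm, OF _ _ tb_bounds5(5), symmetric]]]) (use ne inI in auto)
  have T4: "g {a, c', e} \<le> 116031042 / 1000000000"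
    by (rule order_trans[OF tri_le[of a c' e, unfolded mm] tb_bounds(2)]) (use ne inI in auto)
  have L4: "116031041 / 1000000000 \<le> g {a, c', e}"
    by (rule order_trans[OF tb_bounds5(4) eq_refl[OF tri_eq[of a c' e, unfolded mm, OF _ _ tb_bounds5(3), symmetric]]]) (use ne inI in auto)
  have T5: "g {a, d, e} \<le> 68029457 / 1000000000"
    by (rule order_trans[OF tri_le[of a d e, unfolded mm] tb_bounds(4)]) (use ne inI in auto)
  have L5: "68029456 / 1000000000 \<le> g {a, d, e}"
    by (rule order_trans[OF tb_bounds5(8) eq_refl[OF tri_eq[of a d e, unfolded mm, OF _ _ tb_bounds5(7), symmetric]]]) (use ne inI in auto)
  have T6: "g {b, c', d} \<le> 68029457 / 1000000000"
    by (rule order_trans[OF tri_le[of b c' d, unfolded mm] tb_bounds(18)]) (use ne inI in auto)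
  have L6: "68029456 / 1000000000 \<le> g {b, c', d}"
    by (rule order_trans[OF tb_bounds5(18) eq_refl[OF tri_eq[of b c' d, unfolded mm, OF _ _ tb_bounds5(17), symmetric]]]) (use ne inI in auto)
  have T7: "g {b, c', e} \<le> 116031042 / 1000000000"
    by (rule order_trans[OF tri_le[of b c' e, unfolded mm] tb_bounds(13)]) (use ne inI in auto)
  have L7: "116031041 / 1000000000 \<le> g {b, c', e}"
    by (rule order_trans[OF tb_bounds5(14) eq_refl[OF tri_eq[of b c' e, unfolded mm, OF _ _ tb_bounds5(13), symmetric]]]) (use ne inI in auto)
  have T8: "g {b, d, e} \<le> 116031042 / 1000000000"
    by (rule order_trans[OF tri_le[of b d e, unfolded mm] tb_bounds(3)]) (use ne inI in auto)
  have L8: "116031041 / 1000000000 \<le> g {b, d, e}"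
    by (rule order_trans[OF tb_bounds5(6) eq_refl[OF tri_eq[of b d e, unfolded mm, OF _ _ tb_bounds5(5), symmetric]]]) (use ne inI in auto)
  have T9: "g {c', d, e} \<le> 68029457 / 1000000000"
    by (rule order_trans[OF tri_le[of c' d e, unfolded mm] tb_bounds(18)]) (use ne inI in auto)
  have L9: "68029456 / 1000000000 \<le> g {c', d, e}"
    by (rule order_trans[OF tb_bounds5(18) eq_refl[OF tri_eq[of c' d e, unfolded mm, OF _ _ tb_bounds5(17), symmetric]]]) (use ne inI in auto)
  have E0: "E {a, b, c', d} \<le> 61442458 / 1000000000"
    using E_B4[of d c' b a] ne inI mm by (simp add: insert_commute)
  have "distinct [a, b, c', d]" "{a, b, c', d} \<subseteq> I" using ne inI by auto
  from quad_le[OF this E0, unfolded mm] have Q0: "g {a, b, c', d} * (938557542 / 1000000000) \<le> g {a, b, c'} + g {a, b, d} + g {a, c', d} + g {b, c', d} + -312362830 / 1000000000"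
    using gp_bounds by simp
  have E1: "E {a, b, c', e} \<le> 15230104 / 1000000000"
    using E_F4[of c' b a e] ne inI mm by (simp add: insert_commute)
  have "distinct [a, b, c', e]" "{a, b, c', e} \<subseteq> I" using ne inI by auto
  from quad_le[OF this E1, unfolded mm] have Q1: "g {a, b, c', e} * (984769896 / 1000000000) \<le> g {a, b, c'} + g {a, b, e} + g {a, c', e} + g {b, c', e} + -312362830 / 1000000000"
    using gp_bounds by simp
  have E2: "E {a, b, d, e} \<le> 61442458 / 1000000000"
    using E_B4[of d e a b] ne inI mm by (simp add: insert_commute)
  have "distinct [a, b, d, e]" "{a, b, d, e} \<subseteq> I" using ne inI by auto
  from quad_le[OF this E2, unfolded mm] have Q2: "g {a, b, d, e} * (938557542 / 1000000000) \<le> g {a, b, d} + g {a, b, e} + g {a, d, e} + g {b, d, e} + -312362830 / 1000000000"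
    using gp_bounds by simp
  have E3: "E {a, c', d, e} \<le> 174901229 / 1000000000"
    using E_A4[of a e d c'] ne inI mm by (simp add: insert_commute)
  have "distinct [a, c', d, e]" "{a, c', d, e} \<subseteq> I" using ne inI by auto
  from quad_le[OF this E3, unfolded mm] have Q3: "g {a, c', d, e} * (825098771 / 1000000000) \<le> g {a, c', d} + g {a, c', e} + g {a, d, e} + g {c', d, e} + -352684161 / 1000000000"
    using gp_bounds by simp
  have E4: "E {b, c', d, e} \<le> 174901229 / 1000000000"
    using E_A4[of b c' d e] ne inI mm by (simp add: insert_commute)
  have "distinct [b, c', d, e]" "{b, c', d, e} \<subseteq> I" using ne inI by auto
  from quad_le[OF this E4, unfolded mm] have Q4: "g {b, c', d, e} * (825098771 / 1000000000) \<le> g {b, c', d} + g {b, c', e} + g {b, d, e} + g {c', d, e} + -352684161 / 1000000000"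
    using gp_bounds by simp
  have "E {a, b, c', d, e} * g {a, b, c', d, e} \<ge> 0" "g {a, b, c', d, e} > 0"
    using E_nonneg g_pos[OF assms(2)] by (simp_all add: less_imp_le)
  then have "0 < 786616060 / 1000000000 - g {a, b, c'} - g {a, b, d} - g {a, b, e} - g {a, c', d} - g {a, c', e} - g {a, d, e} - g {b, c', d} - g {b, c', e} - g {b, d, e} - g {c', d, e} + g {a, b, c', d} + g {a, b, c', e} + g {a, b, d, e} + g {a, c', d, e} + g {b, c', d, e}"
    using quint_id[OF assms(1,2), unfolded mm] gp_bounds by linarith
  then show False
    using Q0 Q1 Q2 Q3 Q4 T0 T1 T2 T3 T4 T5 T6 T7 T8 T9 L0 L1 L2 L3 L4 L5 L6 L7 L8 L9
    by linarith
qed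

end

section \<open>Coxeter diagrams\<close>

text \<open>The label 0 stands for an infinite one and counts as larger than every
  \<open>k0\<close>.\<close>

lemma gp_antimono:
  assumes "2 \<le> k0" "k = 0 \<or> k0 \<le> k"
  shows "gp k \<le> gp k0"
proof (cases "k = 0")
  case True
  have "(21 / 25 :: real) ^ k0 < 1" using assms by (simp add: power_less_one_iff)
  then have "2 / 23 \<le> (2 / 23 :: real) / (1 - (21 / 25) ^ k0)" by (simp add: le_divide_eq)
  then show ?thesis using True assms by (simp add: gp_def)
next
  case False
  then have "k0 \<le> k" using assms by simp
  then have le: "(21 / 25 :: real) ^ k \<le> (21 / 25) ^ k0" by (intro power_decreasing) auto
  have lt: "(21 / 25 :: real) ^ k0 < 1" using assms by (simp add: power_less_one_iff)
  have "(2 / 23 :: real) / (1 - (21 / 25) ^ k) \<le> 2 / 23 / (1 - (21 / 25) ^ k0)"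
  proof (rule divide_left_mono)
    show "1 - (21 / 25 :: real) ^ k0 \<le> 1 - (21 / 25) ^ k" using le by linarith
    show "0 < (1 - (21 / 25 :: real) ^ k) * (1 - (21 / 25) ^ k0)"
      by (rule mult_pos_pos) (use le lt in linarith)+
  qed simp
  then show ?thesis using False assms by (simp add: gp_def)
qed

text \<open>Together with \<open>gp_antimono\<close> these exclude every hyperbolic triangle except
  (2,3,7), since each of the others dominates one of the four label by label.\<close>

lemma td_seeds: "td 2 3 8 \<le> 0" "td 2 4 5 \<le> 0" "td 3 3 4 \<le> 0" "td 2 3 0 \<le> 0"
  by (simp_all add: td_def gp_def power_divide)

lemma even_symmetric_sum:
  fixes f :: "'a \<Rightarrow> 'a \<Rightarrow> int"
  assumes "finite U" "\<And>i j. i \<in> U \<Longrightarrow> j \<in> U \<Longrightarrow> f i j = f j i" "\<And>i. i \<in> U \<Longrightarrow> even (f i i)"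
  shows "even (\<Sum>i\<in>U. \<Sum>j\<in>U. f i j)"
  using assms
proof (induction U rule: finite_induct)
  case (insert a U)
  have "(\<Sum>i\<in>insert a U. \<Sum>j\<in>insert a U. f i j) =
    f a a + (\<Sum>j\<in>U. f a j) + ((\<Sum>i\<in>U. f i a) + (\<Sum>i\<in>U. \<Sum>j\<in>U. f i j))"
    using insert.hyps(1,2) by (simp add: sum.distrib)
  moreover have "(\<Sum>i\<in>U. f i a) = (\<Sum>j\<in>U. f a j)"
    by (intro sum.cong refl insert.prems(1)) auto
  moreover have "even (\<Sum>i\<in>U. \<Sum>j\<in>U. f i j)"
    by (rule insert.IH) (auto intro: insert.prems)
  moreover have "even (f a a)" by (rule insert.prems(2)) simp
  ultimately show ?case by simp
qed simp

text \<open>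
  What compactness says about the diagram. A positive null vector of a principal submatrix would be
  an ideal point of the polyhedron; the last two conditions hold because a hyperbolic component of
  the diagram cannot be orthogonal to all other walls.
\<close>

locale compact_growth_system = growth_system_21_25 +
  assumes no_affine: "\<lbrakk>U \<subseteq> I; U \<noteq> {}; \<forall>i\<in>U. x i > 0; \<forall>i\<in>U. (\<Sum>j\<in>U. x j * c i j) = 0\<rbrakk> \<Longrightarrow> False"
    and not_pos_def: "\<exists>x. (\<exists>i\<in>I. x i \<noteq> 0) \<and> (\<Sum>i\<in>I. \<Sum>j\<in>I. x i * x j * c i j) \<le> 0"
    and conn_inf: "\<lbrakk>i \<in> I; j \<in> I; i \<noteq> j; m i j = 0\<rbrakk> \<Longrightarrow> \<exists>k\<in>I - {i, j}. m i k \<noteq> 2 \<or> m j k \<noteq> 2"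
    and conn_237: "\<lbrakk>distinct [i, j, k]; {i, j, k} \<subset> I; m i j = 3; m j k = 7; m i k = 2\<rbrakk> \<Longrightarrow>
      \<exists>l\<in>I - {i, j, k}. m i l \<noteq> 2 \<or> m j l \<noteq> 2 \<or> m k l \<noteq> 2"
begin

lemma c_label6: "i \<in> I \<Longrightarrow> j \<in> I \<Longrightarrow> i \<noteq> j \<Longrightarrow> m i j = 6 \<Longrightarrow> c i j = - sqrt 3"
  using c_cos[of i j] by (simp add: cos_30)

lemma na3:
  assumes "distinct [a, b, c']" "{a, b, c'} \<subseteq> I" "x > 0" "y > 0" "z > 0"
    "2 * x + y * c a b + z * c a c' = 0" "x * c a b + 2 * y + z * c b c' = 0" "x * c a c' + y * c b c' + 2 * z = 0"
  shows False
proof (rule no_affine[OF assms(2)])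
  have "c b a = c a b" "c c' a = c a c'" "c c' b = c b c'" "c a a = 2" "c b b = 2" "c c' c' = 2"
    using assms(2) c_sym c_refl by auto
  then show "\<forall>i\<in>{a, b, c'}. (\<Sum>j\<in>{a, b, c'}. ((\<lambda>_. z)(a := x, b := y)) j * c i j) = 0"
    using assms by (simp add: algebra_simps)
qed (use assms in auto)

lemma na4:
  assumes "distinct [a, b, c', d]" "{a, b, c', d} \<subseteq> I" "x > 0" "y > 0" "z > 0" "w > 0"
    "2 * x + y * c a b + z * c a c' + w * c a d = 0" "x * c a b + 2 * y + z * c b c' + w * c b d = 0"
    "x * c a c' + y * c b c' + 2 * z + w * c c' d = 0" "x * c a d + y * c b d + z * c c' d + 2 * w = 0"
  shows False
proof (rule no_affine[OF assms(2)])
  have "c b a = c a b" "c c' a = c a c'" "c c' b = c b c'" "c d a = c a d" "c d b = c b d" "c d c' = c c' d"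
    "c a a = 2" "c b b = 2" "c c' c' = 2" "c d d = 2"
    using assms(2) c_sym c_refl by auto
  then show "\<forall>i\<in>{a, b, c', d}. (\<Sum>j\<in>{a, b, c', d}. ((\<lambda>_. w)(a := x, b := y, c' := z)) j * c i j) = 0"
    using assms by (simp add: algebra_simps)
qed (use assms in auto)

lemma label_cases: "i \<in> I \<Longrightarrow> j \<in> I \<Longrightarrow> i \<noteq> j \<Longrightarrow> m i j = 0 \<or> m i j = 2 \<or> m i j \<ge> 3"
  using m_ge2[of i j] by auto

text \<open>The affine triangles (3,3,3), (2,4,4) and (2,3,6) are excluded by the null vectors (1,
  1, 1), (1, sqrt 2, 1) and (1, 2, sqrt 3), the hyperbolic ones by \<open>td_seeds\<close>. What
  remains of connected triples is A3, B3, H3 and (2,3,7).\<close>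

lemma tri_class:
  assumes d: "distinct [a, b, c']" and I: "{a, b, c'} \<subseteq> I" and e: "m a b \<noteq> 2" "m b c' \<noteq> 2"
  shows "m a c' = 2 \<and> (m a b = 3 \<and> m b c' \<in> {3, 4, 5, 7} \<or> m b c' = 3 \<and> m a b \<in> {3, 4, 5, 7})"
proof -
  have pos: "gp (m a b) + gp (m b c') + gp (m a c') > 29 / 46"
    using tri_pos[OF d I] by (simp add: td_def)
  have ab: "m a b = 0 \<or> m a b \<ge> 3" and bc: "m b c' = 0 \<or> m b c' \<ge> 3"
    and ac: "m a c' = 0 \<or> m a c' \<ge> 2"
    using label_cases[of a b] label_cases[of b c'] label_cases[of a c'] e d I by auto
  have nb: False if "gp (m a b) \<le> x" "gp (m b c') \<le> y" "gp (m a c') \<le> z" "x + y + z \<le> 29 / 46" for x y z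
    using that pos by linarith
  have g3: "gp (m a b) \<le> gp 3" "gp (m b c') \<le> gp 3" "gp (m a c') \<le> gp 2"
    using gp_antimono[of 3 "m a b"] gp_antimono[of 3 "m b c'"] gp_antimono[of 2 "m a c'"] ab bc ac by auto
  have s: "gp 2 + gp 3 + gp 8 \<le> 29 / 46" "gp 2 + gp 4 + gp 5 \<le> 29 / 46" "gp 3 + gp 3 + gp 4 \<le> 29 / 46"
    "gp 2 + gp 3 + gp 0 \<le> 29 / 46"
    using td_seeds by (simp_all add: td_def)
  have n0: "m a b \<noteq> 0" "m b c' \<noteq> 0" "m a c' \<noteq> 0"
  proof -
    show "m a b \<noteq> 0"
    proof
      assume "m a b = 0"
      then show False using nb[of "gp 0" "gp 3" "gp 2"] g3 s by simp
    qed
    show "m b c' \<noteq> 0"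
    proof
      assume "m b c' = 0"
      then show False using nb[of "gp 3" "gp 0" "gp 2"] g3 s by simp
    qed
    have g32: "gp 3 \<le> gp 2" by (rule gp_antimono) auto
    show "m a c' \<noteq> 0"
    proof
      assume "m a c' = 0"
      then show False using nb[of "gp 3" "gp 3" "gp 0"] g3 g32 s by simp
    qed
  qed
  have ne: "a \<in> I" "b \<in> I" "c' \<in> I" "a \<noteq> b" "b \<noteq> c'" "a \<noteq> c'" using d I by auto
  have ac2: "m a c' = 2"
  proof (rule ccontr)
    assume "m a c' \<noteq> 2"
    then have ac3: "gp (m a c') \<le> gp 3" "m a c' \<ge> 3" using gp_antimono[of 3 "m a c'"] ac n0 by auto
    show False
    proof (cases "m a b = 3 \<and> m b c' = 3 \<and> m a c' = 3")
      case True
      then have "c a b = -1" "c b c' = -1" "c a c' = -1" using c_label(2) ne by auto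
      then show False using na3[OF d I, of 1 1 1] by simp
    next
      case False
      then consider "m a b \<ge> 4" | "m b c' \<ge> 4" | "m a c' \<ge> 4" using ab bc n0 ac3 by linarith
      then show False
      proof cases
        case 1
        then show False using nb[of "gp 4" "gp 3" "gp 3"] gp_antimono[of 4 "m a b"] g3 ac3 s by simp
      next
        case 2
        then show False using nb[of "gp 3" "gp 4" "gp 3"] gp_antimono[of 4 "m b c'"] g3 ac3 s by simp
      next
        case 3
        then show False using nb[of "gp 3" "gp 3" "gp 4"] gp_antimono[of 4 "m a c'"] g3 ac3 s by simp
      qed
    qed
  qed
  then have cac: "c a c' = 0" using c_label(1) ne by auto
  have not4: "\<not> (m a b \<ge> 4 \<and> m b c' \<ge> 4)"
  proof
    assume h: "m a b \<ge> 4 \<and> m b c' \<ge> 4"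
    then have g4: "gp (m a b) \<le> gp 4" "gp (m b c') \<le> gp 4" using gp_antimono by auto
    show False
    proof (cases "m a b = 4 \<and> m b c' = 4")
      case True
      then have "c a b = - sqrt 2" "c b c' = - sqrt 2" using c_label(3) ne by auto
      then show False using na3[OF d I, of 1 "sqrt 2" 1] cac by simp
    next
      case False
      then consider "m a b \<ge> 5" | "m b c' \<ge> 5" using h by linarith
      then show False
      proof cases
        case 1
        then show False using nb[of "gp 5" "gp 4" "gp 2"] gp_antimono[of 5 "m a b"] g4 g3 s by simp
      next
        case 2
        then show False using nb[of "gp 4" "gp 5" "gp 2"] gp_antimono[of 5 "m b c'"] g4 g3 s by simp
      qed
    qed
  qed
  have le7: "m a b < 8" "m b c' < 8"
    using nb[of "gp 8" "gp 3" "gp 2"] nb[of "gp 3" "gp 8" "gp 2"] gp_antimono[of 8 "m a b"]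
      gp_antimono[of 8 "m b c'"] g3 s by force+
  have no6: "\<not> (m a b = 3 \<and> m b c' = 6)" "\<not> (m a b = 6 \<and> m b c' = 3)"
  proof -
    show "\<not> (m a b = 3 \<and> m b c' = 6)"
    proof
      assume "m a b = 3 \<and> m b c' = 6"
      then have "c a b = -1" "c b c' = - sqrt 3" using c_label(2) c_label6 ne by auto
      then show False using na3[OF d I, of 1 2 "sqrt 3"] cac by simp
    qed
    show "\<not> (m a b = 6 \<and> m b c' = 3)"
    proof
      assume "m a b = 6 \<and> m b c' = 3"
      then have "c a b = - sqrt 3" "c b c' = - 1" using c_label(2) c_label6 ne by auto
      then show False using na3[OF d I, of "sqrt 3" 2 1] cac by simp
    qed
  qed
  have "m a b = 3 \<or> m b c' = 3" using not4 ab bc n0 by linarith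
  moreover have "m a b \<in> {3, 4, 5, 6, 7}" "m b c' \<in> {3, 4, 5, 6, 7}" using ab bc n0 le7 by auto
  ultimately show ?thesis using ac2 no6 by auto
qed

text \<open>\<open>conn_inf\<close> supplies a third wall joined to an infinite edge, and by
  \<open>tri_class\<close> a connected triple has no infinite label.\<close>

lemma m_nonzero: "i \<in> I \<Longrightarrow> j \<in> I \<Longrightarrow> i \<noteq> j \<Longrightarrow> m i j \<ge> 2"
proof (rule ccontr)
  assume ij: "i \<in> I" "j \<in> I" "i \<noteq> j" "\<not> m i j \<ge> 2"
  then have z: "m i j = 0" using m_ge2 by blast
  obtain k where k: "k \<in> I" "k \<noteq> i" "k \<noteq> j" "m i k \<noteq> 2 \<or> m j k \<noteq> 2" using conn_inf[OF ij(1-3) z] by auto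
  from k(4) show False
  proof
    assume "m i k \<noteq> 2"
    then show False using tri_class[of k i j] ij k z m_sym[of k i] by auto
  next
    assume "m j k \<noteq> 2"
    then show False using tri_class[of i j k] ij k z by auto
  qed
qed

text \<open>By \<open>conn_237\<close> a fourth wall is joined to the triangle, and
  \<open>tri_class\<close> leaves only labels for which \<open>qd_values\<close> contradicts
  \<open>quad_neg\<close>.\<close>

lemma not_237:
  assumes d: "distinct [i, j, k]" and sub: "{i, j, k} \<subset> I" and lab: "m i j = 3" "m j k = 7" "m i k = 2"
  shows False
proof -
  obtain l where l: "l \<in> I" "l \<noteq> i" "l \<noteq> j" "l \<noteq> k" "m i l \<noteq> 2 \<or> m j l \<noteq> 2 \<or> m k l \<noteq> 2"
    using conn_237[OF assms] by auto
  have I: "i \<in> I" "j \<in> I" "k \<in> I" and ne: "i \<noteq> j" "j \<noteq> k" "i \<noteq> k" using d sub by auto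
  have sy: "m j i = 3" "m k j = 7" "m k i = 2" "m l i = m i l" "m l j = m j l" "m l k = m k l"
    using lab m_sym I l by auto
  note facts = I ne l(1-4) l(2-4)[symmetric] lab sy
  consider (b) "m j l \<noteq> 2" | (c) "m j l = 2" "m k l \<noteq> 2" | (a) "m j l = 2" "m k l = 2" "m i l \<noteq> 2"
    using l by auto
  then show False
  proof cases
    case b
    have "m j l = 3 \<and> m k l = 2" "m i l = 2"
      using tri_class[of l j k] tri_class[of l j i] facts b by auto
    then show False
      using quad_neg[of j k i l] qd_values facts by simp
  next
    case c
    have kl: "m k l = 3" using tri_class[of l k j] facts c by auto
    show False
    proof (cases "m i l = 2")
      case True
      then show False using quad_neg[of i j k l] qd_values facts c kl by simp
    next
      case False
      then have "m i l \<in> {3, 4, 5, 7}" using tri_class[of i l k] facts kl by auto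
      then show False using quad_neg[of i j k l] qd_values facts c kl by auto
    qed
  next
    case a
    then have "m i l \<in> {3, 4, 5, 7}" using tri_class[of l i j] facts by auto
    then show False using quad_neg[of l i j k] qd_values facts a by auto
  qed
qed

definition QF :: "nat set \<Rightarrow> (nat \<Rightarrow> real) \<Rightarrow> real" where
  "QF U x = (\<Sum>i\<in>U. \<Sum>j\<in>U. x i * x j * c i j)"

lemma not_7:
  assumes "\<And>a b c'. distinct [a, b, c'] \<Longrightarrow> I = {a, b, c'} \<Longrightarrow> m a b = 3 \<Longrightarrow> m b c' = 7 \<Longrightarrow> m a c' = 2 \<Longrightarrow> False"
    and d: "distinct [a, b, c']" and I: "{a, b, c'} \<subseteq> I" and e: "m a b \<noteq> 2" "m b c' \<noteq> 2"
  shows "m a c' = 2 \<and> (m a b = 3 \<and> m b c' \<in> {3, 4, 5} \<or> m b c' = 3 \<and> m a b \<in> {3, 4, 5})"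
proof -
  have n: False if "distinct [i, j, k]" "{i, j, k} \<subseteq> I" "m i j = 3" "m j k = 7" "m i k = 2" for i j k
    using that assms(1)[of i j k] not_237[of i j k] by auto
  have sy: "m b a = m a b" "m c' b = m b c'" "m c' a = m a c'" using I m_sym by auto
  show ?thesis
    using tri_class[OF d I e] n[of a b c'] n[of c' b a] d I sy by auto
qed

end

text \<open>The polygon (2,3,7) is itself compact and passes the test \<open>tri_pos\<close> at
  21/25, so it has to be set aside here; it is treated by analytic continuation.\<close>

locale simplex_free = compact_growth_system +
  assumes not_simplex: "\<lbrakk>distinct [a, b, c']; I = {a, b, c'}; m a b = 3; m b c' = 7; m a c' = 2\<rbrakk> \<Longrightarrow> False"
begin

lemma tri:
  assumes "distinct [a, b, c']" "{a, b, c'} \<subseteq> I" "m a b \<noteq> 2" "m b c' \<noteq> 2"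
  shows "m a c' = 2" "m a b = 3 \<and> m b c' \<in> {3, 4, 5} \<or> m b c' = 3 \<and> m a b \<in> {3, 4, 5}"
  using not_7[OF not_simplex assms] by auto

text \<open>Type H3 extends only to type H4, by continuing the path at the end away from the label
  5; every other admissible way of attaching w appears in \<open>qd_values\<close>.\<close>

lemma five4:
  assumes d: "distinct [x, y, z, w]" and I: "{x, y, z, w} \<subseteq> I"
    and l: "m x y = 5" "m y z = 3" "m x z = 2" and e: "m x w \<noteq> 2 \<or> m y w \<noteq> 2 \<or> m z w \<noteq> 2"
  shows "m x w = 2 \<and> m y w = 2 \<and> m z w = 3"
proof -
  have ne: "x \<in> I" "y \<in> I" "z \<in> I" "w \<in> I" "x \<noteq> y" "x \<noteq> z" "x \<noteq> w" "y \<noteq> z" "y \<noteq> w" "z \<noteq> w"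
    using d I by auto
  have sy: "m y x = 5" "m z y = 3" "m z x = 2" "m w x = m x w" "m w y = m y w" "m w z = m z w"
    using l m_sym ne by auto
  note facts = ne ne(5-10)[symmetric] l sy
  consider (y) "m y w \<noteq> 2" | (x) "m y w = 2" "m x w \<noteq> 2" | (z) "m y w = 2" "m x w = 2" "m z w \<noteq> 2"
    using e by auto
  then show ?thesis
  proof cases
    case y
    have "m w x = 2" "m w z = 2" "m y w = 3"
      using tri[of w y x] tri[of w y z] facts y by auto
    then show ?thesis using quad_neg[of y x z w] qd_values facts by simp
  next
    case x
    have xw: "m x w = 3" using tri[of w x y] facts x by auto
    show ?thesis
    proof (cases "m z w = 2")
      case True
      then show ?thesis using quad_neg[of w x y z] qd_values facts x xw by simp
    next
      case False
      then have "m z w \<in> {3, 4, 5}" using tri[of w z y] facts x by auto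
      then show ?thesis
        using quad_neg[of x y z w] quad_neg[of z w x y] qd_values facts x xw by auto
    qed
  next
    case z
    then have "m z w \<in> {3, 4, 5}" using tri[of w z y] facts by auto
    then show ?thesis using quad_neg[of x y z w] qd_values facts z by auto
  qed
qed

text \<open>A fifth vertex joined to z gives the branched diagram of rank five, and one joined to w
  gives a path 5-3-3-k.\<close>

lemma five5:
  assumes d: "distinct [x, y, z, w, v]" and I: "{x, y, z, w, v} \<subseteq> I"
    and l: "m x y = 5" "m y z = 3" "m x z = 2" "m x w = 2" "m y w = 2" "m z w = 3"
    and e: "m x v \<noteq> 2 \<or> m y v \<noteq> 2 \<or> m z v \<noteq> 2 \<or> m w v \<noteq> 2"
  shows False
proof -
  have ne: "x \<in> I" "y \<in> I" "z \<in> I" "w \<in> I" "v \<in> I" "x \<noteq> y" "x \<noteq> z" "x \<noteq> w" "y \<noteq> z" "y \<noteq> w" "z \<noteq> w"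
    "x \<noteq> v" "y \<noteq> v" "z \<noteq> v" "w \<noteq> v"
    using d I by auto
  have sy: "m v w = m w v" "m v z = m z v" "m w z = 3"
    using l m_sym ne by auto
  note facts = ne ne(6-15)[symmetric] l sy
  show False
  proof (cases "m x v \<noteq> 2 \<or> m y v \<noteq> 2 \<or> m z v \<noteq> 2")
    case True
    have v: "m x v = 2 \<and> m y v = 2 \<and> m z v = 3"
      by (rule five4[OF _ _ l(1-3) True]) (use facts in auto)
    then have "m w v = 2" using tri(1)[of w z v] facts by auto
    then show False using no_diagram_53311[OF d I] facts v by simp
  next
    case False
    then have "m w v \<in> {3, 4, 5}" using tri(2)[of z w v] facts e by auto
    then show False using no_diagram_5333[OF d I] no_diagram_5334[OF d I] no_diagram_5335[OF d I] facts False by auto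
  qed
qed

lemma c_nonpos: "i \<in> I \<Longrightarrow> j \<in> I \<Longrightarrow> i \<noteq> j \<Longrightarrow> c i j \<le> 0"
proof -
  assume ij: "i \<in> I" "j \<in> I" "i \<noteq> j"
  have "m i j \<ge> 2" using m_nonzero ij by auto
  then have "pi / real (m i j) \<le> pi / 2" by (intro divide_left_mono) auto
  then have "cos (pi / real (m i j)) \<ge> 0" by (intro cos_ge_zero) (auto intro: order_trans[of _ 0])
  then show ?thesis using c_cos[OF ij] \<open>m i j \<ge> 2\<close> by simp
qed

lemma c_gt: "i \<in> I \<Longrightarrow> j \<in> I \<Longrightarrow> i \<noteq> j \<Longrightarrow> c i j > -2"
proof -
  assume ij: "i \<in> I" "j \<in> I" "i \<noteq> j"
  have m2: "m i j \<ge> 2" using m_nonzero ij by auto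
  then have "pi / real (m i j) > 0" "pi / real (m i j) \<le> pi" by (auto simp: divide_le_eq)
  then have "cos (pi / real (m i j)) < cos 0" by (intro cos_monotone_0_pi) auto
  then show ?thesis using c_cos[OF ij] m2 by simp
qed

section \<open>Minimal diagrams that are not positive definite\<close>

lemma QF_split:
  assumes "finite T" "A \<subseteq> T" "\<And>i j. i \<in> A \<Longrightarrow> j \<in> T - A \<Longrightarrow> c i j = 0 \<and> c j i = 0"
  shows "QF T x = QF A x + QF (T - A) x"
proof -
  have "QF T x = (\<Sum>i\<in>A. \<Sum>j\<in>T. x i * x j * c i j) + (\<Sum>i\<in>T - A. \<Sum>j\<in>T. x i * x j * c i j)"
    unfolding QF_def using sum.subset_diff[OF assms(2,1)] by (simp add: add.commute)
  also have "(\<Sum>i\<in>A. \<Sum>j\<in>T. x i * x j * c i j) = (\<Sum>i\<in>A. \<Sum>j\<in>A. x i * x j * c i j)"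
    using assms by (intro sum.cong refl sum.mono_neutral_right) auto
  also have "(\<Sum>i\<in>T - A. \<Sum>j\<in>T. x i * x j * c i j) = (\<Sum>i\<in>T - A. \<Sum>j\<in>T - A. x i * x j * c i j)"
    using assms by (intro sum.cong refl sum.mono_neutral_right) auto
  finally show ?thesis by (simp add: QF_def)
qed

definition minimal :: "nat set \<Rightarrow> bool" where
  "minimal T \<longleftrightarrow> T \<subseteq> I \<and> (\<exists>x. (\<forall>i\<in>T. x i > 0) \<and> QF T x \<le> 0) \<and> T \<noteq> {} \<and>
     (\<forall>U x. U \<subset> T \<longrightarrow> (\<exists>i\<in>U. x i \<noteq> 0) \<longrightarrow> QF U x > 0)"

lemma QF_support:
  assumes "finite T" "U \<subseteq> T" "\<And>i. i \<in> T - U \<Longrightarrow> x i = 0"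
  shows "QF T x = QF U x"
proof -
  have "QF T x = (\<Sum>i\<in>U. \<Sum>j\<in>T. x i * x j * c i j)"
    unfolding QF_def using assms by (intro sum.mono_neutral_right) auto
  also have "\<dots> = QF U x"
    unfolding QF_def using assms by (intro sum.cong refl sum.mono_neutral_right) auto
  finally show ?thesis .
qed

text \<open>Taking absolute values does not increase the form, because its off-diagonal entries are
  nonpositive; a zero coordinate would yield a smaller subset. So on a smallest subset the vector
  can be taken positive.\<close>

lemma minimal_ex: "\<exists>T. minimal T"
proof -
  define N where "N = (\<lambda>U. U \<subseteq> I \<and> (\<exists>x. (\<exists>i\<in>U. x i \<noteq> 0) \<and> QF U x \<le> 0))"
  have "N I" using not_pos_def by (auto simp: N_def QF_def)
  then obtain T where T: "N T" "\<And>U. N U \<Longrightarrow> card T \<le> card U"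
    using ex_has_least_nat[of N I card] by blast
  have TI: "T \<subseteq> I" and fT: "finite T" using T fin finite_subset by (auto simp: N_def)
  have min: "QF U x > 0" if "U \<subset> T" "\<exists>i\<in>U. x i \<noteq> 0" for U x
  proof (rule ccontr)
    assume "\<not> QF U x > 0"
    then have "N U" using that TI by (auto simp: N_def)
    then show False using T(2) psubset_card_mono[OF fT that(1)] by fastforce
  qed
  obtain x where x: "\<exists>i\<in>T. x i \<noteq> 0" "QF T x \<le> 0" using T by (auto simp: N_def)
  define y where "y = (\<lambda>i. \<bar>x i\<bar>)"
  have "QF T y \<le> QF T x"
    unfolding QF_def
  proof (intro sum_mono)
    fix i j assume ij: "i \<in> T" "j \<in> T"
    show "y i * y j * c i j \<le> x i * x j * c i j"
    proof (cases "i = j")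
      case False
      then have "c i j \<le> 0" using c_nonpos ij TI by auto
      moreover have "x i * x j \<le> y i * y j" by (simp add: y_def abs_mult[symmetric])
      ultimately show ?thesis by (rule mult_right_mono_neg[rotated])
    qed (simp add: y_def abs_mult[symmetric])
  qed
  then have y: "QF T y \<le> 0" using x by simp
  have "y i > 0" if i: "i \<in> T" for i
  proof (rule ccontr)
    assume "\<not> y i > 0"
    then have yi: "y i = 0" by (simp add: y_def)
    define U where "U = {i \<in> T. y i \<noteq> 0}"
    have "U \<subset> T" using i yi by (auto simp: U_def)
    moreover have "\<exists>i\<in>U. y i \<noteq> 0" using x by (auto simp: U_def y_def)
    moreover have "QF T y = QF U y" using fT by (intro QF_support) (auto simp: U_def)
    ultimately show False using min[of U y] y by simp
  qed
  moreover have "T \<noteq> {}" using x by auto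
  ultimately have "minimal T"
    unfolding minimal_def using TI y min by (intro conjI exI[of _ y] allI impI ballI)
  then show ?thesis ..
qed

text \<open>Without an edge leaving A the form would split into two parts, both positive by
  minimality.\<close>

lemma minimal_connected:
  assumes T: "minimal T" and A: "A \<subset> T" "A \<noteq> {}"
  shows "\<exists>i\<in>A. \<exists>j\<in>T - A. m i j \<noteq> 2"
proof (rule ccontr)
  assume n: "\<not> ?thesis"
  have TI: "T \<subseteq> I" and fT: "finite T" using T fin finite_subset by (auto simp: minimal_def)
  obtain x where x: "\<forall>i\<in>T. x i > 0" "QF T x \<le> 0" using T by (auto simp: minimal_def)
  have "c i j = 0 \<and> c j i = 0" if "i \<in> A" "j \<in> T - A" for i j
  proof -
    have "i \<in> I" "j \<in> I" "i \<noteq> j" "m i j = 2" using n that TI A by auto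
    then show ?thesis using c_label(1)[of i j] c_sym[of i j] by simp
  qed
  then have "QF T x = QF A x + QF (T - A) x" using A by (intro QF_split fT) auto
  moreover have "QF A x > 0" "QF (T - A) x > 0"
  proof -
    have "\<exists>i\<in>A. x i \<noteq> 0" "\<exists>i\<in>T - A. x i \<noteq> 0" "T - A \<subset> T" using A x(1) by force+
    then show "QF A x > 0" "QF (T - A) x > 0" using T A(1) unfolding minimal_def by blast+
  qed
  ultimately show False using x by simp
qed

lemma QF_small:
  "QF {a} x = x a * x a * c a a"
  "a \<noteq> b \<Longrightarrow> {a, b} \<subseteq> I \<Longrightarrow> QF {a, b} x = 2 * (x a * x a + x b * x b + c a b * (x a * x b))"
  "distinct [a, b, c'] \<Longrightarrow> {a, b, c'} \<subseteq> I \<Longrightarrow> QF {a, b, c'} x = 2 * (x a * x a + x b * x b + x c' * x c'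
    + c a b * (x a * x b) + c a c' * (x a * x c') + c b c' * (x b * x c'))"
  "distinct [a, b, c', d] \<Longrightarrow> {a, b, c', d} \<subseteq> I \<Longrightarrow> QF {a, b, c', d} x = 2 * (x a * x a + x b * x b + x c' * x c' + x d * x d
    + c a b * (x a * x b) + c a c' * (x a * x c') + c b c' * (x b * x c')
    + c a d * (x a * x d) + c b d * (x b * x d) + c c' d * (x c' * x d))"
  using c_sym[of a b] c_sym[of a c'] c_sym[of b c'] c_sym[of a d] c_sym[of b d] c_sym[of c' d]
  by (simp_all add: QF_def c_refl algebra_simps)

lemma gold_less: "gold < 2"
proof -
  have "(gold - 2) * (gold + 1) < 0" using gold by (simp add: algebra_simps)
  then show ?thesis using gold(1) by (simp add: mult_less_0_iff)
qed

text \<open>A connected diagram of rank at most three is by now a single vertex, dihedral, or of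
  type A3, B3 or H3, and thus positive definite. For the path with labels 3 and k this amounts to
  r^2 < 3 with r = 2 cos (pi / k).\<close>

lemma minimal_card:
  assumes T: "minimal T"
  shows "card T \<ge> 4"
proof -
  have TI: "T \<subseteq> I" and fT: "finite T" and ne: "T \<noteq> {}" using T fin finite_subset by (auto simp: minimal_def)
  obtain x where "\<forall>i\<in>T. x i > 0" and x2: "QF T x \<le> 0" using T by (auto simp: minimal_def)
  then have x: "\<And>i. i \<in> T \<Longrightarrow> x i > 0" "QF T x \<le> 0" by simp_all
  obtain a where a: "a \<in> T" using ne by auto
  have "T \<noteq> {a}"
  proof
    assume "T = {a}"
    then show False using x(1)[OF a] x(2) TI by (simp add: QF_small c_refl) (simp add: mult_le_0_iff)
  qed
  then obtain b where b: "b \<in> T - {a}" "m a b \<noteq> 2" using minimal_connected[OF T, of "{a}"] a by auto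
  then have abI: "{a, b} \<subseteq> I" "a \<noteq> b" and bT: "b \<in> T" using a TI by auto
  have "T \<noteq> {a, b}"
  proof
    assume "T = {a, b}"
    moreover have "c a b * (x a * x b) > -2 * (x a * x b)"
      using c_gt[of a b] abI x(1)[OF a] x(1)[OF bT] by (intro mult_strict_right_mono) auto
    moreover have "(x a - x b) * (x a - x b) \<ge> 0" by simp
    ultimately show False using x(2) by (simp add: QF_small(2)[OF abI(2,1)] algebra_simps)
  qed
  then obtain i k where ik: "i \<in> {a, b}" "k \<in> T - {a, b}" "m i k \<noteq> 2"
    using minimal_connected[OF T, of "{a, b}"] a bT by auto
  obtain u v w where uvw: "distinct [u, v, w]" "{u, v, w} \<subseteq> T" "m u v \<noteq> 2" "m v w \<noteq> 2"
  proof (cases "i = b")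
    case True
    then show ?thesis using that[of a b k] ik a b abI by auto
  next
    case False
    then show ?thesis using that[of b a k] ik a b abI m_sym[of a b] by auto
  qed
  then have uI: "{u, v, w} \<subseteq> I" using TI by auto
  have "T \<noteq> {u, v, w}"
  proof
    assume Te: "T = {u, v, w}"
    note t = tri[OF uvw(1) uI uvw(3,4)]
    have pos: "x u > 0" "x v > 0" "x w > 0" using x(1) uvw(2) by auto
    have nn: "u \<in> I" "v \<in> I" "w \<in> I" "u \<noteq> v" "v \<noteq> w" "u \<noteq> w" using uI uvw(1) by auto
    have cuw: "c u w = 0" using c_label(1) t nn by auto
    have core: False if "r * r < 3" "p' * p' + q * q + y * y - p' * y - r * (y * q) \<le> 0" "y > 0" for p' q y r :: real
    proof -
      have "p' * p' + q * q + y * y - p' * y - r * (y * q) =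
        (p' - y / 2) * (p' - y / 2) + (q - r * y / 2) * (q - r * y / 2) + (3 - r * r) / 4 * (y * y)"
        by (simp add: field_simps)
      moreover have "(3 - r * r) / 4 * (y * y) > 0" using that by simp
      moreover have "(p' - y / 2) * (p' - y / 2) \<ge> 0" "(q - r * y / 2) * (q - r * y / 2) \<ge> 0" by simp_all
      ultimately show False using that by linarith
    qed
    have lab: "c i j \<in> {-1, - sqrt 2, - gold}" if "i \<in> I" "j \<in> I" "i \<noteq> j" "m i j \<in> {3, 4, 5}" for i j
      using c_label[OF that(1-3)] that(4) by auto
    have r3: "r * r < 3" if "- r \<in> {-1, - sqrt 2, - gold}" for r :: real
      using that gold gold_less by auto
    from t(2) show False
    proof
      assume h: "m u v = 3 \<and> m v w \<in> {3, 4, 5}"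
      then have "c u v = -1" "- (- c v w) \<in> {-1, - sqrt 2, - gold}" using c_label(2) nn lab by auto
      then show False
        using core[OF r3[of "- c v w"], of "x u" "x w" "x v"] pos x(2) cuw
        by (simp add: Te QF_small(3)[OF uvw(1) uI] algebra_simps)
    next
      assume h: "m v w = 3 \<and> m u v \<in> {3, 4, 5}"
      then have "c v w = -1" "- (- c u v) \<in> {-1, - sqrt 2, - gold}" using c_label(2) nn lab by auto
      then show False
        using core[OF r3[of "- c u v"], of "x w" "x u" "x v"] pos x(2) cuw
        by (simp add: Te QF_small(3)[OF uvw(1) uI] algebra_simps)
    qed
  qed
  then have "{u, v, w} \<subset> T" using uvw by auto
  from psubset_card_mono[OF fT this] uvw(1) show ?thesis by simp
qed

text \<open>Having rank at least 4, a minimal diagram with a label 5 contains H4. It cannot be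
  larger by \<open>five5\<close>, and H4 itself is positive definite.\<close>

lemma no_five:
  assumes T: "minimal T" and xy: "x \<in> T" "y \<in> T" "x \<noteq> y"
  shows "m x y \<noteq> 5"
proof
  assume five: "m x y = 5"
  have TI: "T \<subseteq> I" and fT: "finite T" using T fin finite_subset by (auto simp: minimal_def)
  note c4 = minimal_card[OF T]
  have ex: "\<exists>i\<in>A. \<exists>j\<in>T - A. m i j \<noteq> 2" if "A \<subseteq> T" "A \<noteq> {}" "card A < card T" for A
    using minimal_connected[OF T, of A] that by auto
  obtain i z where iz: "i \<in> {x, y}" "z \<in> T - {x, y}" "m i z \<noteq> 2"
    using ex[of "{x, y}"] xy c4 by auto
  obtain x y z where xyz: "distinct [x, y, z]" "{x, y, z} \<subseteq> T" "m x y = 5" "m y z \<noteq> 2"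
  proof (cases "i = y")
    case True
    then show ?thesis using that[of x y z] iz xy five by auto
  next
    case False
    then show ?thesis using that[of y x z] iz xy five m_sym[of x y] TI by auto
  qed
  have t: "m x z = 2" "m y z = 3" using tri[OF xyz(1)] xyz TI by auto
  obtain j w where jw: "j \<in> {x, y, z}" "w \<in> T - {x, y, z}" "m j w \<noteq> 2"
    using ex[of "{x, y, z}"] xyz c4 by auto
  have d4: "distinct [x, y, z, w]" "{x, y, z, w} \<subseteq> T" using jw xyz by auto
  have w: "m x w = 2 \<and> m y w = 2 \<and> m z w = 3"
    using five4[of x y z w] d4 TI xyz(3) t jw by auto
  show False
  proof (cases "T = {x, y, z, w}")
    case True
    obtain f where "\<forall>i\<in>T. f i > 0" and f2: "QF T f \<le> 0" using T by (auto simp: minimal_def)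
    then have f: "\<And>i. i \<in> T \<Longrightarrow> f i > 0" "QF T f \<le> 0" by simp_all
    have nn: "x \<in> I" "y \<in> I" "z \<in> I" "w \<in> I" "x \<noteq> y" "y \<noteq> z" "x \<noteq> z" "x \<noteq> w" "y \<noteq> w" "z \<noteq> w"
      using d4 TI by auto
    have cc: "c x y = - gold" "c y z = -1" "c x z = 0" "c x w = 0" "c y w = 0" "c z w = -1"
      using c_label nn xyz(3) t w by auto
    define A B C D where "A = f x" "B = f y" "C = f z" "D = f w"
    have pos: "D > 0" using f(1) True by (simp add: A_B_C_D_def)
    have "QF T f = 2 * (A * A + B * B + C * C + D * D - gold * (A * B) - B * C - C * D)"
      using QF_small(4)[of x y z w f] d4 TI cc True by (simp add: A_B_C_D_def)
    then have le: "A * A + B * B + C * C + D * D - gold * (A * B) - B * C - C * D \<le> 0" using f(2) by simp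
    \<comment> \<open>4 - gold^2 = 3 - gold, and 1 / e = (gold + 2) / 5. Eliminating A, B and C in
      turn leaves the pivots e / 4, e / 5 and (2 - gold) / 4.\<close>
    define e where "e = 3 - gold"
    have e: "e > 0" "e * (gold + 2) = 5" using gold gold_less by (simp_all add: e_def algebra_simps)
    have gg: "gold * gold * z = gold * z + z" for z using gold(2) by (simp add: algebra_simps)
    define k where "k = (gold + 2) / 5"
    have ek: "e * k = 1" using e by (simp add: k_def)
    have "A * A + B * B + C * C + D * D - gold * (A * B) - B * C - C * D =
      (A - gold * B / 2) * (A - gold * B / 2) + e / 4 * ((B - 2 * k * C) * (B - 2 * k * C))
      + e / 5 * ((C - 5 / 2 * k * D) * (C - 5 / 2 * k * D)) + (2 - gold) / 4 * (D * D)"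
    proof -
      have "e / 4 * ((B - 2 * k * C) * (B - 2 * k * C)) = e / 4 * (B * B) - (e * k) * (B * C) + (e * k) * k * (C * C)"
        by (simp add: field_simps)
      moreover have "e / 5 * ((C - 5 / 2 * k * D) * (C - 5 / 2 * k * D)) =
        e / 5 * (C * C) - (e * k) * (C * D) + 5 / 4 * (e * k) * k * (D * D)"
        by (simp add: field_simps)
      moreover have "(A - gold * B / 2) * (A - gold * B / 2) = A * A - gold * (A * B) + (gold + 1) / 4 * (B * B)"
        using gg[of "B * B"] by (simp add: field_simps)
      ultimately show ?thesis unfolding ek by (simp add: e_def k_def field_simps)
    qed
    moreover have "(2 - gold) / 4 * (D * D) > 0" using gold_less pos by simp
    moreover have "(A - gold * B / 2) * (A - gold * B / 2) \<ge> 0" "e / 4 * ((B - 2 * k * C) * (B - 2 * k * C)) \<ge> 0"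
      "e / 5 * ((C - 5 / 2 * k * D) * (C - 5 / 2 * k * D)) \<ge> 0"
      using e(1) by simp_all
    ultimately show False using le by linarith
  next
    case False
    then have "card {x, y, z, w} < card T" using psubset_card_mono[OF fT, of "{x, y, z, w}"] d4 by auto
    then obtain k v where kv: "k \<in> {x, y, z, w}" "v \<in> T - {x, y, z, w}" "m k v \<noteq> 2"
      using ex[of "{x, y, z, w}"] d4 by auto
    show False
      using five5[of x y z w v] kv d4 TI xyz(3) t w by auto
  qed
qed

end

lemma quad_form_upd:
  fixes a :: "'i \<Rightarrow> 'i \<Rightarrow> 'a::comm_ring_1"
  assumes "finite T" "k \<in> T" "\<And>i j. i \<in> T \<Longrightarrow> j \<in> T \<Longrightarrow> a i j = a j i"
  shows "(\<Sum>i\<in>T. \<Sum>j\<in>T. (y(k := y k + s)) i * (y(k := y k + s)) j * a i j) =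
    (\<Sum>i\<in>T. \<Sum>j\<in>T. y i * y j * a i j) + 2 * s * (\<Sum>j\<in>T. y j * a k j) + s * s * a k k"
proof -
  define d where "d = (\<lambda>i. if i = k then s else 0)"
  have d: "(y(k := y k + s)) i = y i + d i" for i by (simp add: d_def)
  have sd: "(\<Sum>i\<in>T. d i * f i) = s * f k" for f :: "'i \<Rightarrow> 'a"
  proof -
    have "(\<Sum>i\<in>T. d i * f i) = (\<Sum>i\<in>T. if i = k then s * f i else 0)"
      by (intro sum.cong) (auto simp: d_def)
    then show ?thesis using assms by simp
  qed
  have "(\<Sum>i\<in>T. \<Sum>j\<in>T. (y i + d i) * (y j + d j) * a i j) =
    (\<Sum>i\<in>T. \<Sum>j\<in>T. y i * y j * a i j) + (\<Sum>i\<in>T. y i * (\<Sum>j\<in>T. d j * a i j))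
    + (\<Sum>i\<in>T. d i * (\<Sum>j\<in>T. y j * a i j)) + (\<Sum>i\<in>T. d i * (\<Sum>j\<in>T. d j * a i j))"
    by (simp add: sum_distrib_left sum.distrib[symmetric] algebra_simps)
  also have "(\<Sum>i\<in>T. y i * (\<Sum>j\<in>T. d j * a i j)) = s * (\<Sum>j\<in>T. y j * a k j)"
    using assms by (simp add: sd sum_distrib_left mult_ac)
  finally show ?thesis unfolding d by (simp only: sd) (simp add: algebra_simps)
qed

lemma floor_scaled_tendsto:
  fixes u :: real
  assumes "u \<ge> 0"
  shows "(\<lambda>n. real (nat \<lfloor>real n * u\<rfloor>) / real n) \<longlonglongrightarrow> u"
proof (rule tendsto_sandwich[of "\<lambda>n. u - 1 / real n" _ _ "\<lambda>n. u"])
  have b: "real n * u - 1 \<le> real (nat \<lfloor>real n * u\<rfloor>) \<and> real (nat \<lfloor>real n * u\<rfloor>) \<le> real n * u" for n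
    using assms by (simp add: of_nat_nat)
  show "\<forall>\<^sub>F n in sequentially. u - 1 / real n \<le> real (nat \<lfloor>real n * u\<rfloor>) / real n"
    using eventually_gt_at_top[of 0]
  proof eventually_elim
    case (elim n)
    then have "(real n * u - 1) / real n \<le> real (nat \<lfloor>real n * u\<rfloor>) / real n"
      using b[of n] by (intro divide_right_mono) auto
    then show ?case using elim by (simp add: diff_divide_distrib)
  qed
  show "\<forall>\<^sub>F n in sequentially. real (nat \<lfloor>real n * u\<rfloor>) / real n \<le> u"
    using eventually_gt_at_top[of 0]
  proof eventually_elim
    case (elim n)
    then have "real (nat \<lfloor>real n * u\<rfloor>) / real n \<le> (real n * u) / real n"
      using b[of n] by (intro divide_right_mono) auto
    then show ?case using elim by simp
  qed
  show "(\<lambda>n. u - 1 / real n) \<longlonglongrightarrow> u"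
    using tendsto_diff[OF tendsto_const[of u] lim_1_over_n] by simp
qed simp

context simplex_free
begin

section \<open>Diagrams with edges labelled 4\<close>

lemma na5:
  assumes "distinct [a, b, c', d, e]" "{a, b, c', d, e} \<subseteq> I" "x > 0" "y > 0" "z > 0" "w > 0" "v > 0"
    "2 * x + y * c a b + z * c a c' + w * c a d + v * c a e = 0"
    "x * c a b + 2 * y + z * c b c' + w * c b d + v * c b e = 0"
    "x * c a c' + y * c b c' + 2 * z + w * c c' d + v * c c' e = 0"
    "x * c a d + y * c b d + z * c c' d + 2 * w + v * c d e = 0"
    "x * c a e + y * c b e + z * c c' e + w * c d e + 2 * v = 0"
  shows False
proof (rule no_affine[OF assms(2)])
  have "c b a = c a b" "c c' a = c a c'" "c c' b = c b c'" "c d a = c a d" "c d b = c b d" "c d c' = c c' d"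
    "c e a = c a e" "c e b = c b e" "c e c' = c c' e" "c e d = c d e"
    "c a a = 2" "c b b = 2" "c c' c' = 2" "c d d = 2" "c e e = 2"
    "b \<noteq> a" "c' \<noteq> a" "c' \<noteq> b" "d \<noteq> a" "d \<noteq> b" "d \<noteq> c'" "e \<noteq> a" "e \<noteq> b" "e \<noteq> c'" "e \<noteq> d"
    using assms(1,2) c_sym c_refl by auto
  then show "\<forall>i\<in>{a, b, c', d, e}. (\<Sum>j\<in>{a, b, c', d, e}. ((\<lambda>_. v)(a := x, b := y, c' := z, d := w)) j * c i j) = 0"
    using assms by (simp add: algebra_simps)
qed (use assms in auto)

text \<open>This and the next two lemmas are about the affine diagrams of types C3, B3 and F4; the
  numbers supplied to \<open>na4\<close> and \<open>na5\<close> are their positive null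
  vectors.\<close>

lemma no_C3:
  assumes "distinct [a, b, c', d]" "{a, b, c', d} \<subseteq> I" "m a b = 4" "m b c' = 3" "m c' d = 4"
    "m a c' = 2" "m a d = 2" "m b d = 2"
  shows False
proof -
  have "c a b = - sqrt 2" "c b c' = -1" "c c' d = - sqrt 2" "c a c' = 0" "c a d = 0" "c b d = 0"
    using assms c_label(3)[of a b] c_label(2)[of b c'] c_label(3)[of c' d] c_label(1)[of a c'] c_label(1)[of a d]
      c_label(1)[of b d] by simp_all
  then show False using na4[OF assms(1,2), of 1 "sqrt 2" "sqrt 2" 1] by simp
qed

lemma no_B3:
  assumes "distinct [a, b, c', d]" "{a, b, c', d} \<subseteq> I" "m a b = 4" "m a c' = 3" "m a d = 3"
    "m b c' = 2" "m b d = 2" "m c' d = 2"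
  shows False
proof -
  have "c a b = - sqrt 2" "c b c' = 0" "c c' d = 0" "c a c' = -1" "c a d = -1" "c b d = 0"
    using assms c_label(3)[of a b] c_label(1)[of b c'] c_label(1)[of c' d] c_label(2)[of a c'] c_label(2)[of a d]
      c_label(1)[of b d] by simp_all
  then show False using na4[OF assms(1,2), of 2 "sqrt 2" 1 1] by simp
qed

lemma no_F4:
  assumes "distinct [a, b, c', d, e]" "{a, b, c', d, e} \<subseteq> I" "m a b = 3" "m b c' = 3" "m c' d = 4" "m d e = 3"
    "m a c' = 2" "m a d = 2" "m a e = 2" "m b d = 2" "m b e = 2" "m c' e = 2"
  shows False
proof -
  have "c a b = -1" "c b c' = -1" "c c' d = - sqrt 2" "c d e = -1" "c a c' = 0" "c a d = 0" "c a e = 0"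
    "c b d = 0" "c b e = 0" "c c' e = 0"
    using assms c_label(2)[of a b] c_label(2)[of b c'] c_label(3)[of c' d] c_label(2)[of d e] c_label(1)[of a c']
      c_label(1)[of a d] c_label(1)[of a e] c_label(1)[of b d] c_label(1)[of b e] c_label(1)[of c' e] by simp_all
  then show False using na5[OF assms(1,2), of 1 2 3 "2 * sqrt 2" "sqrt 2"] by simp
qed

text \<open>If both ends of an edge labelled 4 have further neighbours, only type F4 survives:
  joining x' to y' would close one of the hyperbolic cycles of rank four.\<close>

lemma four_edge:
  assumes d: "distinct [x', x, y, y']" and I: "{x', x, y, y'} \<subseteq> I"
    and l: "m x' x \<noteq> 2" "m x y = 4" "m y y' \<noteq> 2"
  shows "m x' x = 3 \<and> m y y' = 3 \<and> m x' y = 2 \<and> m x y' = 2 \<and> m x' y' = 2"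
proof -
  have ne: "x' \<in> I" "x \<in> I" "y \<in> I" "y' \<in> I" "x' \<noteq> x" "x' \<noteq> y" "x' \<noteq> y'" "x \<noteq> y" "x \<noteq> y'" "y \<noteq> y'"
    using d I by auto
  have sy: "m x x' = m x' x" "m y x = 4" "m y' y = m y y'" "m y x' = m x' y" "m y' x = m x y'" "m y' x' = m x' y'"
    using l m_sym ne by auto
  note facts = ne ne(5-10)[symmetric] l sy
  have 1: "m x' x = 3" "m x' y = 2" using tri[of x' x y] facts by auto
  have 2: "m y y' = 3" "m x y' = 2" using tri[of x y y'] facts by auto
  have "m x' y' = 2"
  proof (rule ccontr)
    assume n: "m x' y' \<noteq> 2"
    have "m x' y' \<in> {3, 4, 5}" using tri(2)[of x x' y'] facts 1 n by auto
    then show False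
      using quad_neg[of x y y' x'] quad_neg[of x' y' y x] qd_values facts 1 2 by auto
  qed
  then show ?thesis using 1 2 by simp
qed

text \<open>Attaching z to F4 on the side of x produces an affine diagram of type B3, C3 or F4, the
  path 5-3-4, or the cycle 4,3,3,3,3.\<close>

lemma four_edge_end:
  assumes d: "distinct [x', x, y, y', z]" and I: "{x', x, y, y', z} \<subseteq> I"
    and l: "m x' x \<noteq> 2" "m x y = 4" "m y y' \<noteq> 2" and z: "m x z \<noteq> 2 \<or> m x' z \<noteq> 2"
  shows False
proof -
  have ne: "x' \<in> I" "x \<in> I" "y \<in> I" "y' \<in> I" "z \<in> I" "x' \<noteq> x" "x' \<noteq> y" "x' \<noteq> y'" "x \<noteq> y" "x \<noteq> y'" "y \<noteq> y'"
    "x' \<noteq> z" "x \<noteq> z" "y \<noteq> z" "y' \<noteq> z"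
    using d I by auto
  have f: "m x' x = 3 \<and> m y y' = 3 \<and> m x' y = 2 \<and> m x y' = 2 \<and> m x' y' = 2"
    by (rule four_edge) (use d I l in auto)
  have sy: "m x x' = 3" "m y x = 4" "m y' y = 3" "m y x' = 2" "m y' x = 2" "m y' x' = 2"
    "m z x = m x z" "m z x' = m x' z" "m z y = m y z" "m z y' = m y' z"
    using l f m_sym ne by auto
  note facts = ne ne(6-15)[symmetric] l f sy
  show False
  proof (cases "m x z = 2")
    case False
    have "m x z = 3" "m y z = 2" "m x' z = 2" using tri[of z x y] tri(1)[of x' x z] facts False by auto
    then show False using no_B3[of x y x' z] facts by auto
  next
    case xz: True
    then have "m x' z \<noteq> 2" using z by simp
    then have x'z: "m x' z \<in> {3, 4, 5}" using tri(2)[of z x' x] facts by auto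
    have yz: "m y z = 2"
    proof (rule ccontr)
      assume "m y z \<noteq> 2"
      then have "m y z = 3" "m y' z = 2" using tri[of x y z] tri(1)[of y' y z] facts by auto
      then show False using no_B3[of y x y' z] facts xz by auto
    qed
    show False
    proof (cases "m y' z = 2")
      case True
      from x'z consider "m x' z = 3" | "m x' z = 4" | "m x' z = 5" by auto
      then show False
      proof cases
        case 1
        then show False using no_F4[of z x' x y y'] facts xz yz True by auto
      next
        case 2
        then show False using no_C3[of z x' x y] facts xz yz by auto
      next
        case 3
        then show False using quad_neg[of z x' x y] qd_values facts xz yz by auto
      qed
    next
      case False
      then have y'z: "m y' z \<in> {3, 4, 5}" using tri(2)[of z y' y] facts by auto
      have 1: "m x' z = 3"
        using x'z no_C3[of z x' x y] quad_neg[of z x' x y] qd_values facts xz yz by auto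
      have 2: "m y' z = 3"
        using y'z no_C3[of z y' y x] quad_neg[of z y' y x] qd_values facts xz yz by auto
      show False using no_diagram_c43333[of x y y' z x'] facts xz yz 1 2 by auto
    qed
  qed
qed

text \<open>An edge labelled 4 with no leaf lies in a diagram F4, which cannot grow by
  \<open>four_edge_end\<close> and is positive definite.\<close>

lemma four_edge_pendant:
  assumes T: "minimal T" and xy: "x \<in> T" "y \<in> T" "x \<noteq> y" "m x y = 4"
  shows "(\<forall>k\<in>T - {x, y}. m x k = 2) \<or> (\<forall>k\<in>T - {x, y}. m y k = 2)"
proof (rule ccontr)
  assume "\<not> ?thesis"
  then obtain x' y' where x': "x' \<in> T" "x' \<noteq> x" "x' \<noteq> y" "m x x' \<noteq> 2"
    and y': "y' \<in> T" "y' \<noteq> x" "y' \<noteq> y" "m y y' \<noteq> 2" by auto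
  have TI: "T \<subseteq> I" and fT: "finite T" using T fin finite_subset by (auto simp: minimal_def)
  have I: "x \<in> I" "y \<in> I" "x' \<in> I" "y' \<in> I" using TI xy x' y' by auto
  have sy: "m x' x = m x x'" "m y x = 4" "m x' y = m y x'" using m_sym I xy by auto
  have "x' \<noteq> y'"
  proof
    assume "x' = y'"
    then show False using tri(1)[of x' x y] x' y' xy I sy by auto
  qed
  then have d: "distinct [x', x, y, y']" using x' y' xy by auto
  have f: "m x' x = 3 \<and> m y y' = 3 \<and> m x' y = 2 \<and> m x y' = 2 \<and> m x' y' = 2"
    by (rule four_edge[OF d]) (use I x' y' xy sy in auto)
  show False
  proof (cases "T = {x', x, y, y'}")
    case True
    obtain h where "\<forall>i\<in>T. h i > 0" and h: "QF T h \<le> 0" using T by (auto simp: minimal_def)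
    then have pos: "h x > 0" "h y > 0" using xy by auto
    have "c x' x = -1" "c x y = - sqrt 2" "c y y' = -1" "c x' y = 0" "c x' y' = 0" "c x y' = 0"
      using f xy(4) d I c_label(2)[of x' x] c_label(3)[of x y] c_label(2)[of y y'] c_label(1)[of x' y]
        c_label(1)[of x' y'] c_label(1)[of x y'] by simp_all
    then have "h x' * h x' + h x * h x + h y * h y + h y' * h y' - h x' * h x - sqrt 2 * (h x * h y) - h y * h y' \<le> 0"
      using h QF_small(4)[OF d, of h] I True by (simp add: algebra_simps)
    moreover have "(h x' - h x / 2) * (h x' - h x / 2) \<ge> 0" "(h y' - h y / 2) * (h y' - h y / 2) \<ge> 0"
      "(h x - h y) * (h x - h y) \<ge> 0" by simp_all
    \<comment> \<open>This is what makes F4 positive definite: beyond the squares above the form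
      retains (3/2 - sqrt 2) times \<open>h x * h y\<close>.\<close>
    moreover have "sqrt 2 * (h x * h y) < 3 / 2 * (h x * h y)"
    proof -
      have "sqrt 2 < sqrt (9 / 4)" by (intro real_sqrt_less_mono) simp
      also have "sqrt (9 / 4) = 3 / 2" by (simp add: real_sqrt_divide)
      finally show ?thesis using pos by (intro mult_strict_right_mono) auto
    qed
    ultimately show False by (simp add: algebra_simps)
  next
    case False
    then have "{x', x, y, y'} \<subset> T" using x' y' xy by auto
    then obtain k z where k: "k \<in> {x', x, y, y'}" "z \<in> T - {x', x, y, y'}" "m k z \<noteq> 2"
      using minimal_connected[OF T, of "{x', x, y, y'}"] by auto
    have zI: "z \<in> I" using k TI by auto
    show False
    proof (cases "m x z \<noteq> 2 \<or> m x' z \<noteq> 2")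
      case True
      show False by (rule four_edge_end[of x' x y y' z]) (use d I zI k True f xy in auto)
    next
      case False
      then have z: "m y z \<noteq> 2 \<or> m y' z \<noteq> 2" using k by auto
      have "m y' y \<noteq> 2" using f m_sym[of y' y] I by simp
      moreover have "distinct [y', y, x, x', z]" "{y', y, x, x', z} \<subseteq> I" using d I zI k by auto
      ultimately show False
        using four_edge_end[of y' y x x' z] sy(2) x'(4) z by blast
    qed
  qed
qed

text \<open>
  Scaling the basis vectors at the leaves of edges labelled 4 by \<open>sqrt 2\<close> makes the quadratic form
  of a minimal diagram integral. A rational approximation of its nonpositive vector then gives an
  integer vector, on which a minimality argument applies.
\<close>

definition pendants :: "nat set \<Rightarrow> nat set" where
  "pendants T = {i \<in> T. \<exists>j\<in>T. i \<noteq> j \<and> m i j = 4 \<and> (\<forall>k\<in>T - {i, j}. m i k = 2)}"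

text \<open>Scaling a leaf by \<open>sqrt 2\<close> doubles its diagonal entry to 4, and an edge
  labelled 4, of which exactly one end is scaled, gets - sqrt 2 * sqrt 2 = -2.\<close>

definition entry :: "nat set \<Rightarrow> nat \<Rightarrow> nat \<Rightarrow> int" where
  "entry L i j = (if i = j then if i \<in> L then 4 else 2 else if m i j = 2 then 0 else if m i j = 3 then -1 else -2)"

definition hgt :: "nat set \<Rightarrow> nat \<Rightarrow> real" where
  "hgt L i = (if i \<in> L then sqrt 2 else 1)"

lemma minimal_labels:
  assumes T: "minimal T" and ij: "i \<in> T" "j \<in> T" "i \<noteq> j"
  shows "m i j \<in> {2, 3, 4}"
proof (rule ccontr)
  assume n: "m i j \<notin> {2, 3, 4}"
  have TI: "T \<subseteq> I" and fT: "finite T" using T fin finite_subset by (auto simp: minimal_def)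
  have "card {i, j} < card T" using minimal_card[OF T] ij by simp
  then have "{i, j} \<subset> T" using ij by auto
  then obtain k z where k: "k \<in> {i, j}" "z \<in> T - {i, j}" "m k z \<noteq> 2"
    using minimal_connected[OF T, of "{i, j}"] by auto
  have I: "i \<in> I" "j \<in> I" "z \<in> I" using ij k TI by auto
  have "m i j \<in> {3, 4, 5}"
    using tri(2)[of z i j] tri(2)[of i j z] k ij I n m_sym[of i z] by auto
  then show False using n no_five[OF T ij] by auto
qed

text \<open>If both ends of the edge were such leaves, the edge would be a component by itself, but
  a minimal diagram is connected and has rank at least 4.\<close>

lemma pendant_other:
  assumes T: "minimal T" and i: "i \<in> pendants T" and j: "j \<in> T" "i \<noteq> j" "m i j \<noteq> 2"
  shows "m i j = 4 \<and> j \<notin> pendants T"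
proof -
  obtain j' where j': "j' \<in> T" "i \<noteq> j'" "m i j' = 4" "\<forall>k\<in>T - {i, j'}. m i k = 2" "i \<in> T"
    using i by (auto simp: pendants_def)
  have jj: "j = j'" using j j' by auto
  have TI: "T \<subseteq> I" using T by (auto simp: minimal_def)
  have "j \<notin> pendants T"
  proof
    assume "j \<in> pendants T"
    then obtain i' where i': "i' \<in> T" "j \<noteq> i'" "m j i' = 4" "\<forall>k\<in>T - {j, i'}. m j k = 2"
      by (auto simp: pendants_def)
    have "m j i = 4" using j' jj m_sym[of i j] TI by auto
    have ii: "i' = i"
    proof (rule ccontr)
      assume "i' \<noteq> i"
      then have "m j i = 2" using i'(4) j j'(5) by simp
      then show False using \<open>m j i = 4\<close> by simp
    qed
    have "card {i, j} < card T" using minimal_card[OF T] j by simp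
    then have "{i, j} \<subset> T" using j j' by auto
    then obtain k z where "k \<in> {i, j}" "z \<in> T - {i, j}" "m k z \<noteq> 2"
      using minimal_connected[OF T, of "{i, j}"] by auto
    then show False using i'(4) j'(4) ii jj by auto
  qed
  then show ?thesis using j' jj by simp
qed

lemma entry_c:
  assumes T: "minimal T" and ij: "i \<in> T" "j \<in> T"
  defines "L \<equiv> pendants T"
  shows "hgt L i * hgt L j * c i j = of_int (entry L i j)"
proof (cases "i = j")
  case True
  then show ?thesis using c_refl[of i] T ij by (auto simp: hgt_def entry_def minimal_def)
next
  case ne: False
  have TI: "T \<subseteq> I" using T by (auto simp: minimal_def)
  have I: "i \<in> I" "j \<in> I" using TI ij by auto
  have sy: "m j i = m i j" using m_sym I by auto
  from minimal_labels[OF T ij ne] consider "m i j = 2" | "m i j = 3" | "m i j = 4" by auto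
  then show ?thesis
  proof cases
    case 1
    then show ?thesis using c_label(1)[OF I ne] ne by (simp add: entry_def)
  next
    case 2
    then have "i \<notin> L" "j \<notin> L"
      using pendant_other[OF T, of i j] pendant_other[OF T, of j i] ij ne sy by (auto simp: L_def)
    then show ?thesis using c_label(2)[OF I ne 2] ne 2 by (simp add: entry_def hgt_def)
  next
    case 3
    have "i \<in> L \<or> j \<in> L"
      using four_edge_pendant[OF T ij ne 3] ij ne 3 sy by (auto simp: L_def pendants_def insert_commute)
    then have "hgt L i * hgt L j = sqrt 2"
      using pendant_other[OF T, of i j] pendant_other[OF T, of j i] ij ne 3 sy by (auto simp: L_def hgt_def)
    then show ?thesis using c_label(3)[OF I ne 3] ne 3 by (simp add: entry_def)
  qed
qed

text \<open>Two edges labelled 4 share no vertex, so the pendants inject into the other vertices,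
  and fewer than three of the latter would force the affine path 4-3-4. Three is the number that the
  final estimate of \<open>minimal_no_integer_vector\<close> requires.\<close>

lemma nonpendants_card:
  assumes T: "minimal T"
  shows "card (T - pendants T) \<ge> 3"
proof (rule ccontr)
  define L where "L = pendants T"
  define R where "R = T - L"
  assume "\<not> ?thesis"
  then have R2: "card R \<le> 2" by (simp add: R_def L_def)
  have TI: "T \<subseteq> I" and fT: "finite T" using T fin finite_subset by (auto simp: minimal_def)
  have LT: "L \<subseteq> T" by (auto simp: L_def pendants_def)
  have "\<forall>i\<in>L. \<exists>j. j \<in> R \<and> i \<noteq> j \<and> m i j = 4 \<and> (\<forall>k\<in>T - {i, j}. m i k = 2)"
  proof
    fix i assume i: "i \<in> L"
    then obtain j where j: "j \<in> T" "i \<noteq> j" "m i j = 4" "\<forall>k\<in>T - {i, j}. m i k = 2"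
      by (auto simp: L_def pendants_def)
    then have "j \<notin> L" using pendant_other[OF T, of i j] i by (simp add: L_def)
    then show "\<exists>j. j \<in> R \<and> i \<noteq> j \<and> m i j = 4 \<and> (\<forall>k\<in>T - {i, j}. m i k = 2)"
      using j by (auto simp: R_def)
  qed
  from bchoice[OF this] obtain f where
    f0: "\<forall>i\<in>L. f i \<in> R \<and> i \<noteq> f i \<and> m i (f i) = 4 \<and> (\<forall>k\<in>T - {i, f i}. m i k = 2)" ..
  then have f: "\<And>i. i \<in> L \<Longrightarrow> f i \<in> R" "\<And>i. i \<in> L \<Longrightarrow> i \<noteq> f i" "\<And>i. i \<in> L \<Longrightarrow> m i (f i) = 4"
    "\<And>i k. i \<in> L \<Longrightarrow> k \<in> T \<Longrightarrow> k \<noteq> i \<Longrightarrow> k \<noteq> f i \<Longrightarrow> m i k = 2" by auto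
  have fTI: "f i \<in> T" "f i \<in> I" if "i \<in> L" for i using f(1)[OF that] TI by (auto simp: R_def)
  have inj: "inj_on f L"
  proof (rule inj_onI, rule ccontr)
    fix i i' assume h: "i \<in> L" "i' \<in> L" "f i = f i'" "i \<noteq> i'"
    have I: "i \<in> I" "i' \<in> I" using h LT TI by auto
    have "m (f i) i' = 4" using f(3)[OF h(2)] h(3) m_sym[of i' "f i"] I fTI[OF h(1)] by simp
    then show False
      using tri(2)[of i "f i" i'] f(2,3)[OF h(1)] f(2)[OF h(2)] h I fTI[OF h(1)] by auto
  qed
  have fR: "finite R" using fT by (simp add: R_def)
  have "card L \<le> card R" using card_inj_on_le[OF inj _ fR] f(1) by blast
  moreover have "card T = card L + card R"
    using card_Diff_subset[OF finite_subset[OF LT fT] LT] card_mono[OF fT LT] by (simp add: R_def)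
  ultimately have cL: "card L = 2" "card R = 2" using minimal_card[OF T] R2 by auto
  then obtain a b where ab: "L = {a, b}" "a \<noteq> b" by (auto simp: card_2_iff)
  have L: "a \<in> L" "b \<in> L" using ab by auto
  have fab: "f a \<noteq> f b" using inj ab by (auto simp: inj_on_def)
  have Rf: "R = {f a, f b}"
    by (rule card_subset_eq[OF fR, symmetric]) (use f(1)[OF L(1)] f(1)[OF L(2)] fab cL(2) in auto)
  have notL: "f a \<notin> L" "f b \<notin> L" using f(1) L by (auto simp: R_def)
  have Te: "T = {a, b, f a, f b}" using Rf ab LT by (auto simp: R_def)
  have ne: "a \<noteq> f a" "a \<noteq> f b" "b \<noteq> f a" "b \<noteq> f b" using notL L by auto
  have I: "a \<in> I" "b \<in> I" "f a \<in> I" "f b \<in> I" using Te TI by auto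
  have z: "m a b = 2" "m a (f b) = 2" "m b (f a) = 2"
    using f(4)[OF L(1)] f(4)[OF L(2)] Te ne ab fab by auto
  have sy: "m (f a) b = 2" "m (f b) b = 4" using z f(3)[OF L(2)] m_sym I by auto
  have "{a, f a} \<subset> T" using Te ne ab fab by auto
  then obtain k l where kl: "k \<in> {a, f a}" "l \<in> T - {a, f a}" "m k l \<noteq> 2"
    using minimal_connected[OF T, of "{a, f a}"] by auto
  then have ff: "m (f a) (f b) \<noteq> 2" using Te z sy by auto
  then have "m (f a) (f b) = 3" using tri(2)[of a "f a" "f b"] f(3)[OF L(1)] ne fab I by auto
  then show False
    using no_C3[of a "f a" "f b" b] f(3)[OF L(1)] sy z ne ab(2) fab I by auto
qed

text \<open>Choose y with least coordinate sum; all its coordinates are positive by minimality of T.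
  Lowering one of them by 1 makes the form positive, hence at least 2 by evenness, which bounds the
  sums \<open>Ay i\<close> from above. If \<open>F y = 0\<close>, all \<open>Ay i\<close> vanish and
  y yields an affine null vector. If \<open>F y < 0\<close>, each of at least three vertices outside
  the pendants contributes at most \<open>F y\<close> to \<open>2 * F y\<close>, so that
  \<open>2 * F y <= 3 * F y\<close>.\<close>

lemma minimal_no_integer_vector:
  fixes y :: "nat \<Rightarrow> nat"
  assumes T: "minimal T" and y: "\<exists>i\<in>T. y i \<noteq> 0"
    "(\<Sum>i\<in>T. \<Sum>j\<in>T. int (y i) * int (y j) * entry (pendants T) i j) \<le> 0"
  shows False
proof -
  define L where "L = pendants T"
  define F where "F = (\<lambda>y :: nat \<Rightarrow> nat. \<Sum>i\<in>T. \<Sum>j\<in>T. int (y i) * int (y j) * entry L i j)"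
  have TI: "T \<subseteq> I" and fT: "finite T" using T fin finite_subset by (auto simp: minimal_def)
  define P where "P = (\<lambda>y :: nat \<Rightarrow> nat. (\<exists>i\<in>T. y i \<noteq> 0) \<and> F y \<le> 0)"
  have "P y" using y by (simp add: P_def F_def L_def)
  then obtain y where y: "P y" "\<And>y'. P y' \<Longrightarrow> sum y T \<le> sum y' T"
    using ex_has_least_nat[of P y "\<lambda>y. sum y T"] by blast
  have sym: "entry L i j = entry L j i" if "i \<in> T" "j \<in> T" for i j
  proof -
    have "m i j = m j i" using that TI m_sym by auto
    then show ?thesis by (simp add: entry_def)
  qed
  have qf: "QF T (\<lambda>i. real (y i) * hgt L i) = of_int (F y)"
    unfolding QF_def F_def of_int_sum
  proof (intro sum.cong refl)
    fix i j assume ij: "i \<in> T" "j \<in> T"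
    have "real (y i) * hgt L i * (real (y j) * hgt L j) * c i j = real (y i) * real (y j) * (hgt L i * hgt L j * c i j)"
      by (simp only: mult_ac)
    then show "real (y i) * hgt L i * (real (y j) * hgt L j) * c i j = of_int (int (y i) * int (y j) * entry L i j)"
      unfolding L_def entry_c[OF T ij] by simp
  qed
  have hp: "hgt L i > 0" for i by (simp add: hgt_def)
  have full: "y i \<ge> 1" if i: "i \<in> T" for i
  proof (rule ccontr)
    assume "\<not> y i \<ge> 1"
    define U where "U = {i \<in> T. y i \<noteq> 0}"
    have "i \<notin> U" "U \<subseteq> T" using \<open>\<not> y i \<ge> 1\<close> by (auto simp: U_def)
    then have "U \<subset> T" using i by blast
    moreover have "\<exists>i\<in>U. real (y i) * hgt L i \<noteq> 0"
    proof -
      obtain j where "j \<in> T" "y j \<noteq> 0" using y(1) by (auto simp: P_def)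
      then show ?thesis using hp[of j] by (intro bexI[of _ j]) (auto simp: U_def)
    qed
    moreover have "\<forall>U x. U \<subset> T \<longrightarrow> (\<exists>i\<in>U. x i \<noteq> 0) \<longrightarrow> QF U x > 0"
      using T by (simp add: minimal_def)
    ultimately have "QF U (\<lambda>i. real (y i) * hgt L i) > 0"
      by simp
    moreover have "QF T (\<lambda>i. real (y i) * hgt L i) = QF U (\<lambda>i. real (y i) * hgt L i)"
      using fT by (intro QF_support) (auto simp: U_def)
    ultimately show False using qf y(1) by (simp add: P_def)
  qed
  define Ay where "Ay = (\<lambda>i. \<Sum>j\<in>T. int (y j) * entry L i j)"
  have evF: "even (F z)" for z
    unfolding F_def
  proof (rule even_symmetric_sum[OF fT])
    fix i j assume ij: "i \<in> T" "j \<in> T"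
    show "int (z i) * int (z j) * entry L i j = int (z j) * int (z i) * entry L j i"
      using sym[OF ij] by simp
  qed (simp add: entry_def)
  have step: "2 * Ay i \<le> F y + entry L i i - 2" if i: "i \<in> T" for i
  proof -
    define z where "z = y(i := y i - 1)"
    have zi: "(\<lambda>j. int (z j)) = (\<lambda>j. int (y j))(i := int (y i) + (-1))"
      using full[OF i] by (auto simp: z_def fun_eq_iff)
    have "F z = (\<Sum>k\<in>T. \<Sum>j\<in>T. ((\<lambda>j. int (y j))(i := int (y i) + (-1))) k
        * ((\<lambda>j. int (y j))(i := int (y i) + (-1))) j * entry L k j)"
      unfolding F_def zi[symmetric] by simp
    also have "\<dots> = F y - 2 * Ay i + entry L i i"
      using quad_form_upd[OF fT i, of "entry L" "\<lambda>j. int (y j)" "-1"] sym by (simp add: F_def Ay_def)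
    finally have Fz: "F z = F y - 2 * Ay i + entry L i i" .
    have "sum z T < sum y T"
      using full[OF i] i fT by (intro sum_strict_mono_ex1) (auto simp: z_def intro!: bexI[of _ i])
    then have "\<not> P z" using y(2) by fastforce
    moreover have "\<exists>j\<in>T. z j \<noteq> 0"
    proof -
      have "card (T - {i}) \<noteq> 0" using minimal_card[OF T] i fT by simp
      then obtain j where j: "j \<in> T" "j \<noteq> i" by (metis DiffE card.empty equals0I insertI1)
      then show ?thesis using full[OF j(1)] by (auto simp: z_def intro!: bexI[of _ j])
    qed
    ultimately have "F z > 0" unfolding P_def by (meson not_le)
    moreover have "even (F z)" by (rule evF)
    ultimately have "F z \<ge> 2" by presburger
    then show ?thesis using Fz by simp
  qed
  have evA: "even (Ay i)" if i: "i \<in> T" "i \<in> L" for i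
  proof -
    have "even (entry L i j)" if j: "j \<in> T" for j
    proof -
      have "i \<noteq> j \<Longrightarrow> m i j \<noteq> 3" using pendant_other[OF T, of i j] i j by (auto simp: L_def)
      then show ?thesis using i by (auto simp: entry_def)
    qed
    then show ?thesis unfolding Ay_def by (intro dvd_sum) auto
  qed
  have FA: "F y = (\<Sum>i\<in>T. int (y i) * Ay i)"
    by (simp add: F_def Ay_def sum_distrib_left mult.assoc)
  have F0: "F y \<le> 0" using y(1) by (simp add: P_def)
  \<comment> \<open>At a pendant vertex \<open>step\<close> gives only \<open>Ay i <= 1\<close>;
    evenness improves this to 0.\<close>
  have nonpos: "Ay i \<le> 0" if i: "i \<in> T" for i
  proof (cases "i \<in> L")
    case True
    then have "2 * Ay i \<le> 2" "even (Ay i)" using step[OF i] F0 evA[OF i] by (simp_all add: entry_def)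
    then show ?thesis by presburger
  next
    case False
    then show ?thesis using step[OF i] F0 by (simp add: entry_def)
  qed
  show False
  proof (cases "F y = 0")
    case True
    have "\<forall>i\<in>T. int (y i) * Ay i = 0"
    proof -
      have "(\<Sum>i\<in>T. - (int (y i) * Ay i)) = 0" using True FA by (simp add: sum_negf)
      moreover have "- (int (y i) * Ay i) \<ge> 0" if "i \<in> T" for i
        using nonpos[OF that] by (simp add: mult_nonneg_nonpos)
      ultimately have "\<forall>i\<in>T. - (int (y i) * Ay i) = 0"
        using sum_nonneg_eq_0_iff[OF fT, of "\<lambda>i. - (int (y i) * Ay i)"] by blast
      then show ?thesis by simp
    qed
    then have A0: "Ay i = 0" if "i \<in> T" for i
    proof -
      have "int (y i) * Ay i = 0" "y i \<noteq> 0" using \<open>\<forall>i\<in>T. int (y i) * Ay i = 0\<close> that full[OF that] by auto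
      then show ?thesis by simp
    qed
    show False
    proof (rule no_affine[OF TI, of "\<lambda>i. real (y i) * hgt L i"])
      show "T \<noteq> {}" using T by (simp add: minimal_def)
      show "\<forall>i\<in>T. 0 < real (y i) * hgt L i" using full hp by (simp add: Suc_le_eq)
      show "\<forall>i\<in>T. (\<Sum>j\<in>T. real (y j) * hgt L j * c i j) = 0"
      proof
        fix i assume i: "i \<in> T"
        have "hgt L i * (\<Sum>j\<in>T. real (y j) * hgt L j * c i j) = (\<Sum>j\<in>T. real (y j) * of_int (entry L i j))"
          unfolding sum_distrib_left
        proof (intro sum.cong refl)
          fix j assume j: "j \<in> T"
          have "hgt L i * (real (y j) * hgt L j * c i j) = real (y j) * (hgt L i * hgt L j * c i j)"
            by (simp only: mult_ac)
          then show "hgt L i * (real (y j) * hgt L j * c i j) = real (y j) * of_int (entry L i j)"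
            unfolding L_def entry_c[OF T i j] .
        qed
        also have "\<dots> = of_int (Ay i)" by (simp add: Ay_def)
        finally show "(\<Sum>j\<in>T. real (y j) * hgt L j * c i j) = 0" using A0[OF i] hp[of i] by simp
      qed
    qed
  next
    case False
    then have "F y < 0" "even (F y)" using F0 evF by auto
    define R where "R = T - L"
    have "2 * F y = (\<Sum>i\<in>T. int (y i) * (2 * Ay i))"
      unfolding FA by (simp add: sum_distrib_left mult_ac)
    also have "\<dots> \<le> (\<Sum>i\<in>T. if i \<in> R then F y else 0)"
    proof (rule sum_mono)
      fix i assume i: "i \<in> T"
      show "int (y i) * (2 * Ay i) \<le> (if i \<in> R then F y else 0)"
      proof (cases "i \<in> R")
        case True
        then have "2 * Ay i \<le> F y" using step[OF i] by (simp add: R_def entry_def)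
        moreover have "int (y i) * (2 * Ay i) \<le> 1 * (2 * Ay i)"
          using full[OF i] nonpos[OF i] by (intro mult_right_mono_neg) auto
        ultimately show ?thesis using True by simp
      next
        case False
        then show ?thesis using nonpos[OF i] by (simp add: mult_nonneg_nonpos)
      qed
    qed
    also have "\<dots> = int (card R) * F y"
      using fT by (simp add: sum.If_cases R_def Int_Diff Int_absorb1 Int_def conj_commute set_diff_eq)
    also have "\<dots> \<le> 3 * F y"
      using nonpendants_card[OF T] \<open>F y < 0\<close> by (intro mult_right_mono_neg) (auto simp: R_def L_def)
    finally show False using \<open>F y < 0\<close> by simp
  qed
qed

text \<open>If the form is nonnegative on nonnegative vectors and vanishes at the positive vector x,
  then x is a critical point and hence an affine null vector. Otherwise some nonnegative vector has
  a negative value, and a sufficiently fine rational approximation of it, cleared of denominators,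
  is an integer vector with a negative value.\<close>

theorem contradiction: False
proof -
  obtain T where T: "minimal T" using minimal_ex by blast
  define L where "L = pendants T"
  have TI: "T \<subseteq> I" and fT: "finite T" and Tne: "T \<noteq> {}" using T fin finite_subset by (auto simp: minimal_def)
  obtain x where x: "\<forall>i\<in>T. x i > 0" "QF T x \<le> 0" using T by (auto simp: minimal_def)
  have sy: "c i j = c j i" if "i \<in> T" "j \<in> T" for i j using that TI c_sym by auto
  show False
  proof (cases "QF T x = 0 \<and> (\<forall>z. (\<forall>i\<in>T. z i \<ge> 0) \<longrightarrow> QF T z \<ge> 0)")
    case True
    have "(\<Sum>j\<in>T. x j * c i j) = 0" if i: "i \<in> T" for i
    proof (rule ccontr)
      define w where "w = (\<Sum>j\<in>T. x j * c i j)"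
      assume n: "(\<Sum>j\<in>T. x j * c i j) \<noteq> 0"
      have upd: "QF T (x(i := x i + s)) = 2 * s * w + 2 * (s * s)" for s
        using quad_form_upd[OF fT i, of c x s] sy True c_refl[of i] i TI by (simp add: QF_def w_def mult_ac subset_iff)
      show False
      proof (cases "w > 0")
        case True
        \<comment> \<open>Lowering coordinate i by at most \<open>x i\<close> keeps it nonnegative,
          and by at most w / 2 keeps the linear term dominant.\<close>
        define s where "s = - min (x i) (w / 2)"
        have s: "s < 0" "- s \<le> x i" "- s \<le> w / 2" using True x i by (auto simp: s_def)
        have "\<forall>j\<in>T. (x(i := x i + s)) j \<ge> 0" using s x by (auto simp: less_imp_le)
        then have "2 * s * w + 2 * (s * s) \<ge> 0" using upd \<open>QF T x = 0 \<and> _\<close> by metis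
        then have "s * (w + s) \<ge> 0" by (simp add: algebra_simps)
        then show False using s True by (simp add: zero_le_mult_iff)
      next
        case False
        then have w: "w < 0" using n by (simp add: w_def)
        define s where "s = - w / 2"
        have s: "s > 0" "w + s < 0" using w by (auto simp: s_def)
        have "x i > 0" using x i by simp
        then have "\<forall>j\<in>T. (x(i := x i + s)) j \<ge> 0" using s x by (auto simp: less_imp_le)
        then have "2 * s * w + 2 * (s * s) \<ge> 0" using upd True by metis
        then have "s * (w + s) \<ge> 0" by (simp add: algebra_simps)
        then show False using s by (simp add: zero_le_mult_iff)
      qed
    qed
    then show False using no_affine[OF TI Tne x(1)] by blast
  next
    case False
    then obtain z where z: "\<forall>i\<in>T. z i \<ge> 0" "QF T z < 0"
      using x by (metis linorder_not_le order_le_less)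
    define u where "u = (\<lambda>i. z i / hgt L i)"
    have u: "u i \<ge> 0" if "i \<in> T" for i using z that by (simp add: u_def hgt_def)
    have "(\<Sum>i\<in>T. \<Sum>j\<in>T. u i * u j * of_int (entry L i j)) = QF T z"
      unfolding QF_def
    proof (intro sum.cong refl)
      fix i j assume ij: "i \<in> T" "j \<in> T"
      have "hgt L i \<noteq> 0" "hgt L j \<noteq> 0" by (simp_all add: hgt_def)
      then have "u i * u j * (hgt L i * hgt L j * c i j) = z i * z j * c i j"
        by (simp add: u_def)
      then show "u i * u j * of_int (entry L i j) = z i * z j * c i j"
        unfolding L_def entry_c[OF T ij] .
    qed
    moreover have "(\<lambda>n. \<Sum>i\<in>T. \<Sum>j\<in>T. (real (nat \<lfloor>real n * u i\<rfloor>) / real n) * (real (nat \<lfloor>real n * u j\<rfloor>) / real n)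
        * of_int (entry L i j)) \<longlonglongrightarrow> (\<Sum>i\<in>T. \<Sum>j\<in>T. u i * u j * of_int (entry L i j))"
      using u by (intro tendsto_intros floor_scaled_tendsto)
    ultimately have "\<forall>\<^sub>F n in sequentially. (\<Sum>i\<in>T. \<Sum>j\<in>T. (real (nat \<lfloor>real n * u i\<rfloor>) / real n)
        * (real (nat \<lfloor>real n * u j\<rfloor>) / real n) * of_int (entry L i j)) < 0"
      using z(2) by (intro order_tendstoD(2)) auto
    then obtain n where n: "(\<Sum>i\<in>T. \<Sum>j\<in>T. (real (nat \<lfloor>real n * u i\<rfloor>) / real n)
        * (real (nat \<lfloor>real n * u j\<rfloor>) / real n) * of_int (entry L i j)) < 0"
      by (auto simp: eventually_sequentially)
    define y where "y = (\<lambda>i. nat \<lfloor>real n * u i\<rfloor>)"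
    define F where "F = (\<Sum>i\<in>T. \<Sum>j\<in>T. int (y i) * int (y j) * entry L i j)"
    have "(\<Sum>i\<in>T. \<Sum>j\<in>T. (real (y i) / real n) * (real (y j) / real n) * of_int (entry L i j)) =
      of_int F / (real n * real n)"
      by (simp add: F_def sum_divide_distrib)
    then have "of_int F / (real n * real n) < 0" using n by (simp add: y_def)
    then have F: "F < 0" by (simp add: divide_less_0_iff)
    have "\<exists>i\<in>T. y i \<noteq> 0"
    proof (rule ccontr)
      assume "\<not> ?thesis"
      then have "F = 0" by (simp add: F_def)
      then show False using F by simp
    qed
    then show False using minimal_no_integer_vector[OF T, of y] F by (simp add: F_def L_def)
  qed
qed

end

section \<open>A Salem number\<close>

definition rpoly :: "rat poly \<Rightarrow> 'a::field_char_0 \<Rightarrow> 'a" where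
  "rpoly p x = poly (map_poly of_rat p) x"

lemma rpoly_0 [simp]: "rpoly 0 x = 0"
  by (simp add: rpoly_def)

lemma rpoly_pCons [simp]: "rpoly (pCons a p) x = of_rat a + x * rpoly p x"
  by (simp add: rpoly_def map_poly_pCons)

lemma rpoly_add [simp]: "rpoly (p + q) x = rpoly p x + rpoly q x"
  by (induction p q rule: poly_induct2) (simp_all add: of_rat_add algebra_simps)

lemma rpoly_smult [simp]: "rpoly (smult a p) x = of_rat a * rpoly p x"
  by (induction p) (simp_all add: of_rat_mult algebra_simps)

lemma rpoly_mult [simp]: "rpoly (p * q) x = rpoly p x * rpoly q x"
  by (induction p) (simp_all add: algebra_simps)

lemma map_poly_of_rat_eq_0: "map_poly of_rat p = (0 :: 'a::field_char_0 poly) \<longleftrightarrow> p = 0"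
  by (intro map_poly_eq_0_iff) auto

lemma minimal_rat_poly:
  fixes x :: "'a::field_char_0"
  assumes "rpoly q x = 0" "q \<noteq> 0"
  obtains p where "irreducible p" "rpoly p x = 0" "\<And>r. rpoly r x = 0 \<Longrightarrow> p dvd r"
proof -
  define P where "P = (\<lambda>p. rpoly p x = 0 \<and> p \<noteq> 0)"
  obtain p where p: "P p" "\<And>r. P r \<Longrightarrow> degree p \<le> degree r"
    using ex_has_least_nat[of P q degree] assms by (auto simp: P_def)
  have dvd: "p dvd r" if r: "rpoly r x = 0" for r
  proof -
    have "rpoly r x = rpoly (r div p) x * rpoly p x + rpoly (r mod p) x"
      by (metis div_mult_mod_eq rpoly_add rpoly_mult)
    then have "rpoly (r mod p) x = 0" using r p(1) by (simp add: P_def)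
    moreover have "r mod p = 0 \<or> degree (r mod p) < degree p"
      using degree_mod_less[of p r] p(1) by (simp add: P_def)
    ultimately have "r mod p = 0" using p(2)[of "r mod p"] unfolding P_def by linarith
    then show ?thesis by (simp add: mod_eq_0_iff_dvd)
  qed
  have "irreducible p"
  proof (rule irreducibleI)
    show "p \<noteq> 0" using p(1) by (simp add: P_def)
    show "\<not> is_unit p"
    proof
      assume "is_unit p"
      then obtain a where "p = [:a:]" "a \<noteq> 0"
        using \<open>p \<noteq> 0\<close> by (metis is_unit_iff_degree degree_eq_zeroE pCons_eq_0_iff)
      then show False using p(1) by (simp add: P_def)
    qed
    fix a b assume ab: "p = a * b"
    then have ne: "a \<noteq> 0" "b \<noteq> 0" using \<open>p \<noteq> 0\<close> by auto
    then have d: "degree p = degree a + degree b" using ab by (simp add: degree_mult_eq)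
    have "rpoly a x = 0 \<or> rpoly b x = 0" using p(1) ab by (simp add: P_def)
    then have "degree p \<le> degree a \<or> degree p \<le> degree b" using p(2) ne by (auto simp: P_def)
    then show "a dvd 1 \<or> b dvd 1" using d ne is_unit_iff_degree by auto
  qed
  then show ?thesis using that p(1) dvd by (auto simp: P_def)
qed

lemma irreducible_root_dvd:
  fixes x :: "'a::field_char_0"
  assumes "irreducible p" "rpoly p x = 0" "rpoly r x = 0"
  shows "p dvd r"
proof -
  have "p \<noteq> 0" using assms by auto
  obtain p0 where p0: "irreducible p0" "\<And>r. rpoly r x = 0 \<Longrightarrow> p0 dvd r"
    using minimal_rat_poly[OF assms(2) \<open>p \<noteq> 0\<close>] by metis
  obtain k where k: "p = p0 * k" using p0(2)[OF assms(2)] by (auto simp: dvd_def)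
  have "is_unit k"
    using assms(1) p0(1) k by (metis irreducibleD irreducible_not_unit)
  then have "p dvd p0" using k by (simp add: mult_unit_dvd_iff)
  then show ?thesis using p0(2)[OF assms(3)] by (rule dvd_trans)
qed

lemma map_poly_pderiv_of_rat: "pderiv (map_poly of_rat p) = (map_poly of_rat (pderiv p) :: 'a::field_char_0 poly)"
  by (rule poly_eqI) (simp add: coeff_pderiv coeff_map_poly of_rat_mult of_rat_add)

text \<open>A multiple root would make p divide its derivative, which in characteristic zero is
  nonzero and of smaller degree.\<close>

lemma irreducible_card_roots:
  assumes "irreducible (p :: rat poly)"
  shows "card {z :: complex. rpoly p z = 0} = degree p"
proof -
  define q where "q = (map_poly of_rat p :: complex poly)"
  have p0: "p \<noteq> 0" using assms by auto
  have q0: "q \<noteq> 0" using p0 by (simp add: q_def map_poly_of_rat_eq_0)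
  have dq: "degree q = degree p" unfolding q_def by (intro degree_map_poly) auto
  have dp: "degree p > 0"
    using assms p0 is_unit_iff_degree[OF p0] irreducible_not_unit by blast
  have "rsquarefree q"
    unfolding rsquarefree_roots
  proof (intro allI notI, elim conjE)
    fix a assume a: "poly q a = 0" "poly (pderiv q) a = 0"
    then have "p dvd pderiv p"
      using irreducible_root_dvd[OF assms, of a "pderiv p"] by (simp add: rpoly_def q_def map_poly_pderiv_of_rat)
    moreover have "pderiv p \<noteq> 0" using dp by (simp add: pderiv_eq_0_iff)
    ultimately have "degree p \<le> degree (pderiv p)" by (rule dvd_imp_degree_le)
    then show False using dp by (simp add: degree_pderiv)
  qed
  from complex_poly_decompose_rsquarefree[OF this]
  have "degree q = degree (smult (lead_coeff q) (\<Prod>z|poly q z = 0. [:-z, 1:]))" by simp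
  also have "\<dots> = card {z. poly q z = 0}"
    using q0 by (simp add: degree_prod_sum_eq)
  finally show ?thesis using dq by (simp add: q_def rpoly_def)
qed

text \<open>The d sign changes already account for d real roots, which leaves no room for further
  complex ones.\<close>

lemma real_roots_sign_changes:
  fixes p :: "real poly" and x :: "nat \<Rightarrow> real"
  assumes p0: "p \<noteq> 0" and d: "degree p = d"
    and x: "\<And>i. i < d \<Longrightarrow> x i < x (Suc i) \<and> poly p (x i) * poly p (x (Suc i)) < 0"
  shows "\<exists>r. (\<forall>i<d. x i < r i \<and> r i < x (Suc i) \<and> poly p (r i) = 0) \<and>
    (\<forall>w :: complex. poly (map_poly of_real p) w = 0 \<longrightarrow> (\<exists>i<d. w = of_real (r i)))"
proof -
  have "\<forall>i. \<exists>r. i < d \<longrightarrow> x i < r \<and> r < x (Suc i) \<and> poly p r = 0"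
    using x poly_IVT[of "x i" "x (Suc i)" p for i] by blast
  then obtain r where r: "\<And>i. i < d \<Longrightarrow> x i < r i" "\<And>i. i < d \<Longrightarrow> r i < x (Suc i)" "\<And>i. i < d \<Longrightarrow> poly p (r i) = 0"
    by metis
  have xm: "x i \<le> x j" if "i \<le> j" "j \<le> d" for i j
    using that
  proof (induction j rule: dec_induct)
    case (step k)
    then show ?case using x[of k] by auto
  qed simp
  have rm: "r i < r j" if "i < j" "j < d" for i j
    using r(2)[of i] r(1)[of j] xm[of "Suc i" j] that by linarith
  have inj: "inj_on (\<lambda>i. complex_of_real (r i)) {..<d}"
    by (rule inj_onI) (metis lessThan_iff nat_neq_iff of_real_eq_iff order_less_irrefl rm)
  define q where "q = (map_poly of_real p :: complex poly)"
  have q0: "q \<noteq> 0" using p0 unfolding q_def by (subst map_poly_eq_0_iff) auto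
  have dq: "degree q = d" unfolding q_def d[symmetric] by (intro degree_map_poly) auto
  have pq: "poly q (of_real y) = of_real (poly p y)" for y
    unfolding q_def by (induction p) (simp_all add: map_poly_pCons)
  have sub: "(\<lambda>i. complex_of_real (r i)) ` {..<d} \<subseteq> {z. poly q z = 0}"
    using r(3) pq by auto
  have "card {z. poly q z = 0} \<le> card ((\<lambda>i. complex_of_real (r i)) ` {..<d})"
    using card_poly_roots_bound[OF q0] dq inj by (simp add: card_image)
  then have "(\<lambda>i. complex_of_real (r i)) ` {..<d} = {z. poly q z = 0}"
    using card_seteq[OF poly_roots_finite[OF q0] sub] by simp
  then have "\<exists>i<d. w = of_real (r i)" if "poly (map_poly of_real p) w = 0" for w :: complex
    using that unfolding q_def by blast
  then show ?thesis using r by (intro exI[of _ r]) blast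
qed

text \<open>The imaginary part of z + 1/z is Im z times 1 - 1/|z|^2, so z is real or of modulus one,
  and r decides between the two.\<close>

lemma joukowsky:
  fixes z :: complex
  assumes "z \<noteq> 0" "z + 1 / z = of_real r"
  shows "\<bar>r\<bar> < 2 \<Longrightarrow> norm z = 1" "r > 2 \<Longrightarrow> \<exists>x. z = of_real x \<and> x > 0 \<and> x + 1 / x = r"
proof -
  define n where "n = (Re z)\<^sup>2 + (Im z)\<^sup>2"
  have n: "n > 0" using assms(1) by (simp add: n_def complex_neq_0)
  have z1: "1 / z = Complex (Re z / n) (- Im z / n)"
    by (simp add: complex_eq_iff Re_divide Im_divide n_def)
  have "Im z + - Im z / n = 0" "Re z + Re z / n = r"
    using arg_cong[OF assms(2), of Im] arg_cong[OF assms(2), of Re] unfolding z1 by simp_all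
  then have "Im z * (n - 1) = 0" and r: "Re z * (n + 1) = r * n"
    using n by (simp_all add: field_simps)
  then consider "Im z = 0" | "n = 1" by auto
  then have "(\<bar>r\<bar> < 2 \<longrightarrow> norm z = 1) \<and> (r > 2 \<longrightarrow> (\<exists>x. z = of_real x \<and> x > 0 \<and> x + 1 / x = r))"
  proof cases
    case 1
    define x where "x = Re z"
    have zx: "z = of_real x" using 1 by (simp add: x_def complex_eq_iff)
    have x0: "x \<noteq> 0" using assms(1) zx by auto
    have "of_real (x + 1 / x) = complex_of_real r" using assms(2) zx by simp
    then have xr: "x + 1 / x = r" using of_real_eq_iff by blast
    have sq: "x * x + 1 = r * x" using xr x0 by (simp add: field_simps)
    have "\<bar>r\<bar> \<ge> 2"
    proof (rule ccontr)
      assume "\<not> \<bar>r\<bar> \<ge> 2"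
      then have "r * r < 4" using abs_square_less_1[of "r / 2"] by (simp add: power2_eq_square)
      moreover have "(2 * x - r) * (2 * x - r) \<ge> 0" by simp
      ultimately show False using sq by (simp add: algebra_simps)
    qed
    moreover have "x > 0" if "r > 2"
    proof (rule ccontr)
      assume "\<not> x > 0"
      then have "r * x \<le> 0" using that by (simp add: mult_nonneg_nonpos)
      moreover have "x * x \<ge> 0" by simp
      ultimately show False using sq by linarith
    qed
    ultimately show ?thesis using zx xr by auto
  next
    case 2
    have "(norm z)\<^sup>2 = 1" using 2 by (simp add: cmod_power2 n_def)
    then have nz: "norm z = 1" by (simp add: power2_eq_1_iff) (metis norm_ge_zero neg_0_le_iff_le not_one_le_zero)
    have "\<bar>Re z\<bar> \<le> 1" using abs_Re_le_cmod[of z] nz by simp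
    then have "\<not> r > 2" using r 2 by auto
    then show ?thesis using nz by simp
  qed
  then show "\<bar>r\<bar> < 2 \<Longrightarrow> norm z = 1" "r > 2 \<Longrightarrow> \<exists>x. z = of_real x \<and> x > 0 \<and> x + 1 / x = r" by auto
qed

text \<open>The polynomial in y = z + 1/z that represents z^k + 1/z^k.\<close>

fun trc :: "'a::comm_ring_1 \<Rightarrow> nat \<Rightarrow> 'a" where
  "trc y 0 = 2"
| "trc y (Suc 0) = y"
| "trc y (Suc (Suc k)) = y * trc y (Suc k) - trc y k"

lemma trc: "z \<noteq> 0 \<Longrightarrow> trc (z + 1 / z) k = z ^ k + 1 / z ^ k" for z :: "'a::field"
  by (induction "z + 1 / z" k rule: trc.induct) (simp_all add: field_simps)

lemma mult_trc: "z \<noteq> 0 \<Longrightarrow> k \<le> n \<Longrightarrow> z ^ n * trc (z + 1 / z) k = z ^ (n + k) + z ^ (n - k)" for z :: "'a::field"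
  by (simp add: trc algebra_simps power_add power_diff)

text \<open>Its root above 1 is 1.18836..., the second smallest Salem number known.\<close>

definition salem_poly :: "'a::field \<Rightarrow> 'a" where
  "salem_poly x = x^18 - x^17 + x^16 - x^15 - x^12 + x^11 - x^10 + x^9 - x^8 + x^7 - x^6 - x^3 + x^2 - x + 1"

definition salem_rat :: "rat poly" where
  "salem_rat = [:1,-1,1,-1,0,0,-1,1,-1,1,-1,1,-1,0,0,-1,1,-1,1:]"

text \<open>
  The self-reciprocal polynomials below are \<open>z^d * q (z + 1/z)\<close> for a polynomial \<open>q\<close> of degree \<open>d\<close> all of
  whose roots are isolated by sign changes; roots of \<open>q\<close> in the interval from \<open>-2\<close> to \<open>2\<close> correspond to zeros on
  the unit circle.
\<close>

definition salem_trace :: "real poly" where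
  "salem_trace = [:-1,4,8,-17,-14,20,7,-8,-1,1:]"

definition lehmer_poly :: "'a::field \<Rightarrow> 'a" where
  "lehmer_poly x = x^10 + x^9 - x^7 - x^6 - x^5 - x^4 - x^3 + x + 1"

definition lehmer_trace :: "real poly" where
  "lehmer_trace = [:3,4,-5,-5,1,1:]"

lemma rpoly_salem: "rpoly salem_rat x = salem_poly x"
  by (simp add: salem_rat_def salem_poly_def algebra_simps eval_nat_numeral)

lemma salem_poly_trace:
  fixes z :: complex
  assumes "z \<noteq> 0"
  shows "salem_poly z = z ^ 9 * poly (map_poly of_real salem_trace) (z + 1 / z)"
proof -
  define y where "y = z + 1 / z"
  have "poly (map_poly of_real salem_trace) y =
    trc y 9 - trc y 8 + trc y 7 - trc y 6 - trc y 3 + trc y 2 - trc y 1 + 1"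
    by (simp add: salem_trace_def map_poly_pCons eval_nat_numeral algebra_simps)
  then have "z ^ 9 * poly (map_poly of_real salem_trace) y =
    z ^ 9 * trc y 9 - z ^ 9 * trc y 8 + z ^ 9 * trc y 7 - z ^ 9 * trc y 6 - z ^ 9 * trc y 3 + z ^ 9 * trc y 2
      - z ^ 9 * trc y 1 + z ^ 9"
    by (simp only: ring_distribs mult_1_right)
  also have "\<dots> = salem_poly z"
    unfolding y_def using assms mult_trc[OF assms, of 1 9] by (simp add: mult_trc salem_poly_def)
  finally show ?thesis by (simp add: y_def)
qed

lemma lehmer_poly_trace:
  fixes z :: complex
  assumes "z \<noteq> 0"
  shows "lehmer_poly z = z ^ 5 * poly (map_poly of_real lehmer_trace) (z + 1 / z)"
proof -
  define y where "y = z + 1 / z"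
  have "poly (map_poly of_real lehmer_trace) y = trc y 5 + trc y 4 - trc y 2 - trc y 1 - 1"
    by (simp add: lehmer_trace_def map_poly_pCons eval_nat_numeral algebra_simps)
  then have "z ^ 5 * poly (map_poly of_real lehmer_trace) y =
    z ^ 5 * trc y 5 + z ^ 5 * trc y 4 - z ^ 5 * trc y 2 - z ^ 5 * trc y 1 - z ^ 5"
    by (simp only: ring_distribs mult_1_right)
  also have "\<dots> = lehmer_poly z"
    unfolding y_def using assms mult_trc[OF assms, of 1 5] by (simp add: mult_trc lehmer_poly_def)
  finally show ?thesis by (simp add: y_def)
qed

lemma salem_trace_roots:
  "\<exists>\<rho>. 2 < \<rho> \<and> \<rho> < 203 / 100 \<and> poly salem_trace \<rho> = 0 \<and>
     (\<forall>w :: complex. poly (map_poly of_real salem_trace) w = 0 \<longrightarrow> w = of_real \<rho> \<or> (\<exists>r. w = of_real r \<and> \<bar>r\<bar> < 2))"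
proof -
  \<comment> \<open>Ten points with alternating signs of the trace polynomial; only the last
    interval lies beyond 2.\<close>
  define x where "x = (!) [-2, -9/5, -6/5, -7/10, 0, 1/2, 1, 3/2, 2, 203 / 100 :: real]"
  have v: "poly salem_trace (-2) < 0" "poly salem_trace (-9/5) > 0" "poly salem_trace (-6/5) < 0" "poly salem_trace (-7/10) > 0" "poly salem_trace (0) < 0" "poly salem_trace (1/2) > 0" "poly salem_trace (1) < 0" "poly salem_trace (3/2) > 0" "poly salem_trace (2) < 0" "poly salem_trace (203 / 100) > 0"
    by (simp_all add: salem_trace_def)
  have ch: "\<forall>i<9. x i < x (Suc i) \<and> poly salem_trace (x i) * poly salem_trace (x (Suc i)) < 0"
  proof (intro allI impI)
    fix i :: nat assume "i < 9"
    then have "i \<in> {0, 1, 2, 3, 4, 5, 6, 7, 8}" by auto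
    then show "x i < x (Suc i) \<and> poly salem_trace (x i) * poly salem_trace (x (Suc i)) < 0"
      using v by (auto simp: x_def mult_less_0_iff)
  qed
  have "salem_trace \<noteq> 0" "degree salem_trace = 9" by (simp_all add: salem_trace_def)
  from real_roots_sign_changes[OF this, of x] ch obtain r where
    r: "\<forall>i<9. x i < r i \<and> r i < x (Suc i) \<and> poly salem_trace (r i) = 0"
    "\<forall>w :: complex. poly (map_poly of_real salem_trace) w = 0 \<longrightarrow> (\<exists>i<9. w = of_real (r i))" by blast
  have small: "\<bar>r i\<bar> < 2" if "i < 8" for i
  proof -
    have "i \<in> {0, 1, 2, 3, 4, 5, 6, 7}" using that by auto
    then show ?thesis using spec[OF r(1), of i] by (auto simp: x_def abs_less_iff)
  qed
  have "2 < r 8" "r 8 < 203 / 100" "poly salem_trace (r 8) = 0"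
    using spec[OF r(1), of 8] by (simp_all add: x_def)
  moreover have "w = of_real (r 8) \<or> (\<exists>r. w = of_real r \<and> \<bar>r\<bar> < 2)"
    if w: "poly (map_poly of_real salem_trace) w = 0" for w :: complex
  proof -
    obtain i where i: "i < 9" "w = of_real (r i)" using r(2) w by blast
    then have "i = 8 \<or> i < 8" by auto
    then show ?thesis using i small by blast
  qed
  ultimately show ?thesis by blast
qed

lemma lehmer_trace_roots:
  "\<exists>\<rho>. 2 < \<rho> \<and> \<rho> < 811 / 400 \<and> poly lehmer_trace \<rho> = 0 \<and>
     (\<forall>w :: complex. poly (map_poly of_real lehmer_trace) w = 0 \<longrightarrow> w = of_real \<rho> \<or> (\<exists>r. w = of_real r \<and> \<bar>r\<bar> < 2))"
proof -
  define x where "x = (!) [-2, -17/10, -1, 0, 2, 811 / 400 :: real]"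
  have ch: "\<forall>i<5. x i < x (Suc i) \<and> poly lehmer_trace (x i) * poly lehmer_trace (x (Suc i)) < 0"
    by (simp add: numeral_eq_Suc All_less_Suc x_def lehmer_trace_def field_simps)
  have "lehmer_trace \<noteq> 0" "degree lehmer_trace = 5" by (simp_all add: lehmer_trace_def)
  from real_roots_sign_changes[OF this, of x] ch obtain r where
    r: "\<forall>i<5. x i < r i \<and> r i < x (Suc i) \<and> poly lehmer_trace (r i) = 0"
    "\<forall>w :: complex. poly (map_poly of_real lehmer_trace) w = 0 \<longrightarrow> (\<exists>i<5. w = of_real (r i))" by blast
  have small: "\<bar>r i\<bar> < 2" if "i < 4" for i
  proof -
    have "i \<in> {0, 1, 2, 3}" using that by auto
    then show ?thesis using spec[OF r(1), of i] by (auto simp: x_def abs_less_iff)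
  qed
  have "2 < r 4" "r 4 < 811 / 400" "poly lehmer_trace (r 4) = 0"
    using spec[OF r(1), of 4] by (simp_all add: x_def)
  moreover have "w = of_real (r 4) \<or> (\<exists>r. w = of_real r \<and> \<bar>r\<bar> < 2)"
    if w: "poly (map_poly of_real lehmer_trace) w = 0" for w :: complex
  proof -
    obtain i where i: "i < 5" "w = of_real (r i)" using r(2) w by blast
    then have "i = 4 \<or> i < 4" by auto
    then show ?thesis using i small by blast
  qed
  ultimately show ?thesis by blast
qed

text \<open>A zero inside the disc would be a real x > 0 with x + 1/x < 811/400. But x + 1/x
  decreases on (0, 1) and at 423/500 still exceeds 811/400.\<close>

lemma lehmer_poly_no_zeros:
  fixes z :: complex
  assumes "norm z \<le> 423 / 500"
  shows "lehmer_poly z \<noteq> 0"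
proof
  assume l: "lehmer_poly z = 0"
  have z0: "z \<noteq> 0" using l by (auto simp: lehmer_poly_def)
  then have "poly (map_poly of_real lehmer_trace) (z + 1 / z) = 0"
    using lehmer_poly_trace[OF z0] l by simp
  then obtain r where
    r: "z + 1 / z = of_real r" "\<bar>r\<bar> < 2 \<or> (2 < r \<and> r < 811 / 400)"
    using lehmer_trace_roots by metis
  from r(2) show False
  proof
    assume "\<bar>r\<bar> < 2"
    then show False using joukowsky(1)[OF z0 r(1)] assms by simp
  next
    assume r2: "2 < r \<and> r < 811 / 400"
    then obtain x where x: "z = of_real x" "x > 0" "x + 1 / x = r" using joukowsky(2)[OF z0 r(1)] by auto
    have "x \<le> 423 / 500" using assms x by simp
    then have "(423 / 500 - x) * (500 / 423 - x) \<ge> 0" by (intro mult_nonneg_nonneg) auto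
    then have "x * x + 1 \<ge> (423 / 500 + 500 / 423) * x" by (simp add: algebra_simps)
    moreover have "x * x + 1 = r * x" using x by (simp add: field_simps)
    ultimately have "(423 / 500 + 500 / 423) * x \<le> r * x" by simp
    then have "423 / 500 + 500 / 423 \<le> r" using x(2) by (rule mult_right_le_imp_le)
    then show False using r2 by simp
  qed
qed

text \<open>The minimal polynomial p of \<alpha> divides \<open>salem_rat\<close>, so its roots are
  among \<alpha>, 1/\<alpha> and points of the unit circle. Were none on the circle, p would have
  degree at most 2, and \<alpha> or \<alpha> + 1/\<alpha> would be a rational algebraic integer,
  hence an integer, strictly between 1 and 2 or between 2 and 3.\<close>

lemma salem_ex: "\<exists>\<alpha>. salem_number \<alpha> \<and> 297 / 250 < \<alpha> \<and> \<alpha> < 119 / 100"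
proof -
  define P where "P = [:1,-1,1,-1,0,0,-1,1,-1,1,-1,1,-1,0,0,-1,1,-1,1 :: real:]"
  have "poly P (297 / 250) < 0" "0 < poly P (119 / 100)" by (simp_all add: P_def)
  then obtain \<alpha> where a: "297 / 250 < \<alpha>" "\<alpha> < 119 / 100" "poly P \<alpha> = 0"
    using poly_IVT_pos[of "297 / 250" "119 / 100" P] by auto
  have coeffs: "\<forall>i. coeff P i \<in> \<int>"
    by (auto simp: P_def coeff_pCons split: nat.splits)
  have alg: "algebraic_int \<alpha>"
    using a(3) coeffs by (intro algebraic_int.intros[of P]) (simp_all add: P_def)
  have Pr: "poly P x = rpoly salem_rat x" for x :: real
    by (simp add: P_def salem_rat_def)
  have of_real_rpoly: "rpoly q (complex_of_real x) = of_real (rpoly q x)" for q x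
  proof -
    have "complex_of_rat a = of_real (of_rat a)" for a
      by (cases a) (simp add: of_rat_rat)
    then show ?thesis by (induction q) simp_all
  qed
  have root: "rpoly salem_rat (complex_of_real \<alpha>) = 0"
    using a(3) Pr of_real_rpoly by simp
  have s0: "salem_rat \<noteq> 0" by (simp add: salem_rat_def)
  obtain \<rho> where \<rho>: "2 < \<rho>" "\<rho> < 203 / 100" "\<And>w :: complex. poly (map_poly of_real salem_trace) w = 0 \<Longrightarrow>
      w = of_real \<rho> \<or> (\<exists>r. w = of_real r \<and> \<bar>r\<bar> < 2)" and \<rho>0: "poly salem_trace \<rho> = 0"
    using salem_trace_roots by blast
  have y\<rho>: "\<alpha> + 1 / \<alpha> = \<rho>"
  proof -
    define y where "y = \<alpha> + 1 / \<alpha>"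
    have a0: "complex_of_real \<alpha> \<noteq> 0" using a by simp
    have "(\<alpha> - 1) * (\<alpha> - 1) > 0" using a by simp
    then have ypos: "y > 2" using a by (simp add: y_def field_simps)
    have "poly (map_poly of_real salem_trace) (complex_of_real y) = 0"
      using salem_poly_trace[OF a0] root a0 by (simp add: rpoly_salem y_def)
    from \<rho>(3)[OF this] have "y = \<rho>" using ypos by (auto simp: of_real_eq_iff)
    then show ?thesis by (simp add: y_def)
  qed
  have zeros: "norm z = 1 \<or> z = of_real \<alpha> \<or> z = of_real (1 / \<alpha>)" if z: "rpoly salem_rat z = 0" for z :: complex
  proof -
    have z0: "z \<noteq> 0" using z by (auto simp: salem_rat_def)
    have "poly (map_poly of_real salem_trace) (z + 1 / z) = 0"
      using salem_poly_trace[OF z0] z z0 by (simp add: rpoly_salem)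
    from \<rho>(3)[OF this] show ?thesis
    proof
      assume "\<exists>r. z + 1 / z = of_real r \<and> \<bar>r\<bar> < 2"
      then show ?thesis using joukowsky(1)[OF z0] by blast
    next
      assume "z + 1 / z = of_real \<rho>"
      from joukowsky(2)[OF z0 this \<rho>(1)] obtain x where x: "z = of_real x" "x > 0" "x + 1 / x = \<rho>" by auto
      have "\<alpha> > 0" using a by simp
      moreover have "x + 1 / x = \<alpha> + 1 / \<alpha>" using x(3) y\<rho> by simp
      ultimately have "x * x * \<alpha> + \<alpha> = x * \<alpha> * \<alpha> + x" using x(2) by (simp add: field_simps)
      then have "(x - \<alpha>) * (x * \<alpha> - 1) = 0" by (simp add: algebra_simps)
      then have "x = \<alpha> \<or> x = 1 / \<alpha>" using \<open>\<alpha> > 0\<close> by (auto simp: eq_divide_eq)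
      then show ?thesis using x(1) by auto
    qed
  qed
  have galois: "rpoly salem_rat z = 0" if "galois_conjugate (of_real \<alpha>) z" for z
  proof -
    obtain p where p: "irreducible p" "rpoly p (complex_of_real \<alpha>) = 0" "rpoly p z = 0"
      using \<open>galois_conjugate (of_real \<alpha>) z\<close> by (auto simp: galois_conjugate_def rpoly_def)
    obtain k where "salem_rat = p * k" using irreducible_root_dvd[OF p(1,2) root] by (auto simp: dvd_def)
    then show ?thesis using p(3) by (metis mult_zero_left rpoly_mult)
  qed
  have le1: "norm z \<le> 1" if "galois_conjugate (of_real \<alpha>) z" "z \<noteq> of_real \<alpha>" for z
    using zeros[OF galois[OF that(1)]] that(2) a by (auto simp: norm_divide)
  obtain p where p: "irreducible p" "rpoly p (complex_of_real \<alpha>) = 0" "\<And>r. rpoly r (complex_of_real \<alpha>) = 0 \<Longrightarrow> p dvd r"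
    using minimal_rat_poly[OF root s0] by metis
  have "\<exists>z :: complex. rpoly p z = 0 \<and> z \<noteq> of_real \<alpha> \<and> norm z = 1"
  proof (rule ccontr)
    assume n: "\<not> ?thesis"
    have sub: "{z :: complex. rpoly p z = 0} \<subseteq> {of_real \<alpha>, of_real (1 / \<alpha>)}"
    proof
      fix z :: complex assume "z \<in> {z. rpoly p z = 0}"
      then have z: "rpoly p z = 0" by simp
      obtain k where "salem_rat = p * k" using p(3)[OF root] by (auto simp: dvd_def)
      then have "rpoly salem_rat z = 0" using z by (metis mult_zero_left rpoly_mult)
      from zeros[OF this] show "z \<in> {of_real \<alpha>, of_real (1 / \<alpha>)}" using n z by auto
    qed
    have ra: "rpoly p \<alpha> = 0" using p(2) of_real_rpoly by simp
    have card: "card {z :: complex. rpoly p z = 0} = degree p" by (rule irreducible_card_roots[OF p(1)])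
    have c2: "card {complex_of_real \<alpha>, of_real (1 / \<alpha>)} \<le> 2" by (simp add: card_insert_if)
    have d2: "degree p \<le> 2" using card_mono[OF _ sub] card c2 by simp
    have p0: "p \<noteq> 0" using p(1) by auto
    have pe: "p = [:coeff p 0, coeff p 1, coeff p 2:]"
      using d2 by (intro poly_eqI) (auto simp: coeff_pCons coeff_eq_0 numeral_2_eq_2 split: nat.splits)
    define b c d where "b = coeff p 0" "c = coeff p 1" "d = coeff p 2"
    have pe: "p = [:b, c, d:]" using pe by (simp add: b_c_d_def)
    have eq: "of_rat b + of_rat c * \<alpha> + of_rat d * (\<alpha> * \<alpha>) = 0"
      using ra by (simp add: pe algebra_simps)
    show False
    proof (cases "d = 0")
      case True
      have "c \<noteq> 0"
      proof
        assume "c = 0"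
        then show False using eq True p0 pe by simp
      qed
      then have "\<alpha> = of_rat (- b / c)"
        using eq True by (simp add: of_rat_divide of_rat_minus field_simps add_eq_0_iff2)
      then have "\<alpha> \<in> \<rat>" by simp
      then obtain n where "\<alpha> = of_int n" using rational_algebraic_int_is_int[OF alg] by (auto elim: Ints_cases)
      then have "1 < n" "n < 2" using a by linarith+
      then show False by simp
    next
      case False
      then have "degree p = 2" by (simp add: pe)
      then have "{z :: complex. rpoly p z = 0} = {of_real \<alpha>, of_real (1 / \<alpha>)}"
        using card_seteq[OF _ sub] card c2 by simp
      then have "rpoly p (complex_of_real (1 / \<alpha>)) = 0" by blast
      then have "rpoly p (1 / \<alpha>) = 0" using of_real_rpoly[of p "1 / \<alpha>"] by simp
      then have "of_rat b * (\<alpha> * \<alpha>) + of_rat c * \<alpha> + of_rat d = 0"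
        using a by (simp add: pe field_simps)
      then have "(of_rat c + of_rat d * (\<alpha> + 1 / \<alpha>)) * (\<alpha> * \<alpha> - 1) = 0"
        using eq a by (simp add: field_simps) algebra
      moreover have "\<alpha> * \<alpha> > 1 * 1" using a by (intro mult_strict_mono) auto
      ultimately have "of_rat c + of_rat d * \<rho> = 0" using y\<rho> by simp
      then have "\<rho> = of_rat (- c / d)"
        using False by (simp add: of_rat_divide of_rat_minus field_simps add_eq_0_iff2)
      then have "\<rho> \<in> \<rat>" by simp
      moreover have "algebraic_int \<rho>"
        using \<rho>0 by (intro algebraic_int.intros[of salem_trace])
          (auto simp: salem_trace_def coeff_pCons split: nat.splits)
      ultimately obtain n where "\<rho> = of_int n" using rational_algebraic_int_is_int by (metis Ints_cases)
      then have "2 < n" "n < 3" using \<rho>(1,2) by linarith+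
      then show False by simp
    qed
  qed
  then obtain z :: complex where z: "rpoly p z = 0" "z \<noteq> of_real \<alpha>" "norm z = 1" by blast
  have "galois_conjugate (of_real \<alpha>) z"
    unfolding galois_conjugate_def using p z by (intro exI[of _ p]) (simp add: rpoly_def)
  then show ?thesis
    using a alg le1 z by (intro exI[of _ \<alpha>]) (auto simp: salem_number_def)
qed

section \<open>Hyperbolic geometry\<close>

lemma homogeneous_system_solution:
  fixes a :: "'i \<Rightarrow> 'k \<Rightarrow> real"
  assumes "finite K" "finite S" "card K < card S"
  shows "\<exists>x. (\<exists>i\<in>S. x i \<noteq> 0) \<and> (\<forall>k\<in>K. (\<Sum>i\<in>S. x i * a i k) = 0)"
  using assms
proof (induction K arbitrary: S a rule: finite_induct)
  case empty
  then have "S \<noteq> {}" by auto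
  then show ?case by (intro exI[of _ "\<lambda>_. 1"]) auto
next
  case (insert k K)
  show ?case
  proof (cases "\<forall>i\<in>S. a i k = 0")
    case True
    have "card K < card S" using insert by simp
    then obtain x where "\<exists>i\<in>S. x i \<noteq> 0" "\<forall>k\<in>K. (\<Sum>i\<in>S. x i * a i k) = 0"
      using insert.IH[of S a] insert.prems by blast
    then show ?thesis using True by (intro exI[of _ x]) auto
  next
    case False
    then obtain j where j: "j \<in> S" "a j k \<noteq> 0" by auto
    define S' where "S' = S - {j}"
    have S': "finite S'" "card K < card S'" "S = insert j S'" "j \<notin> S'"
      using insert j by (auto simp: S'_def)
    define b where "b = (\<lambda>i l. a i l - a i k / a j k * a j l)"
    obtain x where x: "\<exists>i\<in>S'. x i \<noteq> 0" "\<forall>l\<in>K. (\<Sum>i\<in>S'. x i * b i l) = 0"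
      using insert.IH[of S' b] S' by blast
    define y where "y = x(j := - (\<Sum>i\<in>S'. x i * a i k) / a j k)"
    have y: "(\<Sum>i\<in>S. y i * a i l) = (\<Sum>i\<in>S'. x i * a i l) - (\<Sum>i\<in>S'. x i * a i k) / a j k * a j l" for l
    proof -
      have "(\<Sum>i\<in>S'. y i * a i l) = (\<Sum>i\<in>S'. x i * a i l)"
        using S'(4) by (intro sum.cong) (auto simp: y_def)
      then show ?thesis using S' by (simp add: y_def)
    qed
    have "(\<Sum>i\<in>S. y i * a i l) = 0" if "l \<in> insert k K" for l
    proof (cases "l = k")
      case True
      then show ?thesis using y[of k] j by simp
    next
      case False
      then have "(\<Sum>i\<in>S'. x i * b i l) = 0" using x that by auto
      moreover have "(\<Sum>i\<in>S'. x i * b i l) = (\<Sum>i\<in>S'. x i * a i l) - (\<Sum>i\<in>S'. x i * a i k) / a j k * a j l"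
        by (simp add: b_def right_diff_distrib sum_subtractf sum_distrib_right sum_divide_distrib mult.assoc)
      ultimately show ?thesis using y[of l] by simp
    qed
    moreover have "\<exists>i\<in>S. y i \<noteq> 0" using x(1) S' by (auto simp: y_def)
    ultimately show ?thesis by (intro exI[of _ y]) auto
  qed
qed

section \<open>The Minkowski form\<close>

abbreviation "mf \<equiv> minkowski_form"

lemma mf_sym: "mf n x y = mf n y x"
  by (simp add: minkowski_form_def mult.commute)

lemma mf_lin: "mf n (\<lambda>k. a * x k + b * y k) z = a * mf n x z + b * mf n y z"
  by (simp add: minkowski_form_def sum.distrib sum_distrib_left algebra_simps)

lemma mf_add: "mf n (\<lambda>k. x k + b * y k) z = mf n x z + b * mf n y z"
  using mf_lin[of n 1 x b y z] by simp

lemma mf_diff: "mf n (\<lambda>k. x k - b * y k) z = mf n x z - b * mf n y z"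
  using mf_lin[of n 1 x "-b" y z] by simp

lemma mf_scale: "mf n (\<lambda>k. a * x k) z = a * mf n x z"
  using mf_lin[of n a x 0 x z] by simp

lemma mf_sum: "finite S \<Longrightarrow> mf n (\<lambda>k. \<Sum>i\<in>S. a i * x i k) z = (\<Sum>i\<in>S. a i * mf n (x i) z)"
proof (induction S rule: finite_induct)
  case (insert i S)
  then show ?case using mf_lin[of n "a i" "x i" 1 "\<lambda>k. \<Sum>i\<in>S. a i * x i k" z] by simp
qed (simp add: minkowski_form_def)

lemma mf_lin_right: "mf n z (\<lambda>k. a * x k + b * y k) = a * mf n z x + b * mf n z y"
  unfolding mf_sym[of n z "\<lambda>k. a * x k + b * y k"] mf_lin mf_sym[of n z x] mf_sym[of n z y] ..

lemma mf_add_right: "mf n z (\<lambda>k. x k + b * y k) = mf n z x + b * mf n z y"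
  using mf_lin_right[of n z 1 x b y] by simp

lemma mf_diff_right: "mf n z (\<lambda>k. x k - b * y k) = mf n z x - b * mf n z y"
  using mf_lin_right[of n z 1 x "-b" y] by simp

lemma mf_scale_right: "mf n z (\<lambda>k. a * x k) = a * mf n z x"
  using mf_lin_right[of n z a x 0 x] by simp

lemma mf_quadratic:
  "mf n (\<lambda>k. x k + b * y k) (\<lambda>k. x k + b * y k) = mf n x x + 2 * b * mf n x y + b * b * mf n y y"
  unfolding mf_add mf_add_right using mf_sym[of n y x] by (simp add: algebra_simps)

text \<open>Cauchy-Schwarz on the space coordinates: the form is positive definite on the orthogonal
  complement of a timelike vector.\<close>

lemma timelike_orthogonal:
  assumes "mf n x x < 0" "mf n x y = 0"
  shows "mf n y y \<ge> 0" "mf n y y = 0 \<Longrightarrow> k \<le> n \<Longrightarrow> y k = 0"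
proof -
  define A where "A = (\<Sum>i=1..n. (x i)\<^sup>2)"
  define B where "B = (\<Sum>i=1..n. (y i)\<^sup>2)"
  have A: "A < (x 0)\<^sup>2" "A \<ge> 0"
    using assms(1) by (simp_all add: A_def minkowski_form_def power2_eq_square sum_nonneg)
  have B0: "B \<ge> 0" by (simp add: B_def sum_nonneg)
  have yy: "mf n y y = B - (y 0)\<^sup>2" by (simp add: B_def minkowski_form_def power2_eq_square)
  have "(\<Sum>i=1..n. x i * y i) = x 0 * y 0" using assms(2) by (simp add: minkowski_form_def)
  then have cs: "(x 0)\<^sup>2 * (y 0)\<^sup>2 \<le> A * B"
    using Cauchy_Schwarz_ineq_sum[of x y "{1..n}"] by (simp add: A_def B_def power_mult_distrib)
  have main: "B \<ge> (y 0)\<^sup>2 \<and> (B = (y 0)\<^sup>2 \<longrightarrow> y 0 = 0)"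
  proof (cases "y 0 = 0")
    case True
    then show ?thesis using B0 by simp
  next
    case False
    then have "(y 0)\<^sup>2 > 0" by simp
    then have "A * (y 0)\<^sup>2 < (x 0)\<^sup>2 * (y 0)\<^sup>2" using A by simp
    then have lt: "A * (y 0)\<^sup>2 < A * B" using cs by linarith
    then have "(y 0)\<^sup>2 < B" using A(2) by (metis mult_left_mono not_le)
    then show ?thesis by simp
  qed
  then show "mf n y y \<ge> 0" using yy by simp
  assume h: "mf n y y = 0" "k \<le> n"
  then have "y 0 = 0" "B = 0" using main yy by auto
  then have "\<forall>i\<in>{1..n}. (y i)\<^sup>2 = 0" unfolding B_def by (subst (asm) sum_nonneg_eq_0_iff) auto
  then show "y k = 0" using \<open>y 0 = 0\<close> h(2) by (cases "k = 0") auto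
qed

lemma timelike_product_neg:
  assumes "mf n x x < 0" "mf n y y < 0" "x 0 > 0" "y 0 > 0"
  shows "mf n x y < 0"
proof -
  define A where "A = (\<Sum>i=1..n. (x i)\<^sup>2)"
  define B where "B = (\<Sum>i=1..n. (y i)\<^sup>2)"
  have AB: "A < (x 0)\<^sup>2" "A \<ge> 0" "B < (y 0)\<^sup>2" "B \<ge> 0"
    using assms by (simp_all add: A_def B_def minkowski_form_def power2_eq_square sum_nonneg)
  have "(\<Sum>i=1..n. x i * y i)\<^sup>2 \<le> A * B"
    using Cauchy_Schwarz_ineq_sum[of x y "{1..n}"] by (simp add: A_def B_def)
  also have "\<dots> < (x 0)\<^sup>2 * (y 0)\<^sup>2"
    using AB assms by (intro mult_strict_mono) auto
  finally have "(\<Sum>i=1..n. x i * y i)\<^sup>2 < (x 0 * y 0)\<^sup>2" by (simp add: power_mult_distrib)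
  then have "(\<Sum>i=1..n. x i * y i) < x 0 * y 0"
    by (rule power_less_imp_less_base) (use assms(3,4) in simp)
  then show ?thesis by (simp add: minkowski_form_def)
qed

text \<open>Otherwise -z would be timelike with positive time coordinate, and its product with x
  would be negative.\<close>

lemma future:
  assumes "mf n x x < 0" "x 0 > 0" "mf n z z < 0" "mf n x z < 0"
  shows "z 0 > 0"
proof (rule ccontr)
  assume n: "\<not> z 0 > 0"
  have "z 0 \<noteq> 0"
  proof
    assume "z 0 = 0"
    then have "mf n z z \<ge> 0" by (simp add: minkowski_form_def sum_nonneg)
    then show False using assms by simp
  qed
  then have "(\<lambda>k. -1 * z k) 0 > 0" using n by simp
  moreover have "mf n (\<lambda>k. -1 * z k) (\<lambda>k. -1 * z k) < 0"
    unfolding mf_scale mf_scale_right using assms(3) by simp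
  ultimately have "mf n x (\<lambda>k. -1 * z k) < 0" by (rule timelike_product_neg[OF assms(1) _ assms(2), rotated])
  then have "mf n x z > 0" unfolding mf_scale_right by simp
  then show False using assms(4) by simp
qed

lemma hyp_spaceD: "x \<in> hyp_space n \<Longrightarrow> x \<in> minkowski_space n \<and> mf n x x = -1 \<and> x 0 > 0"
  by (simp add: hyp_space_def)

lemma minkowski_lin: "x \<in> minkowski_space n \<Longrightarrow> y \<in> minkowski_space n \<Longrightarrow> (\<lambda>k. a * x k + b * y k) \<in> minkowski_space n"
  by (simp add: minkowski_space_def)

definition refl :: "nat \<Rightarrow> (nat \<Rightarrow> real) \<Rightarrow> (nat \<Rightarrow> real) \<Rightarrow> (nat \<Rightarrow> real)" where
  "refl n e x = (\<lambda>k. x k - 2 * mf n x e * e k)"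

lemma refl_mf: "mf n e e = 1 \<Longrightarrow> mf n (refl n e x) (refl n e y) = mf n x y"
  unfolding refl_def mf_diff mf_diff_right using mf_sym[of n e y] by simp

lemma refl_refl: "mf n e e = 1 \<Longrightarrow> refl n e (refl n e x) = x"
  unfolding refl_def mf_diff by (rule ext) (simp add: algebra_simps)

lemma refl_in:
  assumes "e \<in> unit_spacelike n" "x \<in> hyp_space n"
  shows "refl n e x \<in> hyp_space n"
proof -
  have e: "mf n e e = 1" "e \<in> minkowski_space n" using assms by (auto simp: unit_spacelike_def)
  have x: "mf n x x = -1" "x 0 > 0" "x \<in> minkowski_space n" using assms hyp_spaceD by auto
  have r: "mf n (refl n e x) (refl n e x) = -1" using refl_mf[OF e(1)] x by simp
  have "mf n x (refl n e x) = mf n x x - 2 * mf n x e * mf n x e"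
    unfolding refl_def mf_diff_right ..
  also have "\<dots> < 0"
  proof -
    have "mf n x e * mf n x e \<ge> 0" by simp
    then show ?thesis using x(1) by linarith
  qed
  finally have "refl n e x 0 > 0" using r x by (intro future[of n x "refl n e x"]) auto
  moreover have "refl n e x \<in> minkowski_space n" using e x by (simp add: minkowski_space_def refl_def)
  ultimately show ?thesis using r by (simp add: hyp_space_def)
qed

section \<open>Geodesics, perpendiculars and angles\<close>

lemma geodesic_mf:
  assumes "mf n p p = -1" "mf n v v = 1" "mf n p v = 0"
  shows "mf n (geodesic p v s) (geodesic p v s) = -1"
    "mf n (geodesic_velocity p v s) (geodesic_velocity p v t) = cosh (s - t)"
    "mf n (geodesic p v s) (geodesic_velocity p v s) = 0"
    "mf n p (geodesic p v s) = - cosh s"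
    "mf n v (geodesic p v s) = sinh s"
proof -
  have a: "mf n v p = 0" using assms mf_sym by metis
  note l = geodesic_def geodesic_velocity_def mf_lin mf_lin_right
  show "mf n (geodesic p v s) (geodesic p v s) = -1"
    using assms a cosh_square_eq[of s] by (simp add: l power2_eq_square)
  show "mf n (geodesic_velocity p v s) (geodesic_velocity p v t) = cosh (s - t)"
    using assms a by (simp add: l cosh_diff)
  show "mf n (geodesic p v s) (geodesic_velocity p v s) = 0"
    using assms a by (simp add: l)
  show "mf n p (geodesic p v s) = - cosh s" "mf n v (geodesic p v s) = sinh s"
    using assms a by (simp_all add: l)
qed

lemma geodesic_in:
  assumes "p \<in> hyp_space n" "v \<in> minkowski_space n" "mf n v v = 1" "mf n p v = 0"
  shows "geodesic p v s \<in> hyp_space n"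
proof -
  have p: "mf n p p = -1" "p 0 > 0" "p \<in> minkowski_space n" using assms hyp_spaceD by auto
  note g = geodesic_mf[OF p(1) assms(3,4), of s]
  have "cosh s > 0" by simp
  then have "geodesic p v s 0 > 0" using g p by (intro future[of n p "geodesic p v s"]) simp_all
  moreover have "geodesic p v s \<in> minkowski_space n"
    unfolding geodesic_def using minkowski_lin[OF p(3) assms(2)] by simp
  ultimately show ?thesis using g by (simp add: hyp_space_def)
qed

text \<open>The component w of the velocity orthogonal to e is tangent to the hyperplane, hence
  orthogonal to the velocity and therefore isotropic. It is also orthogonal to the timelike point x,
  so it vanishes.\<close>

lemma perpendicular_normal:
  assumes p: "p \<in> hyp_space n" "v \<in> unit_tangent n p" and e: "e \<in> unit_spacelike n"
    and g: "geodesic p v s \<in> hyperplane n e"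
      "\<forall>w\<in>hyperplane_tangent n e (geodesic p v s). mf n w (geodesic_velocity p v s) = 0"
  obtains \<sigma> :: real where "\<sigma> = 1 \<or> \<sigma> = -1" "e = (\<lambda>k. \<sigma> * geodesic_velocity p v s k)"
proof -
  have pp: "mf n p p = -1" "p \<in> minkowski_space n" using p hyp_spaceD by auto
  have v: "mf n v v = 1" "mf n p v = 0" "v \<in> minkowski_space n" using p by (auto simp: unit_tangent_def unit_spacelike_def)
  have ee: "mf n e e = 1" "e \<in> minkowski_space n" using e by (auto simp: unit_spacelike_def)
  define x where "x = geodesic p v s"
  define d where "d = geodesic_velocity p v s"
  note gm = geodesic_mf[OF pp(1) v(1,2), of s, folded x_def d_def]
  have dd: "mf n d d = 1" using geodesic_mf(2)[OF pp(1) v(1,2), of s s] by (simp add: d_def)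
  have xe: "mf n x e = 0" using g(1) by (simp add: hyperplane_def x_def)
  define \<sigma> where "\<sigma> = mf n d e"
  define w where "w = (\<lambda>k. d k - \<sigma> * e k)"
  have dm: "d \<in> minkowski_space n" unfolding d_def geodesic_velocity_def using minkowski_lin[OF pp(2) v(3)] by simp
  have wx: "mf n w x = 0" and we: "mf n w e = 0"
    unfolding w_def mf_diff using gm xe ee mf_sym[of n d x] mf_sym[of n e x] by (simp_all add: \<sigma>_def)
  have "w \<in> minkowski_space n" using dm ee by (simp add: minkowski_space_def w_def)
  then have "mf n w d = 0" using g(2) wx we by (simp add: hyperplane_tangent_def x_def d_def)
  then have s2: "\<sigma> * \<sigma> = 1" unfolding w_def mf_diff using dd mf_sym[of n e d] by (simp add: \<sigma>_def)
  have "mf n w w = mf n w d - \<sigma> * mf n w e" by (subst (2) w_def) (simp add: mf_diff_right)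
  also have "\<dots> = 0" using \<open>mf n w d = 0\<close> we by simp
  finally have ww: "mf n w w = 0" .
  have "w k = 0" for k
  proof (cases "k \<le> n")
    case True
    have "mf n x x < 0" "mf n x w = 0" using gm wx mf_sym[of n x w] by simp_all
    from timelike_orthogonal(2)[OF this ww True] show ?thesis .
  next
    case False
    then show ?thesis using \<open>w \<in> minkowski_space n\<close> by (simp add: minkowski_space_def)
  qed
  then have dk: "d k = \<sigma> * e k" for k by (simp add: w_def)
  have "e k = \<sigma> * d k" for k
    unfolding dk using s2 by (metis mult.assoc mult_1)
  moreover have "\<sigma> = 1 \<or> \<sigma> = -1" using s2 by (simp add: square_eq_1_iff)
  ultimately show ?thesis using that[of \<sigma>] by (auto simp: d_def)
qed

lemma half_space_incl:
  assumes p: "p \<in> hyp_space n" and s: "\<sigma> * (s2 - s1) \<ge> 0" "\<sigma> = 1 \<or> \<sigma> = -1"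
  shows "half_space n (\<lambda>k. \<sigma> * geodesic_velocity p v s1 k) \<subseteq> half_space n (\<lambda>k. \<sigma> * geodesic_velocity p v s2 k)"
proof
  fix x assume x: "x \<in> half_space n (\<lambda>k. \<sigma> * geodesic_velocity p v s1 k)"
  have xh: "x \<in> hyp_space n" using x by (simp add: half_space_def)
  have A: "mf n x p < 0" by (rule timelike_product_neg) (use hyp_spaceD[OF xh] hyp_spaceD[OF p] in simp_all)
  have e: "mf n x (\<lambda>k. \<sigma> * geodesic_velocity p v t k) = \<sigma> * (sinh t * mf n x p + cosh t * mf n x v)" for t
    unfolding mf_scale_right geodesic_velocity_def mf_lin_right ..
  have le: "\<sigma> * (sinh s1 * mf n x p + cosh s1 * mf n x v) \<le> 0" using x e by (simp add: half_space_def)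
  \<comment> \<open>The term with sinh (s2 - s1) is the difference between the two half-space
    conditions; its sign is known because \<open>mf n x p\<close> is negative.\<close>
  have "cosh s1 * (\<sigma> * (sinh s2 * mf n x p + cosh s2 * mf n x v)) =
    cosh s2 * (\<sigma> * (sinh s1 * mf n x p + cosh s1 * mf n x v)) + \<sigma> * sinh (s2 - s1) * mf n x p"
    by (simp add: sinh_diff algebra_simps)
  also have "\<dots> \<le> 0"
  proof -
    have "\<sigma> * sinh (s2 - s1) \<ge> 0" using s by auto
    then have "\<sigma> * sinh (s2 - s1) * mf n x p \<le> 0" using A by (simp add: mult_nonneg_nonpos)
    moreover have "cosh s2 * (\<sigma> * (sinh s1 * mf n x p + cosh s1 * mf n x v)) \<le> 0"
      by (rule mult_nonneg_nonpos[OF _ le]) simp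
    ultimately show ?thesis by linarith
  qed
  finally have "\<sigma> * (sinh s2 * mf n x p + cosh s2 * mf n x v) \<le> 0"
    using cosh_real_pos[of s1] mult_le_cancel_left_pos[of "cosh s1" _ 0] by (metis mult_zero_right)
  then show "x \<in> half_space n (\<lambda>k. \<sigma> * geodesic_velocity p v s2 k)"
    using xh e by (simp add: half_space_def)
qed

text \<open>Both normals are plus or minus the velocity of the common perpendicular. Opposite signs
  give the product -cosh, equal signs give nested half-spaces, which irredundancy rules out in
  \<open>pair\<close>.\<close>

lemma common_perpendicular_product:
  assumes "e \<in> unit_spacelike n" "f \<in> unit_spacelike n" "admit_common_perpendicular n e f"
  shows "mf n e f \<le> -1 \<or> half_space n e \<subseteq> half_space n f \<or> half_space n f \<subseteq> half_space n e"
proof -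
  obtain p v s1 s2 where p: "p \<in> hyp_space n" "v \<in> unit_tangent n p"
    and 1: "geodesic p v s1 \<in> hyperplane n e"
      "\<forall>w\<in>hyperplane_tangent n e (geodesic p v s1). mf n w (geodesic_velocity p v s1) = 0"
    and 2: "geodesic p v s2 \<in> hyperplane n f"
      "\<forall>w\<in>hyperplane_tangent n f (geodesic p v s2). mf n w (geodesic_velocity p v s2) = 0"
    using assms(3) unfolding admit_common_perpendicular_def meets_perpendicularly_def by blast
  obtain \<sigma> where \<sigma>: "\<sigma> = 1 \<or> \<sigma> = -1" "e = (\<lambda>k. \<sigma> * geodesic_velocity p v s1 k)"
    using perpendicular_normal[OF p assms(1) 1] by metis
  obtain \<tau> where \<tau>: "\<tau> = 1 \<or> \<tau> = -1" "f = (\<lambda>k. \<tau> * geodesic_velocity p v s2 k)"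
    using perpendicular_normal[OF p assms(2) 2] by metis
  have pp: "mf n p p = -1" "mf n v v = 1" "mf n p v = 0"
    using p hyp_spaceD by (auto simp: unit_tangent_def unit_spacelike_def)
  have ef: "mf n e f = \<sigma> * \<tau> * cosh (s1 - s2)"
    unfolding \<sigma>(2) \<tau>(2) mf_scale mf_scale_right geodesic_mf(2)[OF pp, of s1 s2] by simp
  show ?thesis
  proof (cases "\<sigma> = \<tau>")
    case True
    have "\<sigma> * (s2 - s1) \<ge> 0 \<or> \<sigma> * (s1 - s2) \<ge> 0" using \<sigma>(1) by auto
    then show ?thesis
      using half_space_incl[OF p(1) _ \<sigma>(1), of s2 s1 v] half_space_incl[OF p(1) _ \<sigma>(1), of s1 s2 v] \<sigma>(2) \<tau>(2) True
      by auto
  next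
    case False
    then have "\<sigma> * \<tau> = -1" using \<sigma>(1) \<tau>(1) by auto
    then show ?thesis using ef cosh_real_ge_1[of "s1 - s2"] by simp
  qed
qed

text \<open>The arccos in \<open>dihedral_angle\<close> can be inverted only for a product in
  [-1, 1]. This holds because e and f are orthogonal to a common point, so that e + f and e - f have
  nonnegative squares.\<close>

lemma dihedral_product:
  assumes "e \<in> unit_spacelike n" "f \<in> unit_spacelike n" "hyperplane n e \<inter> hyperplane n f \<noteq> {}"
    "dihedral_angle n e f = pi / real k"
  shows "mf n e f = - cos (pi / real k)"
proof -
  obtain x where x: "x \<in> hyp_space n" "mf n x e = 0" "mf n x f = 0" using assms by (auto simp: hyperplane_def)
  have xx: "mf n x x < 0" using hyp_spaceD[OF x(1)] by simp
  have ee: "mf n e e = 1" "mf n f f = 1" using assms by (auto simp: unit_spacelike_def)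
  have "mf n x (\<lambda>k. e k + b * f k) = 0" for b
    unfolding mf_add_right using x by simp
  from timelike_orthogonal(1)[OF xx this] have "1 + 2 * b * mf n e f + b * b \<ge> 0" for b
    unfolding mf_quadratic by (simp add: ee)
  from this[of 1] this[of "-1"] have "- 1 \<le> mf n e f" "mf n e f \<le> 1" by simp_all
  then have "mf n e f = cos (arccos (mf n e f))" by simp
  also have "arccos (mf n e f) = pi - pi / real k" using assms(4) by (simp add: dihedral_angle_def)
  finally show ?thesis by simp
qed

lemma geodesic_continuous: "continuous_on UNIV (\<lambda>s. geodesic p v s)"
  unfolding geodesic_def by (intro continuous_on_coordinatewise_then_product continuous_intros)

text \<open>From a point p on the wall, the geodesic along the outer normal would remain in P for a
  short time and yet leave the half-space at once.\<close>

lemma interior_point: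
  assumes p: "p \<in> (top_of_set (hyp_space n)) interior_of P" and P: "P \<subseteq> half_space n e" and e: "e \<in> unit_spacelike n"
  shows "mf n p e < 0"
proof (rule ccontr)
  assume nl: "\<not> mf n p e < 0"
  obtain T where T: "openin (top_of_set (hyp_space n)) T" "p \<in> T" "T \<subseteq> P"
    using p by (auto simp: interior_of_def)
  then obtain O' where O: "open O'" "T = hyp_space n \<inter> O'" by (auto simp: openin_open)
  have ph: "p \<in> hyp_space n" using T O by auto
  have "mf n p e \<le> 0" using T P by (auto simp: half_space_def)
  then have pe: "mf n p e = 0" using nl by simp
  have ee: "mf n e e = 1" "e \<in> minkowski_space n" using e by (auto simp: unit_spacelike_def)
  have pp: "mf n p p = -1" using hyp_spaceD[OF ph] by simp
  have "open ((\<lambda>s. geodesic p e s) -` O')"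
    by (rule open_vimage[OF O(1) geodesic_continuous])
  moreover have "geodesic p e 0 = p" by (simp add: geodesic_def)
  then have "0 \<in> (\<lambda>s. geodesic p e s) -` O'" using T O by auto
  ultimately obtain d where d: "d > 0" "\<And>s. dist s 0 < d \<Longrightarrow> geodesic p e s \<in> O'"
    unfolding open_dist by blast
  have "geodesic p e (d / 2) \<in> O'" using d by (intro d(2)) (simp add: dist_real_def)
  moreover have "geodesic p e (d / 2) \<in> hyp_space n" by (rule geodesic_in[OF ph ee(2,1) pe])
  ultimately have "geodesic p e (d / 2) \<in> half_space n e" using O T P by blast
  then have "sinh (d / 2) \<le> 0"
    using geodesic_mf(5)[OF pp ee(1) pe, of "d / 2"] mf_sym[of n e "geodesic p e (d / 2)"]
    by (simp add: half_space_def)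
  then show False using d by simp
qed

section \<open>Compact Coxeter polyhedra\<close>

lemma null_time_zero:
  assumes "z \<in> minkowski_space n" "z 0 = 0" "mf n z z \<le> 0"
  shows "z k = 0"
proof -
  have "(\<Sum>i=1..n. z i * z i) \<le> 0" using assms by (simp add: minkowski_form_def)
  then have "(\<Sum>i=1..n. z i * z i) = 0" by (simp add: antisym sum_nonneg)
  then have "\<forall>i\<in>{1..n}. z i * z i = 0" by (subst (asm) sum_nonneg_eq_0_iff) auto
  then show ?thesis
    using assms(1,2) by (cases "k = 0"; cases "k \<le> n") (auto simp: minkowski_space_def)
qed

lemma linear_bounds_quadratic_False:
  fixes a K :: real
  assumes "a > 0" "\<And>s. s \<ge> 1 \<Longrightarrow> a * (s * s) \<le> K * s"
  shows False
proof -
  define s where "s = max 1 ((K + 1) / a)"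
  have s: "s \<ge> 1" "s \<ge> (K + 1) / a" by (auto simp: s_def)
  have "a * s * s \<le> K * s" using assms(2)[OF s(1)] by (simp add: mult.assoc)
  then have "a * s \<le> K" using s(1) mult_le_cancel_right_pos[of s "a * s" K] by simp
  moreover have "K + 1 \<le> a * s" using s(2) assms(1) by (simp add: divide_le_eq mult.commute)
  ultimately show False by linarith
qed

text \<open>
  Along the ray \<open>p + s * y\<close> the vectors, normalised to the hyperboloid, stay in \<open>P\<close> until the ray leaves
  the light cone, and their time coordinate is unbounded there.
\<close>

lemma compact_no_ideal_direction:
  assumes e: "\<forall>i\<in>J. e i \<in> unit_spacelike n" and J: "J \<noteq> {}" and P: "P = (\<Inter>i\<in>J. half_space n (e i))" "compact P"
    and p: "p \<in> P"
    and y: "y \<in> minkowski_space n" "\<And>i. i \<in> J \<Longrightarrow> mf n y (e i) \<le> 0" "mf n y y \<ge> 0"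
  shows "y k = 0"
proof (rule ccontr)
  assume nz: "y k \<noteq> 0"
  have ph: "p \<in> hyp_space n" and pe: "\<And>i. i \<in> J \<Longrightarrow> mf n p (e i) \<le> 0"
    using p J unfolding P(1) by (auto simp: half_space_def)
  have pp: "mf n p p = -1" "p 0 > 0" "p \<in> minkowski_space n" using hyp_spaceD[OF ph] by auto
  have "continuous_on P (\<lambda>x. x 0)"
    by (rule continuous_on_subset[OF continuous_on_product_coordinates]) simp
  then have "bounded ((\<lambda>x. x 0) ` P)" using P(2) by (intro compact_imp_bounded compact_continuous_image)
  then obtain M where M: "\<And>x. x \<in> P \<Longrightarrow> \<bar>x 0\<bar> \<le> M" unfolding bounded_iff by auto
  \<comment> \<open>Scaling z to the hyperboloid gives a point of \<open>P\<close>, whose time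
    coordinate is at most M.\<close>
  have bd: "(z 0)\<^sup>2 \<le> M\<^sup>2 * (- mf n z z)"
    if z: "z \<in> minkowski_space n" "mf n z z < 0" "z 0 > 0" "\<And>i. i \<in> J \<Longrightarrow> mf n z (e i) \<le> 0" for z
  proof -
    define r where "r = sqrt (- mf n z z)"
    have r: "r > 0" "r * r = - mf n z z" using z(2) by (auto simp: r_def)
    define u where "u = (\<lambda>k. (1 / r) * z k)"
    have "mf n z z = - (r * r)" using r by simp
    then have "mf n u u = -1" unfolding u_def mf_scale mf_scale_right using r(1) by simp
    moreover have "u 0 > 0" using z(3) r by (simp add: u_def)
    moreover have "u \<in> minkowski_space n" using z(1) by (simp add: u_def minkowski_space_def)
    ultimately have uh: "u \<in> hyp_space n" by (simp add: hyp_space_def)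
    have "mf n u (e i) \<le> 0" if "i \<in> J" for i
      unfolding u_def mf_scale using z(4)[OF that] r(1) by (simp add: divide_nonpos_pos)
    then have "u \<in> P" using uh P(1) by (simp add: half_space_def)
    then have "\<bar>u 0\<bar> \<le> M" by (rule M)
    then have "z 0 \<le> M * r" using r(1) z(3) by (simp add: u_def divide_le_eq)
    then have "(z 0)\<^sup>2 \<le> (M * r)\<^sup>2" using z(3) by (intro power_mono) auto
    also have "\<dots> = M\<^sup>2 * (- mf n z z)" unfolding r(2)[symmetric] by (simp add: power2_eq_square)
    finally show ?thesis .
  qed
  define b where "b = mf n p y"
  define w where "w = mf n y y"
  define z where "z = (\<lambda>s k. p k + s * y k)"
  have zz: "mf n (z s) (z s) = -1 + 2 * b * s + w * (s * s)" for s
    unfolding z_def mf_quadratic by (simp add: pp b_def w_def mult_ac)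
  have zm: "z s \<in> minkowski_space n" for s
    using pp y(1) by (simp add: z_def minkowski_space_def)
  have ze: "mf n (z s) (e i) \<le> 0" if "s \<ge> 0" "i \<in> J" for s i
    unfolding z_def mf_add using pe[OF that(2)] y(2)[OF that(2)] that(1)
    by (simp add: add_nonpos_nonpos mult_nonneg_nonpos)
  \<comment> \<open>If the time coordinate vanished somewhere on the way, the form would be
    nonnegative there.\<close>
  have z0: "z s 0 > 0" if s: "s \<ge> 0" "\<And>s'. 0 \<le> s' \<Longrightarrow> s' \<le> s \<Longrightarrow> mf n (z s') (z s') < 0" for s
  proof (rule ccontr)
    assume "\<not> z s 0 > 0"
    then have le: "p 0 + s * y 0 \<le> 0" by (simp add: z_def)
    have y0: "y 0 < 0"
    proof (rule ccontr)
      assume "\<not> y 0 < 0"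
      then have "s * y 0 \<ge> 0" using s(1) by simp
      then show False using le pp by linarith
    qed
    define s' where "s' = - p 0 / y 0"
    have s': "0 \<le> s'" "s' \<le> s" "z s' 0 = 0"
      using y0 pp(2) le by (auto simp: s'_def z_def divide_simps mult.commute)
    have "mf n (z s') (z s') \<ge> 0" using s'(3) by (simp add: minkowski_form_def sum_nonneg)
    then show False using s(2)[OF s'(1,2)] by simp
  qed
  show False
  \<comment> \<open>In this case the ray stays timelike forever, and the square of its time
    coordinate, which grows quadratically, would be bounded linearly. Otherwise the ray reaches the
    light cone at some S > 0.\<close>
  proof (cases "w = 0 \<and> b \<le> 0")
    case True
    have neg: "mf n (z s) (z s) < 0" if "s \<ge> 0" for s
    proof -
      have "b * s \<le> 0" using True that by (simp add: mult_nonpos_nonneg)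
      then show ?thesis using True by (simp add: zz)
    qed
    have pos: "p 0 + s * y 0 > 0" if "s \<ge> 0" for s
      using z0[OF that neg] by (simp add: z_def)
    have "y 0 \<ge> 0"
    proof (rule ccontr)
      assume "\<not> y 0 \<ge> 0"
      then have "- p 0 / y 0 \<ge> 0" "p 0 + (- p 0 / y 0) * y 0 = 0" using pp(2) by (auto simp: divide_simps)
      then show False using pos[of "- p 0 / y 0"] by simp
    qed
    moreover have "y 0 \<noteq> 0"
    proof
      assume "y 0 = 0"
      then show False using null_time_zero[OF y(1), of k] nz True by (simp add: w_def)
    qed
    ultimately have y0: "y 0 > 0" by simp
    have "(y 0 * y 0) * (s * s) \<le> (M\<^sup>2 * (1 - 2 * b)) * s" if s: "s \<ge> 1" for s
    proof -
      have "(s * y 0)\<^sup>2 \<le> (p 0 + s * y 0)\<^sup>2" using s y0 pp(2) by (intro power_mono) auto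
      also have "\<dots> \<le> M\<^sup>2 * (1 - 2 * b * s)"
        using bd[OF zm neg _ ze, of s, unfolded zz] pos[of s] s True by (simp add: z_def)
      also have "\<dots> \<le> M\<^sup>2 * ((1 - 2 * b) * s)"
        using s by (intro mult_left_mono) (auto simp: left_diff_distrib)
      finally show ?thesis by (simp add: power2_eq_square mult_ac)
    qed
    then show False using linear_bounds_quadratic_False[of "y 0 * y 0" "M\<^sup>2 * (1 - 2 * b)"] y0 by simp
  next
    case False
    have w: "w \<ge> 0" using y(3) by (simp add: w_def)
    obtain S where S: "S > 0" "2 * b * S + w * (S * S) = 1"
    proof (cases "w = 0")
      case True
      then have "b > 0" using False by simp
      then show ?thesis using that[of "1 / (2 * b)"] True by simp
    next
      case wn: False
      define r where "r = sqrt (b * b + w)"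
      have rr: "r * r = b * b + w" using w by (simp add: r_def)
      have "\<bar>b\<bar> < r" unfolding r_def using w wn by (intro real_less_rsqrt) (simp add: power2_eq_square)
      then have "(r - b) / w > 0" using w wn by simp
      moreover have "2 * b * ((r - b) / w) + w * ((r - b) / w * ((r - b) / w)) = 1"
        using wn rr by (simp add: field_simps)
      ultimately show ?thesis using that by blast
    qed
    have q: "mf n (z (\<theta> * S)) (z (\<theta> * S)) = - (1 - \<theta>) * (1 + \<theta> * (w * (S * S)))" for \<theta>
    proof -
      have "2 * b * S = 1 - w * (S * S)" using S(2) by simp
      then have "2 * b * (\<theta> * S) = \<theta> * (1 - w * (S * S))" by (metis mult.left_commute)
      then show ?thesis unfolding zz by (simp add: algebra_simps)
    qed
    have neg: "mf n (z (\<theta> * S)) (z (\<theta> * S)) < 0" if "0 \<le> \<theta>" "\<theta> < 1" for \<theta>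
    proof -
      have "1 + \<theta> * (w * (S * S)) > 0" using that w S(1) by (intro add_pos_nonneg) auto
      then show ?thesis unfolding q using that by (simp add: mult_neg_pos)
    qed
    have le: "(z (\<theta> * S) 0)\<^sup>2 \<le> M\<^sup>2 * ((1 - \<theta>) * (1 + \<theta> * (w * (S * S))))" if "0 \<le> \<theta>" "\<theta> < 1" for \<theta>
    proof -
      have "mf n (z s') (z s') < 0" if "0 \<le> s'" "s' \<le> \<theta> * S" for s'
      proof -
        have "s' / S \<le> \<theta>" using that S(1) by (simp add: divide_le_eq)
        then have "s' / S < 1" using \<open>\<theta> < 1\<close> by simp
        then show ?thesis using neg[of "s' / S"] that S(1) by simp
      qed
      moreover have "\<theta> * S \<ge> 0" using that S(1) by simp
      ultimately show ?thesis
        using bd[OF zm neg[OF that] z0 ze] unfolding q by (simp add: algebra_simps)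
    qed
    have l1: "((\<lambda>\<theta>. (z (\<theta> * S) 0)\<^sup>2) \<longlongrightarrow> (z (1 * S) 0)\<^sup>2) (at_left 1)"
      unfolding z_def by (intro tendsto_intros)
    have l2: "((\<lambda>\<theta>. M\<^sup>2 * ((1 - \<theta>) * (1 + \<theta> * (w * (S * S))))) \<longlongrightarrow> M\<^sup>2 * ((1 - 1) * (1 + 1 * (w * (S * S))))) (at_left (1::real))"
      by (intro tendsto_intros)
    have "eventually (\<lambda>\<theta>::real. \<theta> \<in> {0<..<1}) (at_left 1)"
      by (rule eventually_at_leftI[of 0]) auto
    then have "eventually (\<lambda>\<theta>. (z (\<theta> * S) 0)\<^sup>2 \<le> M\<^sup>2 * ((1 - \<theta>) * (1 + \<theta> * (w * (S * S))))) (at_left 1)"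
      by (rule eventually_mono) (simp add: le)
    \<comment> \<open>The bound tends to 0 at the light cone, so the time coordinate of
      \<open>z S\<close> vanishes and with it the null vector \<open>z S\<close>. Then p is a
      multiple of y, which is not timelike.\<close>
    from tendsto_le[OF _ l2 l1 this] have "z S 0 = 0" by simp
    moreover have "mf n (z S) (z S) = 0" using q[of 1] by simp
    ultimately have zk: "z S k = 0" for k using null_time_zero[OF zm] by simp
    have "p = (\<lambda>k. (- S) * y k)"
    proof
      fix k show "p k = (- S) * y k" using zk[of k] by (simp add: z_def)
    qed
    from arg_cong[OF this, of "\<lambda>x. mf n x x"] have "mf n p p = S * S * w"
      unfolding mf_scale mf_scale_right by (simp add: w_def)
    moreover have "S * S * w \<ge> 0" using w by simp
    ultimately show False using pp(1) by simp
  qed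
qed

section \<open>The reflection group of a compact Coxeter polyhedron\<close>

locale coxeter_polyhedron =
  fixes n N :: nat and e :: "nat \<Rightarrow> nat \<Rightarrow> real" and P :: "(nat \<Rightarrow> real) set" and p :: "nat \<Rightarrow> real"
  assumes polyhedron: "compact_coxeter_polyhedron n N e P"
    and p_interior: "p \<in> (top_of_set (hyp_space n)) interior_of P"
begin

text \<open>Read off the Gram entry alone, which makes the symmetry of the label immediate; the
  value is 0 if no k fits.\<close>

definition m :: "nat \<Rightarrow> nat \<Rightarrow> nat" where
  "m i j = (if \<exists>k\<ge>2. mf n (e i) (e j) = - cos (pi / real k)
    then SOME k. k \<ge> 2 \<and> mf n (e i) (e j) = - cos (pi / real k) else 0)"

definition "gram i j = 2 * mf n (e i) (e j)"

lemma N: "N \<ge> 3" "n + 1 \<le> N" "n \<ge> 2" using polyhedron by (auto simp: compact_coxeter_polyhedron_def)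

lemma e: "i < N \<Longrightarrow> e i \<in> unit_spacelike n" using polyhedron by (auto simp: compact_coxeter_polyhedron_def)

lemma e_unit: "i < N \<Longrightarrow> mf n (e i) (e i) = 1" and e_in: "i < N \<Longrightarrow> e i \<in> minkowski_space n"
  using e by (auto simp: unit_spacelike_def)

lemma P_eq: "P = (\<Inter>i<N. half_space n (e i))" using polyhedron by (simp add: compact_coxeter_polyhedron_def)

lemma P_compact: "compact P"
  and P_irredundant: "\<forall>j<N. P \<noteq> (\<Inter>i\<in>{..<N} - {j}. half_space n (e i))"
  using polyhedron unfolding compact_coxeter_polyhedron_def by blast+

lemma p_P: "p \<in> P" by (rule subsetD[OF interior_of_subset p_interior])

lemma p_hyp: "p \<in> hyp_space n"
proof -
  have "p \<in> half_space n (e 0)" using p_P N(1) unfolding P_eq by auto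
  then show ?thesis by (simp add: half_space_def)
qed

lemma mf_p: "i < N \<Longrightarrow> mf n p (e i) < 0"
  by (rule interior_point[OF p_interior]) (auto simp: P_eq e)

lemma no_ideal:
  assumes "y \<in> minkowski_space n" "\<And>i. i < N \<Longrightarrow> mf n y (e i) \<le> 0" "mf n y y \<ge> 0"
  shows "y k = 0"
proof (rule compact_no_ideal_direction)
  show "\<forall>i\<in>{..<N}. e i \<in> unit_spacelike n" using e by simp
  have "0 \<in> {..<N}" using N(1) by simp
  then show "{..<N} \<noteq> {}" by blast
  show "compact P" by (rule P_compact)
qed (use assms P_eq p_P in auto)

text \<open>Nested half-spaces would make one wall redundant, so a common perpendicular leaves only
  a product of at most -1.\<close>

lemma pair:
  assumes "i < N" "j < N" "i \<noteq> j"
  shows "m i j = 0 \<and> mf n (e i) (e j) \<le> -1 \<or> m i j \<ge> 2 \<and> mf n (e i) (e j) = - cos (pi / real (m i j))"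
proof (cases "\<exists>k\<ge>2. mf n (e i) (e j) = - cos (pi / real k)")
  case True
  then have "\<exists>k. k \<ge> 2 \<and> mf n (e i) (e j) = - cos (pi / real k)" by blast
  from someI_ex[OF this] show ?thesis using True by (simp add: m_def)
next
  case False
  have "(hyperplane n (e i) \<inter> hyperplane n (e j) \<noteq> {} \<and>
          (\<exists>k::nat. k \<ge> 2 \<and> dihedral_angle n (e i) (e j) = pi / real k)) \<or>
        admit_common_perpendicular n (e i) (e j)"
    using polyhedron assms by (simp add: compact_coxeter_polyhedron_def)
  then have "admit_common_perpendicular n (e i) (e j)"
    using dihedral_product[OF e[OF assms(1)] e[OF assms(2)]] False by blast
  from common_perpendicular_product[OF e[OF assms(1)] e[OF assms(2)] this]
  have "mf n (e i) (e j) \<le> -1 \<or> half_space n (e i) \<subseteq> half_space n (e j) \<or> half_space n (e j) \<subseteq> half_space n (e i)" .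
  moreover have "\<not> half_space n (e a) \<subseteq> half_space n (e b)" if "a < N" "b < N" "a \<noteq> b" for a b
  proof
    assume s: "half_space n (e a) \<subseteq> half_space n (e b)"
    note P_irredundant[rule_format, OF that(2)]
    moreover have "P = (\<Inter>i\<in>{..<N} - {b}. half_space n (e i))"
    proof
      show "P \<subseteq> (\<Inter>i\<in>{..<N} - {b}. half_space n (e i))" unfolding P_eq by blast
      show "(\<Inter>i\<in>{..<N} - {b}. half_space n (e i)) \<subseteq> P"
      proof
        fix x assume x: "x \<in> (\<Inter>i\<in>{..<N} - {b}. half_space n (e i))"
        then have "x \<in> half_space n (e b)" using that s by blast
        then show "x \<in> P" using x unfolding P_eq by blast
      qed
    qed
    ultimately show False by simp
  qed
  ultimately show ?thesis using assms False by (auto simp: m_def)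
qed

lemma mf_nonpos: "i < N \<Longrightarrow> j < N \<Longrightarrow> i \<noteq> j \<Longrightarrow> mf n (e i) (e j) \<le> 0"
proof -
  assume a: "i < N" "j < N" "i \<noteq> j"
  have "cos (pi / real k) \<ge> 0" if "k \<ge> 2" for k
  proof (rule cos_ge_zero)
    show "pi / real k \<le> pi / 2" using that by (intro divide_left_mono) auto
    have "0 \<le> pi / real k" by simp
    then show "- (pi / 2) \<le> pi / real k" using pi_gt_zero by linarith
  qed
  then show ?thesis using pair[OF a] by fastforce
qed

lemma m_commute: "m i j = m j i"
  unfolding m_def mf_sym[of n "e j" "e i"] ..

sublocale reflections "{..<N}" "hyp_space n" "\<lambda>i. refl n (e i)" "\<lambda>i x. mf n x (e i)" gram
proof
  fix i j x
  show "i \<in> {..<N} \<Longrightarrow> x \<in> hyp_space n \<Longrightarrow> refl n (e i) x \<in> hyp_space n" using refl_in e by simp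
  show "mf n (refl n (e i) x) (e j) = mf n x (e j) - gram i j * mf n x (e i)"
    unfolding refl_def mf_diff by (simp add: gram_def)
  show "i \<in> {..<N} \<Longrightarrow> gram i i = 2" by (simp add: gram_def e_unit)
  show "gram i j = gram j i" unfolding gram_def mf_sym[of n "e j" "e i"] ..
qed

lemma act_span:
  assumes "ss \<in> lists {i, j}"
  shows "\<exists>a b. act (\<lambda>i. refl n (e i)) ss x = (\<lambda>k. x k + a * e i k + b * e j k)"
  using assms
proof (induction ss rule: list.induct)
  case Nil
  show ?case by (intro exI[of _ 0]) simp
next
  case (Cons l ss)
  then obtain a b where ab: "act (\<lambda>i. refl n (e i)) ss x = (\<lambda>k. x k + a * e i k + b * e j k)" by auto
  define q where "q = mf n (\<lambda>k. x k + a * e i k + b * e j k) (e l)"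
  have r: "act (\<lambda>i. refl n (e i)) (l # ss) x = (\<lambda>k. x k + a * e i k + b * e j k - 2 * q * e l k)"
    by (simp only: act.simps ab refl_def q_def)
  have "l = i \<or> l = j" using Cons.prems by simp
  then show ?case
  proof
    assume "l = i"
    then show ?thesis unfolding r by (intro exI[of _ "a - 2 * q"] exI[of _ b]) (simp add: fun_eq_iff algebra_simps)
  next
    assume "l = j"
    then show ?thesis unfolding r by (intro exI[of _ a] exI[of _ "b - 2 * q"]) (simp add: fun_eq_iff algebra_simps)
  qed
qed

text \<open>Both words move x by a vector in the span of the two normals. By
  \<open>lam_braid\<close> these two vectors have the same products with both normals, and the Gram
  determinant sin^2 (pi / m) is positive.\<close>

lemma braid_relation:
  assumes i: "i < N" and j: "j < N" and ij: "i \<noteq> j" and m0: "m i j \<noteq> 0" and x: "x \<in> hyp_space n"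
  shows "act (\<lambda>i. refl n (e i)) (alt (m i j) i j) x = act (\<lambda>i. refl n (e i)) (alt (m i j) j i) x"
proof -
  let ?s = "\<lambda>i. refl n (e i)"
  define h where "h = mf n (e i) (e j)"
  have m: "m i j \<ge> 2" "h = - cos (pi / real (m i j))" using pair[OF i j ij] m0 by (auto simp: h_def)
  have ji: "mf n (e j) (e i) = h" unfolding h_def by (rule mf_sym)
  have u: "mf n (e i) (e i) = 1" "mf n (e j) (e j) = 1" using e_unit i j by auto
  obtain a b where A: "act ?s (alt (m i j) i j) x = (\<lambda>k. x k + a * e i k + b * e j k)"
    using act_span[OF alt_in_lists[of i "{i, j}" j]] by blast
  obtain a' b' where B: "act ?s (alt (m i j) j i) x = (\<lambda>k. x k + a' * e i k + b' * e j k)"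
    using act_span[OF alt_in_lists[of j "{i, j}" i]] by blast
  have g: "gram i j = - 2 * cos (pi / real (m i j))" "gram j i = - 2 * cos (pi / real (m i j))"
    using m(2) ji by (auto simp: gram_def h_def)
  have "mf n (act ?s (alt (m i j) i j) x) (e i) = mf n (act ?s (alt (m i j) j i) x) (e i)"
    by (rule lam_braid) (use i j x m(1) g in auto)
  then have 1: "a + b * h = a' + b' * h" unfolding A B mf_add by (simp add: u ji)
  have "mf n (act ?s (alt (m i j) j i) x) (e j) = mf n (act ?s (alt (m i j) i j) x) (e j)"
    by (rule lam_braid) (use i j x m(1) g in auto)
  then have 2: "a * h + b = a' * h + b'" unfolding A B mf_add by (simp add: u h_def)
  have "sin (pi / real (m i j)) > 0" using m(1) by (intro sin_gt_zero) (auto simp: field_simps)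
  then have "(sin (pi / real (m i j)))\<^sup>2 > 0" by simp
  then have hh: "1 - h * h > 0" using m(2) sin_cos_squared_add[of "pi / real (m i j)"] by (simp add: power2_eq_square)
  have "(b - b') * (1 - h * h) = 0" using 1 2 by algebra
  then have "b = b'" using hh by simp
  then have "a = a'" using 1 by simp
  then show ?thesis unfolding A B using \<open>b = b'\<close> by simp
qed

sublocale reflection_system "{..<N}" "hyp_space n" "\<lambda>i. refl n (e i)" "\<lambda>i x. mf n x (e i)" gram m p
proof
  fix i j x
  assume "i \<in> {..<N}"
  then have i: "i < N" by simp
  show "refl n (e i) (refl n (e i) x) = x" by (rule refl_refl[OF e_unit[OF i]])
  show "m i j = m j i" by (rule m_commute)
  show "mf n p (e i) < 0" by (rule mf_p[OF i])
  assume "j \<in> {..<N}" "i \<noteq> j"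
  then have j: "j < N" "i \<noteq> j" by auto
  note pr = pair[OF i j]
  show "m i j = 0 \<Longrightarrow> gram i j \<le> - 2" using pr by (simp add: gram_def)
  show "m i j \<noteq> 0 \<Longrightarrow> 2 \<le> m i j" using pr by auto
  show "m i j \<noteq> 0 \<Longrightarrow> gram i j = - 2 * cos (pi / real (m i j))" using pr by (auto simp: gram_def)
  show "m i j \<noteq> 0 \<Longrightarrow> x \<in> hyp_space n \<Longrightarrow>
    act (\<lambda>i. refl n (e i)) (alt (m i j) i j) x = act (\<lambda>i. refl n (e i)) (alt (m i j) j i) x"
    by (rule braid_relation[OF i j])
qed (auto intro: p_hyp)

text \<open>
  If \<open>w\<close> moves \<open>p\<close> to the negative side of every wall, then \<open>p - w p\<close> is not timelike and points into
  the cone over \<open>P\<close>.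
\<close>

lemma fulldesc_empty: "fulldesc {..<N} = {}"
proof (rule ccontr)
  assume "fulldesc {..<N} \<noteq> {}"
  then obtain w where w: "w \<in> W {..<N}" "\<forall>i\<in>{..<N}. mf n (w p) (e i) > 0" by (auto simp: fulldesc_def)
  define x where "x = w p"
  have xh: "x \<in> hyp_space n" unfolding x_def using W_in[OF order_refl w(1) p_hyp] .
  note px = hyp_spaceD[OF p_hyp] and xx = hyp_spaceD[OF xh]
  have neg: "mf n p x < 0" by (rule timelike_product_neg) (use px xx in simp_all)
  have a: "mf n p (\<lambda>k. x k + mf n p x * p k) = 0" unfolding mf_add_right using px by simp
  have "mf n (\<lambda>k. x k + mf n p x * p k) (\<lambda>k. x k + mf n p x * p k) \<ge> 0"
    by (rule timelike_orthogonal(1)[OF _ a]) (use px in simp)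
  then have "(mf n p x)\<^sup>2 \<ge> 1"
    unfolding mf_quadratic using px xx mf_sym[of n x p] by (simp add: power2_eq_square)
  then have le: "mf n p x \<le> -1" using neg abs_le_square_iff[of 1 "mf n p x"] by simp
  have y0: "p k + (- 1) * x k = 0" for k
  proof (rule no_ideal[of "\<lambda>k. p k + (- 1) * x k"])
    show "(\<lambda>k. p k + (- 1) * x k) \<in> minkowski_space n" using px xx by (simp add: minkowski_space_def)
    show "mf n (\<lambda>k. p k + (- 1) * x k) (e i) \<le> 0" if "i < N" for i
    proof -
      have "mf n x (e i) > 0" using w(2) that by (simp add: x_def)
      then show ?thesis unfolding mf_add using mf_p[OF that] by simp
    qed
    show "mf n (\<lambda>k. p k + (- 1) * x k) (\<lambda>k. p k + (- 1) * x k) \<ge> 0"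
      unfolding mf_quadratic using le px xx by simp
  qed
  then have "p k = x k" for k using y0[of k] by simp
  then have "p = x" by (rule ext)
  moreover have "0 < N" using N by simp
  ultimately show False using mf_p[of 0] w(2) x_def by force
qed

text \<open>The combination v of normals has product 0 with the walls of U, at most 0 with the
  others, and square 0. By \<open>no_ideal\<close> it vanishes, although its product with the
  interior point p is negative.\<close>

lemma isotropic_False:
  assumes "U \<subseteq> {..<N}" "U \<noteq> {}" "\<forall>i\<in>U. x i > 0" "\<forall>i\<in>U. (\<Sum>j\<in>U. x j * gram i j) = 0"
  shows False
proof -
  have fU: "finite U" using assms(1) finite_subset by blast
  define v where "v = (\<lambda>k. \<Sum>j\<in>U. x j * e j k)"
  have ve: "mf n v y = (\<Sum>j\<in>U. x j * mf n (e j) y)" for y unfolding v_def by (rule mf_sum[OF fU])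
  have v0: "mf n v (e i) = 0" if "i \<in> U" for i
  proof -
    have "(\<Sum>j\<in>U. x j * gram i j) = 2 * (\<Sum>j\<in>U. x j * mf n (e j) (e i))"
      unfolding sum_distrib_left gram_def by (intro sum.cong) (simp_all add: mf_sym[of n "e i"])
    then show ?thesis using assms(4) that ve by simp
  qed
  have "v k = 0" for k
  proof (rule no_ideal)
    show "v \<in> minkowski_space n"
      using e_in assms(1) unfolding v_def minkowski_space_def by (auto intro!: sum.neutral)
    show "mf n v (e i) \<le> 0" if "i < N" for i
    proof (cases "i \<in> U")
      case False
      have "x j * mf n (e j) (e i) \<le> 0" if "j \<in> U" for j
        using mf_nonpos[of j i] assms(1,3) that \<open>i < N\<close> False by (intro mult_nonneg_nonpos) (auto simp: less_imp_le)
      then show ?thesis unfolding ve by (intro sum_nonpos) auto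
    qed (simp add: v0)
    have "mf n v v = (\<Sum>j\<in>U. x j * mf n v (e j))" unfolding ve by (intro sum.cong) (simp_all add: mf_sym[of n _ v] ve)
    then show "mf n v v \<ge> 0" using v0 by simp
  qed
  then have "mf n v p = 0" by (simp add: minkowski_form_def)
  moreover have "mf n v p < 0"
  proof -
    have "x j * mf n (e j) p < 0" if "j \<in> U" for j
      using mf_p[of j] assms(1,3) that mf_sym[of n p "e j"] by (auto simp: mult_pos_neg)
    then have "(\<Sum>j\<in>U. x j * mf n (e j) p) < (\<Sum>j\<in>U. 0)"
      by (intro sum_strict_mono[OF fU assms(2)])
    then show ?thesis by (simp add: ve)
  qed
  ultimately show False by simp
qed

text \<open>There are more than n normals, so some nontrivial combination v has vanishing space
  coordinates and square \<open>- (v 0)^2\<close>.\<close>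

lemma not_positive_definite:
  "\<exists>x. (\<exists>i\<in>{..<N}. x i \<noteq> 0) \<and> (\<Sum>i\<in>{..<N}. \<Sum>j\<in>{..<N}. x i * x j * gram i j) \<le> 0"
proof -
  have "card {1..n} < card {..<N}" using N by simp
  then obtain x where x: "\<exists>i\<in>{..<N}. x i \<noteq> 0" "\<forall>k\<in>{1..n}. (\<Sum>i\<in>{..<N}. x i * e i k) = 0"
    using homogeneous_system_solution[of "{1..n}" "{..<N}" e] by auto
  define v where "v = (\<lambda>k. \<Sum>i\<in>{..<N}. x i * e i k)"
  have "mf n v v \<le> 0" using x(2) by (simp add: minkowski_form_def v_def)
  moreover have "mf n v v = (\<Sum>i\<in>{..<N}. x i * (\<Sum>j\<in>{..<N}. x j * mf n (e j) (e i)))"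
    using mf_sum[of "{..<N}" n x e] mf_sym[of n _ v] by (simp add: v_def)
  moreover have "(\<Sum>i\<in>{..<N}. \<Sum>j\<in>{..<N}. x i * x j * gram i j) = 2 * (\<Sum>i\<in>{..<N}. x i * (\<Sum>j\<in>{..<N}. x j * mf n (e j) (e i)))"
    unfolding sum_distrib_left gram_def by (intro sum.cong refl) (simp add: mf_sym)
  ultimately show ?thesis using x(1) by (intro exI[of _ x]) simp
qed

text \<open>
  The component \<open>y\<close> of \<open>p\<close> orthogonal to the timelike span of the \<open>e i\<close>, \<open>i \<in> U\<close>, is spacelike and still points
  into the cone over \<open>P\<close>.
\<close>

lemma timelike_component_False:
  assumes U: "U \<subset> {..<N}" and o: "\<And>i k. i \<in> U \<Longrightarrow> k \<in> {..<N} - U \<Longrightarrow> mf n (e i) (e k) = 0"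
    and a: "\<And>i. i \<in> U \<Longrightarrow> mf n p (e i) = (\<Sum>j\<in>U. a j * mf n (e j) (e i))"
    and b: "(\<Sum>i\<in>U. b i * (\<Sum>j\<in>U. b j * mf n (e j) (e i))) < 0"
  shows False
proof -
  have fU: "finite U" using U finite_subset by blast
  define v where "v = (\<lambda>k. \<Sum>j\<in>U. b j * e j k)"
  define y where "y = (\<lambda>k. p k + (-1) * (\<Sum>j\<in>U. a j * e j k))"
  have ve: "mf n v z = (\<Sum>j\<in>U. b j * mf n (e j) z)" for z unfolding v_def by (rule mf_sum[OF fU])
  have ye: "mf n y z = mf n p z - (\<Sum>j\<in>U. a j * mf n (e j) z)" for z
    unfolding y_def mf_add mf_sum[OF fU] by simp
  have yU: "mf n y (e i) = 0" if "i \<in> U" for i using a[OF that] by (simp add: ye)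
  have yk: "mf n y (e k) < 0" if "k \<in> {..<N} - U" for k using o[OF _ that] mf_p[of k] that by (simp add: ye)
  have "mf n v v < 0"
  proof -
    have "mf n v v = (\<Sum>i\<in>U. b i * mf n v (e i))"
      unfolding ve[of v] by (intro sum.cong) (simp_all add: mf_sym[of n _ v])
    then show ?thesis using b by (simp add: ve)
  qed
  moreover have "mf n v y = 0"
    unfolding ve using yU by (intro sum.neutral) (simp add: mf_sym[of n _ y])
  ultimately have yy: "mf n y y \<ge> 0" by (rule timelike_orthogonal(1))
  obtain k where k: "k \<in> {..<N} - U" using U by blast
  have "y l = 0" for l
  proof (rule no_ideal[OF _ _ yy])
    show "y \<in> minkowski_space n"
      using e_in U hyp_spaceD[OF p_hyp] unfolding y_def minkowski_space_def by (auto intro!: sum.neutral)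
    show "mf n y (e i) \<le> 0" if "i < N" for i using yU[of i] yk[of i] that by (cases "i \<in> U") auto
  qed
  then have "mf n y (e k) = 0" by (simp add: minkowski_form_def)
  then show False using yk[OF k] by simp
qed

lemma m2: "i < N \<Longrightarrow> j < N \<Longrightarrow> i \<noteq> j \<Longrightarrow> m i j = 2 \<Longrightarrow> mf n (e i) (e j) = 0"
  using pair[of i j] by simp

text \<open>The vector e i + e j is isotropic for h = -1 and timelike for h < -1. In the second case
  \<open>a\<close> solves the 2 by 2 Gram system for the projection of p to the span of the two
  normals.\<close>

lemma connected_infinite_edge:
  assumes i: "i < N" and j: "j < N" and ij: "i \<noteq> j" and m0: "m i j = 0"
  shows "\<exists>k\<in>{..<N} - {i, j}. m i k \<noteq> 2 \<or> m j k \<noteq> 2"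
proof (rule ccontr)
  assume "\<not> ?thesis"
  then have 2: "m i k = 2" "m j k = 2" if "k \<in> {..<N} - {i, j}" for k using that by auto
  define h where "h = mf n (e i) (e j)"
  have h1: "h \<le> -1" using pair[OF i j ij] m0 by (simp add: h_def)
  have ji: "mf n (e j) (e i) = h" unfolding h_def by (rule mf_sym)
  have u: "mf n (e i) (e i) = 1" "mf n (e j) (e j) = 1" using e_unit i j by auto
  show False
  proof (cases "h = -1")
    case True
    show ?thesis
      by (rule isotropic_False[of "{i, j}" "\<lambda>_. 1"]) (use i j ij True ji u h_def in \<open>auto simp: gram_def\<close>)
  next
    case False
    then have "h < -1" using h1 by simp
    then have "1 * 1 < (- h) * (- h)" by (intro mult_strict_mono) auto
    then have hh: "h * h > 1" by simp
    define li where "li = mf n p (e i)"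
    define lj where "lj = mf n p (e j)"
    define a where "a = (\<lambda>k. if k = i then (li - h * lj) / (1 - h * h) else (lj - h * li) / (1 - h * h))"
    have U: "{i, j} \<subset> {..<N}"
    proof -
      have "card {i, j} < card {..<N}" using N ij by simp
      then have "{i, j} \<noteq> {..<N}" by (metis less_irrefl)
      moreover have "{i, j} \<subseteq> {..<N}" using i j by simp
      ultimately show ?thesis by (rule psubsetI[rotated])
    qed
    show ?thesis
    proof (rule timelike_component_False[OF U, of a "\<lambda>_. 1"])
      show "mf n (e l) (e k) = 0" if "l \<in> {i, j}" "k \<in> {..<N} - {i, j}" for l k
        using that 2[of k] m2[of l k] i j by auto
      have nz: "1 - h * h \<noteq> 0" using hh by simp
      have "li = a i + a j * h" "lj = a i * h + a j"
        using nz ij by (simp_all add: a_def divide_simps) (simp_all add: algebra_simps)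
      then show "mf n p (e l) = (\<Sum>k\<in>{i, j}. a k * mf n (e k) (e l))" if "l \<in> {i, j}" for l
        using that ij u ji by (auto simp: li_def lj_def h_def)
      show "(\<Sum>l\<in>{i, j}. 1 * (\<Sum>k\<in>{i, j}. 1 * mf n (e k) (e l))) < 0"
        using ij u ji \<open>h < -1\<close> by (simp add: h_def)
    qed
  qed
qed

text \<open>Since C > cos (pi / 6), the null vector (1, 2, sqrt 3) of the affine triangle (2,3,6)
  becomes timelike here. The Gram determinant is 3/4 - C^2, which is nonzero, so p can be projected
  to the span; B is the coefficient of e j.\<close>

lemma connected_237:
  assumes d: "distinct [i, j, k]" and U: "{i, j, k} \<subset> {..<N}" and mm: "m i j = 3" "m j k = 7" "m i k = 2"
  shows "\<exists>l\<in>{..<N} - {i, j, k}. m i l \<noteq> 2 \<or> m j l \<noteq> 2 \<or> m k l \<noteq> 2"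
proof (rule ccontr)
  assume "\<not> ?thesis"
  then have 2: "m i l = 2" "m j l = 2" "m k l = 2" if "l \<in> {..<N} - {i, j, k}" for l using that by auto
  have lt: "i < N" "j < N" "k < N" using U by auto
  define C where "C = cos (pi / 7)"
  have "cos (pi / 6) < C" unfolding C_def by (intro cos_monotone_0_pi) auto
  then have C: "sqrt 3 / 2 < C" by (simp add: cos_30)
  have "(sqrt 3 / 2)\<^sup>2 < C\<^sup>2" using C by (intro power_strict_mono) auto
  then have CC: "3 / 4 - C * C < 0" by (simp add: power_divide power2_eq_square[of C])
  have g: "mf n (e i) (e j) = -1/2" "mf n (e j) (e k) = - C" "mf n (e i) (e k) = 0"
    using pair[of i j] pair[of j k] pair[of i k] lt d mm by (auto simp: C_def cos_60)
  then have g': "mf n (e j) (e i) = -1/2" "mf n (e k) (e j) = - C" "mf n (e k) (e i) = 0"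
    using mf_sym by metis+
  have u: "mf n (e i) (e i) = 1" "mf n (e j) (e j) = 1" "mf n (e k) (e k) = 1" using e_unit lt by auto
  define li where "li = mf n p (e i)"
  define lj where "lj = mf n p (e j)"
  define lk where "lk = mf n p (e k)"
  define B where "B = (lj + li / 2 + C * lk) / (3 / 4 - C * C)"
  have B: "B * (3 / 4 - C * C) = lj + li / 2 + C * lk" using CC by (simp add: B_def)
  define a where "a = (\<lambda>l. if l = i then li + B / 2 else if l = j then B else lk + C * B)"
  define b where "b = (\<lambda>l. if l = i then 1 else if l = j then 2 else sqrt 3)"
  show False
  proof (rule timelike_component_False[OF U, of a b])
    show "mf n (e l) (e l') = 0" if "l \<in> {i, j, k}" "l' \<in> {..<N} - {i, j, k}" for l l'
      using that 2[of l'] m2[of l l'] lt by auto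
    have "- (li + B / 2) / 2 + B - C * (lk + C * B) = B * (3 / 4 - C * C) - li / 2 - C * lk"
      by (simp add: field_simps)
    then have "lj = - (li + B / 2) / 2 + B - C * (lk + C * B)" unfolding B by simp
    then show "mf n p (e l) = (\<Sum>l'\<in>{i, j, k}. a l' * mf n (e l') (e l))" if "l \<in> {i, j, k}" for l
      using that d u g g' by (auto simp: a_def li_def lj_def lk_def) (simp add: field_simps)
    have "sqrt 3 * (sqrt 3 / 2) < sqrt 3 * C" by (rule mult_strict_left_mono[OF C]) simp
    then have "3 / 2 < C * sqrt 3" by (simp add: mult.commute)
    then show "(\<Sum>l\<in>{i, j, k}. b l * (\<Sum>l'\<in>{i, j, k}. b l' * mf n (e l') (e l))) < 0"
      using d u g g' by (simp add: b_def algebra_simps)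
  qed
qed

end

section \<open>Growth rates\<close>

context reflection_system
begin

definition sphere :: "nat \<Rightarrow> ('x \<Rightarrow> 'x) set" where
  "sphere k = {w \<in> W I. len I w = k}"

lemma finite_sphere: "finite (sphere k)"
proof (rule finite_subset)
  show "sphere k \<subseteq> elt ` {ss. set ss \<subseteq> I \<and> length ss = k}"
  proof
    fix w assume "w \<in> sphere k"
    then have w: "w \<in> W I" "len I w = k" by (auto simp: sphere_def)
    obtain ss where "red I ss" "elt ss = w" "length ss = len I w" using red_ex[OF w(1)] by blast
    then show "w \<in> elt ` {ss. set ss \<subseteq> I \<and> length ss = k}"
      using w(2) by (auto simp: red_def in_lists_conv_set)
  qed
  show "finite (elt ` {ss. set ss \<subseteq> I \<and> length ss = k})"
    using finite_lists_length_eq[OF fin] by simp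
qed

lemma sum_ball: "(\<Sum>w\<in>(\<Union>k<K. sphere k). t ^ len I w) = (\<Sum>k<K. real (card (sphere k)) * t ^ k)"
proof -
  have "(\<Sum>w\<in>(\<Union>k<K. sphere k). t ^ len I w) = (\<Sum>k<K. \<Sum>w\<in>sphere k. t ^ len I w)"
    by (rule sum.UNION_disjoint) (auto simp: finite_sphere, auto simp: sphere_def)
  also have "\<dots> = (\<Sum>k<K. real (card (sphere k)) * t ^ k)"
  proof (rule sum.cong)
    fix k
    have "(\<Sum>w\<in>sphere k. t ^ len I w) = (\<Sum>w\<in>sphere k. t ^ k)"
      by (rule sum.cong) (auto simp: sphere_def)
    then show "(\<Sum>w\<in>sphere k. t ^ len I w) = real (card (sphere k)) * t ^ k" by simp
  qed simp
  finally show ?thesis .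
qed

lemma finite_sub_ball:
  assumes "finite F" "F \<subseteq> W I"
  obtains K0 where "\<And>K. K \<ge> K0 \<Longrightarrow> F \<subseteq> (\<Union>k<K. sphere k)"
proof
  fix K assume K: "K \<ge> Suc (Max (insert 0 (len I ` F)))"
  show "F \<subseteq> (\<Union>k<K. sphere k)"
  proof
    fix w assume w: "w \<in> F"
    then have "len I w \<le> Max (insert 0 (len I ` F))" using assms(1) by (intro Max_ge) auto
    then have "len I w < K" using K by simp
    then show "w \<in> (\<Union>k<K. sphere k)" using assms(2) w by (auto simp: sphere_def)
  qed
qed

text \<open>Every finite set of elements lies in a ball, so the sums over finite sets are bounded by
  the sum of the power series.\<close>

lemma summable_on_W:
  assumes "t \<ge> 0" "summable (\<lambda>k. real (card (sphere k)) * t ^ k)"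
  shows "(\<lambda>w. t ^ len I w) summable_on W I"
proof (rule nonneg_bdd_above_summable_on)
  show "bdd_above (sum (\<lambda>w. t ^ len I w) ` {F. F \<subseteq> W I \<and> finite F})"
  proof (rule bdd_aboveI2)
    fix F assume "F \<in> {F. F \<subseteq> W I \<and> finite F}"
    then have F: "finite F" "F \<subseteq> W I" by auto
    obtain K where K: "F \<subseteq> (\<Union>k<K. sphere k)" using finite_sub_ball[OF F] by (metis order_refl)
    have "(\<Sum>w\<in>F. t ^ len I w) \<le> (\<Sum>w\<in>(\<Union>k<K. sphere k). t ^ len I w)"
      using K assms(1) by (intro sum_mono2) (auto simp: finite_sphere)
    also have "\<dots> \<le> (\<Sum>k. real (card (sphere k)) * t ^ k)"
      unfolding sum_ball using assms by (intro sum_le_suminf) auto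
    finally show "(\<Sum>w\<in>F. t ^ len I w) \<le> (\<Sum>k. real (card (sphere k)) * t ^ k)" .
  qed
qed (use assms in auto)

lemma sums_infsum:
  assumes "(\<lambda>w. t ^ len I w) summable_on W I"
  shows "(\<lambda>k. real (card (sphere k)) * t ^ k) sums infsum (\<lambda>w. t ^ len I w) (W I)"
proof -
  have h: "(sum (\<lambda>w. t ^ len I w) \<longlongrightarrow> infsum (\<lambda>w. t ^ len I w) (W I)) (finite_subsets_at_top (W I))"
    using has_sum_infsum[OF assms] by (simp add: has_sum_def)
  have "filterlim (\<lambda>K. \<Union>k<K. sphere k) (finite_subsets_at_top (W I)) sequentially"
    unfolding filterlim_finite_subsets_at_top
  proof (intro allI impI)
    fix F assume "finite F \<and> F \<subseteq> W I"
    then obtain K0 where "\<And>K. K \<ge> K0 \<Longrightarrow> F \<subseteq> (\<Union>k<K. sphere k)" using finite_sub_ball by metis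
    then show "\<forall>\<^sub>F K in sequentially. finite (\<Union>k<K. sphere k) \<and> F \<subseteq> (\<Union>k<K. sphere k) \<and> (\<Union>k<K. sphere k) \<subseteq> W I"
      unfolding eventually_sequentially by (intro exI[of _ K0]) (auto simp: finite_sphere, auto simp: sphere_def)
  qed
  from filterlim_compose[OF h this] show ?thesis by (simp add: sums_def sum_ball)
qed

end

lemma conv_radius_growth:
  assumes "limsup (\<lambda>k. ereal (root k (real (a k)))) = ereal \<alpha>" "\<alpha> > 0"
  shows "conv_radius (\<lambda>k. of_nat (a k) :: complex) = ereal (1 / \<alpha>)"
  using assms by (simp add: conv_radius_def inverse_eq_divide)

text \<open>Power series and q / r agree on small positive reals, which accumulate at 0, hence in a
  neighbourhood of 0. As q / r is holomorphic on the whole ball, its expansion converges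
  there.\<close>

lemma conv_radius_rational:
  fixes a :: "nat \<Rightarrow> nat" and q r :: "complex \<Rightarrow> complex"
  assumes R: "conv_radius (\<lambda>k. of_nat (a k) :: complex) = ereal R" "R > 0"
    and h: "q holomorphic_on ball 0 \<rho>" "r holomorphic_on ball 0 \<rho>" "\<rho> > 0" "\<And>z. norm z < \<rho> \<Longrightarrow> r z \<noteq> 0"
    and eq: "\<And>t. 0 < t \<Longrightarrow> t < R \<Longrightarrow> t < \<rho> \<Longrightarrow> (\<Sum>k. of_nat (a k) * of_real t ^ k) * r (of_real t) = q (of_real t)"
  shows "R \<ge> \<rho>"
proof -
  define F where "F = Abs_fps (\<lambda>k. of_nat (a k) :: complex)"
  have FR: "fps_conv_radius F = ereal R" using R(1) by (simp add: F_def fps_conv_radius_def)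
  define f where "f = (\<lambda>z. q z / r z)"
  have hf: "f holomorphic_on ball 0 \<rho>"
    unfolding f_def using h by (intro holomorphic_on_divide) auto
  define d where "d = min R \<rho>"
  have d: "d > 0" "d \<le> R" "d \<le> \<rho>" using R h by (auto simp: d_def)
  have e: "ball (0::complex) d \<subseteq> eball 0 (fps_conv_radius F)"
    using d(2) by (auto simp: FR)
  have "eval_fps F z - f z = 0" if z: "z \<in> ball 0 d" for z
  proof (rule analytic_continuation[where S = "ball 0 d" and \<xi> = 0 and U = "of_real ` {0<..<d}" and f = "\<lambda>z. eval_fps F z - f z"])
    show "(\<lambda>z. eval_fps F z - f z) holomorphic_on ball 0 d"
      using e d(3) by (intro holomorphic_on_diff holomorphic_on_eval_fps holomorphic_on_subset[OF hf]) auto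
    show "0 \<in> ball (0::complex) d" "open (ball (0::complex) d)" "connected (ball (0::complex) d)" using d by auto
    show "complex_of_real ` {0<..<d} \<subseteq> ball 0 d" by auto
    show "(0::complex) islimpt complex_of_real ` {0<..<d}"
      unfolding islimpt_approachable
    proof (intro allI impI)
      fix \<epsilon> :: real assume "\<epsilon> > 0"
      define u where "u = min \<epsilon> d / 2"
      have u: "0 < u" "u < d" "u < \<epsilon>" using \<open>\<epsilon> > 0\<close> d(1) by (auto simp: u_def min_def)
      then show "\<exists>x'\<in>complex_of_real ` {0<..<d}. x' \<noteq> 0 \<and> dist x' 0 < \<epsilon>"
        by (intro bexI[of _ "complex_of_real u"] imageI) auto
    qed
    show "eval_fps F w - f w = 0" if w: "w \<in> complex_of_real ` {0<..<d}" for w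
    proof -
      obtain t where t: "w = of_real t" "0 < t" "t < d" using w by auto
      have "r w \<noteq> 0" using t d by (intro h) auto
      moreover have "eval_fps F w * r w = q w"
        using eq[of t] t d by (simp add: eval_fps_def F_def)
      ultimately show ?thesis by (simp add: f_def divide_simps)
    qed
  qed (fact z)
  then have "eventually (\<lambda>z. eval_fps F z = f z) (nhds 0)"
    using d(1) by (intro eventually_nhds_in_open[of "ball 0 d", THEN eventually_mono]) auto
  then have "f has_fps_expansion F" using FR R(2) by (simp add: has_fps_expansion_def)
  moreover have "f has_fps_expansion fps_expansion f 0"
    by (rule has_fps_expansion_fps_expansion[OF _ _ hf]) (use h in auto)
  ultimately have "F = fps_expansion f 0" by (rule fps_expansion_unique_complex)
  moreover have "fps_conv_radius (fps_expansion f 0) \<ge> ereal \<rho>"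
    using hf by (intro conv_radius_fps_expansion) simp
  ultimately show ?thesis using FR by simp
qed

context coxeter_polyhedron
begin

abbreviation "rs i \<equiv> refl n (e i)"

lemma hyp_reflection_elt: "hyp_reflection n (e i) = elt [i]"
  by (simp add: hyp_reflection_def elt_def refl_def restrict_def fun_eq_iff)

lemma elt_Bij: "ss \<in> lists {..<N} \<Longrightarrow> elt ss \<in> Bij (hyp_space n)"
proof -
  assume ss: "ss \<in> lists {..<N}"
  have "bij_betw (elt ss) (hyp_space n) (hyp_space n)"
  proof (rule bij_betw_byWitness[where f' = "elt (rev ss)"])
    show "\<forall>x\<in>hyp_space n. elt (rev ss) (elt ss x) = x"
      using act_rev[OF ss] act_in[OF ss] by (simp add: elt_apply)
    have r: "rev ss \<in> lists {..<N}" using ss by simp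
    show "\<forall>x\<in>hyp_space n. elt ss (elt (rev ss) x) = x"
      using act_rev[OF r] act_in[OF r] by (simp add: elt_apply)
    show "elt ss ` hyp_space n \<subseteq> hyp_space n" "elt (rev ss) ` hyp_space n \<subseteq> hyp_space n"
      using act_in[OF ss] act_in[OF r] by (auto simp: elt_apply)
  qed
  then show ?thesis by (simp add: Bij_def elt_def)
qed

lemma mult_hyp_isom:
  "f \<in> Bij (hyp_space n) \<Longrightarrow> g \<in> Bij (hyp_space n) \<Longrightarrow> f \<otimes>\<^bsub>hyp_isom n\<^esub> g = compose (hyp_space n) f g"
  by (simp add: hyp_isom_def BijGroup_def)

lemma one_hyp_isom: "\<one>\<^bsub>hyp_isom n\<^esub> = elt []"
  by (simp add: hyp_isom_def BijGroup_def elt_def restrict_def fun_eq_iff)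

lemma mult_elt:
  "ss \<in> lists {..<N} \<Longrightarrow> tt \<in> lists {..<N} \<Longrightarrow> elt ss \<otimes>\<^bsub>hyp_isom n\<^esub> elt tt = elt (ss @ tt)"
  using mult_hyp_isom[OF elt_Bij elt_Bij] elt_append by metis

lemma elt_single_carrier: "i < N \<Longrightarrow> elt [i] \<in> carrier (hyp_isom n)"
proof -
  assume i: "i < N"
  have "hyp_dist n (elt [i] x) (elt [i] y) = hyp_dist n x y" if "x \<in> hyp_space n" "y \<in> hyp_space n" for x y
    using that refl_mf[OF e_unit[OF i]] by (simp add: hyp_dist_def elt_apply)
  then show ?thesis using elt_Bij[of "[i]"] i by (simp add: hyp_isom_def)
qed

text \<open>The inverse is computed from its definition: any two-sided inverse y satisfies
  \<open>rs i (y x) = x\<close>, and the involution \<open>rs i\<close> recovers y.\<close>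

lemma inv_elt_single:
  assumes i: "i < N"
  shows "inv\<^bsub>hyp_isom n\<^esub> (elt [i]) = elt [i]"
  unfolding m_inv_def
proof (rule the_equality)
  have il: "[i] \<in> lists {..<N}" using i by simp
  have sq: "elt [i] \<otimes>\<^bsub>hyp_isom n\<^esub> elt [i] = \<one>\<^bsub>hyp_isom n\<^esub>"
    unfolding mult_hyp_isom[OF elt_Bij[OF il] elt_Bij[OF il]] one_hyp_isom using elt_rev[OF il] by simp
  show "elt [i] \<in> carrier (hyp_isom n) \<and> elt [i] \<otimes>\<^bsub>hyp_isom n\<^esub> elt [i] = \<one>\<^bsub>hyp_isom n\<^esub> \<and>
    elt [i] \<otimes>\<^bsub>hyp_isom n\<^esub> elt [i] = \<one>\<^bsub>hyp_isom n\<^esub>"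
    using sq elt_single_carrier[OF i] by simp
  fix y assume y: "y \<in> carrier (hyp_isom n) \<and> elt [i] \<otimes>\<^bsub>hyp_isom n\<^esub> y = \<one>\<^bsub>hyp_isom n\<^esub> \<and> y \<otimes>\<^bsub>hyp_isom n\<^esub> elt [i] = \<one>\<^bsub>hyp_isom n\<^esub>"
  then have yB: "y \<in> Bij (hyp_space n)" by (simp add: hyp_isom_def)
  then have ye: "y \<in> extensional (hyp_space n)" "\<And>x. x \<in> hyp_space n \<Longrightarrow> y x \<in> hyp_space n"
    by (auto simp: Bij_def bij_betw_def)
  have c: "compose (hyp_space n) (elt [i]) y = elt []"
    using y mult_hyp_isom[OF elt_Bij[OF il] yB] one_hyp_isom by simp
  have "rs i (y x) = x" if "x \<in> hyp_space n" for x
    using fun_cong[OF c, of x] that ye(2)[OF that] by (simp add: compose_def elt_apply)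
  then have "y x = rs i x" if "x \<in> hyp_space n" for x
    using that s_s[of i "y x"] i ye(2)[OF that] by fastforce
  then show "y = elt [i]"
    by (intro extensionalityI[OF ye(1)]) (auto simp: elt_def)
qed

lemma generate_eq: "generate (hyp_isom n) (wall_reflections n N e) = W {..<N}"
proof
  show "generate (hyp_isom n) (wall_reflections n N e) \<subseteq> W {..<N}"
  proof
    fix w assume "w \<in> generate (hyp_isom n) (wall_reflections n N e)"
    then show "w \<in> W {..<N}"
    proof induction
      case one
      then show ?case unfolding one_hyp_isom by (rule W_elt) simp
    next
      case (incl h)
      then show ?case by (auto simp: wall_reflections_def hyp_reflection_elt intro!: W_elt)
    next
      case (inv h)
      then show ?case by (auto simp: wall_reflections_def hyp_reflection_elt inv_elt_single intro!: W_elt)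
    next
      case (eng h1 h2)
      then obtain ss tt where "ss \<in> lists {..<N}" "tt \<in> lists {..<N}" "h1 = elt ss" "h2 = elt tt"
        by (auto simp: W_def)
      then show ?case using mult_elt by (auto intro!: W_elt)
    qed
  qed
  have "elt ss \<in> generate (hyp_isom n) (wall_reflections n N e)" if "ss \<in> lists {..<N}" for ss
    using that
  proof (induction ss rule: list.induct)
    case Nil
    then show ?case using generate.one[of "hyp_isom n"] by (simp add: one_hyp_isom)
  next
    case (Cons i ss)
    then have i: "[i] \<in> lists {..<N}" "ss \<in> lists {..<N}" by auto
    have w: "elt [i] \<in> wall_reflections n N e"
      using i by (auto simp: wall_reflections_def hyp_reflection_elt)
    then show ?case
      using generate.eng[OF generate.incl[OF w] Cons.IH[OF i(2)]] mult_elt[OF i] by simp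
  qed
  then show "W {..<N} \<subseteq> generate (hyp_isom n) (wall_reflections n N e)" by (auto simp: W_def)
qed

lemma foldr_elt:
  "ss \<in> lists {..<N} \<Longrightarrow> foldr (mult (hyp_isom n)) (map (\<lambda>i. elt [i]) ss) (one (hyp_isom n)) = elt ss"
proof (induction ss rule: list.induct)
  case Nil
  then show ?case by (simp add: one_hyp_isom)
next
  case (Cons i ss)
  then have i: "[i] \<in> lists {..<N}" "ss \<in> lists {..<N}" by auto
  show ?case using Cons.IH[OF i(2)] mult_elt[OF i] by simp
qed

lemma word_length_eq: "word_length (hyp_isom n) (wall_reflections n N e) w = len {..<N} w"
proof -
  have "(\<exists>ss. length ss = k \<and> set ss \<subseteq> wall_reflections n N e \<and> foldr (mult (hyp_isom n)) ss (one (hyp_isom n)) = w)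
    \<longleftrightarrow> (\<exists>ss\<in>lists {..<N}. length ss = k \<and> elt ss = w)" (is "?L \<longleftrightarrow> ?R") for k
  proof
    assume ?L
    then obtain ws where ws: "length ws = k" "set ws \<subseteq> (\<lambda>i. elt [i]) ` {..<N}"
      "foldr (mult (hyp_isom n)) ws (one (hyp_isom n)) = w"
      by (auto simp: wall_reflections_def hyp_reflection_elt)
    then have "ws \<in> lists ((\<lambda>i. elt [i]) ` {..<N})" by (auto simp: in_lists_conv_set)
    then obtain ss where "ss \<in> lists {..<N}" "ws = map (\<lambda>i. elt [i]) ss" unfolding lists_image by blast
    then show ?R using ws foldr_elt[of ss] by auto
  next
    assume ?R
    then obtain ss where "ss \<in> lists {..<N}" "length ss = k" "elt ss = w" by blast
    then show ?L
      using foldr_elt[of ss]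
      by (intro exI[of _ "map (\<lambda>i. elt [i]) ss"])
        (auto simp: wall_reflections_def hyp_reflection_elt in_lists_conv_set)
  qed
  then show ?thesis by (simp add: word_length_def len_def)
qed

lemma growth_coeff_eq: "growth_coeff (hyp_isom n) (wall_reflections n N e) k = card (sphere k)"
  by (simp add: growth_coeff_def generate_eq word_length_eq sphere_def)

lemma conv_radius_sphere:
  assumes "polyhedron_growth_rate n N e = ereal \<alpha>" "\<alpha> > 0"
  shows "conv_radius (\<lambda>k. of_nat (card (sphere k)) :: complex) = ereal (1 / \<alpha>)"
  using assms by (intro conv_radius_growth) (simp_all add: polyhedron_growth_rate_def growth_rate_def growth_coeff_eq)

lemma growth_system_at:
  assumes "polyhedron_growth_rate n N e = ereal \<alpha>" "\<alpha> > 0" "0 < t" "t < 1" "t < 1 / \<alpha>"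
  shows "growth_system {..<N} (hyp_space n) rs (\<lambda>i x. mf n x (e i)) gram m p t"
proof
  have "summable (\<lambda>k. norm (of_nat (card (sphere k)) * (of_real t :: complex) ^ k))"
    using assms by (intro abs_summable_in_conv_radius) (simp add: conv_radius_sphere)
  then have "summable (\<lambda>k. real (card (sphere k)) * t ^ k)"
    using assms by (simp add: norm_mult norm_power)
  then show "(\<lambda>w. t ^ len {..<N} w) summable_on W {..<N}"
    using assms by (intro summable_on_W) auto
qed (use assms in auto)

text \<open>There is no longest element, so the identity expresses 1 / G through the dihedral
  subgroups of orders 6, 4 and 14. Multiplied by \<open>T2 * T2 * T3 * T7\<close> the right-hand
  side becomes Lehmer's polynomial, whose zero-free disc bounds the radius of convergence from
  below.\<close>

lemma triangle_237:
  assumes a: "polyhedron_growth_rate n N e = ereal \<alpha>" "\<alpha> > 0"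
    and d: "distinct [a, b, c']" "{..<N} = {a, b, c'}" and mm: "m a b = 3" "m b c' = 7" "m a c' = 2"
  shows "423 / 500 \<le> 1 / \<alpha>"
proof (rule conv_radius_rational[OF conv_radius_sphere[OF a], where r = lehmer_poly
      and q = "\<lambda>z. (1 + z) * (1 + z) * (1 + z + z\<^sup>2) * (1 + z + z\<^sup>2 + z^3 + z^4 + z^5 + z^6)"])
  show "(lehmer_poly :: complex \<Rightarrow> complex) holomorphic_on ball 0 (423 / 500)"
    unfolding lehmer_poly_def[abs_def] by (intro holomorphic_intros)
  show "(\<lambda>z::complex. (1 + z) * (1 + z) * (1 + z + z\<^sup>2) * (1 + z + z\<^sup>2 + z^3 + z^4 + z^5 + z^6)) holomorphic_on ball 0 (423 / 500)"
    by (intro holomorphic_intros)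
  show "lehmer_poly z \<noteq> 0" if "norm z < 423 / 500" for z :: complex
    using lehmer_poly_no_zeros that by simp
  fix t :: real
  assume t: "0 < t" "t < 1 / \<alpha>" "t < 423 / 500"
  then have t1: "t < 1" by simp
  interpret gs: growth_system "{..<N}" "hyp_space n" rs "\<lambda>i x. mf n x (e i)" gram m p t
    by (rule growth_system_at[OF a t(1) t1 t(2)])
  have "gs.E {..<N} = 0" by (rule gs.E_empty[OF fulldesc_empty])
  then have "(\<Sum>V\<in>Pow {..<N}. (-1) ^ card V * gs.g V) = 0" using gs.identity[OF order_refl] by simp
  moreover have I: "a \<in> {..<N}" "b \<in> {..<N}" "c' \<in> {..<N}" "a \<noteq> b" "a \<noteq> c'" "b \<noteq> c'" using d by auto
  note single = gs.g_single[OF I(1)] gs.g_single[OF I(2)] gs.g_single[OF I(3)]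
  ultimately have id: "1 - 3 / (1 + t) + gs.g {a, b} + gs.g {a, c'} + gs.g {b, c'} - gs.g {a, b, c'} = 0"
    using d(1) unfolding d(2) by (simp add: sum_Pow_insert gs.g_empty single insert_commute)
  define T2 T3 T7 where "T2 = 1 + t" and "T3 = 1 + t + t\<^sup>2" and "T7 = 1 + t + t\<^sup>2 + t^3 + t^4 + t^5 + t^6"
  have T: "T2 > 0" "T3 > 0" "T7 > 0" using t by (auto simp: T2_def T3_def T7_def intro!: add_pos_pos)
  have f: "1 - t ^ 2 = (1 - t) * T2" "1 - t ^ 3 = (1 - t) * T3" "1 - t ^ 7 = (1 - t) * T7"
    by (simp_all add: T2_def T3_def T7_def algebra_simps eval_nat_numeral)
  have g: "gs.g {a, b} = 1 / (T2 * T3)" "gs.g {a, c'} = 1 / (T2 * T2)" "gs.g {b, c'} = 1 / (T2 * T7)"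
    using gs.g_pair[OF I(1,2,4)] gs.g_pair[OF I(1,3,5)] gs.g_pair[OF I(2,3,6)] mm f T t1
    by (simp_all add: T2_def[symmetric])
  have gi: "gs.g {a, b, c'} = 1 / gs.G {..<N}" unfolding gs.g_def d(2) ..
  have G: "gs.G {..<N} \<noteq> 0" using gs.G_ge_1[OF order_refl] by simp
  have "1 / gs.G {..<N} = 1 - 3 / T2 + 1 / (T2 * T3) + 1 / (T2 * T2) + 1 / (T2 * T7)"
    using id unfolding g gi T2_def by linarith
  then have "T2 * T2 * T3 * T7 = gs.G {..<N} * (T2 * T2 * T3 * T7 - 3 * T2 * T3 * T7 + T2 * T7 + T3 * T7 + T2 * T3)"
    using T G by (simp add: field_simps)
  also have "T2 * T2 * T3 * T7 - 3 * T2 * T3 * T7 + T2 * T7 + T3 * T7 + T2 * T3 = lehmer_poly t"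
    by (simp add: T2_def T3_def T7_def lehmer_poly_def algebra_simps eval_nat_numeral)
  finally have main: "gs.G {..<N} * lehmer_poly t = T2 * T2 * T3 * T7" ..
  have "(\<lambda>k. of_real (real (card (sphere k)) * t ^ k) :: complex) sums of_real (gs.G {..<N})"
    using sums_infsum[OF gs.summ] unfolding gs.G_def by (rule sums_of_real)
  then have s: "(\<Sum>k. of_nat (card (sphere k)) * (of_real t :: complex) ^ k) = of_real (gs.G {..<N})"
    by (simp add: sums_iff)
  have "of_real (gs.G {..<N}) * lehmer_poly (of_real t) = (of_real (gs.G {..<N} * lehmer_poly t) :: complex)"
    by (simp add: lehmer_poly_def)
  also have "\<dots> = (1 + of_real t) * (1 + of_real t) * (1 + of_real t + (of_real t)\<^sup>2) *
    (1 + of_real t + (of_real t)\<^sup>2 + of_real t^3 + of_real t^4 + of_real t^5 + of_real t^6)"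
    unfolding main by (simp add: T2_def T3_def T7_def)
  finally show "(\<Sum>k. of_nat (card (sphere k)) * (of_real t :: complex) ^ k) * lehmer_poly (of_real t) =
    (1 + of_real t) * (1 + of_real t) * (1 + of_real t + (of_real t)\<^sup>2) *
    (1 + of_real t + (of_real t)\<^sup>2 + of_real t^3 + of_real t^4 + of_real t^5 + of_real t^6)"
    unfolding s .
qed (use a in simp_all)

text \<open>The two bounds on \<alpha> act separately: the upper one makes all series converge at
  21/25, the lower one puts 1/\<alpha> below 423/500, against \<open>triangle_237\<close>.\<close>

theorem growth_rate_gap:
  assumes a: "polyhedron_growth_rate n N e = ereal \<alpha>" and l: "297 / 250 < \<alpha>" and u: "\<alpha> < 119 / 100"
  shows False
proof -
  have a0: "\<alpha> > 0" using l by simp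
  have "(21 / 25 :: real) < 1 / \<alpha>" using a0 u by (simp add: field_simps)
  then interpret gs: growth_system "{..<N}" "hyp_space n" rs "\<lambda>i x. mf n x (e i)" gram m p "21 / 25"
    by (intro growth_system_at[OF a a0]) auto
  interpret free: simplex_free "{..<N}" "hyp_space n" rs "\<lambda>i x. mf n x (e i)" gram m p "21 / 25"
  proof
    fix a b c' assume "distinct [a, b, c']" "{..<N} = {a, b, c'}" "m a b = 3" "m b c' = 7" "m a c' = 2"
    from triangle_237[OF assms(1) a0 this] show False using l a0 by (simp add: field_simps)
  next
    fix U x assume "U \<subseteq> {..<N}" "U \<noteq> {}" "\<forall>i\<in>U. x i > 0" "\<forall>i\<in>U. (\<Sum>j\<in>U. x j * gram i j) = 0"
    then show False by (rule isotropic_False)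
  next
    show "\<exists>x. (\<exists>i\<in>{..<N}. x i \<noteq> 0) \<and> (\<Sum>i\<in>{..<N}. \<Sum>j\<in>{..<N}. x i * x j * gram i j) \<le> 0"
      by (rule not_positive_definite)
  next
    fix i j assume "i \<in> {..<N}" "j \<in> {..<N}" "i \<noteq> j" "m i j = 0"
    then show "\<exists>k\<in>{..<N} - {i, j}. m i k \<noteq> 2 \<or> m j k \<noteq> 2" by (intro connected_infinite_edge) auto
  next
    fix i j k assume "distinct [i, j, k]" "{i, j, k} \<subset> {..<N}" "m i j = 3" "m j k = 7" "m i k = 2"
    then show "\<exists>l\<in>{..<N} - {i, j, k}. m i l \<noteq> 2 \<or> m j l \<noteq> 2 \<or> m k l \<noteq> 2" by (rule connected_237)
  qed simp
  show False by (rule free.contradiction)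
qed

end

theorem theorem1:
  shows "\<exists>\<alpha>::real. salem_number \<alpha> \<and>
    (\<forall>n N e P. n \<ge> 2 \<longrightarrow> compact_coxeter_polyhedron n N e P \<longrightarrow>
       polyhedron_growth_rate n N e \<noteq> ereal \<alpha>)"
proof -
  obtain \<alpha> where \<alpha>: "salem_number \<alpha>" "297 / 250 < \<alpha>" "\<alpha> < 119 / 100" using salem_ex by blast
  have "polyhedron_growth_rate n N e \<noteq> ereal \<alpha>" if c: "compact_coxeter_polyhedron n N e P" for n N e P
  proof
    assume g: "polyhedron_growth_rate n N e = ereal \<alpha>"
    have "(top_of_set (hyp_space n)) interior_of P \<noteq> {}"
      using c unfolding compact_coxeter_polyhedron_def by blast
    then obtain p where "p \<in> (top_of_set (hyp_space n)) interior_of P" by blast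
    then interpret coxeter_polyhedron n N e P p using c by unfold_locales
    show False by (rule growth_rate_gap[OF g \<alpha>(2,3)])
  qed
  then show ?thesis using \<alpha>(1) by blast
qed

end
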